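(* Let $\alpha_1(s)\mid\cdots\mid\alpha_n(s)$ be monic real polynomials with $\sum_i\deg\alpha_i(s)=n$. Let $(F,G)\in\mathbb R^{n\times n}\times\mathbb R^{n\times m}$ be a controllable pair in $p$-Brunovsky canonical form, $G=[G_1\ \ 0]$, $G_1\in\mathbb R^{n\times r}$, $\operatorname{rank}G_1=r$, with controllability indices $k_1\ge\cdots\ge k_r>0=k_{r+1}=\cdots=k_m$ and nonzero Brunovsky indices $\underline r:\ r=r_1\ge\cdots\ge r_k>0$, and assume $(k_1,\dots,k_m)\prec(\deg\alpha_n(s),\dots,\deg\alpha_1(s))$. Let $A\in\mathbb R^{n\times n}$ be the real Weyr canonical form with invariant polynomials $\alpha_1(s)\mid\cdots\mid\alpha_n(s)$ and let $\underline{\mathcal I}\in\mathcal A_A$. For $x\in\mathcal W_{\underline{\mathcal I}}$ let $p_1(x),\dots,p_r(x)$ be the first $r$ rows of $\nu_{\underline{\mathcal I}}(x)$ and put $$\alpha_{\underline{\mathcal I}}(x)=\begin{bmatrix} p_1(x)A^{k_1} \\ \vdots \\ p_r(x)A^{k_r} \end{bmatrix}\nu_{\underline{\mathcal I}}(x)^{-1}\in\mathbb R^{r\times n}.$$ Then $\widehat{\mathcal V}_{\underline{\mathcal I}}=\phi(\widetilde{\mathcal V}_{\underline{\mathcal I}})$ is an open subset of $\mathcal H_{(F,G_1)}$ and $\alpha_{\underline{\mathcal I}}:\mathcal W_{\underline{\mathcal I}}\to\widehat{\mathcal V}_{\underline{\mathcal I}}$ is a diffeomorphism; moreover $\widehat{\mathcal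 V}'_{\underline{\mathcal I}}=\widehat{\mathcal V}_{\underline{\mathcal I}}\times\mathbb R^{(m-r)\times n}$ is an open subset of $\mathcal H_{(F,G)}=\mathcal H_{(F,G_1)}\times\mathbb R^{(m-r)\times n}$ and $$\alpha'_{\underline{\mathcal I}}:\ \mathcal W_{\underline{\mathcal I}}\times\mathbb R^{(m-r)\times n}\to\widehat{\mathcal V}'_{\underline{\mathcal I}},\qquad (x,K_2)\mapsto\begin{bmatrix} \alpha_{\underline{\mathcal I}}(x) \\ K_2 \end{bmatrix}$$ is a diffeomorphism (so $\alpha'_{\underline{\mathcal I}}$ is a local parameterization, and its inverse a local system of coordinates, of $\mathcal H_{(F,G)}$).
   Context: Majorization $a\prec b$ (nonincreasing sequences padded with zeros to equal length): $\sum_{i\le j}a_i\le\sum_{i\le j}b_i$ for all $j$ and equal total sums. The conjugate partition of $(a_i)$ is $b_i=\#\{j:a_j\ge i\}$. $I_{p,q}=\begin{bmatrix} I_q \\ 0 \end{bmatrix}\in\mathbb R^{p\times q}$ for $p\ge q$; $X^{(p)}=\operatorname{diag}(X,\dots,X)$ ($p$ copies). $\mathcal O(\underline\alpha)$ is the set of matrices in $\mathbb R^{n\times n}$ with invariant polynomials $\alpha_1(s)\mid\cdots\mid\alpha_n(s)$. $\mathcal H_{(F,G)}=\{K\in\mathbb R^{m\times n}:F+GK\in\mathcal O(\underline\alpha)\}$ and $\mathcal H_{(F,G_1)}=\{K\in\mathbb R^{r\times n}:F+G_1K\in\mathcal O(\underline\alpha)\}$, regarded as submanifolds of $\mathbb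 R^{m\times n}$ and $\mathbb R^{r\times n}$. Brunovsky indices of a controllable pair: $r_1+\cdots+r_i=\operatorname{rank}[G\ FG\ \cdots\ F^{i-1}G]$; controllability indices: $k_i=\#\{j:r_j\ge i\}$. $p$-Brunovsky canonical form (with $k=k_1$, $r_{k+1}=0$): $F$ is the $k\times k$ block matrix with block sizes $r_1,\dots,r_k$ whose $(i,i+1)$ block is $I_{r_i,r_{i+1}}$, all other blocks zero; $G=[G_1\ 0]$, where $G_1$ has row blocks of sizes $r_1,\dots,r_k$ and column blocks of sizes $r_k,r_{k-1}-r_k,\dots,r_1-r_2$, the only nonzero block in row block $i$ being in column block $k-i+1$ and equal to $\begin{bmatrix} 0 \\ I_{r_i-r_{i+1}} \end{bmatrix}\in\mathbb R^{r_i\times(r_i-r_{i+1})}$. Real Weyr form. Let $\lambda_1,\dots,\lambda_p$ be the distinct real roots of $\alpha_n$ and $\lambda_{p+1},\overline\lambda_{p+1},\dots,\lambda_{p+q},\overline\lambda_{p+q}$ the distinct nonreal ones. For $1\le i\le p+q$ let $m_{i1}\ge m_{i2}\ge\cdots$ be the multiplicities of $\lambda_i$ in $\alpha_n,\alpha_{n-1},\dots$, let $(w_{i1},\dots,w_{im_i})$, $m_i=m_{i1}$, be the conjugate partition of $(m_{i1},m_{i2},\dots)$, and $s^{(i)}=\sum_jw_{ij}$. $A=\operatorname{diag}(W_1,\dots,W_p,\widehat W_{p+1},\dots,\widehat W_{p+q})$, where for $i\le p$, $W_i$ has diagonal blocks $\lambda_iI_{w_{ij}}$, $1\le j\le m_i$,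 $(j,j+1)$ blocks $I_{w_{ij},w_{i,j+1}}$ and zeros elsewhere; for $i>p$, $\lambda_i=a_i+b_i\mathrm i$, $B_i=\begin{bmatrix} a_i & b_i \\ -b_i & a_i \end{bmatrix}$, $\widehat W_i$ has diagonal blocks $B_i^{(w_{ij})}$, $(j,j+1)$ blocks $I_{2w_{ij},2w_{i,j+1}}$ and zeros elsewhere. Put $\epsilon_i=1$ for $i\le p$, $\epsilon_i=2$ for $i>p$, and write $M_i=W_i$ ($i\le p$), $M_i=\widehat W_i$ ($i>p$); $M_i$ has size $\epsilon_is^{(i)}$. For a square matrix $M$ of size $d$, $\mathcal P_{(M;\underline r)}$ is the set of $P=\begin{bmatrix} P_1 \\ \vdots \\ P_k \end{bmatrix}\in\mathbb R^{n\times d}$ with $\operatorname{rank}P=d$, $P_1\in\mathbb R^{r\times d}$ and $P_l\in\mathbb R^{r_l\times d}$ equal to the first $r_l$ rows of $P_1M^{l-1}$. $\widetilde C_A$ is the Lie group of invertible real matrices commuting with $A$, acting on $\mathcal P_{(A;\underline r)}$ by $P\mapsto PX$; $\pi:\mathcal P_{(A;\underline r)}\to\mathcal P_{(A;\underline r)}/\widetilde C_A$ is the natural projection, and $\phi:\mathcal P_{(A;\underline r)}/\widetilde C_A\to\mathcal H_{(F,G_1)}$ sends the orbit of $P$, with first $r$ rows $p_1,\dots,p_r$, to $\begin{bmatrix} p_1A^{k_1} \\ \vdots \\ p_rA^{k_r} \end{bmatrix}P^{-1}$. $N=\sum_{l=1}^n(2l-1)\deg\alpha_{n-l+1}$. For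 $z=[z_1\ z_2]$, $z^\diamond=\begin{bmatrix} z_1 & z_2 \\ -z_2 & z_1 \end{bmatrix}$, and for $Z=[z_{ij}]\in\mathbb R^{p\times2q}$, $z_{ij}\in\mathbb R^{1\times2}$, $Z^\diamond=[z_{ij}^\diamond]\in\mathbb R^{2p\times2q}$. Index sequences. For each $i$ put $\tau^{(i)}_0=0$, $\tau^{(i)}_j=w_{i,m_i-j+1}$. $\mathcal A_{M_i}$ is the set of $\underline{\mathcal I}^{(i)}=(\mathcal I_1,\dots,\mathcal I_{m_i})$ where $\mathcal I_j$ is a sequence of $\tau_j^{(i)}$ distinct indices in $\{1,\dots,r\}$, $\mathcal I_{j-1}$ is an initial segment of $\mathcal I_j$ ($\mathcal I_0=\emptyset$), and the remaining part $\mathcal I_j\setminus\mathcal I_{j-1}$ is strictly increasing. $\mathcal A_A=\prod_{i=1}^{p+q}\mathcal A_{M_i}$. $\mathcal U_{\underline{\mathcal I}^{(i)}}$ is the set of $P\in\mathcal P_{(M_i;\underline r)}$ such that for all $j$ the submatrix $P(\mathcal I_j,1{:}\tau^{(i)}_j)$ (rows $\mathcal I_j$, first $\tau^{(i)}_j$ columns) is invertible (if $i\le p$), respectively $P(\mathcal I_j,1{:}2\tau^{(i)}_j)^\diamond$ is invertible (if $i>p$). For $\underline{\mathcal I}=(\underline{\mathcal I}^{(1)},\dots,\underline{\mathcal I}^{(p+q)})$, $\mathcal V_{\underline{\mathcal I}}$ is the set of $P=[P^{(1)}\ \cdots\ P^{(p+q)}]\in\mathcal P_{(A;\underline r)}$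 (columns partitioned according to the diagonal blocks of $A$) with $P^{(i)}\in\mathcal U_{\underline{\mathcal I}^{(i)}}$ for all $i$; $\widetilde{\mathcal V}_{\underline{\mathcal I}}=\pi(\mathcal V_{\underline{\mathcal I}})$. Reduced shape and $\nu_{\underline{\mathcal I}}$. For given $i$, a matrix $R=\begin{bmatrix} R_1 \\ \vdots \\ R_k \end{bmatrix}\in\mathbb R^{n\times\epsilon_is^{(i)}}$ has reduced shape with respect to $\underline{\mathcal I}^{(i)}$ if $R_l$ is the first $r_l$ rows of $R_1M_i^{l-1}$ for all $l$ and, writing $R_1=[R_{11}\cdots R_{1m_i}]$ with $R_{1j}\in\mathbb R^{r\times\epsilon_iw_{ij}}$ and partitioning $R_{1j}(\mathcal I_{m_i},:)$ (the rows of $R_{1j}$ indexed by $\mathcal I_{m_i}$, in that order) into blocks $R^{(j)}_{ab}$ of size $(\tau^{(i)}_a-\tau^{(i)}_{a-1})\times\epsilon_i(\tau^{(i)}_b-\tau^{(i)}_{b-1})$, $1\le a\le m_i$, $1\le b\le m_i-j+1$: $R^{(1)}_{aa}$ (if $i\le p$), resp. $R^{(1)\diamond}_{aa}$ (if $i>p$), is the identity; $R^{(1)}_{ab}=0$ for $a<b$; and $R^{(j)}_{ab}=0$ for $j\ge2$ and $\max\{a-j+1,1\}\le b\le m_i-j+1$. All the other entries of $R_1$ (including all those in rows not indexed by $\mathcal I_{m_i}$) are free; their number, summed over all $i$, is $nr-N$. $\nu_{\underline{\mathcal I}}$ is the affine bijection assigning to $x\in\mathbb R^{nr-N}$ the matrix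 in $\mathbb R^{n\times n}$ whose $i$-th block of columns has reduced shape with respect to $\underline{\mathcal I}^{(i)}$ for every $i$, and whose free entries, listed in some fixed order, are the coordinates of $x$. Finally $\mathcal W_{\underline{\mathcal I}}=\{x\in\mathbb R^{nr-N}:\nu_{\underline{\mathcal I}}(x)\in\mathcal P_{(A;\underline r)}\}$ (that is, $\nu_{\underline{\mathcal I}}(x)$ is invertible), an open set. *)

theory Defs
  imports
    "HOL-Analysis.Function_Topology"
    "Jordan_Normal_Form.Gauss_Jordan_Elimination"
    "Jordan_Normal_Form.Char_Poly"
    "Jordan_Normal_Form.DL_Rank"
begin

text \<open>
  Conventions. Matrices are those of Jordan_Normal_Form (rows and columns numbered from 0).
  The finite families of the control-theoretic data (invariant polynomials, Brunovsky and
  controllability indices, blocks of a block matrix, Weyr characteristics) are functions on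
  \<^typ>\<open>nat\<close> numbered from 1.
\<close>

section \<open>Smooth maps between subsets of Euclidean spaces\<close>

text \<open>
  For a finite index set \<open>I\<close>, the Euclidean space of real families indexed by \<open>I\<close> is the set
  of functions vanishing off \<open>I\<close>, with the topology induced by the product topology
  (for \<open>I = {..<d}\<close>, this is the space \<open>Euclidean_space d\<close> of HOL-Analysis). Unlike
  \<open>real ^ 'd\<close>, this covers dimension 0, which does occur below (for instance when \<open>r = 1\<close>).
\<close>

definition euc :: "'i set \<Rightarrow> ('i \<Rightarrow> real) set" where
  "euc I = {x. \<forall>i. i \<notin> I \<longrightarrow> x i = 0}"

text \<open>\<open>C_on k I U f\<close>: \<open>f\<close> is of class \<open>C\<^sup>k\<close> on the (relatively open) subset \<open>U\<close> of \<open>euc I\<close>.\<close>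

primrec C_on :: "nat \<Rightarrow> 'i set \<Rightarrow> ('i \<Rightarrow> real) set \<Rightarrow> (('i \<Rightarrow> real) \<Rightarrow> real) \<Rightarrow> bool" where
  "C_on 0 I U f \<longleftrightarrow> continuous_on U f"
| "C_on (Suc k) I U f \<longleftrightarrow> continuous_on U f \<and>
     (\<forall>i\<in>I. \<exists>f'. C_on k I U f' \<and>
        (\<forall>x\<in>U. ((\<lambda>t. f (x(i := t))) has_real_derivative f' x) (at (x i))))"

text \<open>
  A coordinate system \<open>(I, c)\<close> identifies the points of a set with points of \<open>euc I\<close>
  through the map \<open>c\<close>: real vectors, real matrices (through their entries), and products.
\<close>

type_synonym ('a, 'i) coords = "'i set \<times> ('a \<Rightarrow> 'i \<Rightarrow> real)"

definition vec_coords :: "nat \<Rightarrow> (nat \<Rightarrow> real, nat) coords" where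
  "vec_coords d = ({..<d}, \<lambda>x. x)"

definition mat_coords :: "nat \<Rightarrow> nat \<Rightarrow> (real mat, nat \<times> nat) coords" where
  "mat_coords p q = ({..<p} \<times> {..<q}, \<lambda>A (i, j). if i < p \<and> j < q then A $$ (i, j) else 0)"

definition prod_coords ::
  "('a, 'i) coords \<Rightarrow> ('b, 'j) coords \<Rightarrow> ('a \<times> 'b, 'i + 'j) coords" where
  "prod_coords c d = (fst c <+> fst d, \<lambda>(x, y). case_sum (snd c x) (snd d y))"

definition coords_topology :: "('a, 'i) coords \<Rightarrow> 'a set \<Rightarrow> 'a topology" where
  "coords_topology c X = pullback_topology X (snd c) euclidean"

text \<open>
  Smoothness on arbitrary subsets \<open>X\<close> of a Euclidean space is, as usual, local extendability to
  a \<open>C\<^sup>\<infinity>\<close> map on an open subset of the ambient space. For (embedded) submanifolds, and for open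
  subsets of them, this is smoothness with respect to the submanifold structure.
\<close>

definition smooth_map ::
  "('a, 'i) coords \<Rightarrow> ('b, 'j) coords \<Rightarrow> 'a set \<Rightarrow> ('a \<Rightarrow> 'b) \<Rightarrow> bool" where
  "smooth_map c d X f \<longleftrightarrow>
     (\<forall>x\<in>X. \<exists>U g. openin (top_of_set (euc (fst c))) U \<and> snd c x \<in> U \<and>
        (\<forall>j\<in>fst d. \<forall>k. C_on k (fst c) U (g j)) \<and>
        (\<forall>y\<in>X. snd c y \<in> U \<longrightarrow> (\<forall>j\<in>fst d. snd d (f y) j = g j (snd c y))))"

definition diffeomorphism ::
  "('a, 'i) coords \<Rightarrow> ('b, 'j) coords \<Rightarrow> 'a set \<Rightarrow> 'b set \<Rightarrow> ('a \<Rightarrow> 'b) \<Rightarrow> bool" where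
  "diffeomorphism c d X Y f \<longleftrightarrow>
     bij_betw f X Y \<and> smooth_map c d X f \<and> smooth_map d c Y (the_inv_into X f)"


section \<open>Block matrices\<close>

text \<open>\<open>block_offset s i = s\<^sub>1 + \<dots> + s\<^sub>i\<^sub>-\<^sub>1\<close>; \<open>block_index s a\<close> is the (1-based) number of the block
  that contains the (0-based) position \<open>a\<close>.\<close>

definition block_offset :: "(nat \<Rightarrow> nat) \<Rightarrow> nat \<Rightarrow> nat" where
  "block_offset s i = (\<Sum>j=1..<i. s j)"

definition block_index :: "(nat \<Rightarrow> nat) \<Rightarrow> nat \<Rightarrow> nat" where
  "block_index s a = (LEAST i. 1 \<le> i \<and> a < block_offset s (Suc i))"

definition block_mat ::
  "(nat \<Rightarrow> nat) \<Rightarrow> nat \<Rightarrow> (nat \<Rightarrow> nat) \<Rightarrow> nat \<Rightarrow> (nat \<Rightarrow> nat \<Rightarrow> 'a mat) \<Rightarrow> 'a mat" where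
  "block_mat s p t q B = mat (\<Sum>i=1..p. s i) (\<Sum>j=1..q. t j)
     (\<lambda>(a, b). let i = block_index s a; j = block_index t b
               in B i j $$ (a - block_offset s i, b - block_offset t j))"

definition eye :: "nat \<Rightarrow> nat \<Rightarrow> real mat" where
  "eye p q = mat p q (\<lambda>(i, j). if i = j then 1 else 0)"

definition append_cols :: "real mat \<Rightarrow> real mat \<Rightarrow> real mat" where
  "append_cols A B = four_block_mat A B (0\<^sub>m 0 (dim_col A)) (0\<^sub>m 0 (dim_col B))"

definition first_rows :: "nat \<Rightarrow> real mat \<Rightarrow> real mat" where
  "first_rows c X = mat c (dim_col X) (\<lambda>(a, b). X $$ (a, b))"

definition row_block :: "(nat \<Rightarrow> nat) \<Rightarrow> nat \<Rightarrow> real mat \<Rightarrow> real mat" where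
  "row_block s l P = mat (s l) (dim_col P) (\<lambda>(a, b). P $$ (block_offset s l + a, b))"

text \<open>\<open>pick_mat P rs c\<close>: the rows of \<open>P\<close> listed in \<open>rs\<close>, in that order, restricted to the first
  \<open>c\<close> columns.\<close>

definition pick_mat :: "real mat \<Rightarrow> nat list \<Rightarrow> nat \<Rightarrow> real mat" where
  "pick_mat P rs c = mat (length rs) c (\<lambda>(a, b). P $$ (rs ! a, b))"

definition diamond :: "real mat \<Rightarrow> real mat" where
  "diamond Z = mat (2 * dim_row Z) (dim_col Z)
     (\<lambda>(a, b). if even a then Z $$ (a div 2, b)
               else if even b then - (Z $$ (a div 2, b + 1))
               else Z $$ (a div 2, b - 1))"

definition mat_rank :: "real mat \<Rightarrow> nat" where
  "mat_rank P = vec_space.rank (dim_row P) P"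


section \<open>Invariant polynomials, majorization, Brunovsky indices\<close>

text \<open>\<open>\<O>(\<alpha>)\<close>: the Smith normal form over \<open>\<real>[s]\<close> of \<open>s I - M\<close> is \<open>diag(\<alpha>\<^sub>1, \<dots>, \<alpha>\<^sub>n)\<close>
  (\<open>invertible_mat\<close> over \<open>real poly\<close> means unimodular).\<close>

definition inv_poly_class :: "nat \<Rightarrow> (nat \<Rightarrow> real poly) \<Rightarrow> real mat set" where
  "inv_poly_class n \<alpha> = {M \<in> carrier_mat n n.
     \<exists>U \<in> carrier_mat n n. \<exists>V \<in> carrier_mat n n. invertible_mat U \<and> invertible_mat V \<and>
       U * char_poly_matrix M * V = mat_diag n (\<lambda>i. \<alpha> (Suc i))}"

definition feedback_set :: "nat \<Rightarrow> (nat \<Rightarrow> real poly) \<Rightarrow> real mat \<Rightarrow> real mat \<Rightarrow> real mat set" where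
  "feedback_set n \<alpha> F G = {K \<in> carrier_mat (dim_col G) n. F + G * K \<in> inv_poly_class n \<alpha>}"

text \<open>Majorization of nonincreasing lists; as \<open>take\<close> stops at the end of a list, this amounts to
  padding with zeros.\<close>

definition majorized_by :: "nat list \<Rightarrow> nat list \<Rightarrow> bool" where
  "majorized_by as bs \<longleftrightarrow>
     (\<forall>j. sum_list (take j as) \<le> sum_list (take j bs)) \<and> sum_list as = sum_list bs"

text \<open>\<open>ctrb F G i = [G  F G  \<dots>  F\<^sup>i\<^sup>-\<^sup>1 G]\<close>\<close>

definition ctrb :: "real mat \<Rightarrow> real mat \<Rightarrow> nat \<Rightarrow> real mat" where
  "ctrb F G i = mat (dim_row G) (i * dim_col G)
     (\<lambda>(a, b). (F ^\<^sub>m (b div dim_col G) * G) $$ (a, b mod dim_col G))"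

definition controllable :: "real mat \<Rightarrow> real mat \<Rightarrow> bool" where
  "controllable F G \<longleftrightarrow> mat_rank (ctrb F G (dim_row F)) = dim_row F"

definition brunovsky_index :: "real mat \<Rightarrow> real mat \<Rightarrow> nat \<Rightarrow> nat" where
  "brunovsky_index F G i = mat_rank (ctrb F G i) - mat_rank (ctrb F G (i - 1))"

definition controllability_index :: "real mat \<Rightarrow> real mat \<Rightarrow> nat \<Rightarrow> nat" where
  "controllability_index F G i = card {j. 1 \<le> j \<and> i \<le> brunovsky_index F G j}"

definition brunovsky_F :: "(nat \<Rightarrow> nat) \<Rightarrow> nat \<Rightarrow> real mat" where
  "brunovsky_F r k = block_mat r k r k
     (\<lambda>i j. if j = i + 1 then eye (r i) (r j) else 0\<^sub>m (r i) (r j))"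

definition brunovsky_G1 :: "(nat \<Rightarrow> nat) \<Rightarrow> nat \<Rightarrow> real mat" where
  "brunovsky_G1 r k =
    (let r' = (\<lambda>i. if i \<le> k then r i else 0);
         c = (\<lambda>j. r' (k - j + 1) - r' (k - j + 2))
     in block_mat r k c k
          (\<lambda>i j. if j = k - i + 1
                 then 0\<^sub>m (r' (i + 1)) (c j) @\<^sub>r 1\<^sub>m (c j)
                 else 0\<^sub>m (r i) (c j)))"


section \<open>The real Weyr form\<close>

text \<open>
  \<open>root_listing a zs\<close>: \<open>zs\<close> lists the distinct real roots of \<open>a\<close>, followed by exactly one element
  of each pair of conjugate nonreal roots. The Weyr data below depend on the index \<open>i\<close> only
  through the root \<open>z = zs ! i\<close>.
\<close>

definition root_listing :: "real poly \<Rightarrow> complex list \<Rightarrow> bool" where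
  "root_listing a zs \<longleftrightarrow> (\<exists>xs ys. zs = xs @ ys \<and> distinct zs \<and>
     set xs = {z. poly (map_poly complex_of_real a) z = 0 \<and> z \<in> \<real>} \<and>
     set ys \<union> cnj ` set ys = {z. poly (map_poly complex_of_real a) z = 0 \<and> z \<notin> \<real>} \<and>
     set ys \<inter> cnj ` set ys = {})"

definition root_eps :: "complex \<Rightarrow> nat" where
  "root_eps z = (if z \<in> \<real> then 1 else 2)"

text \<open>The multiplicity \<open>m\<^sub>i\<^sub>l\<close> of the root in \<open>\<alpha>\<^sub>n\<^sub>-\<^sub>l\<^sub>+\<^sub>1\<close>, for \<open>1 \<le> l \<le> n\<close>.\<close>

definition root_mult :: "nat \<Rightarrow> (nat \<Rightarrow> real poly) \<Rightarrow> complex \<Rightarrow> nat \<Rightarrow> nat" where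
  "root_mult n \<alpha> z l = Polynomial.order z (map_poly complex_of_real (\<alpha> (n - l + 1)))"

definition weyr_char :: "nat \<Rightarrow> (nat \<Rightarrow> real poly) \<Rightarrow> complex \<Rightarrow> nat \<Rightarrow> nat" where
  "weyr_char n \<alpha> z j = card {l \<in> {1..n}. j \<le> root_mult n \<alpha> z l}"

definition weyr_len :: "nat \<Rightarrow> (nat \<Rightarrow> real poly) \<Rightarrow> complex \<Rightarrow> nat" where
  "weyr_len n \<alpha> z = root_mult n \<alpha> z 1"

definition weyr_tau :: "nat \<Rightarrow> (nat \<Rightarrow> real poly) \<Rightarrow> complex \<Rightarrow> nat \<Rightarrow> nat" where
  "weyr_tau n \<alpha> z j = (if j = 0 then 0 else weyr_char n \<alpha> z (weyr_len n \<alpha> z - j + 1))"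

definition weyr_size :: "nat \<Rightarrow> (nat \<Rightarrow> real poly) \<Rightarrow> complex \<Rightarrow> nat" where
  "weyr_size n \<alpha> z = root_eps z * (\<Sum>j=1..weyr_len n \<alpha> z. weyr_char n \<alpha> z j)"

definition weyr_block :: "nat \<Rightarrow> (nat \<Rightarrow> real poly) \<Rightarrow> complex \<Rightarrow> real mat" where
  "weyr_block n \<alpha> z =
    (let mi = weyr_len n \<alpha> z; w = weyr_char n \<alpha> z; d = (\<lambda>j. root_eps z * w j)
     in block_mat d mi d mi
          (\<lambda>i j. if j = i then
                   (if z \<in> \<real> then Re z \<cdot>\<^sub>m 1\<^sub>m (w i)
                    else diag_block_mat (replicate (w i)
                           (mat_of_rows_list 2 [[Re z, Im z], [- Im z, Re z]])))
                 else if j = i + 1 then eye (d i) (d j)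
                 else 0\<^sub>m (d i) (d j)))"

definition real_weyr :: "nat \<Rightarrow> (nat \<Rightarrow> real poly) \<Rightarrow> complex list \<Rightarrow> real mat" where
  "real_weyr n \<alpha> zs = diag_block_mat (map (weyr_block n \<alpha>) zs)"

text \<open>First column, and submatrix, of the \<open>i\<close>-th block of columns (0-based \<open>i\<close>), with columns
  partitioned as the diagonal blocks of the Weyr form.\<close>

definition weyr_offset :: "nat \<Rightarrow> (nat \<Rightarrow> real poly) \<Rightarrow> complex list \<Rightarrow> nat \<Rightarrow> nat" where
  "weyr_offset n \<alpha> zs i = (\<Sum>i'<i. weyr_size n \<alpha> (zs ! i'))"

definition weyr_cols :: "nat \<Rightarrow> (nat \<Rightarrow> real poly) \<Rightarrow> complex list \<Rightarrow> nat \<Rightarrow> real mat \<Rightarrow> real mat" where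
  "weyr_cols n \<alpha> zs i P = mat (dim_row P) (weyr_size n \<alpha> (zs ! i))
     (\<lambda>(a, b). P $$ (a, weyr_offset n \<alpha> zs i + b))"


section \<open>The orbit space and the map \<open>\<phi>\<close>\<close>

definition has_shape :: "(nat \<Rightarrow> nat) \<Rightarrow> nat \<Rightarrow> real mat \<Rightarrow> real mat \<Rightarrow> bool" where
  "has_shape r k M P \<longleftrightarrow> P \<in> carrier_mat (\<Sum>l=1..k. r l) (dim_row M) \<and>
     (\<forall>l\<in>{1..k}. row_block r l P = first_rows (r l) (row_block r 1 P * M ^\<^sub>m (l - 1)))"

definition P_set :: "(nat \<Rightarrow> nat) \<Rightarrow> nat \<Rightarrow> real mat \<Rightarrow> real mat set" where
  "P_set r k M = {P. has_shape r k M P \<and> mat_rank P = dim_row M}"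

definition commuting_group :: "real mat \<Rightarrow> real mat set" where
  "commuting_group A = {X \<in> carrier_mat (dim_row A) (dim_row A). invertible_mat X \<and> A * X = X * A}"

text \<open>\<open>orbit_proj\<close> is \<open>\<pi>\<close> (orbits as sets of matrices); \<open>feedback_of\<close> is the formula defining
  \<open>\<phi>\<close> on representatives, \<open>\<rho>\<close> being the number \<open>r\<close> of rows; \<open>orbit_map\<close> is \<open>\<phi>\<close>.\<close>

definition orbit_proj :: "real mat \<Rightarrow> real mat \<Rightarrow> real mat set" where
  "orbit_proj A P = {P * X | X. X \<in> commuting_group A}"

definition feedback_of :: "(nat \<Rightarrow> nat) \<Rightarrow> nat \<Rightarrow> real mat \<Rightarrow> real mat \<Rightarrow> real mat" where
  "feedback_of \<kappa> \<rho> A P =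
     mat \<rho> (dim_col P) (\<lambda>(j, b). (P * A ^\<^sub>m \<kappa> (Suc j)) $$ (j, b)) * the (mat_inverse P)"

definition orbit_map :: "(nat \<Rightarrow> nat) \<Rightarrow> nat \<Rightarrow> real mat \<Rightarrow> real mat set \<Rightarrow> real mat" where
  "orbit_map \<kappa> \<rho> A \<omega> = the_elem (feedback_of \<kappa> \<rho> A ` \<omega>)"


section \<open>Index sequences and charts\<close>

text \<open>An element of \<open>\<A>\<^sub>M\<^sub>i\<close> is \<open>J\<close> with \<open>J j\<close>, \<open>1 \<le> j \<le> m\<^sub>i\<close>, the sequence \<open>\<I>\<^sub>j\<close> (and \<open>J 0 = []\<close>).
  Row indices are 0-based, so they range over \<open>{0..<r\<^sub>1}\<close>.\<close>

definition index_seqs :: "nat \<Rightarrow> nat \<Rightarrow> (nat \<Rightarrow> real poly) \<Rightarrow> complex \<Rightarrow> (nat \<Rightarrow> nat list) set" where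
  "index_seqs \<rho> n \<alpha> z = {J. J 0 = [] \<and>
     (\<forall>j\<in>{1..weyr_len n \<alpha> z}.
        length (J j) = weyr_tau n \<alpha> z j \<and> distinct (J j) \<and> set (J j) \<subseteq> {0..<\<rho>} \<and>
        (\<exists>ys. J j = J (j - 1) @ ys \<and> sorted_wrt (<) ys))}"

definition index_families ::
  "nat \<Rightarrow> nat \<Rightarrow> (nat \<Rightarrow> real poly) \<Rightarrow> complex list \<Rightarrow> (nat \<Rightarrow> nat \<Rightarrow> nat list) set" where
  "index_families \<rho> n \<alpha> zs = {J. \<forall>i<length zs. J i \<in> index_seqs \<rho> n \<alpha> (zs ! i)}"

definition U_set ::
  "(nat \<Rightarrow> nat) \<Rightarrow> nat \<Rightarrow> nat \<Rightarrow> (nat \<Rightarrow> real poly) \<Rightarrow> complex \<Rightarrow> (nat \<Rightarrow> nat list) \<Rightarrow> real mat set" where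
  "U_set r k n \<alpha> z J = {P \<in> P_set r k (weyr_block n \<alpha> z).
     \<forall>j\<in>{1..weyr_len n \<alpha> z}.
       (if z \<in> \<real> then invertible_mat (pick_mat P (J j) (weyr_tau n \<alpha> z j))
        else invertible_mat (diamond (pick_mat P (J j) (2 * weyr_tau n \<alpha> z j))))}"

definition V_set ::
  "(nat \<Rightarrow> nat) \<Rightarrow> nat \<Rightarrow> nat \<Rightarrow> (nat \<Rightarrow> real poly) \<Rightarrow> complex list \<Rightarrow> (nat \<Rightarrow> nat \<Rightarrow> nat list)
    \<Rightarrow> real mat set" where
  "V_set r k n \<alpha> zs J = {P \<in> P_set r k (real_weyr n \<alpha> zs).
     \<forall>i<length zs. weyr_cols n \<alpha> zs i P \<in> U_set r k n \<alpha> (zs ! i) (J i)}"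

text \<open>\<open>reduced_block \<dots> R j a b\<close> is the block \<open>R\<^sup>(\<^sup>j\<^sup>)\<^sub>a\<^sub>b\<close> of \<open>R\<^sub>1\<^sub>j(\<I>\<^sub>m\<^sub>i, :)\<close>; the partitions start at
  row \<open>\<tau>\<^sub>a\<^sub>-\<^sub>1\<close> and column \<open>\<epsilon>\<^sub>i \<tau>\<^sub>b\<^sub>-\<^sub>1\<close>. Rows with index below \<open>r\<^sub>1\<close> of \<open>R\<close> are those of \<open>R\<^sub>1\<close>.\<close>

definition reduced_block ::
  "nat \<Rightarrow> (nat \<Rightarrow> real poly) \<Rightarrow> complex \<Rightarrow> (nat \<Rightarrow> nat list) \<Rightarrow> real mat \<Rightarrow> nat \<Rightarrow> nat \<Rightarrow> nat \<Rightarrow> real mat"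
  where
  "reduced_block n \<alpha> z J R j a b =
    (let \<tau> = weyr_tau n \<alpha> z; e = root_eps z
     in mat (\<tau> a - \<tau> (a - 1)) (e * (\<tau> b - \<tau> (b - 1)))
          (\<lambda>(u, v). R $$ (J (weyr_len n \<alpha> z) ! (\<tau> (a - 1) + u),
                          e * block_offset (weyr_char n \<alpha> z) j + e * \<tau> (b - 1) + v)))"

definition reduced_shape ::
  "(nat \<Rightarrow> nat) \<Rightarrow> nat \<Rightarrow> nat \<Rightarrow> (nat \<Rightarrow> real poly) \<Rightarrow> complex \<Rightarrow> (nat \<Rightarrow> nat list) \<Rightarrow> real mat \<Rightarrow> bool"
  where
  "reduced_shape r k n \<alpha> z J R \<longleftrightarrow>
    (let mi = weyr_len n \<alpha> z; \<tau> = weyr_tau n \<alpha> z; e = root_eps z; B = reduced_block n \<alpha> z J R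
     in has_shape r k (weyr_block n \<alpha> z) R \<and>
        (\<forall>a\<in>{1..mi}. (if z \<in> \<real> then B 1 a a else diamond (B 1 a a))
                        = 1\<^sub>m (e * (\<tau> a - \<tau> (a - 1)))) \<and>
        (\<forall>a\<in>{1..mi}. \<forall>b\<in>{1..mi}. a < b \<longrightarrow>
           B 1 a b = 0\<^sub>m (\<tau> a - \<tau> (a - 1)) (e * (\<tau> b - \<tau> (b - 1)))) \<and>
        (\<forall>j\<in>{2..mi}. \<forall>a\<in>{1..mi}. \<forall>b. max (a - j + 1) 1 \<le> b \<and> b \<le> mi - j + 1 \<longrightarrow>
           B j a b = 0\<^sub>m (\<tau> a - \<tau> (a - 1)) (e * (\<tau> b - \<tau> (b - 1)))))"

text \<open>Positions in \<open>R\<^sub>1\<close> prescribed by the reduced shape (all entries of the diagonal blocks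
  \<open>R\<^sup>(\<^sup>1\<^sup>)\<^sub>a\<^sub>a\<close> and of the blocks required to vanish), relative to the \<open>i\<close>-th block of columns;
  and the free positions in the first \<open>r\<close> rows of the whole matrix.\<close>

definition prescribed_positions ::
  "nat \<Rightarrow> (nat \<Rightarrow> real poly) \<Rightarrow> complex \<Rightarrow> (nat \<Rightarrow> nat list) \<Rightarrow> (nat \<times> nat) set" where
  "prescribed_positions n \<alpha> z J =
    (let mi = weyr_len n \<alpha> z; \<tau> = weyr_tau n \<alpha> z; e = root_eps z
     in {(J mi ! (\<tau> (a - 1) + u), e * block_offset (weyr_char n \<alpha> z) j + e * \<tau> (b - 1) + v)
         | j a b u v.
           1 \<le> j \<and> j \<le> mi \<and> 1 \<le> a \<and> a \<le> mi \<and>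
           (if j = 1 then a \<le> b else max (a - j + 1) 1 \<le> b) \<and> b \<le> mi - j + 1 \<and>
           u < \<tau> a - \<tau> (a - 1) \<and> v < e * (\<tau> b - \<tau> (b - 1))})"

definition free_positions ::
  "nat \<Rightarrow> nat \<Rightarrow> (nat \<Rightarrow> real poly) \<Rightarrow> complex list \<Rightarrow> (nat \<Rightarrow> nat \<Rightarrow> nat list) \<Rightarrow> (nat \<times> nat) set" where
  "free_positions \<rho> n \<alpha> zs J =
     {(u, weyr_offset n \<alpha> zs i + v) | i u v. i < length zs \<and> u < \<rho> \<and> v < weyr_size n \<alpha> (zs ! i) \<and>
        (u, v) \<notin> prescribed_positions n \<alpha> (zs ! i) (J i)}"

text \<open>\<open>\<nu>\<close>, for the order of the free entries given by the list \<open>es\<close> of free positions.\<close>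

definition nu ::
  "(nat \<Rightarrow> nat) \<Rightarrow> nat \<Rightarrow> nat \<Rightarrow> (nat \<Rightarrow> real poly) \<Rightarrow> complex list \<Rightarrow> (nat \<Rightarrow> nat \<Rightarrow> nat list)
    \<Rightarrow> (nat \<times> nat) list \<Rightarrow> (nat \<Rightarrow> real) \<Rightarrow> real mat" where
  "nu r k n \<alpha> zs J es x = (THE R. R \<in> carrier_mat n n \<and>
     (\<forall>i<length zs. reduced_shape r k n \<alpha> (zs ! i) (J i) (weyr_cols n \<alpha> zs i R)) \<and>
     (\<forall>t<length es. R $$ (es ! t) = x t))"

definition orbit_dim :: "nat \<Rightarrow> (nat \<Rightarrow> real poly) \<Rightarrow> nat" where
  "orbit_dim n \<alpha> = (\<Sum>l=1..n. (2 * l - 1) * degree (\<alpha> (n - l + 1)))"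

definition W_set ::
  "(nat \<Rightarrow> nat) \<Rightarrow> nat \<Rightarrow> nat \<Rightarrow> (nat \<Rightarrow> real poly) \<Rightarrow> complex list \<Rightarrow> (nat \<Rightarrow> nat \<Rightarrow> nat list)
    \<Rightarrow> (nat \<times> nat) list \<Rightarrow> (nat \<Rightarrow> real) set" where
  "W_set r k n \<alpha> zs J es = {x \<in> euc {..<n * r 1 - orbit_dim n \<alpha>}.
     nu r k n \<alpha> zs J es x \<in> P_set r k (real_weyr n \<alpha> zs)}"

end

(*
  K has the required invariant polynomials iff F + G1 K is similar to A, i.e. iff the linear
  system (F + G1 K) P = P A has an invertible solution P; then P has the block shape of the
  paper and K is recovered as phi(P). Solutions are unique up to the centralizer of A. Over the
  complex numbers the columns of an element of the centralizer are Jordan chains of A, so it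
  consists of Toeplitz blocks, and its free coefficients correspond one to one to the prescribed
  entries of a reduced matrix. For P in the domain of the chart, prescribing these entries of P X
  is a triangular linear system for X in the centralizer, whose diagonal blocks are the
  submatrices P(I_j, 1:tau_j). Hence every P is equivalent to exactly one reduced one.

  For K near a point of the chart, the reduced P is the unique solution of the overdetermined
  linear system {(F + G1 K) P = P A, prescribed entries}; it is injective at that point, so its
  solution is a rational, hence smooth, function of K. A solution exists for every K with the
  right invariant polynomials, because the intertwiners from A to F + G1 K form a space whose
  dimension, that of the centralizer, is the number of prescribed entries. This gives both the
  smooth inverse and the openness of the image.

  A itself has the right invariant polynomials because the rows on which A acts form a sum of
  cyclic modules R[s]/(alpha_i), generated by the vectors with a 1 in degree 0 of the i-th chain
  of every root.
*)

theory Submission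
  imports Defs
begin

text \<open>Smoothness of the inverse means extension to an open set of matrices K, including those
  for which there is no invertible P and the linear system for P is inconsistent. The normal
  equations of the system remain solvable near the given point and supply the extension; whenever
  the system does have a solution, they return it.

  Real and nonreal roots are treated alike by reading a row as a family of truncated polynomials in
  t over the complex numbers, on which A acts as multiplication by z + t. Only one root of each
  conjugate pair is listed. A column splits into a part for z and a part for its conjugate; the
  second part vanishes in the centralizer because no listed nonreal root is the conjugate of
  another.

  Solvability in the centralizer uses no dimension theory: one index set labels both the prescribed
  entries and a family of elements of the centralizer, so the system is square and injectivity is
  enough. The same injectivity is available near a point of the chart, even where the submatrices of
  P are not known to be invertible.\<close>

definition C_inf :: "'i set \<Rightarrow> ('i \<Rightarrow> real) set \<Rightarrow> (('i \<Rightarrow> real) \<Rightarrow> real) \<Rightarrow> bool" where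
  "C_inf I U f \<longleftrightarrow> (\<forall>k. C_on k I U f)"

section \<open>Closure properties of smooth functions\<close>

lemma C_on_imp_continuous_on: "C_on k I U f \<Longrightarrow> continuous_on U f"
  by (cases k) auto

lemma C_inf_imp_continuous_on: "C_inf I U f \<Longrightarrow> continuous_on U f"
  unfolding C_inf_def using C_on_imp_continuous_on by blast

text \<open>Orders are lowered one at a time because the product and reciprocal rules express a
  derivative through the functions themselves, which the induction knows at order k + 1 but must use
  at order k.\<close>

lemma C_on_Suc_imp_C_on: "C_on (Suc k) I U f \<Longrightarrow> C_on k I U f"
proof (induction k arbitrary: f)
  case 0
  then show ?case by simp
next
  case (Suc k)
  have "continuous_on U f" using Suc.prems by simp
  moreover have "\<exists>f'. C_on k I U f' \<and>
      (\<forall>x\<in>U. ((\<lambda>t. f (x(i := t))) has_real_derivative f' x) (at (x i)))" if "i \<in> I" for i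
  proof -
    from Suc.prems that obtain f' where f': "C_on (Suc k) I U f'"
      "\<forall>x\<in>U. ((\<lambda>t. f (x(i := t))) has_real_derivative f' x) (at (x i))"
      by (auto simp del: C_on.simps simp: C_on.simps(2)[of "Suc k"])
    from Suc.IH[OF f'(1)] f'(2) show ?thesis by blast
  qed
  ultimately show ?case by simp
qed

lemma C_on_const: "C_on k I U (\<lambda>_. c)"
proof (induction k arbitrary: c)
  case (Suc k)
  show ?case
    using Suc[of 0] by (auto intro!: exI[of _ "\<lambda>_. 0"])
qed simp

lemma continuous_on_coordinate: "continuous_on U (\<lambda>x :: 'i \<Rightarrow> real. x j)"
  by (rule continuous_on_subset[OF continuous_on_product_coordinates]) simp

lemma C_on_coordinate: "C_on k I U (\<lambda>x. x j)"
proof (cases k)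
  case (Suc k')
  have "\<exists>f'. C_on k' I U f' \<and>
      (\<forall>x\<in>U. ((\<lambda>t. (x(i := t)) j) has_real_derivative f' x) (at (x i)))" for i
  proof (intro exI conjI ballI)
    show "C_on k' I U (\<lambda>_. if i = j then 1 else 0)" by (rule C_on_const)
    show "((\<lambda>t. (x(i := t)) j) has_real_derivative (if i = j then 1 else 0)) (at (x i))" for x
      by (cases "i = j") auto
  qed
  then show ?thesis using Suc by (simp add: continuous_on_coordinate)
qed (simp add: continuous_on_coordinate)

lemma C_on_add:
  assumes "C_on k I U f" "C_on k I U g"
  shows "C_on k I U (\<lambda>x. f x + g x)"
  using assms
proof (induction k arbitrary: f g)
  case 0
  then show ?case by (simp add: continuous_on_add)
next
  case (Suc k)
  have "\<exists>h. C_on k I U h \<and>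
      (\<forall>x\<in>U. ((\<lambda>t. f (x(i := t)) + g (x(i := t))) has_real_derivative h x) (at (x i)))"
    if "i \<in> I" for i
  proof -
    from Suc.prems that obtain f' g' where
      "C_on k I U f'" "\<And>x. x\<in>U \<Longrightarrow> ((\<lambda>t. f (x(i := t))) has_real_derivative f' x) (at (x i))"
      "C_on k I U g'" "\<And>x. x\<in>U \<Longrightarrow> ((\<lambda>t. g (x(i := t))) has_real_derivative g' x) (at (x i))"
      by fastforce
    then show ?thesis using Suc.IH DERIV_add by (intro exI[of _ "\<lambda>x. f' x + g' x"]) blast
  qed
  then show ?case using Suc.prems by (auto intro: continuous_on_add)
qed

lemma C_on_mult:
  assumes "C_on k I U f" "C_on k I U g"
  shows "C_on k I U (\<lambda>x. f x * g x)"
  using assms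
proof (induction k arbitrary: f g)
  case 0
  then show ?case by (simp add: continuous_on_mult)
next
  case (Suc k)
  have "\<exists>h. C_on k I U h \<and>
      (\<forall>x\<in>U. ((\<lambda>t. f (x(i := t)) * g (x(i := t))) has_real_derivative h x) (at (x i)))"
    if "i \<in> I" for i
  proof -
    from Suc.prems that obtain f' g' where
      f': "C_on k I U f'" "\<And>x. x\<in>U \<Longrightarrow> ((\<lambda>t. f (x(i := t))) has_real_derivative f' x) (at (x i))"
      and g': "C_on k I U g'" "\<And>x. x\<in>U \<Longrightarrow> ((\<lambda>t. g (x(i := t))) has_real_derivative g' x) (at (x i))"
      by fastforce
    have "((\<lambda>t. f (x(i := t)) * g (x(i := t))) has_real_derivative f' x * g x + g' x * f x) (at (x i))"
      if "x \<in> U" for x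
      using DERIV_mult[OF f'(2)[OF that] g'(2)[OF that]] by simp
    moreover have "C_on k I U (\<lambda>x. f' x * g x + g' x * f x)"
      using Suc.IH f'(1) g'(1) Suc.prems[THEN C_on_Suc_imp_C_on] by (intro C_on_add) blast+
    ultimately show ?thesis by blast
  qed
  then show ?case using Suc.prems by (auto intro: continuous_on_mult)
qed

text \<open>The derivative of 1/f is - (1/f) f' (1/f), so 1/f has order k + 1 as soon as it has
  order k; the induction runs on the order with f fixed.\<close>

lemma C_on_inverse:
  assumes "C_on k I U f" "\<And>x. x \<in> U \<Longrightarrow> f x \<noteq> 0"
  shows "C_on k I U (\<lambda>x. inverse (f x))"
  using assms
proof (induction k)
  case 0
  then show ?case by (simp add: continuous_on_inverse)
next
  case (Suc k)
  have IH: "C_on k I U (\<lambda>x. inverse (f x))"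
    using Suc.IH Suc.prems C_on_Suc_imp_C_on by blast
  have "\<exists>h. C_on k I U h \<and>
      (\<forall>x\<in>U. ((\<lambda>t. inverse (f (x(i := t)))) has_real_derivative h x) (at (x i)))"
    if "i \<in> I" for i
  proof -
    from Suc.prems that obtain f' where
      f': "C_on k I U f'" "\<And>x. x\<in>U \<Longrightarrow> ((\<lambda>t. f (x(i := t))) has_real_derivative f' x) (at (x i))"
      by fastforce
    have "((\<lambda>t. inverse (f (x(i := t)))) has_real_derivative
        (- 1) * (inverse (f x) * (f' x * inverse (f x)))) (at (x i))" if "x \<in> U" for x
      using DERIV_inverse'[OF f'(2)[OF that]] Suc.prems(2)[OF that] by (simp add: mult.assoc)
    moreover have "C_on k I U (\<lambda>x. (- 1) * (inverse (f x) * (f' x * inverse (f x))))"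
      by (intro C_on_mult C_on_const IH f'(1))
    ultimately show ?thesis by blast
  qed
  then show ?case using Suc.prems by (auto intro: continuous_on_inverse)
qed

lemma C_on_subset: "C_on k I U f \<Longrightarrow> V \<subseteq> U \<Longrightarrow> C_on k I V f"
proof (induction k arbitrary: f)
  case 0
  then show ?case by (auto intro: continuous_on_subset)
next
  case (Suc k)
  then have "continuous_on V f" by (auto intro: continuous_on_subset)
  moreover have "\<exists>f'. C_on k I V f' \<and>
      (\<forall>x\<in>V. ((\<lambda>t. f (x(i := t))) has_real_derivative f' x) (at (x i)))" if "i \<in> I" for i
  proof -
    from Suc.prems that obtain f' where "C_on k I U f'"
      "\<forall>x\<in>U. ((\<lambda>t. f (x(i := t))) has_real_derivative f' x) (at (x i))" by auto
    then show ?thesis using Suc.IH[of f'] Suc.prems(2) by blast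
  qed
  ultimately show ?case by simp
qed

lemma C_inf_const: "C_inf I U (\<lambda>_. c)"
  and C_inf_coordinate: "C_inf I U (\<lambda>x. x j)"
  and C_inf_add: "C_inf I U f \<Longrightarrow> C_inf I U g \<Longrightarrow> C_inf I U (\<lambda>x. f x + g x)"
  and C_inf_mult: "C_inf I U f \<Longrightarrow> C_inf I U g \<Longrightarrow> C_inf I U (\<lambda>x. f x * g x)"
  and C_inf_inverse: "C_inf I U f \<Longrightarrow> (\<And>x. x \<in> U \<Longrightarrow> f x \<noteq> 0) \<Longrightarrow> C_inf I U (\<lambda>x. inverse (f x))"
  and C_inf_subset: "C_inf I U f \<Longrightarrow> V \<subseteq> U \<Longrightarrow> C_inf I V f"
  unfolding C_inf_def
  using C_on_const C_on_coordinate C_on_add C_on_mult C_on_inverse C_on_subset by metis+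

lemma C_inf_diff: "C_inf I U f \<Longrightarrow> C_inf I U g \<Longrightarrow> C_inf I U (\<lambda>x. f x - g x)"
  using C_inf_add[of I U f "\<lambda>x. (- 1) * g x"] C_inf_mult[OF C_inf_const, of I U g "- 1"] by simp

lemma C_inf_divide:
  "C_inf I U f \<Longrightarrow> C_inf I U g \<Longrightarrow> (\<And>x. x \<in> U \<Longrightarrow> g x \<noteq> 0) \<Longrightarrow> C_inf I U (\<lambda>x. f x / g x)"
  unfolding divide_inverse by (intro C_inf_mult C_inf_inverse)

lemma C_inf_sum: "(\<And>s. s \<in> S \<Longrightarrow> C_inf I U (\<lambda>x. f x s)) \<Longrightarrow> C_inf I U (\<lambda>x. \<Sum>s\<in>S. f x s)"
proof (induction S rule: infinite_finite_induct)
  case (insert s S)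
  then show ?case by (simp add: C_inf_add)
qed (simp_all add: C_inf_const)

lemma C_inf_prod: "(\<And>s. s \<in> S \<Longrightarrow> C_inf I U (\<lambda>x. f x s)) \<Longrightarrow> C_inf I U (\<lambda>x. \<Prod>s\<in>S. f x s)"
proof (induction S rule: infinite_finite_induct)
  case (insert s S)
  then show ?case by (simp add: C_inf_mult)
qed (simp_all add: C_inf_const)

section \<open>Determinants, inverses and linear systems with smooth coefficients\<close>

lemma C_inf_det:
  assumes "\<And>a b. a < N \<Longrightarrow> b < N \<Longrightarrow> C_inf I U (\<lambda>y. f y a b)"
  shows "C_inf I U (\<lambda>y. det (mat N N (\<lambda>(a, b). f y a b)))"
proof -
  have "(\<lambda>y. det (mat N N (\<lambda>(a, b). f y a b))) =
    (\<lambda>y. \<Sum>p\<in>{p. p permutes {0..<N}}. signof p * (\<Prod>i=0..<N. f y i (p i)))"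
  proof
    fix y
    have "(\<Prod>i=0..<N. mat N N (\<lambda>(a, b). f y a b) $$ (i, p i)) = (\<Prod>i=0..<N. f y i (p i))"
      if "p permutes {0..<N}" for p
      using permutes_in_image[OF that] by (intro prod.cong) auto
    then show "det (mat N N (\<lambda>(a, b). f y a b)) =
       (\<Sum>p\<in>{p. p permutes {0..<N}}. signof p * (\<Prod>i=0..<N. f y i (p i)))"
      by (subst det_def'[of _ N]) (auto intro!: sum.cong)
  qed
  moreover have "C_inf I U (\<lambda>y. \<Sum>p\<in>{p. p permutes {0..<N}}. signof p * (\<Prod>i=0..<N. f y i (p i)))"
  proof (intro C_inf_sum C_inf_mult C_inf_prod)
    show "C_inf I U (\<lambda>y. f y i (p i))" if "p \<in> {p. p permutes {0..<N}}" "i \<in> {0..<N}" for p i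
      using that permutes_in_image[of p "{0..<N}" i] by (intro assms) auto
  qed (rule C_inf_const)
  ultimately show ?thesis by simp
qed

lemma C_inf_cofactor:
  assumes "\<And>a b. a < N \<Longrightarrow> b < N \<Longrightarrow> C_inf I U (\<lambda>y. f y a b)"
    and "i < N" "j < N"
  shows "C_inf I U (\<lambda>y. cofactor (mat N N (\<lambda>(a, b). f y a b)) i j)"
proof -
  have "(\<lambda>y. cofactor (mat N N (\<lambda>(a, b). f y a b)) i j) =
     (\<lambda>y. (- 1) ^ (i + j) * det (mat (N - 1) (N - 1)
        (\<lambda>(a, b). f y (if a < i then a else Suc a) (if b < j then b else Suc b))))"
    unfolding cofactor_def mat_delete_def
    by (intro ext arg_cong2[of _ _ _ _ "(*)"] refl arg_cong[of _ _ det] eq_matI) auto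
  moreover have "C_inf I U (\<lambda>y. (- 1) ^ (i + j) * det (mat (N - 1) (N - 1)
        (\<lambda>(a, b). f y (if a < i then a else Suc a) (if b < j then b else Suc b))))"
    by (intro C_inf_mult C_inf_const C_inf_det assms) auto
  ultimately show ?thesis by simp
qed

text \<open>\<open>mat_inverse\<close> is computed by elimination, whose branching hides the
  dependence on the entries. Cramer's rule identifies it with cofactors over the determinant, which
  is smooth wherever the determinant does not vanish.\<close>

lemma adj_inverse:
  fixes P :: "'a :: field mat"
  assumes P: "P \<in> carrier_mat n n" and d: "det P \<noteq> 0"
  defines "Q \<equiv> mat n n (\<lambda>(i, j). cofactor P j i / det P)"
  shows "Q \<in> carrier_mat n n" "P * Q = 1\<^sub>m n" "Q * P = 1\<^sub>m n" "the (mat_inverse P) = Q"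
proof -
  show Q: "Q \<in> carrier_mat n n" unfolding Q_def by simp
  have Q_eq: "Q = inverse (det P) \<cdot>\<^sub>m adj_mat P"
    using P unfolding Q_def adj_mat_def by (intro eq_matI) (auto simp: field_simps)
  have adj: "adj_mat P \<in> carrier_mat n n" "P * adj_mat P = det P \<cdot>\<^sub>m 1\<^sub>m n" "adj_mat P * P = det P \<cdot>\<^sub>m 1\<^sub>m n"
    using adj_mat[OF P] by auto
  have "P * Q = inverse (det P) \<cdot>\<^sub>m (P * adj_mat P)"
    unfolding Q_eq using mult_smult_distrib[OF P adj(1)] by simp
  then show PQ: "P * Q = 1\<^sub>m n" using adj d by (intro eq_matI) auto
  have "Q * P = inverse (det P) \<cdot>\<^sub>m (adj_mat P * P)"
    unfolding Q_eq using mult_smult_assoc_mat[OF adj(1) P] by simp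
  then show QP: "Q * P = 1\<^sub>m n" using adj d by (intro eq_matI) auto
  show "the (mat_inverse P) = Q"
  proof (cases "mat_inverse P")
    case None
    have "P \<in> Units (ring_mat TYPE('a) n ())"
      unfolding Units_def ring_mat_def using P Q PQ QP by auto
    then show ?thesis using mat_inverse(1)[OF P None, of "()"] by blast
  next
    case (Some B)
    then have B: "B * P = 1\<^sub>m n" "B \<in> carrier_mat n n" using mat_inverse(2)[OF P] by auto
    have "B = B * (P * Q)" using PQ B by simp
    also have "\<dots> = Q" using assoc_mult_mat[OF B(2) P Q] B Q by simp
    finally show ?thesis using Some by simp
  qed
qed

lemma invertible_mat_iff_det:
  fixes P :: "'a :: field mat"
  assumes P: "P \<in> carrier_mat n n"
  shows "invertible_mat P \<longleftrightarrow> det P \<noteq> 0"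
proof
  assume "invertible_mat P"
  then obtain B where B: "P * B = 1\<^sub>m (dim_row P)" "B * P = 1\<^sub>m (dim_row B)"
    unfolding invertible_mat_def inverts_mat_def by auto
  have "dim_row B = n" using arg_cong[OF B(2), of dim_col] P by simp
  moreover have "dim_col B = n" using arg_cong[OF B(1), of dim_col] P by simp
  ultimately have "B \<in> carrier_mat n n" by auto
  then have "det P * det B = 1" using det_mult[OF P, of B] B(1) P by simp
  then show "det P \<noteq> 0" by auto
next
  assume "det P \<noteq> 0"
  from adj_inverse[OF P this] P show "invertible_mat P"
    unfolding invertible_mat_def inverts_mat_def by (metis carrier_matD square_mat.simps)
qed

text \<open>Vectors are plain functions here, so that kernels can be handled by sums and transported
  to other finite index sets.\<close>

lemma det_nonzeroI:
  fixes P :: "'a :: field mat"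
  assumes P: "P \<in> carrier_mat n n"
    and inj: "\<And>v. (\<And>a. a < n \<Longrightarrow> (\<Sum>b<n. P $$ (a, b) * v b) = 0) \<Longrightarrow> \<forall>b<n. v b = 0"
  shows "det P \<noteq> 0"
proof
  assume "det P = 0"
  then obtain v where v: "v \<in> carrier_vec n" "v \<noteq> 0\<^sub>v n" "P *\<^sub>v v = 0\<^sub>v n"
    using det_0_iff_vec_prod_zero_field[OF P] by blast
  have "(\<Sum>b<n. P $$ (a, b) * v $ b) = 0" if "a < n" for a
    using arg_cong[OF v(3), of "\<lambda>u. u $ a"] that P v(1)
    by (auto simp: scalar_prod_def atLeast0LessThan)
  from inj[of "\<lambda>b. v $ b", OF this] v(1) have "v = 0\<^sub>v n" by (intro eq_vecI) auto
  with v(2) show False by simp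
qed

lemma det_nonzeroD:
  fixes P :: "'a :: field mat"
  assumes P: "P \<in> carrier_mat n n" and d: "det P \<noteq> 0"
    and v: "\<And>a. a < n \<Longrightarrow> (\<Sum>b<n. P $$ (a, b) * v b) = 0"
    and b: "b < n"
  shows "v b = 0"
proof -
  have "P *\<^sub>v vec n v = 0\<^sub>v n"
    using P v by (intro eq_vecI) (auto simp: scalar_prod_def atLeast0LessThan)
  then have "vec n v = 0\<^sub>v n" using det_0_iff_vec_prod_zero_field[OF P] d vec_carrier[of n v] by blast
  then show ?thesis using b by (metis index_vec index_zero_vec(1))
qed

lemma sum_reindex_lessThan:
  "bij_betw h {..<N} Q \<Longrightarrow> (\<Sum>q\<in>Q. f q) = (\<Sum>a<N. f (h a))" for N :: nat
  by (rule sum.reindex_bij_betw[symmetric])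

text \<open>Equations and unknowns carry the same index set, so an injective system is square and
  hence invertible. This takes the place of a dimension count.\<close>

lemma injective_system_solvable:
  fixes G :: "'q \<Rightarrow> 'q \<Rightarrow> real"
  assumes fin: "finite Q"
    and inj: "\<And>v. (\<And>a. a \<in> Q \<Longrightarrow> (\<Sum>b\<in>Q. G a b * v b) = 0) \<Longrightarrow> \<forall>a\<in>Q. v a = 0"
  shows "\<exists>v. \<forall>a\<in>Q. (\<Sum>b\<in>Q. G a b * v b) = c a"
proof -
  obtain h where h: "bij_betw h {..<card Q} Q"
    using ex_bij_betw_nat_finite[OF fin] by (auto simp: atLeast0LessThan)
  let ?N = "card Q"
  define P where "P = mat ?N ?N (\<lambda>(a, b). G (h a) (h b))"
  have P: "P \<in> carrier_mat ?N ?N" unfolding P_def by simp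
  define g where "g = the_inv_into {..<?N} h"
  have gh: "g (h a) = a" if "a < ?N" for a
    unfolding g_def using h that by (simp add: bij_betw_def the_inv_into_f_f)
  have hg: "g q < ?N" "h (g q) = q" if "q \<in> Q" for q
    using gh that bij_betw_imp_surj_on[OF h] by (metis imageE lessThan_iff)+
  have "det P \<noteq> 0"
  proof (rule det_nonzeroI[OF P])
    fix v assume v: "\<And>a. a < ?N \<Longrightarrow> (\<Sum>b<?N. P $$ (a, b) * v b) = 0"
    have "(\<Sum>b\<in>Q. G a b * v (g b)) = 0" if "a \<in> Q" for a
      using v[of "g a"] hg[OF that] gh unfolding sum_reindex_lessThan[OF h] P_def by simp
    from inj[OF this] show "\<forall>b<?N. v b = 0" using gh h unfolding bij_betw_def by force
  qed
  from adj_inverse[OF P this] obtain B where B: "B \<in> carrier_mat ?N ?N" "P * B = 1\<^sub>m ?N" by blast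
  define u where "u = B *\<^sub>v vec ?N (\<lambda>a. c (h a))"
  have u: "u \<in> carrier_vec ?N" unfolding u_def using B by auto
  have Pu: "P *\<^sub>v u = vec ?N (\<lambda>a. c (h a))"
    unfolding u_def using assoc_mult_mat_vec[OF P B(1), of "vec ?N (\<lambda>a. c (h a))"] B(2) by simp
  have "(\<Sum>b\<in>Q. G a b * (u $ g b)) = c a" if "a \<in> Q" for a
    using arg_cong[OF Pu, of "\<lambda>w. w $ g a"] hg[OF that] gh u
    unfolding sum_reindex_lessThan[OF h] P_def by (simp add: scalar_prod_def atLeast0LessThan)
  then show ?thesis by (intro exI[of _ "\<lambda>b. u $ g b"]) auto
qed

text \<open>The solution is read off the normal equations \<open>M(y\<^sub>0)\<^sup>T M(y) v = M(y\<^sub>0)\<^sup>T c\<close>, whose matrix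
  is invertible at \<open>y\<^sub>0\<close>, hence near \<open>y\<^sub>0\<close>.\<close>

lemma smooth_solution_of_injective_system:
  fixes M :: "('i \<Rightarrow> real) \<Rightarrow> 'e \<Rightarrow> 'q \<Rightarrow> real"
  assumes finQ: "finite Q" and finE: "finite E"
    and smooth: "\<And>e q. e \<in> E \<Longrightarrow> q \<in> Q \<Longrightarrow> C_inf I UNIV (\<lambda>y. M y e q)"
    and inj: "\<And>v. (\<And>e. e \<in> E \<Longrightarrow> (\<Sum>q\<in>Q. M y0 e q * v q) = 0) \<Longrightarrow> \<forall>q\<in>Q. v q = 0"
    and y0: "y0 \<in> euc I"
  obtains U sol where "openin (top_of_set (euc I)) U" "y0 \<in> U"
    "\<And>q. q \<in> Q \<Longrightarrow> C_inf I U (sol q)"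
    "\<And>y v q. y \<in> U \<Longrightarrow> (\<And>e. e \<in> E \<Longrightarrow> (\<Sum>q\<in>Q. M y e q * v q) = c e) \<Longrightarrow> q \<in> Q \<Longrightarrow> v q = sol q y"
    "\<And>y v q. y \<in> U \<Longrightarrow> (\<And>e. e \<in> E \<Longrightarrow> (\<Sum>q\<in>Q. M y e q * v q) = 0) \<Longrightarrow> q \<in> Q \<Longrightarrow> v q = 0"
proof -
  obtain h where h: "bij_betw h {..<card Q} Q"
    using ex_bij_betw_nat_finite[OF finQ] by (auto simp: atLeast0LessThan)
  let ?N = "card Q"
  define g where "g = the_inv_into {..<?N} h"
  have gh: "g (h a) = a" if "a < ?N" for a
    unfolding g_def using h that by (simp add: bij_betw_def the_inv_into_f_f)
  have hQ: "h a \<in> Q" if "a < ?N" for a using h that unfolding bij_betw_def by auto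
  have hg: "g q < ?N" "h (g q) = q" if "q \<in> Q" for q
    using gh that bij_betw_imp_surj_on[OF h] by (metis imageE lessThan_iff)+
  define f where "f y a b = (\<Sum>e\<in>E. M y0 e (h a) * M y e (h b))" for y a b
  define G where "G y = mat ?N ?N (\<lambda>(a, b). f y a b)" for y
  have G: "G y \<in> carrier_mat ?N ?N" for y unfolding G_def by simp
  have f_smooth: "C_inf I UNIV (\<lambda>y. f y a b)" if "a < ?N" "b < ?N" for a b
    unfolding f_def using that hQ by (intro C_inf_sum C_inf_mult C_inf_const smooth) auto
  have normal: "(\<Sum>b<?N. G y $$ (a, b) * v (h b)) = (\<Sum>e\<in>E. M y0 e (h a) * (\<Sum>q\<in>Q. M y e q * v q))"
    if "a < ?N" for y a v
  proof -
    have "(\<Sum>b<?N. G y $$ (a, b) * v (h b)) = (\<Sum>b<?N. \<Sum>e\<in>E. M y0 e (h a) * (M y e (h b) * v (h b)))"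
      using that by (simp add: G_def f_def sum_distrib_right mult.assoc)
    also have "\<dots> = (\<Sum>e\<in>E. \<Sum>b<?N. M y0 e (h a) * (M y e (h b) * v (h b)))" by (rule sum.swap)
    finally show ?thesis by (simp add: sum_reindex_lessThan[OF h] sum_distrib_left)
  qed
  define U where "U = {y \<in> euc I. det (G y) \<noteq> 0}"
  have det_smooth: "C_inf I UNIV (\<lambda>y. det (G y))"
    unfolding G_def by (intro C_inf_det f_smooth)
  have opU: "openin (top_of_set (euc I)) U"
  proof -
    have "open {y. det (G y) \<noteq> 0}"
      using open_Collect_neq[OF C_inf_imp_continuous_on[OF det_smooth] continuous_on_const[of _ 0]] by simp
    then show ?thesis unfolding U_def openin_open by blast
  qed
  have y0U: "y0 \<in> U"
  proof -
    have "det (G y0) \<noteq> 0"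
    proof (rule det_nonzeroI[OF G])
      fix v assume v: "\<And>a. a < ?N \<Longrightarrow> (\<Sum>b<?N. G y0 $$ (a, b) * v b) = 0"
      define v' where "v' q = v (g q)" for q
      have vv: "v b = v' (h b)" if "b < ?N" for b using that by (simp add: v'_def gh)
      have "(\<Sum>e\<in>E. M y0 e (h a) * (\<Sum>q\<in>Q. M y0 e q * v' q)) = 0" if "a < ?N" for a
        using v[OF that] normal[OF that, of y0 v'] vv by simp
      \<comment> \<open>Pairing the normal equations at \<open>y0\<close> with \<open>v'\<close>
        itself gives the squared norm of the image of \<open>v'\<close>, a sum of squares over the
        equations.\<close>
      then have "(\<Sum>a<?N. v' (h a) * (\<Sum>e\<in>E. M y0 e (h a) * (\<Sum>q\<in>Q. M y0 e q * v' q))) = 0" by simp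
      then have "(\<Sum>a<?N. \<Sum>e\<in>E. (v' (h a) * M y0 e (h a)) * (\<Sum>q\<in>Q. M y0 e q * v' q)) = 0"
        by (simp add: sum_distrib_left mult.assoc)
      then have "(\<Sum>e\<in>E. \<Sum>a<?N. (M y0 e (h a) * v' (h a)) * (\<Sum>q\<in>Q. M y0 e q * v' q)) = 0"
        by (subst sum.swap) (simp add: mult.commute)
      then have "(\<Sum>e\<in>E. (\<Sum>q\<in>Q. M y0 e q * v' q)\<^sup>2) = 0"
        by (simp add: sum_distrib_right[symmetric] sum_reindex_lessThan[OF h] power2_eq_square)
      then have "\<And>e. e \<in> E \<Longrightarrow> (\<Sum>q\<in>Q. M y0 e q * v' q) = 0"
        using finE by (subst (asm) sum_nonneg_eq_0_iff) auto
      from inj[OF this] show "\<forall>b<?N. v b = 0" using vv hQ by auto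
    qed
    then show ?thesis using y0 unfolding U_def by simp
  qed
  define rhs where "rhs b = (\<Sum>e\<in>E. M y0 e (h b) * c e)" for b
  define sol where "sol q y = (\<Sum>b<?N. cofactor (G y) b (g q) / det (G y) * rhs b)" for q y
  \<comment> \<open>Only uniqueness is claimed: off \<open>y0\<close> the normal equations have a
    solution even where the overdetermined system has none, and \<open>sol\<close> agrees with every
    solution that does exist.\<close>
  show thesis
  proof (rule that[OF opU y0U, of sol])
    show "C_inf I U (sol q)" if "q \<in> Q" for q
    proof -
      have "C_inf I U (\<lambda>y. cofactor (G y) b (g q))" if "b < ?N" for b
        unfolding G_def using that hg(1)[OF \<open>q \<in> Q\<close>]
        by (intro C_inf_cofactor C_inf_subset[OF f_smooth]) auto
      then show ?thesis unfolding sol_def using C_inf_subset[OF det_smooth, of U]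
        by (intro C_inf_sum C_inf_mult C_inf_divide C_inf_const) (auto simp: U_def)
    qed
  next
    fix y v q assume y: "y \<in> U" and v: "\<And>e. e \<in> E \<Longrightarrow> (\<Sum>q\<in>Q. M y e q * v q) = c e" and q: "q \<in> Q"
    define B where "B = mat ?N ?N (\<lambda>(i, j). cofactor (G y) j i / det (G y))"
    have d: "det (G y) \<noteq> 0" using y unfolding U_def by simp
    note B = adj_inverse[OF G d, folded B_def]
    have "G y *\<^sub>v vec ?N (\<lambda>b. v (h b)) = vec ?N rhs"
      using G[of y] normal[of _ y v] v
      by (intro eq_vecI) (auto simp: scalar_prod_def atLeast0LessThan rhs_def)
    then have "vec ?N (\<lambda>b. v (h b)) = B *\<^sub>v vec ?N rhs"
      using assoc_mult_mat_vec[OF B(1) G, of "vec ?N (\<lambda>b. v (h b))" y] B(3) by simp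
    from arg_cong[OF this, of "\<lambda>w. w $ g q"] show "v q = sol q y"
      using hg[OF q] B(1) by (simp add: scalar_prod_def atLeast0LessThan sol_def B_def)
  next
    fix y v q assume y: "y \<in> U" and v: "\<And>e. e \<in> E \<Longrightarrow> (\<Sum>q\<in>Q. M y e q * v q) = 0" and q: "q \<in> Q"
    have "(\<Sum>b<?N. G y $$ (a, b) * v (h b)) = 0" if "a < ?N" for a
      using normal[OF that] v by simp
    with det_nonzeroD[OF G, of y "\<lambda>b. v (h b)" "g q"] y hg[OF q] show "v q = 0"
      unfolding U_def by simp
  qed
qed

text \<open>The map \<open>\<phi>\<close> embeds one set of coordinates into another, for instance
  those of a factor into those of a product. Injectivity makes updating \<open>\<phi> i\<close> in
  \<open>y\<close> the same as updating \<open>i\<close> in \<open>\<rho> y\<close>; along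
  coordinates outside the image the function is constant.\<close>

lemma C_on_pullback:
  fixes \<phi> :: "'i \<Rightarrow> 'j"
  assumes inj: "inj_on \<phi> I" and U: "U \<subseteq> euc I"
  defines "\<rho> \<equiv> (\<lambda>y i. if i \<in> I then y (\<phi> i) else 0)"
  shows "C_on k I U f \<Longrightarrow> C_on k I' {y. \<rho> y \<in> U} (\<lambda>y. f (\<rho> y))"
proof (induction k arbitrary: f)
  case 0
  have "continuous_on {y. \<rho> y \<in> U} \<rho>"
    unfolding \<rho>_def
  proof (rule continuous_on_coordinatewise_then_product)
    show "continuous_on {y. (\<lambda>i. if i \<in> I then y (\<phi> i) else 0) \<in> U} (\<lambda>y. if i \<in> I then y (\<phi> i) else 0)" for i
      by (cases "i \<in> I") (auto intro: continuous_on_coordinate)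
  qed
  with 0 show ?case by (auto intro: continuous_on_compose2[of U f])
next
  case (Suc k)
  have cont: "continuous_on {y. \<rho> y \<in> U} \<rho>"
    unfolding \<rho>_def
  proof (rule continuous_on_coordinatewise_then_product)
    show "continuous_on {y. (\<lambda>i. if i \<in> I then y (\<phi> i) else 0) \<in> U} (\<lambda>y. if i \<in> I then y (\<phi> i) else 0)" for i
      by (cases "i \<in> I") (auto intro: continuous_on_coordinate)
  qed
  have "\<exists>f'. C_on k I' {y. \<rho> y \<in> U} f' \<and>
     (\<forall>y\<in>{y. \<rho> y \<in> U}. ((\<lambda>t. f (\<rho> (y(j := t)))) has_real_derivative f' y) (at (y j)))" for j
  proof (cases "j \<in> \<phi> ` I")
    case True
    then obtain i where i: "i \<in> I" "j = \<phi> i" by auto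
    from Suc.prems i obtain f' where f': "C_on k I U f'"
      "\<And>x. x\<in>U \<Longrightarrow> ((\<lambda>t. f (x(i := t))) has_real_derivative f' x) (at (x i))" by fastforce
    have "\<rho> (y(j := t)) = (\<rho> y)(i := t)" for y t
      unfolding \<rho>_def using i inj by (auto simp: fun_eq_iff inj_on_eq_iff)
    moreover have "((\<lambda>t. f ((\<rho> y)(i := t))) has_real_derivative f' (\<rho> y)) (at (y j))"
      if "\<rho> y \<in> U" for y
      using f'(2)[OF that] i by (simp add: \<rho>_def)
    ultimately show ?thesis using Suc.IH[OF f'(1)] by (intro exI[of _ "\<lambda>y. f' (\<rho> y)"]) auto
  next
    case False
    then have "\<rho> (y(j := t)) = \<rho> y" for y t
      unfolding \<rho>_def by (auto simp: fun_eq_iff)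
    then show ?thesis by (intro exI[of _ "\<lambda>_. 0"]) (auto intro: C_on_const)
  qed
  then show ?case using Suc.prems cont by (auto intro: continuous_on_compose2[of U f])
qed

lemma C_inf_pullback:
  assumes "inj_on \<phi> I" "U \<subseteq> euc I" "C_inf I U f"
  shows "C_inf I' {y. (\<lambda>i. if i \<in> I then y (\<phi> i) else 0) \<in> U} (\<lambda>y. f (\<lambda>i. if i \<in> I then y (\<phi> i) else 0))"
  using C_on_pullback[OF assms(1,2)] assms(3) unfolding C_inf_def by blast

lemma openin_euc_pullback:
  assumes "openin (top_of_set (euc I)) U"
  shows "openin (top_of_set (euc I')) {y \<in> euc I'. (\<lambda>i. if i \<in> I then y (\<phi> i) else 0) \<in> U}"
proof -
  obtain T where T: "open T" "U = euc I \<inter> T" using assms by (auto simp: openin_open)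
  let ?\<rho> = "\<lambda>y i. if i \<in> I then y (\<phi> i) else (0::real)"
  have "continuous_on UNIV ?\<rho>"
  proof (rule continuous_on_coordinatewise_then_product)
    show "continuous_on UNIV (\<lambda>y. if i \<in> I then y (\<phi> i) else (0::real))" for i
      by (cases "i \<in> I") (auto intro: continuous_on_coordinate)
  qed
  then have "open (?\<rho> -` T)" using T(1) by (simp add: continuous_on_open_vimage)
  moreover have "{y \<in> euc I'. ?\<rho> y \<in> U} = euc I' \<inter> (?\<rho> -` T)"
    unfolding T(2) by (auto simp: euc_def)
  ultimately show ?thesis unfolding openin_open by blast
qed

section \<open>Invariant polynomials and similarity\<close>

text \<open>Horner's scheme, so that the homomorphism laws are inductions along
  \<open>pCons\<close>.\<close>

definition poly_at_mat :: "nat \<Rightarrow> real mat \<Rightarrow> real poly \<Rightarrow> real mat" where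
  "poly_at_mat n M p = fold_coeffs (\<lambda>a X. a \<cdot>\<^sub>m 1\<^sub>m n + M * X) p (0\<^sub>m n n)"

lemma poly_at_mat_0: "poly_at_mat n M 0 = 0\<^sub>m n n"
  unfolding poly_at_mat_def by simp

lemma poly_at_mat_pCons:
  assumes "M \<in> carrier_mat n n"
  shows "poly_at_mat n M (pCons a p) = a \<cdot>\<^sub>m 1\<^sub>m n + M * poly_at_mat n M p"
proof (cases "a = 0 \<and> p = 0")
  case True
  have "(0::real) \<cdot>\<^sub>m 1\<^sub>m n + M * 0\<^sub>m n n = 0\<^sub>m n n" using assms by (intro eq_matI) auto
  with True show ?thesis by (simp add: poly_at_mat_0)
next
  case False
  then show ?thesis
    unfolding poly_at_mat_def
    by (cases "p = 0") (simp_all add: fold_coeffs_pCons_coeff_not_0_eq fold_coeffs_pCons_not_0_0_eq)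
qed

lemma poly_at_mat_carrier [simp]:
  assumes "M \<in> carrier_mat n n"
  shows "poly_at_mat n M p \<in> carrier_mat n n"
  by (induction p) (use assms in \<open>simp_all add: poly_at_mat_0 poly_at_mat_pCons\<close>)

lemma poly_at_mat_dim [simp]:
  assumes "M \<in> carrier_mat n n"
  shows "dim_row (poly_at_mat n M p) = n" "dim_col (poly_at_mat n M p) = n"
  using poly_at_mat_carrier[OF assms] by auto

lemma poly_at_mat_add:
  assumes M: "M \<in> carrier_mat n n"
  shows "poly_at_mat n M (p + q) = poly_at_mat n M p + poly_at_mat n M q"
proof (induction p q rule: poly_induct2)
  case 0
  then show ?case by (simp add: poly_at_mat_0)
next
  case (pCons a p b q)
  have c: "poly_at_mat n M p \<in> carrier_mat n n" "poly_at_mat n M q \<in> carrier_mat n n" using M by auto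
  show ?case
    unfolding add_pCons poly_at_mat_pCons[OF M] pCons mult_add_distrib_mat[OF M c]
    using M c by (intro eq_matI) (auto simp: algebra_simps)
qed

lemma poly_at_mat_smult:
  assumes M: "M \<in> carrier_mat n n"
  shows "poly_at_mat n M (Polynomial.smult c p) = c \<cdot>\<^sub>m poly_at_mat n M p"
proof (induction p)
  case 0
  then show ?case by (simp add: poly_at_mat_0)
next
  case (pCons a p)
  have c: "poly_at_mat n M p \<in> carrier_mat n n" using M by auto
  show ?case
    unfolding smult_pCons poly_at_mat_pCons[OF M] pCons mult_smult_distrib[OF M c]
    using M c by (intro eq_matI) (auto simp: algebra_simps)
qed

lemma poly_at_mat_mult:
  assumes M: "M \<in> carrier_mat n n"
  shows "poly_at_mat n M (p * q) = poly_at_mat n M p * poly_at_mat n M q"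
proof (induction p)
  case 0
  show ?case using M by (simp add: poly_at_mat_0 left_mult_zero_mat[OF poly_at_mat_carrier[OF M]])
next
  case (pCons a p)
  let ?P = "poly_at_mat n M p" and ?Q = "poly_at_mat n M q"
  have c: "?P \<in> carrier_mat n n" "?Q \<in> carrier_mat n n" using M by auto
  have "poly_at_mat n M (pCons a p * q) = a \<cdot>\<^sub>m ?Q + (0 \<cdot>\<^sub>m 1\<^sub>m n + M * (?P * ?Q))"
    by (simp only: mult_pCons_left poly_at_mat_add[OF M] poly_at_mat_smult[OF M] poly_at_mat_pCons[OF M] pCons)
  also have "\<dots> = (a \<cdot>\<^sub>m 1\<^sub>m n) * ?Q + (M * ?P) * ?Q"
    using M c by (intro eq_matI) (auto simp: assoc_mult_mat[OF M c])
  also have "\<dots> = (a \<cdot>\<^sub>m 1\<^sub>m n + M * ?P) * ?Q"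
    using M c by (subst add_mult_distrib_mat[of _ n n]) auto
  finally show ?case by (simp only: poly_at_mat_pCons[OF M])
qed

lemma poly_at_mat_intertwine:
  assumes M: "M \<in> carrier_mat n n" and M': "M' \<in> carrier_mat n n" and T: "T \<in> carrier_mat n n"
    and TM: "T * M = M' * T"
  shows "T * poly_at_mat n M p = poly_at_mat n M' p * T"
proof (induction p)
  case 0
  show ?case using T by (simp add: poly_at_mat_0)
next
  case (pCons a p)
  let ?P = "poly_at_mat n M p" and ?P' = "poly_at_mat n M' p"
  have c: "?P \<in> carrier_mat n n" "?P' \<in> carrier_mat n n" using M M' by auto
  have "T * (a \<cdot>\<^sub>m 1\<^sub>m n + M * ?P) = a \<cdot>\<^sub>m T + T * (M * ?P)"
    using M T c by (subst mult_add_distrib_mat[of _ n n]) auto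
  also have "T * (M * ?P) = (M' * T) * ?P" using assoc_mult_mat[OF T M c(1)] TM by simp
  also have "\<dots> = M' * (?P' * T)" using assoc_mult_mat[OF M' T c(1)] pCons by simp
  also have "\<dots> = (M' * ?P') * T" using assoc_mult_mat[OF M' c(2) T] by simp
  also have "a \<cdot>\<^sub>m T + (M' * ?P') * T = (a \<cdot>\<^sub>m 1\<^sub>m n + M' * ?P') * T"
    using M' T c by (subst add_mult_distrib_mat[of _ n n]) auto
  finally show ?case by (simp only: poly_at_mat_pCons[OF M] poly_at_mat_pCons[OF M'])
qed

lemma poly_at_mat_const:
  assumes M: "M \<in> carrier_mat n n"
  shows "poly_at_mat n M [:c:] = c \<cdot>\<^sub>m 1\<^sub>m n"
  using M by (simp add: poly_at_mat_pCons poly_at_mat_0)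

lemma poly_at_mat_X:
  assumes M: "M \<in> carrier_mat n n"
  shows "poly_at_mat n M [:0, 1:] = M"
  using M by (subst poly_at_mat_pCons[OF M], subst poly_at_mat_const[OF M]) (intro eq_matI, auto)

lemma poly_at_mat_sum_index:
  assumes M: "M \<in> carrier_mat n n" and "b < n" "c < n"
  shows "poly_at_mat n M (\<Sum>d\<in>D. f d) $$ (b, c) = (\<Sum>d\<in>D. poly_at_mat n M (f d) $$ (b, c))"
proof (induction D rule: infinite_finite_induct)
  case (insert d D)
  then show ?case using assms poly_at_mat_dim[OF M] by (simp add: poly_at_mat_add[OF M])
qed (use assms in \<open>simp_all add: poly_at_mat_0\<close>)

text \<open>\<open>poly_mat_at n M Q = \<Sum>\<^sub>i Q\<^sub>i M\<^sup>i\<close> for a polynomial matrix \<open>Q = \<Sum>\<^sub>i Q\<^sub>i s\<^sup>i\<close>: right evaluation.\<close>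

definition poly_mat_at :: "nat \<Rightarrow> real mat \<Rightarrow> real poly mat \<Rightarrow> real mat" where
  "poly_mat_at n M Q = mat n n (\<lambda>(a, c). \<Sum>b<n. poly_at_mat n M (Q $$ (a, b)) $$ (b, c))"

lemma poly_mat_at_carrier [simp]: "poly_mat_at n M Q \<in> carrier_mat n n"
  unfolding poly_mat_at_def by simp

lemma mult_mat_index:
  assumes "A \<in> carrier_mat p n" "B \<in> carrier_mat n q" "a < p" "c < q"
  shows "(A * B) $$ (a, c) = (\<Sum>b<n. A $$ (a, b) * B $$ (b, c))"
  using assms by (simp add: scalar_prod_def atLeast0LessThan)

text \<open>Right evaluation is not multiplicative, since M need not commute with the coefficients
  of Q. But the value of R Q is the sum of R_i Q(M) M^i over the coefficients R_i of R, so it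
  depends on Q only through Q(M). Left multiples of a matrix that vanishes at M therefore vanish as
  well.\<close>

lemma poly_mat_at_mult:
  assumes M: "M \<in> carrier_mat n n" and R: "R \<in> carrier_mat n n" and Q: "Q \<in> carrier_mat n n"
    and ac: "a < n" "c < n"
  shows "poly_mat_at n M (R * Q) $$ (a, c) =
    (\<Sum>d<n. \<Sum>e<n. poly_mat_at n M Q $$ (d, e) * poly_at_mat n M (R $$ (a, d)) $$ (e, c))"
proof -
  let ?e = "poly_at_mat n M"
  have "poly_mat_at n M (R * Q) $$ (a, c) = (\<Sum>b<n. \<Sum>d<n. ?e (R $$ (a, d) * Q $$ (d, b)) $$ (b, c))"
    using ac M by (simp add: poly_mat_at_def mult_mat_index[OF R Q] poly_at_mat_sum_index del: index_mult_mat)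
  also have "\<dots> = (\<Sum>b<n. \<Sum>d<n. \<Sum>e<n. ?e (Q $$ (d, b)) $$ (b, e) * ?e (R $$ (a, d)) $$ (e, c))"
  proof (intro sum.cong refl)
    fix b d assume "b \<in> {..<n}"
    then show "?e (R $$ (a, d) * Q $$ (d, b)) $$ (b, c) =
        (\<Sum>e<n. ?e (Q $$ (d, b)) $$ (b, e) * ?e (R $$ (a, d)) $$ (e, c))"
      using ac M by (subst mult.commute, subst poly_at_mat_mult[OF M], subst mult_mat_index[of _ n n]) auto
  qed
  also have "\<dots> = (\<Sum>d<n. \<Sum>b<n. \<Sum>e<n. ?e (Q $$ (d, b)) $$ (b, e) * ?e (R $$ (a, d)) $$ (e, c))"
    by (rule sum.swap)
  also have "\<dots> = (\<Sum>d<n. \<Sum>e<n. \<Sum>b<n. ?e (Q $$ (d, b)) $$ (b, e) * ?e (R $$ (a, d)) $$ (e, c))"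
    by (intro sum.cong refl sum.swap)
  also have "\<dots> = (\<Sum>d<n. \<Sum>e<n. poly_mat_at n M Q $$ (d, e) * ?e (R $$ (a, d)) $$ (e, c))"
    by (intro sum.cong refl) (simp add: poly_mat_at_def sum_distrib_right)
  finally show ?thesis .
qed

lemma char_poly_matrix_index:
  assumes "M \<in> carrier_mat n n" "a < n" "b < n"
  shows "char_poly_matrix M $$ (a, b) = (if a = b then [:0, 1:] else 0) + [:- (M $$ (a, b)):]"
  using assms unfolding char_poly_matrix_def by auto

lemma poly_mat_at_char_poly_matrix:
  assumes M: "M \<in> carrier_mat n n"
  shows "poly_mat_at n M (char_poly_matrix M) = 0\<^sub>m n n"
proof (intro eq_matI)
  fix a c assume "a < dim_row (0\<^sub>m n n :: real mat)" "c < dim_col (0\<^sub>m n n :: real mat)"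
  then have ac: "a < n" "c < n" by auto
  have "(\<Sum>b<n. poly_at_mat n M (char_poly_matrix M $$ (a, b)) $$ (b, c)) =
     (\<Sum>b<n. (if a = b then M $$ (b, c) else 0) - (if b = c then M $$ (a, b) else 0))"
  proof (intro sum.cong refl)
    fix b assume "b \<in> {..<n}"
    then show "poly_at_mat n M (char_poly_matrix M $$ (a, b)) $$ (b, c) =
       (if a = b then M $$ (b, c) else 0) - (if b = c then M $$ (a, b) else 0)"
      using ac M poly_at_mat_dim[OF M]
      by (simp add: char_poly_matrix_index[OF M] poly_at_mat_add[OF M] poly_at_mat_const[OF M]
        poly_at_mat_X[OF M] poly_at_mat_0 del: add_pCons)
  qed
  also have "\<dots> = 0" using ac by (simp add: sum_subtractf)
  finally show "poly_mat_at n M (char_poly_matrix M) $$ (a, c) = 0\<^sub>m n n $$ (a, c)"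
    using ac by (simp add: poly_mat_at_def)
qed (simp_all add: poly_mat_at_def)

lemma poly_mat_at_mult_char_poly_matrix:
  assumes M: "M \<in> carrier_mat n n" and R: "R \<in> carrier_mat n n"
  shows "poly_mat_at n M (R * char_poly_matrix M) = 0\<^sub>m n n"
proof (intro eq_matI)
  fix a c assume "a < dim_row (0\<^sub>m n n :: real mat)" "c < dim_col (0\<^sub>m n n :: real mat)"
  then show "poly_mat_at n M (R * char_poly_matrix M) $$ (a, c) = 0\<^sub>m n n $$ (a, c)"
    using poly_mat_at_mult[OF M R, of "char_poly_matrix M" a c] M
    by (simp add: poly_mat_at_char_poly_matrix)
qed (simp_all add: poly_mat_at_def)

text \<open>The variable s becomes multiplication by M from the right, while M' stays on the left.
  If the product vanishes at M, then Q(M) intertwines M and M'.\<close>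

lemma poly_mat_at_char_poly_matrix_mult:
  assumes M: "M \<in> carrier_mat n n" and M': "M' \<in> carrier_mat n n" and Q: "Q \<in> carrier_mat n n"
  shows "poly_mat_at n M (char_poly_matrix M' * Q) = poly_mat_at n M Q * M - M' * poly_mat_at n M Q"
proof (intro eq_matI)
  let ?T = "poly_mat_at n M Q"
  have T: "?T \<in> carrier_mat n n" by simp
  fix a c assume "a < dim_row (?T * M - M' * ?T)" "c < dim_col (?T * M - M' * ?T)"
  then have ac: "a < n" "c < n" using M M' T by auto
  have "poly_mat_at n M (char_poly_matrix M' * Q) $$ (a, c) =
    (\<Sum>d<n. \<Sum>e<n. ?T $$ (d, e) * ((if a = d then M $$ (e, c) else 0) - (if e = c then M' $$ (a, d) else 0)))"
    unfolding poly_mat_at_mult[OF M char_poly_matrix_closed[OF M'] Q ac]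
    using ac M poly_at_mat_dim[OF M]
    by (intro sum.cong refl arg_cong2[of _ _ _ _ "(*)"])
      (simp add: char_poly_matrix_index[OF M'] poly_at_mat_add[OF M] poly_at_mat_const[OF M]
        poly_at_mat_X[OF M] poly_at_mat_0 del: add_pCons)
  also have "\<dots> = (\<Sum>d<n. (if a = d then \<Sum>e<n. ?T $$ (d, e) * M $$ (e, c) else 0) - ?T $$ (d, c) * M' $$ (a, d))"
  proof (intro sum.cong refl)
    fix d
    have "(\<Sum>e<n. ?T $$ (d, e) * ((if a = d then M $$ (e, c) else 0) - (if e = c then M' $$ (a, d) else 0))) =
      (\<Sum>e<n. if a = d then ?T $$ (d, e) * M $$ (e, c) else 0) - (\<Sum>e<n. if e = c then ?T $$ (d, c) * M' $$ (a, d) else 0)"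
      unfolding sum_subtractf[symmetric] by (intro sum.cong refl) (simp add: right_diff_distrib)
    then show "(\<Sum>e<n. ?T $$ (d, e) * ((if a = d then M $$ (e, c) else 0) - (if e = c then M' $$ (a, d) else 0))) =
      (if a = d then \<Sum>e<n. ?T $$ (d, e) * M $$ (e, c) else 0) - ?T $$ (d, c) * M' $$ (a, d)"
      using ac by simp
  qed
  also have "\<dots> = (\<Sum>e<n. ?T $$ (a, e) * M $$ (e, c)) - (\<Sum>d<n. M' $$ (a, d) * ?T $$ (d, c))"
    using ac by (simp add: mult.commute sum_subtractf)
  also have "\<dots> = (?T * M - M' * ?T) $$ (a, c)"
    using ac M M' carrier_matD[OF T] by (simp add: mult_mat_index[OF T M] mult_mat_index[OF M' T] del: index_mult_mat(1))
  finally show "poly_mat_at n M (char_poly_matrix M' * Q) $$ (a, c) = (?T * M - M' * ?T) $$ (a, c)" .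
qed (use M M' in \<open>auto simp: poly_mat_at_def\<close>)

lemma invertible_matI:
  assumes "A \<in> carrier_mat n n" "B \<in> carrier_mat n n" "A * B = 1\<^sub>m n" "B * A = 1\<^sub>m n"
  shows "invertible_mat A"
  using assms unfolding invertible_mat_def inverts_mat_def by auto

lemma invertible_matE:
  assumes "invertible_mat A" "A \<in> carrier_mat n n"
  obtains B where "B \<in> carrier_mat n n" "A * B = 1\<^sub>m n" "B * A = 1\<^sub>m n"
proof -
  from assms obtain B where B: "A * B = 1\<^sub>m n" "B * A = 1\<^sub>m (dim_row B)"
    unfolding invertible_mat_def inverts_mat_def by auto
  have "dim_row B = n" using arg_cong[OF B(2), of dim_col] assms(2) by simp
  moreover have "dim_col B = n" using arg_cong[OF B(1), of dim_col] by simp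
  ultimately show thesis using that[of B] B by auto
qed

lemma invertible_mat_mult:
  assumes "A \<in> carrier_mat n n" "B \<in> carrier_mat n n" "invertible_mat A" "invertible_mat B"
  shows "invertible_mat (A * B)"
proof -
  obtain A' where A': "A' \<in> carrier_mat n n" "A * A' = 1\<^sub>m n" "A' * A = 1\<^sub>m n"
    using invertible_matE assms by blast
  obtain B' where B': "B' \<in> carrier_mat n n" "B * B' = 1\<^sub>m n" "B' * B = 1\<^sub>m n"
    using invertible_matE assms by blast
  have "A * B * (B' * A') = A * (B * (B' * A'))" using assms A' B' by (simp add: assoc_mult_mat[of _ n n _ n _ n])
  also have "B * (B' * A') = A'" using assms A' B' by (simp add: assoc_mult_mat[of _ n n _ n _ n, symmetric])
  finally have 1: "A * B * (B' * A') = 1\<^sub>m n" using A' by simp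
  have "B' * A' * (A * B) = B' * (A' * (A * B))" using assms A' B' by (simp add: assoc_mult_mat[of _ n n _ n _ n])
  also have "A' * (A * B) = B" using assms A' B' by (simp add: assoc_mult_mat[of _ n n _ n _ n, symmetric])
  finally have 2: "B' * A' * (A * B) = 1\<^sub>m n" using B' by simp
  show ?thesis using invertible_matI[OF _ _ 1 2] assms A' B' by auto
qed

text \<open>Evaluate \<open>(s I - M') Q' = P' (s I - M)\<close>, where \<open>Q'\<close> is unimodular, at \<open>M\<close> from the right.\<close>

lemma inv_poly_class_similar:
  assumes "M \<in> inv_poly_class n \<alpha>" and "M' \<in> inv_poly_class n \<alpha>"
  obtains T T' where "T \<in> carrier_mat n n" "T' \<in> carrier_mat n n" "T' * T = 1\<^sub>m n" "T * M = M' * T"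
proof -
  let ?X = "char_poly_matrix M" and ?X' = "char_poly_matrix M'"
  from assms obtain U V U' V' where M: "M \<in> carrier_mat n n" and M': "M' \<in> carrier_mat n n"
    and U: "U \<in> carrier_mat n n" "invertible_mat U" and V: "V \<in> carrier_mat n n" "invertible_mat V"
    and U': "U' \<in> carrier_mat n n" "invertible_mat U'" and V': "V' \<in> carrier_mat n n" "invertible_mat V'"
    and eq: "U * ?X * V = U' * ?X' * V'"
    unfolding inv_poly_class_def by auto
  obtain Ui where Ui: "Ui \<in> carrier_mat n n" "U * Ui = 1\<^sub>m n" "Ui * U = 1\<^sub>m n" using invertible_matE U by blast
  obtain Vi where Vi: "Vi \<in> carrier_mat n n" "V * Vi = 1\<^sub>m n" "Vi * V = 1\<^sub>m n" using invertible_matE V by blast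
  obtain Ui' where Ui': "Ui' \<in> carrier_mat n n" "U' * Ui' = 1\<^sub>m n" "Ui' * U' = 1\<^sub>m n" using invertible_matE U' by blast
  obtain Vi' where Vi': "Vi' \<in> carrier_mat n n" "V' * Vi' = 1\<^sub>m n" "Vi' * V' = 1\<^sub>m n" using invertible_matE V' by blast
  have X: "?X \<in> carrier_mat n n" "?X' \<in> carrier_mat n n" using M M' by auto
  note [simp] = assoc_mult_mat[of _ n n _ n _ n]
  define Q where "Q = V * Vi'"
  define Q1 where "Q1 = V' * Vi"
  have Q: "Q \<in> carrier_mat n n" "Q1 \<in> carrier_mat n n" using V Vi Vi' V' unfolding Q_def Q1_def by auto
  have cancel: "B * (B' * Z) = Z" if "B * B' = 1\<^sub>m n" "B \<in> carrier_mat n n" "B' \<in> carrier_mat n n" "Z \<in> carrier_mat n n"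
    for B B' Z :: "real poly mat"
    using that assoc_mult_mat[of B n n B' n Z n] by simp
  have QQ1: "Q * Q1 = 1\<^sub>m n"
    unfolding Q_def Q1_def using V V' Vi Vi' cancel[OF Vi'(3)] by simp
  have eq': "U * (?X * V) = U' * (?X' * V')" using eq X U V U' V' by simp
  have 1: "?X' * Q1 = (Ui' * U) * ?X"
  proof -
    have "(Ui' * U) * ?X = Ui' * ((U * (?X * V)) * Vi)" using U Ui' X V Vi by simp
    also have "\<dots> = ?X' * Q1" unfolding eq' Q1_def using U' Ui' X V' Vi cancel[OF Ui'(3)] by simp
    finally show ?thesis by simp
  qed
  have 2: "?X * Q = (Ui * U') * ?X'"
  proof -
    have "(Ui * U') * ?X' = Ui * ((U' * (?X' * V')) * Vi')" using U' Ui X V' Vi' by simp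
    also have "\<dots> = ?X * Q" unfolding eq'[symmetric] Q_def using U Ui X V Vi' cancel[OF Ui(3)] by simp
    finally show ?thesis by simp
  qed
  define T where "T = poly_mat_at n M Q1"
  define T' where "T' = poly_mat_at n M' Q"
  have T: "T \<in> carrier_mat n n" "T' \<in> carrier_mat n n" unfolding T_def T'_def by auto
  have TM: "T * M = M' * T"
  proof (intro eq_matI)
    have "T * M - M' * T = 0\<^sub>m n n"
      using poly_mat_at_char_poly_matrix_mult[OF M M' Q(2)] poly_mat_at_mult_char_poly_matrix[OF M, of "Ui' * U"]
        1 U Ui' unfolding T_def by simp
    then have z: "(T * M - M' * T) $$ (a, c) = 0" if "a < n" "c < n" for a c using that by simp
    fix a c assume "a < dim_row (M' * T)" "c < dim_col (M' * T)"
    with z[of a c] show "(T * M) $$ (a, c) = (M' * T) $$ (a, c)" using T M M' by (simp del: index_mult_mat(1))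
  qed (use T M M' in auto)
  \<comment> \<open>The inverse is \<open>Q\<close> evaluated at M' and not at M: moving the powers
    of M' across \<open>T\<close> turns \<open>T' * T\<close> into the value at M of
    \<open>Q * Q1\<close>, which is the identity.\<close>
  have "T' * T = 1\<^sub>m n"
  proof (intro eq_matI)
    fix a c assume "a < dim_row (1\<^sub>m n :: real mat)" "c < dim_col (1\<^sub>m n :: real mat)"
    then have ac: "a < n" "c < n" by auto
    let ?q = "\<lambda>b. Q $$ (a, b)"
    have "(T' * T) $$ (a, c) = (\<Sum>d<n. (\<Sum>b<n. poly_at_mat n M' (?q b) $$ (b, d)) * T $$ (d, c))"
      using ac by (simp add: mult_mat_index[OF T(2) T(1)] del: index_mult_mat(1)) (simp add: T'_def poly_mat_at_def)
    also have "\<dots> = (\<Sum>b<n. \<Sum>d<n. poly_at_mat n M' (?q b) $$ (b, d) * T $$ (d, c))"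
      unfolding sum_distrib_right by (rule sum.swap)
    also have "\<dots> = (\<Sum>b<n. (poly_at_mat n M' (?q b) * T) $$ (b, c))"
      using ac by (intro sum.cong refl) (simp add: mult_mat_index[OF poly_at_mat_carrier[OF M'] T(1)] del: index_mult_mat(1))
    also have "\<dots> = (\<Sum>b<n. (T * poly_at_mat n M (?q b)) $$ (b, c))"
      unfolding poly_at_mat_intertwine[OF M M' T(1) TM] ..
    also have "\<dots> = (\<Sum>b<n. \<Sum>e<n. T $$ (b, e) * poly_at_mat n M (?q b) $$ (e, c))"
      using ac by (intro sum.cong refl) (simp add: mult_mat_index[OF T(1) poly_at_mat_carrier[OF M]] del: index_mult_mat(1))
    also have "\<dots> = poly_mat_at n M (1\<^sub>m n) $$ (a, c)"
      using poly_mat_at_mult[OF M Q ac] QQ1 unfolding T_def by simp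
    also have "\<dots> = (\<Sum>b<n. poly_at_mat n M (1\<^sub>m n $$ (a, b)) $$ (b, c))"
      using ac by (simp add: poly_mat_at_def)
    also have "\<dots> = (\<Sum>b<n. if a = b then (1\<^sub>m n :: real mat) $$ (b, c) else 0)"
    proof (intro sum.cong refl)
      fix b assume "b \<in> {..<n}"
      then show "poly_at_mat n M (1\<^sub>m n $$ (a, b)) $$ (b, c) = (if a = b then (1\<^sub>m n :: real mat) $$ (b, c) else 0)"
        using ac poly_at_mat_const[OF M, of 1] by (auto simp: poly_at_mat_0 one_pCons)
    qed
    also have "\<dots> = 1\<^sub>m n $$ (a, c)" using ac by simp
    finally show "(T' * T) $$ (a, c) = 1\<^sub>m n $$ (a, c)" .
  qed (use T in auto)
  from that[OF T this TM] show thesis .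
qed

section \<open>Invariance under similarity\<close>

lemma const_poly_hom: "comm_ring_hom (\<lambda>a :: real. [:a:])"
  by unfold_locales (auto simp: one_pCons)

abbreviation const_mat :: "real mat \<Rightarrow> real poly mat" where
  "const_mat \<equiv> map_mat (\<lambda>a. [:a:])"

lemma sum_const_poly: "(\<Sum>b\<in>B. [:f b:]) = [:\<Sum>b\<in>B. f b:]"
  by (induction B rule: infinite_finite_induct) auto

lemma char_poly_matrix_intertwine:
  assumes M: "M \<in> carrier_mat n n" and M': "M' \<in> carrier_mat n n" and T: "T \<in> carrier_mat n n"
    and TM: "T * M = M' * T"
  shows "const_mat T * char_poly_matrix M = char_poly_matrix M' * const_mat T"
proof (intro eq_matI)
  fix a c assume "a < dim_row (char_poly_matrix M' * const_mat T)" "c < dim_col (char_poly_matrix M' * const_mat T)"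
  then have ac: "a < n" "c < n" using char_poly_matrix_closed[OF M'] T by auto
  have T': "const_mat T \<in> carrier_mat n n" using T by simp
  have "(const_mat T * char_poly_matrix M) $$ (a, c) =
     (\<Sum>b<n. (if b = c then [:0, T $$ (a, b):] else 0) + [:- (T $$ (a, b) * M $$ (b, c)):])"
    unfolding mult_mat_index[OF T' char_poly_matrix_closed[OF M] ac]
    using ac T by (intro sum.cong refl) (auto simp: char_poly_matrix_index[OF M])
  also have "\<dots> = [:0, T $$ (a, c):] + [:- ((T * M) $$ (a, c)):]"
    using ac by (simp add: mult_mat_index[OF T M] sum.distrib sum_const_poly sum_negf del: index_mult_mat(1))
  also have "\<dots> = (\<Sum>b<n. (if a = b then [:0, T $$ (b, c):] else 0) + [:- (M' $$ (a, b) * T $$ (b, c)):])"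
    unfolding TM
    using ac by (simp add: mult_mat_index[OF M' T] sum.distrib sum_const_poly sum_negf del: index_mult_mat(1))
  also have "\<dots> = (char_poly_matrix M' * const_mat T) $$ (a, c)"
    unfolding mult_mat_index[OF char_poly_matrix_closed[OF M'] T' ac]
    using ac T by (intro sum.cong refl) (auto simp: char_poly_matrix_index[OF M'])
  finally show "(const_mat T * char_poly_matrix M) $$ (a, c) = (char_poly_matrix M' * const_mat T) $$ (a, c)" .
qed (use M M' T in \<open>auto simp: char_poly_matrix_def\<close>)

text \<open>An invertible real matrix is unimodular as a constant polynomial matrix, so a similarity
  of M and M' is an equivalence of s I - M and s I - M'.\<close>

lemma inv_poly_class_similarI:
  assumes M: "M \<in> inv_poly_class n \<alpha>" and M': "M' \<in> carrier_mat n n"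
    and T: "T \<in> carrier_mat n n" and T': "T' \<in> carrier_mat n n" and inv: "T' * T = 1\<^sub>m n" "T * T' = 1\<^sub>m n"
    and TM: "T * M = M' * T"
  shows "M' \<in> inv_poly_class n \<alpha>"
proof -
  interpret c: comm_ring_hom "\<lambda>a :: real. [:a:]" by (rule const_poly_hom)
  from M obtain U V where Mc: "M \<in> carrier_mat n n"
    and U: "U \<in> carrier_mat n n" "invertible_mat U" and V: "V \<in> carrier_mat n n" "invertible_mat V"
    and eq: "U * char_poly_matrix M * V = mat_diag n (\<lambda>i. \<alpha> (Suc i))"
    unfolding inv_poly_class_def by auto
  let ?T = "const_mat T" and ?T' = "const_mat T'"
  have cT: "?T \<in> carrier_mat n n" "?T' \<in> carrier_mat n n" using T T' by auto
  have ci: "?T' * ?T = 1\<^sub>m n" "?T * ?T' = 1\<^sub>m n"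
    using c.mat_hom_mult[OF T' T] c.mat_hom_mult[OF T T'] inv c.mat_hom_one[of n] by auto
  have iT: "invertible_mat ?T" "invertible_mat ?T'"
    using invertible_matI[OF cT ci(2) ci(1)] invertible_matI[OF cT(2) cT(1) ci] by auto
  have X: "char_poly_matrix M \<in> carrier_mat n n" "char_poly_matrix M' \<in> carrier_mat n n" using Mc M' by auto
  have "(U * ?T') * char_poly_matrix M' * (?T * V) = U * (?T' * (char_poly_matrix M' * ?T)) * V"
    using U V cT X by (simp add: assoc_mult_mat[of _ n n _ n _ n])
  also have "\<dots> = U * ((?T' * ?T) * char_poly_matrix M) * V"
    unfolding char_poly_matrix_intertwine[OF Mc M' T TM, symmetric]
    using U V cT X by (simp add: assoc_mult_mat[of _ n n _ n _ n])
  also have "\<dots> = mat_diag n (\<lambda>i. \<alpha> (Suc i))" using ci X eq by simp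
  finally have "(U * ?T') * char_poly_matrix M' * (?T * V) = mat_diag n (\<lambda>i. \<alpha> (Suc i))" .
  moreover have "invertible_mat (U * ?T')" "invertible_mat (?T * V)"
    using invertible_mat_mult U V cT iT by blast+
  ultimately show ?thesis
    unfolding inv_poly_class_def mem_Collect_eq using M' U V cT
    by (intro conjI bexI[of _ "U * ?T'"] bexI[of _ "?T * V"]) auto
qed

text \<open>If \<open>\<real>\<^sup>n\<close> with the action of \<open>A\<close> on rows is a direct sum of cyclic modules \<open>\<real>[s]/(\<alpha>\<^sub>i)\<close>
  (with bases \<open>b i 0, b i 1, \<dots>\<close>), then \<open>A\<close> is similar to a block companion matrix \<open>C\<close>;
  \<open>s I - C\<close> maps the column \<open>(1, s, s\<^sup>2, \<dots>)\<close> of the \<open>i\<close>-th block to \<open>\<alpha>\<^sub>i\<close> times a unit vector.\<close>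

lemma cyclic_decomposition_inv_poly_class:
  fixes b :: "nat \<Rightarrow> nat \<Rightarrow> nat \<Rightarrow> real"
  assumes A: "A \<in> carrier_mat n n"
    and monic: "\<And>i. i < n \<Longrightarrow> lead_coeff (\<alpha> (Suc i)) = 1"
    and deg: "(\<Sum>i<n. degree (\<alpha> (Suc i))) = n"
    and step: "\<And>i l c. i < n \<Longrightarrow> c < n \<Longrightarrow> b i (Suc l) c = (\<Sum>a<n. b i l a * A $$ (a, c))"
    and ann: "\<And>i c. i < n \<Longrightarrow> c < n \<Longrightarrow>
       (\<Sum>l\<le>degree (\<alpha> (Suc i)). coeff (\<alpha> (Suc i)) l * b i l c) = 0"
    and indep: "\<And>y. (\<And>c. c < n \<Longrightarrow> (\<Sum>i<n. \<Sum>l<degree (\<alpha> (Suc i)). y i l * b i l c) = 0)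
       \<Longrightarrow> \<forall>i<n. \<forall>l<degree (\<alpha> (Suc i)). y i l = 0"
  shows "A \<in> inv_poly_class n \<alpha>"
proof -
  define d where "d i = degree (\<alpha> (Suc i))" for i
  define B where "B = (SIGMA i:{..<n}. {..<d i})"
  define I0 where "I0 = {i\<in>{..<n}. 0 < d i}"
  have cardB: "card B = n" unfolding B_def using deg by (simp add: d_def)
  have finB: "finite B" unfolding B_def by simp
  let ?B0 = "(\<lambda>i. (i, 0::nat)) ` I0"
  have B0: "?B0 \<subseteq> B" unfolding B_def I0_def by auto
  have bij0: "bij_betw (\<lambda>i. (i, 0::nat)) I0 ?B0" by (auto simp: bij_betw_def inj_on_def)
  have "card ({..<n} - I0) = card (B - ?B0)"
  proof -
    have "card ({..<n} - I0) = n - card I0" by (subst card_Diff_subset) (auto simp: I0_def)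
    moreover have "card (B - ?B0) = n - card ?B0"
      using cardB finB B0 by (subst card_Diff_subset) (auto intro: finite_subset)
    ultimately show ?thesis using bij_betw_same_card[OF bij0] by simp
  qed
  then obtain g where g: "bij_betw g ({..<n} - I0) (B - ?B0)"
    using finite_same_card_bij[of "{..<n} - I0" "B - ?B0"] finB by auto
  \<comment> \<open>A nonconstant \<alpha> keeps its own index as the head (i, 0) of its chain. The
    constant ones are as many as the basis vectors that are not heads, since the degrees add up to
    n, and any matching between these will do.\<close>
  define \<beta> where "\<beta> i = (if i \<in> I0 then (i, 0) else g i)" for i
  have "bij_betw \<beta> (I0 \<union> ({..<n} - I0)) (?B0 \<union> (B - ?B0))"
  proof (rule bij_betw_combine)
    show "bij_betw \<beta> I0 ?B0" using bij0 by (subst bij_betw_cong[of _ _ "\<lambda>i. (i, 0)"]) (auto simp: \<beta>_def)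
    show "bij_betw \<beta> ({..<n} - I0) (B - ?B0)" using g by (subst bij_betw_cong[of _ _ g]) (auto simp: \<beta>_def)
  qed auto
  moreover have "I0 \<union> ({..<n} - I0) = {..<n}" "?B0 \<union> (B - ?B0) = B" using B0 by (auto simp: I0_def)
  ultimately have \<beta>: "bij_betw \<beta> {..<n} B" by simp
  have \<beta>_inj: "\<beta> q = \<beta> q' \<longleftrightarrow> q = q'" if "q < n" "q' < n" for q q'
    using \<beta> that by (auto simp: bij_betw_def inj_on_eq_iff)
  have \<beta>_mem: "fst (\<beta> q) < n" "snd (\<beta> q) < d (fst (\<beta> q))" if "q < n" for q
    using bij_betwE[OF \<beta>] that unfolding B_def by force+
  have \<beta>0: "\<beta> p = (p, 0)" if "p < n" "0 < d p" for p using that by (simp add: \<beta>_def I0_def)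
  have sum\<beta>: "(\<Sum>q<n. f (\<beta> q)) = (\<Sum>i<n. \<Sum>l<d i. f (i, l))" for f :: "nat \<times> nat \<Rightarrow> 'z::comm_monoid_add"
    unfolding sum.reindex_bij_betw[OF \<beta>] B_def by (subst sum.Sigma) auto
  define T where "T = mat n n (\<lambda>(q, c). b (fst (\<beta> q)) (snd (\<beta> q)) c)"
  have T: "T \<in> carrier_mat n n" unfolding T_def by simp
  have "det (transpose_mat T) \<noteq> 0"
  proof (rule det_nonzeroI)
    show "transpose_mat T \<in> carrier_mat n n" using T by simp
    fix y assume y: "\<And>c. c < n \<Longrightarrow> (\<Sum>q<n. transpose_mat T $$ (c, q) * y q) = 0"
    define z where "z p = y (the_inv_into {..<n} \<beta> p)" for p
    have z: "y q = z (\<beta> q)" if "q < n" for q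
      using that \<beta> unfolding z_def by (simp add: bij_betw_def the_inv_into_f_f)
    have "(\<Sum>i<n. \<Sum>l<d i. z (i, l) * b i l c) = 0" if "c < n" for c
      using y[OF that] z that sum\<beta>[of "\<lambda>(i, l). z (i, l) * b i l c"] T
      by (simp add: T_def case_prod_unfold mult.commute)
    from indep[of "\<lambda>i l. z (i, l)", folded d_def, OF this] have "\<forall>i<n. \<forall>l<d i. z (i, l) = 0" .
    then have "z (fst (\<beta> q), snd (\<beta> q)) = 0" if "q < n" for q using \<beta>_mem[OF that] by blast
    then show "\<forall>q<n. y q = 0" using z by simp
  qed
  then have "det T \<noteq> 0" using det_transpose[OF T] by simp
  from adj_inverse[OF T this] obtain Ti where Ti: "Ti \<in> carrier_mat n n" "T * Ti = 1\<^sub>m n" "Ti * T = 1\<^sub>m n" by blast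
  \<comment> \<open>Companion rows: a shift inside a chain, and at its end minus the coefficients of
    the annihilating polynomial.\<close>
  define cf where "cf i l l' = (if Suc l < d i then if l' = Suc l then 1 else 0 else - coeff (\<alpha> (Suc i)) l')" for i l l'
  define C where "C = mat n n (\<lambda>(q, q'). if fst (\<beta> q) = fst (\<beta> q') then cf (fst (\<beta> q)) (snd (\<beta> q)) (snd (\<beta> q')) else 0)"
  have C: "C \<in> carrier_mat n n" unfolding C_def by simp
  have "T * A = C * T"
  proof (intro eq_matI)
    fix q c assume "q < dim_row (C * T)" "c < dim_col (C * T)"
    then have qc: "q < n" "c < n" using C T by auto
    obtain i l where il: "\<beta> q = (i, l)" by fastforce
    have i: "i < n" "l < d i" using \<beta>_mem[OF qc(1)] il by auto
    have "(C * T) $$ (q, c) = (\<Sum>q'<n. (\<lambda>(i', l'). if i = i' then cf i l l' * b i' l' c else 0) (\<beta> q'))"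
      unfolding mult_mat_index[OF C T qc]
      using qc il by (intro sum.cong refl) (auto simp: C_def T_def case_prod_unfold)
    also have "\<dots> = (\<Sum>i'<n. if i = i' then \<Sum>l'<d i'. cf i l l' * b i' l' c else 0)"
      unfolding sum\<beta> by (intro sum.cong refl) auto
    also have "\<dots> = (\<Sum>l'<d i. cf i l l' * b i l' c)" using i by simp
    also have "\<dots> = b i (Suc l) c"
    proof (cases "Suc l < d i")
      case True
      then have "(\<Sum>l'<d i. cf i l l' * b i l' c) = (\<Sum>l'<d i. if l' = Suc l then b i l' c else 0)"
        unfolding cf_def by (intro sum.cong refl) auto
      then show ?thesis using True by simp
    next
      case False
      then have l: "Suc l = d i" using i by simp
      have "b i (d i) c + (\<Sum>l'<d i. coeff (\<alpha> (Suc i)) l' * b i l' c) = 0"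
        using ann[OF i(1) qc(2)] monic[OF i(1)] by (simp add: d_def lessThan_Suc_atMost[symmetric] add.commute)
      then show ?thesis using False l by (simp add: cf_def sum_negf)
    qed
    also have "\<dots> = (T * A) $$ (q, c)"
      unfolding mult_mat_index[OF T A qc] step[OF i(1) qc(2)] using qc il by (simp add: T_def)
    finally show "(T * A) $$ (q, c) = (C * T) $$ (q, c)" by simp
  qed (use T A C in auto)
  then have TiC: "Ti * C = A * Ti"
  proof -
    have "Ti * C = Ti * (C * (T * Ti))" using Ti C by simp
    also have "\<dots> = Ti * ((C * T) * Ti)" using Ti C T by (simp add: assoc_mult_mat[of _ n n _ n _ n])
    also have "\<dots> = Ti * ((T * A) * Ti)" unfolding \<open>T * A = C * T\<close> ..
    also have "\<dots> = Ti * (T * (A * Ti))" using assoc_mult_mat[OF T A Ti(1)] by simp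
    also have "\<dots> = (Ti * T) * (A * Ti)" using assoc_mult_mat[OF Ti(1) T mult_carrier_mat[OF A Ti(1)]] by simp
    finally show ?thesis using Ti A by simp
  qed
  \<comment> \<open>Adding \<open>N\<close> to the identity replaces the column of each head by (1,
    s, s^2, ...) on its chain. Nonzero columns of \<open>N\<close> belong to heads and nonzero rows
    to other indices, hence the square of \<open>N\<close> is 0 and the inverse of 1 + N is 1 -
    N.\<close>
  define N :: "real poly mat" where
    "N = mat n n (\<lambda>(q, p). if 0 < d p \<and> fst (\<beta> q) = p \<and> 0 < snd (\<beta> q) then monom 1 (snd (\<beta> q)) else 0)"
  have N: "N \<in> carrier_mat n n" unfolding N_def by simp
  have NN: "N * N = 0\<^sub>m n n"
  proof (intro eq_matI)
    fix q p assume "q < dim_row (0\<^sub>m n n :: real poly mat)" "p < dim_col (0\<^sub>m n n :: real poly mat)"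
    then have qp: "q < n" "p < n" by auto
    have "N $$ (q, q') * N $$ (q', p) = 0" if "q' < n" for q'
      using qp that \<beta>0[of q'] by (auto simp: N_def)
    then show "(N * N) $$ (q, p) = 0\<^sub>m n n $$ (q, p)"
      using qp unfolding mult_mat_index[OF N N qp] by (auto intro!: sum.neutral)
  qed (use N in auto)
  let ?V = "1\<^sub>m n + N" and ?Vi = "1\<^sub>m n - N"
  have V: "?V \<in> carrier_mat n n" "?Vi \<in> carrier_mat n n" using N by auto
  have VVi: "?V * ?Vi = 1\<^sub>m n" "?Vi * ?V = 1\<^sub>m n"
  proof -
    have "?V * ?Vi = 1\<^sub>m n * ?Vi + (N * 1\<^sub>m n - N * N)"
      using N V by (subst add_mult_distrib_mat[of _ n n]) (auto simp: mult_minus_distrib_mat[of N n n _ n])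
    then show "?V * ?Vi = 1\<^sub>m n" unfolding NN using N V by (intro eq_matI) auto
    have "?Vi * ?V = 1\<^sub>m n * ?V - (N * 1\<^sub>m n + N * N)"
      using N V by (subst minus_mult_distrib_mat[of _ n n]) (auto simp: mult_add_distrib_mat[of N n n _ n])
    then show "?Vi * ?V = 1\<^sub>m n" unfolding NN using N V by (intro eq_matI) auto
  qed
  let ?X = "char_poly_matrix C"
  have X: "?X \<in> carrier_mat n n" using C by simp
  \<comment> \<open>\<open>Y\<close> is the quotient of \<open>?X * ?V\<close> by the diagonal
    matrix. In the column of a head, \<open>?X * ?V\<close> is \<alpha> times the unit vector at the
    end of the chain; in the other columns \<alpha> is 1.\<close>
  define Y where "Y = mat n n (\<lambda>(q, p). if 0 < d p then if \<beta> q = (p, d p - 1) then 1 else 0 else (?X * ?V) $$ (q, p))"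
  have Y: "Y \<in> carrier_mat n n" unfolding Y_def by simp
  let ?D = "mat_diag n (\<lambda>i. \<alpha> (Suc i))"
  have D: "?D \<in> carrier_mat n n" by simp
  have XV: "?X * ?V = Y * ?D"
  proof (intro eq_matI)
    fix q p assume "q < dim_row (Y * ?D)" "p < dim_col (Y * ?D)"
    then have qp: "q < n" "p < n" using Y by (auto simp: mat_diag_def)
    have YD: "(Y * ?D) $$ (q, p) = Y $$ (q, p) * \<alpha> (Suc p)"
      using qp by (simp add: mat_diag_mult_right[OF Y])
    show "(?X * ?V) $$ (q, p) = (Y * ?D) $$ (q, p)"
    proof (cases "0 < d p")
      case False
      then have "\<alpha> (Suc p) = 1"
        using monic[OF qp(2)] unfolding d_def by (metis gr0I lead_coeff_1 monic_degree_0)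
      then show ?thesis using False qp by (simp add: YD) (simp add: Y_def)
    next
      case True
      have V_idx: "?V $$ (q', p) = (if fst (\<beta> q') = p then monom 1 (snd (\<beta> q')) else 0)" if q': "q' < n" for q'
      proof (cases "q' = p")
        case True
        then show ?thesis using \<open>0 < d p\<close> \<beta>0 qp by (simp add: N_def one_pCons[symmetric] monom_0)
      next
        case False
        have "snd (\<beta> q') \<noteq> 0" if "fst (\<beta> q') = p"
          using False \<beta>_inj[OF q' qp(2)] \<beta>0[OF qp(2) True] that by (metis prod.collapse)
        then show ?thesis using False q' qp True by (auto simp: N_def)
      qed
      obtain i l where il: "\<beta> q = (i, l)" by fastforce
      have i: "i < n" "l < d i" using \<beta>_mem[OF qp(1)] il by auto
      have "(?X * ?V) $$ (q, p) = (\<Sum>q'<n. (if q = q' then [:0, 1:] * ?V $$ (q, p) else 0) - [:C $$ (q, q'):] * ?V $$ (q', p))"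
        unfolding mult_mat_index[OF X V(1) qp]
        using qp by (intro sum.cong refl) (auto simp: char_poly_matrix_index[OF C] algebra_simps)
      also have "\<dots> = [:0, 1:] * ?V $$ (q, p) - (\<Sum>q'<n. [:C $$ (q, q'):] * ?V $$ (q', p))"
        using qp by (simp add: sum_subtractf)
      also have "(\<Sum>q'<n. [:C $$ (q, q'):] * ?V $$ (q', p)) =
         (\<Sum>q'<n. (\<lambda>(i', l'). if i' = p then if i = p then monom (cf i l l') l' else 0 else 0) (\<beta> q'))"
        using qp il by (intro sum.cong refl) (auto simp: C_def V_idx case_prod_unfold smult_monom simp del: index_add_mat)
      also have "\<dots> = (\<Sum>i'<n. if i' = p then \<Sum>l'<d i'. if i = p then monom (cf i l l') l' else 0 else 0)"
        unfolding sum\<beta> by (intro sum.cong refl) auto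
      also have "\<dots> = (if i = p then \<Sum>l'<d p. monom (cf p l l') l' else 0)" using qp by simp
      finally have XVqp: "(?X * ?V) $$ (q, p) = [:0, 1:] * ?V $$ (q, p) - (if i = p then \<Sum>l'<d p. monom (cf p l l') l' else 0)" .
      show ?thesis
      proof (cases "i = p")
        case False
        then show ?thesis using XVqp V_idx[OF qp(1)] il True qp by (simp add: YD) (simp add: Y_def)
      next
        case ip: True
        have XVqp': "(?X * ?V) $$ (q, p) = monom 1 (Suc l) - (\<Sum>l'<d p. monom (cf p l l') l')"
          using XVqp V_idx[OF qp(1)] il ip by (simp add: monom_Suc)
        show ?thesis
        proof (cases "Suc l < d p")
          case True
          have "(\<Sum>l'<d p. monom (cf p l l') l') = (\<Sum>l'<d p. if l' = Suc l then monom 1 l' else 0)"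
            using True by (intro sum.cong refl) (auto simp: cf_def)
          then show ?thesis using XVqp' True il qp ip by (simp add: YD) (auto simp: Y_def)
        next
          case False
          then have l: "Suc l = d p" using i ip by simp
          have "(\<Sum>l'<d p. monom (cf p l l') l') = - (\<Sum>l'<d p. monom (coeff (\<alpha> (Suc p)) l') l')"
            using False by (simp add: cf_def sum_negf minus_monom[symmetric])
          moreover have "\<alpha> (Suc p) = (\<Sum>l'<d p. monom (coeff (\<alpha> (Suc p)) l') l') + monom 1 (d p)"
            using poly_as_sum_of_monoms[of "\<alpha> (Suc p)"] monic[OF qp(2)]
            by (simp add: d_def lessThan_Suc_atMost[symmetric])
          ultimately have "(?X * ?V) $$ (q, p) = \<alpha> (Suc p)" using XVqp' l by simp
          moreover have "Y $$ (q, p) = 1" using qp True il ip l[symmetric] by (simp add: Y_def)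
          ultimately show ?thesis using YD by simp
        qed
      qed
    qed
  qed (use X V Y in \<open>auto simp: mat_diag_def\<close>)
  have detV: "degree (det ?V) = 0" "det ?V \<noteq> 0"
  proof -
    have 1: "det ?V * det ?Vi = 1" using det_mult[OF V] VVi(1) by simp
    then show "det ?V \<noteq> 0" by auto
    moreover have "det ?Vi \<noteq> 0" using 1 by auto
    ultimately have "degree (det ?V) + degree (det ?Vi) = 0" using degree_mult_eq[of "det ?V" "det ?Vi"] 1 by simp
    then show "degree (det ?V) = 0" by simp
  qed
  have detD: "det ?D = (\<Prod>i<n. \<alpha> (Suc i))"
  proof -
    have "upper_triangular ?D" by (auto simp: mat_diag_def)
    from det_upper_triangular[OF this D] show ?thesis
      by (simp add: prod_list_diag_prod mat_diag_def atLeast0LessThan)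
  qed
  have nz: "\<alpha> (Suc i) \<noteq> 0" if "i < n" for i using monic[OF that] by auto
  have degD: "degree (det ?D) = n" "det ?D \<noteq> 0"
  proof -
    show "det ?D \<noteq> 0" unfolding detD using nz by simp
    show "degree (det ?D) = n" unfolding detD using nz deg by (subst degree_prod_eq_sum_degree) auto
  qed
  have detX: "degree (det ?X) = n" "det ?X \<noteq> 0"
    using degree_monic_char_poly[OF C] unfolding char_poly_def by auto
  \<comment> \<open>Both \<open>det ?X\<close> and \<open>det ?D\<close> have degree n and
    \<open>det ?V\<close> is a nonzero constant, so \<open>det Y\<close> is a nonzero constant and
    \<open>Y\<close> is unimodular.\<close>
  have "det ?X * det ?V = det Y * det ?D" using arg_cong[OF XV, of det] det_mult[OF X V(1)] det_mult[OF Y D] by simp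
  moreover have "det Y \<noteq> 0" using calculation detX detV by auto
  ultimately have "degree (det ?X) + degree (det ?V) = degree (det Y) + degree (det ?D)"
    using detX detV degD by (metis degree_mult_eq)
  then have "degree (det Y) = 0" using detX detV degD by simp
  then obtain c where c: "det Y = [:c:]" using degree_0_id by metis
  then have "c \<noteq> 0" using \<open>det Y \<noteq> 0\<close> by auto
  define Yi where "Yi = [:inverse c:] \<cdot>\<^sub>m adj_mat Y"
  have adj: "adj_mat Y \<in> carrier_mat n n" "Y * adj_mat Y = det Y \<cdot>\<^sub>m 1\<^sub>m n" "adj_mat Y * Y = det Y \<cdot>\<^sub>m 1\<^sub>m n"
    using adj_mat[OF Y] by auto
  have Yi: "Yi \<in> carrier_mat n n" unfolding Yi_def using adj by simp
  have "Y * Yi = [:inverse c:] \<cdot>\<^sub>m (Y * adj_mat Y)" unfolding Yi_def using mult_smult_distrib[OF Y adj(1)] by simp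
  then have YYi: "Y * Yi = 1\<^sub>m n" using adj c \<open>c \<noteq> 0\<close> by (intro eq_matI) (auto simp: one_pCons)
  have "Yi * Y = [:inverse c:] \<cdot>\<^sub>m (adj_mat Y * Y)" unfolding Yi_def using mult_smult_assoc_mat[OF adj(1) Y] by simp
  then have YiY: "Yi * Y = 1\<^sub>m n" using adj c \<open>c \<noteq> 0\<close> by (intro eq_matI) (auto simp: one_pCons)
  have "Yi * ?X * ?V = ?D"
  proof -
    have "Yi * ?X * ?V = Yi * (Y * ?D)" unfolding XV[symmetric] using Yi X V by (simp add: assoc_mult_mat[of _ n n _ n _ n])
    also have "\<dots> = (Yi * Y) * ?D" using Yi Y D by (simp add: assoc_mult_mat[of _ n n _ n _ n])
    finally show ?thesis using YiY left_mult_one_mat[OF D] by (simp only:)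
  qed
  then have "C \<in> inv_poly_class n \<alpha>"
    unfolding inv_poly_class_def mem_Collect_eq
    using invertible_matI[OF Yi Y YiY YYi] invertible_matI[OF V VVi] Yi V C by (intro conjI bexI[of _ Yi] bexI[of _ ?V]) auto
  from inv_poly_class_similarI[OF this A Ti(1) T Ti(2) Ti(3) TiC] show ?thesis .
qed

section \<open>Positions in block matrices\<close>

lemma block_offset_1: "block_offset f (Suc 0) = 0"
  by (simp add: block_offset_def)

lemma block_offset_Suc: "1 \<le> j \<Longrightarrow> block_offset f (Suc j) = block_offset f j + f j"
  by (simp add: block_offset_def)

lemma block_offset_mono: "i \<le> j \<Longrightarrow> block_offset f i \<le> block_offset f j"
  unfolding block_offset_def by (intro sum_mono2) auto

lemma block_offset_eq_sum: "block_offset f (Suc p) = (\<Sum>j=1..p. f j)"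
  by (simp add: block_offset_def atLeastLessThanSuc_atLeastAtMost)

lemma block_offset_mult: "block_offset (\<lambda>j. e * f j) j = e * block_offset f j"
  by (simp add: block_offset_def sum_distrib_left)

lemma block_pos_less: "1 \<le> j \<Longrightarrow> j \<le> p \<Longrightarrow> a < f j \<Longrightarrow> block_offset f j + a < block_offset f (Suc p)"
  using block_offset_Suc[of j f] block_offset_mono[of "Suc j" "Suc p" f] by linarith

lemma block_index_eq:
  assumes "1 \<le> j" "a < f j"
  shows "block_index f (block_offset f j + a) = j"
  unfolding block_index_def
proof (rule Least_equality)
  show "1 \<le> j \<and> block_offset f j + a < block_offset f (Suc j)"
    using assms by (simp add: block_offset_Suc)
next
  fix y assume y: "1 \<le> y \<and> block_offset f j + a < block_offset f (Suc y)"
  show "j \<le> y"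
  proof (rule ccontr)
    assume "\<not> j \<le> y"
    then have "block_offset f (Suc y) \<le> block_offset f j" by (intro block_offset_mono) simp
    with y show False by simp
  qed
qed

lemma block_pos_inj:
  assumes "1 \<le> j" "a < f j" "1 \<le> j'" "a' < f j'" "block_offset f j + a = block_offset f j' + a'"
  shows "j = j'" "a = a'"
  using block_index_eq[of j a f] block_index_eq[of j' a' f] assms by auto

lemma block_pos_exists:
  "x < block_offset f (Suc p) \<Longrightarrow> \<exists>j a. 1 \<le> j \<and> j \<le> p \<and> a < f j \<and> x = block_offset f j + a"
proof (induction p)
  case (Suc p)
  show ?case
  proof (cases "x < block_offset f (Suc p)")
    case True
    then show ?thesis using Suc.IH by (meson le_SucI)
  next
    case False
    then show ?thesis using Suc.prems block_offset_Suc[of "Suc p" f]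
      by (intro exI[of _ "Suc p"] exI[of _ "x - block_offset f (Suc p)"]) auto
  qed
qed (simp add: block_offset_def)

lemma block_mat_index:
  assumes "1 \<le> i" "i \<le> p" "a < s i" "1 \<le> j" "j \<le> q" "b < t j"
  shows "block_mat s p t q B $$ (block_offset s i + a, block_offset t j + b) = B i j $$ (a, b)"
  using assms block_pos_less[of i p a s] block_pos_less[of j q b t]
  by (simp add: block_mat_def block_offset_eq_sum block_index_eq)

lemma sum_list_map_nth: "sum_list (map f xs) = (\<Sum>j<length xs. f (xs ! j))" for f :: "'a \<Rightarrow> nat"
  by (simp add: sum_list_sum_nth atLeast0LessThan)

lemma list_pos_less:
  fixes f :: "'a \<Rightarrow> nat"
  assumes "i < length xs" "a < f (xs ! i)"
  shows "(\<Sum>j<i. f (xs ! j)) + a < sum_list (map f xs)"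
proof -
  have "(\<Sum>j<Suc i. f (xs ! j)) \<le> (\<Sum>j<length xs. f (xs ! j))"
    using assms by (intro sum_mono2) auto
  then show ?thesis using assms(2) by (simp add: sum_list_map_nth)
qed

lemma diag_block_mat_index:
  assumes "i < length Ms" "i' < length Ms" "a < dim_row (Ms ! i)" "b < dim_col (Ms ! i')"
  shows "diag_block_mat Ms $$ ((\<Sum>j<i. dim_row (Ms ! j)) + a, (\<Sum>j<i'. dim_col (Ms ! j)) + b) =
    (if i = i' then (Ms ! i) $$ (a, b) else 0)"
  using assms
proof (induction Ms arbitrary: i i')
  case (Cons M Ms)
  have D: "dim_row (diag_block_mat Ms) = sum_list (map dim_row Ms)"
    "dim_col (diag_block_mat Ms) = sum_list (map dim_col Ms)" by (simp_all add: dim_diag_block_mat)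
  show ?case
  proof (cases i; cases i')
    assume "i = 0" "i' = 0"
    then show ?thesis using Cons.prems by (simp add: Let_def)
  next
    fix l assume i: "i = 0" "i' = Suc l"
    with Cons.prems D list_pos_less[of l Ms b dim_col] show ?thesis
      by (simp add: Let_def sum.lessThan_Suc_shift del: sum.lessThan_Suc)
  next
    fix l assume i: "i = Suc l" "i' = 0"
    with Cons.prems D list_pos_less[of l Ms a dim_row] show ?thesis
      by (simp add: Let_def sum.lessThan_Suc_shift del: sum.lessThan_Suc)
  next
    fix l l' assume i: "i = Suc l" "i' = Suc l'"
    with Cons.prems D Cons.IH[of l l'] list_pos_less[of l Ms a dim_row] list_pos_less[of l' Ms b dim_col]
    show ?thesis
      by (simp add: Let_def sum.lessThan_Suc_shift add.assoc del: sum.lessThan_Suc)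
  qed
qed simp

lemma down_closed_eq_lessThan_card:
  fixes S :: "nat set"
  assumes "finite S" "\<And>x y. y \<in> S \<Longrightarrow> x \<le> y \<Longrightarrow> x \<in> S"
  shows "S = {..<card S}"
proof (cases "S = {}")
  case False
  have "S = {..<Suc (Max S)}"
  proof (intro subset_antisym subsetI)
    fix x assume "x \<in> S"
    then show "x \<in> {..<Suc (Max S)}" using assms(1) by (simp add: less_Suc_eq_le)
  next
    fix x assume "x \<in> {..<Suc (Max S)}"
    then have "x \<le> Max S" by simp
    then show "x \<in> S" using assms(2)[OF Max_in[OF assms(1) False]] by blast
  qed
  then show ?thesis by (metis card_lessThan)
qed simp

section \<open>Multiplicities of roots\<close>

lemma sum_order_le_degree:
  fixes p :: "complex poly"
  assumes p: "p \<noteq> 0" and R: "finite R"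
  shows "(\<Sum>z\<in>R. Polynomial.order z p) \<le> degree p"
    and "{z. poly p z = 0} \<subseteq> R \<Longrightarrow> (\<Sum>z\<in>R. Polynomial.order z p) = degree p"
proof -
  let ?Z = "{z. poly p z = 0}"
  have fin: "finite ?Z" using p by (rule poly_roots_finite)
  have "degree p = degree (\<Prod>z\<in>?Z. [:- z, 1:] ^ Polynomial.order z p)"
    using complex_poly_decompose[of p] p by (metis degree_smult_eq leading_coeff_0_iff)
  also have "\<dots> = (\<Sum>z\<in>?Z. degree ([:- z, 1:] ^ Polynomial.order z p))"
    by (rule degree_prod_eq_sum_degree) simp
  also have "\<dots> = (\<Sum>z\<in>?Z. Polynomial.order z p)" by (simp add: degree_power_eq)
  finally have deg: "degree p = (\<Sum>z\<in>?Z. Polynomial.order z p)" .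
  have "(\<Sum>z\<in>R. Polynomial.order z p) = (\<Sum>z\<in>R \<inter> ?Z. Polynomial.order z p)"
    using R by (intro sum.mono_neutral_right) (auto simp: order_0I)
  moreover have "\<dots> \<le> (\<Sum>z\<in>?Z. Polynomial.order z p)" using fin by (intro sum_mono2) auto
  ultimately show "(\<Sum>z\<in>R. Polynomial.order z p) \<le> degree p" using deg by simp
  show "(\<Sum>z\<in>R. Polynomial.order z p) = degree p" if "?Z \<subseteq> R"
    unfolding deg using that R by (intro sum.mono_neutral_right) (auto simp: order_0I)
qed

abbreviation cpoly :: "real poly \<Rightarrow> complex poly" where
  "cpoly \<equiv> map_poly complex_of_real"

lemma cpoly_mult: "cpoly (p * q) = cpoly p * cpoly q"
  by (intro poly_eqI) (simp add: coeff_map_poly coeff_mult)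

lemma cpoly_eq_0: "cpoly p = 0 \<longleftrightarrow> p = 0"
  by (simp add: map_poly_eq_0_iff)

lemma degree_cpoly: "degree (cpoly p) = degree p"
  by (rule degree_map_poly) simp

text \<open>Conjugating coefficients fixes a real polynomial and carries a factor (X - z)^k to (X -
  cnj z)^k. The inequality so obtained applies to z as well as to its conjugate.\<close>

lemma order_cnj: "Polynomial.order (cnj z) (cpoly p) = Polynomial.order z (cpoly p)"
proof (cases "p = 0")
  case False
  have c: "map_poly cnj (cpoly q) = cpoly q" for q
    by (simp add: map_poly_map_poly o_def)
  have mult: "map_poly cnj (f * g) = map_poly cnj f * map_poly cnj g" for f g
    by (intro poly_eqI) (simp add: coeff_map_poly coeff_mult)
  have pow: "map_poly cnj (f ^ k) = map_poly cnj f ^ k" for f k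
    by (induction k) (simp_all add: mult one_pCons map_poly_pCons)
  have le: "Polynomial.order z (cpoly p) \<le> Polynomial.order (cnj z) (cpoly p)" for z
  proof -
    obtain g where "cpoly p = [:- z, 1:] ^ Polynomial.order z (cpoly p) * g"
      using order_1[of z "cpoly p"] by (elim dvdE)
    then have "map_poly cnj (cpoly p) = map_poly cnj ([:- z, 1:] ^ Polynomial.order z (cpoly p) * g)" by simp
    then have "cpoly p = [:- cnj z, 1:] ^ Polynomial.order z (cpoly p) * map_poly cnj g"
      by (simp add: c mult pow map_poly_pCons)
    then have "[:- cnj z, 1:] ^ Polynomial.order z (cpoly p) dvd cpoly p" by (metis dvd_triv_left)
    then show ?thesis using order_divides[of "cnj z" _ "cpoly p"] False cpoly_eq_0 by blast
  qed
  show ?thesis using le[of z] le[of "cnj z"] by simp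
qed (simp add: Polynomial.order_def)

text \<open>The second claim separates the listed roots from the conjugates of the nonreal ones; it
  is what removes the conjugate eigenvalues from the centralizer.\<close>

lemma distinct_zs_cnj:
  assumes "root_listing a zs"
  shows "distinct zs" "\<And>y z. y \<in> set zs \<Longrightarrow> z \<in> set zs \<Longrightarrow> y = cnj z \<Longrightarrow> y \<in> \<real>"
    "\<And>z. z \<in> set zs \<Longrightarrow> poly (cpoly a) z = 0"
    "\<And>z. poly (cpoly a) z = 0 \<Longrightarrow> z \<in> set zs \<or> cnj z \<in> set zs"
proof -
  from assms obtain xs ys where zs: "zs = xs @ ys" "distinct zs"
    "set xs = {z. poly (cpoly a) z = 0 \<and> z \<in> \<real>}"
    "set ys \<union> cnj ` set ys = {z. poly (cpoly a) z = 0 \<and> z \<notin> \<real>}"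
    "set ys \<inter> cnj ` set ys = {}"
    unfolding root_listing_def by (elim exE conjE) (rule that; assumption)
  show "distinct zs" by fact
  have ysR: "z \<notin> \<real>" if "z \<in> set ys" for z using zs(4) that by blast
  show "y \<in> \<real>" if "y \<in> set zs" "z \<in> set zs" "y = cnj z" for y z
  proof (cases "z \<in> \<real>")
    case True
    then show ?thesis using that by (metis Reals_cnj_iff)
  next
    case False
    then have "z \<in> set ys" using that zs by auto
    have "y \<notin> set ys" using zs(5) \<open>z \<in> set ys\<close> that(3) by blast
    then show ?thesis using that zs by auto
  qed
  show "poly (cpoly a) z = 0" if "z \<in> set zs" for z
    using that zs by auto
  show "z \<in> set zs \<or> cnj z \<in> set zs" if "poly (cpoly a) z = 0" for z
  proof (cases "z \<in> \<real>")
    case False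
    then have "z \<in> set ys \<union> cnj ` set ys" using that zs(4) by blast
    then show ?thesis unfolding zs(1) by auto
  qed (use that zs in auto)
qed

text \<open>The weight \<open>root_eps\<close> counts the conjugate that the listing omits. The
  inequality, for an arbitrary nonzero polynomial, serves to prove independence of cyclic vectors;
  if p divides a, all roots of p are listed up to conjugation and nothing is lost.\<close>

lemma sum_root_eps_order:
  assumes "root_listing a zs" and p: "p \<noteq> 0"
  shows "(\<Sum>i<length zs. root_eps (zs ! i) * Polynomial.order (zs ! i) (cpoly p)) \<le> degree p"
    and "p dvd a \<Longrightarrow> (\<Sum>i<length zs. root_eps (zs ! i) * Polynomial.order (zs ! i) (cpoly p)) = degree p"
proof -
  note zs = distinct_zs_cnj[OF assms(1)]
  define R where "R = set zs \<union> cnj ` {z\<in>set zs. z \<notin> \<real>}"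
  have disj: "set zs \<inter> cnj ` {z\<in>set zs. z \<notin> \<real>} = {}"
  proof -
    have False if "z \<in> set zs" "z \<notin> \<real>" "cnj z \<in> set zs" for z
      using zs(2)[OF that(3) that(1) refl] that(2) by (metis Reals_cnj_iff complex_cnj_cnj)
    then show ?thesis by blast
  qed
  have "(\<Sum>z\<in>R. Polynomial.order z (cpoly p)) = (\<Sum>z\<in>set zs. Polynomial.order z (cpoly p)) +
      (\<Sum>z\<in>{z\<in>set zs. z \<notin> \<real>}. Polynomial.order z (cpoly p))"
    unfolding R_def using disj
    by (subst sum.union_disjoint) (auto simp: sum.reindex inj_on_def order_cnj)
  also have "(\<Sum>z\<in>{z\<in>set zs. z \<notin> \<real>}. Polynomial.order z (cpoly p)) =
     (\<Sum>z\<in>set zs. if z \<notin> \<real> then Polynomial.order z (cpoly p) else 0)"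
    by (rule sum.inter_filter) simp
  also have "(\<Sum>z\<in>set zs. Polynomial.order z (cpoly p)) + \<dots> =
     (\<Sum>z\<in>set zs. root_eps z * Polynomial.order z (cpoly p))"
    unfolding sum.distrib[symmetric] by (intro sum.cong refl) (simp add: root_eps_def)
  also have "\<dots> = (\<Sum>i<length zs. root_eps (zs ! i) * Polynomial.order (zs ! i) (cpoly p))"
    by (rule sum.reindex_bij_betw[OF bij_betw_nth[OF zs(1) refl refl], symmetric])
  finally have R: "(\<Sum>z\<in>R. Polynomial.order z (cpoly p)) =
     (\<Sum>i<length zs. root_eps (zs ! i) * Polynomial.order (zs ! i) (cpoly p))" .
  have fin: "finite R" unfolding R_def by simp
  have p0: "cpoly p \<noteq> 0" using p cpoly_eq_0 by simp
  show "(\<Sum>i<length zs. root_eps (zs ! i) * Polynomial.order (zs ! i) (cpoly p)) \<le> degree p"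
    using sum_order_le_degree(1)[OF p0 fin] R degree_cpoly by simp
  assume "p dvd a"
  then have "poly (cpoly a) z = 0" if "poly (cpoly p) z = 0" for z
    using that by (auto simp: cpoly_mult elim!: dvdE)
  then have "z \<in> R" if "poly (cpoly p) z = 0" for z
  proof (cases "z \<in> set zs")
    case False
    then have z: "cnj z \<in> set zs" using zs(4)[of z] that \<open>\<And>z. poly (cpoly p) z = 0 \<Longrightarrow> poly (cpoly a) z = 0\<close> by blast
    then have "cnj z \<notin> \<real>" using False by (metis Reals_cnj_iff complex_cnj_cnj)
    then show ?thesis unfolding R_def using z by (intro UnI2 image_eqI[of _ _ "cnj z"]) auto
  qed (simp add: R_def)
  then show "(\<Sum>i<length zs. root_eps (zs ! i) * Polynomial.order (zs ! i) (cpoly p)) = degree p"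
    using sum_order_le_degree(2)[OF p0 fin] R degree_cpoly by auto
qed

section \<open>Coordinates adapted to the real Weyr form\<close>

locale weyr_form =
  fixes n :: nat and \<alpha> :: "nat \<Rightarrow> real poly" and zs :: "complex list"
  assumes n_pos: "1 \<le> n"
    and monic: "\<forall>i\<in>{1..n}. lead_coeff (\<alpha> i) = 1"
    and divides: "\<forall>i\<in>{1..<n}. \<alpha> i dvd \<alpha> (i + 1)"
    and deg_sum: "(\<Sum>i=1..n. degree (\<alpha> i)) = n"
    and roots: "root_listing (\<alpha> n) zs"
begin

abbreviation "w i \<equiv> weyr_char n \<alpha> (zs ! i)"
abbreviation "len i \<equiv> weyr_len n \<alpha> (zs ! i)"
abbreviation "ep i \<equiv> root_eps (zs ! i)"
abbreviation "off \<equiv> weyr_offset n \<alpha> zs"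
abbreviation "size_of i \<equiv> weyr_size n \<alpha> (zs ! i)"
abbreviation "A \<equiv> real_weyr n \<alpha> zs"

text \<open>For the \<open>i\<close>-th root, a row of the Weyr block of size \<open>\<epsilon>\<^sub>i s\<^sup>(\<^sup>i\<^sup>)\<close> is a family of truncated
  polynomials indexed by \<open>c < w i 1\<close>, the \<open>c\<close>-th one modulo the \<open>mu i c\<close>-th power of the variable;
  the entries of degree \<open>s\<close> form the \<open>s + 1\<close>-st block of columns. For nonreal roots, the
  coefficients are complex numbers, with real (\<open>q = 0\<close>) and imaginary (\<open>q = 1\<close>) part.\<close>

definition mu :: "nat \<Rightarrow> nat \<Rightarrow> nat" where
  "mu i c = root_mult n \<alpha> (zs ! i) (Suc c)"

definition lpos :: "nat \<Rightarrow> nat \<Rightarrow> nat \<Rightarrow> nat \<Rightarrow> nat" where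
  "lpos i c s q = ep i * block_offset (w i) (Suc s) + (ep i * c + q)"

definition pos :: "nat \<Rightarrow> nat \<Rightarrow> nat \<Rightarrow> nat \<Rightarrow> nat" where
  "pos i c s q = off i + lpos i c s q"

definition valid :: "nat \<Rightarrow> nat \<Rightarrow> nat \<Rightarrow> nat \<Rightarrow> bool" where
  "valid i c s q \<longleftrightarrow> i < length zs \<and> c < n \<and> s < mu i c \<and> q < ep i"

definition Idx :: "(nat \<times> nat \<times> nat \<times> nat) set" where
  "Idx = {(i, c, s, q). valid i c s q}"

text \<open>Entries of the real matrix [[Re z, Im z], [- Im z, Re z]]. It acts on a row (x, y) as
  multiplication of \<open>x + \<i> y\<close> by z, and on a column (x, y) as multiplication of
  \<open>x - \<i> y\<close> by z.\<close>

definition rot :: "complex \<Rightarrow> nat \<Rightarrow> nat \<Rightarrow> real" where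
  "rot z q q' = (if q = q' then Re z else if q < q' then Im z else - Im z)"

lemma ep_cases: "ep i = 1 \<and> zs ! i \<in> \<real> \<or> ep i = 2 \<and> zs ! i \<notin> \<real>"
  by (simp add: root_eps_def)

lemma ep_pos: "0 < ep i"
  using ep_cases[of i] by auto

lemma alpha_dvd:
  assumes "1 \<le> i" "i \<le> j" "j \<le> n"
  shows "\<alpha> i dvd \<alpha> j"
  using assms(2,3)
proof (induction rule: dec_induct)
  case (step k)
  then have "\<alpha> k dvd \<alpha> (k + 1)" using divides assms(1) by auto
  with step show ?case by (metis Suc_eq_plus1 Suc_leD dvd_trans)
qed simp

lemma alpha_nonzero: "1 \<le> i \<Longrightarrow> i \<le> n \<Longrightarrow> \<alpha> i \<noteq> 0"
  using monic by force

lemma mu_eq: "c < n \<Longrightarrow> mu i c = Polynomial.order (zs ! i) (cpoly (\<alpha> (n - c)))"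
  by (simp add: mu_def root_mult_def Suc_diff_Suc)

lemma mu_antimono:
  assumes "c \<le> c'" "c' < n"
  shows "mu i c' \<le> mu i c"
proof -
  have "\<alpha> (n - c') dvd \<alpha> (n - c)" using assms by (intro alpha_dvd) auto
  then obtain g where "\<alpha> (n - c) = \<alpha> (n - c') * g" by (elim dvdE)
  then have "cpoly (\<alpha> (n - c)) = cpoly (\<alpha> (n - c')) * cpoly g" by (simp only: cpoly_mult)
  moreover have "cpoly (\<alpha> (n - c)) \<noteq> 0" using assms alpha_nonzero[of "n - c"] cpoly_eq_0 by simp
  ultimately show ?thesis using assms by (simp add: mu_eq order_mult)
qed

lemma w_eq_card: "w i (Suc s) = card {c. c < n \<and> s < mu i c}"
proof -
  have "{l \<in> {1..n}. Suc s \<le> root_mult n \<alpha> (zs ! i) l} = Suc ` {c. c < n \<and> s < mu i c}"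
  proof (intro subset_antisym subsetI)
    fix l assume l: "l \<in> {l \<in> {1..n}. Suc s \<le> root_mult n \<alpha> (zs ! i) l}"
    then obtain c where "l = Suc c" by (cases l) auto
    with l show "l \<in> Suc ` {c. c < n \<and> s < mu i c}" by (auto simp: mu_def)
  qed (auto simp: mu_def)
  then show ?thesis unfolding weyr_char_def by (simp add: card_image)
qed

text \<open>The chain lengths \<open>mu i c\<close> do not increase with c, so the chains longer
  than s are the first ones: the conjugate partition, read off the Ferrers diagram.\<close>

lemma less_w_iff: "c < w i (Suc s) \<longleftrightarrow> c < n \<and> s < mu i c"
proof -
  have "{c. c < n \<and> s < mu i c} = {..<w i (Suc s)}"
    unfolding w_eq_card
    by (rule down_closed_eq_lessThan_card) (auto intro: less_le_trans mu_antimono)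
  then show ?thesis by auto
qed

lemma len_eq: "len i = mu i 0"
  by (simp add: weyr_len_def mu_def)

lemma mu_le_len: "c < n \<Longrightarrow> mu i c \<le> len i"
  unfolding len_eq by (rule mu_antimono) auto

lemma degree_alpha:
  assumes "c < n"
  shows "(\<Sum>i<length zs. ep i * mu i c) = degree (\<alpha> (n - c))"
proof -
  have "\<alpha> (n - c) dvd \<alpha> n" using assms by (intro alpha_dvd) auto
  then show ?thesis
    using sum_root_eps_order(2)[OF roots, of "\<alpha> (n - c)"] alpha_nonzero[of "n - c"] assms by (simp add: mu_eq)
qed

lemma sum_degree_alpha: "(\<Sum>c<n. f c * degree (\<alpha> (n - c))) = (\<Sum>l=1..n. f (l - 1) * degree (\<alpha> (n - l + 1)))"
proof -
  have "(\<Sum>l=1..n. f (l - 1) * degree (\<alpha> (n - l + 1))) = (\<Sum>c<n. f (Suc c - 1) * degree (\<alpha> (n - Suc c + 1)))"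
    by (rule sum.reindex_bij_witness[of _ Suc "\<lambda>l. l - 1"]) auto
  also have "\<dots> = (\<Sum>c<n. f c * degree (\<alpha> (n - c)))"
    by (intro sum.cong refl) (simp add: Suc_diff_Suc)
  finally show ?thesis by simp
qed

text \<open>The Ferrers diagram counted by columns and by rows.\<close>

lemma size_eq: "size_of i = ep i * (\<Sum>c<n. mu i c)"
proof -
  have "(\<Sum>j=1..len i. w i j) = (\<Sum>s<len i. w i (Suc s))"
    by (rule sum.reindex_bij_witness[of _ Suc "\<lambda>l. l - 1"]) auto
  also have "\<dots> = (\<Sum>s<len i. \<Sum>c<n. if s < mu i c then 1 else 0)"
  proof (intro sum.cong refl)
    fix s
    have "{c. c < n \<and> s < mu i c} = {c\<in>{..<n}. s < mu i c}" by auto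
    then show "w i (Suc s) = (\<Sum>c<n. if s < mu i c then 1 else 0)"
      by (simp only: w_eq_card sum.inter_filter[symmetric] finite_lessThan card_eq_sum)
  qed
  also have "\<dots> = (\<Sum>c<n. \<Sum>s<len i. if s < mu i c then 1 else 0)" by (rule sum.swap)
  also have "\<dots> = (\<Sum>c<n. mu i c)"
  proof (intro sum.cong refl)
    fix c assume "c \<in> {..<n}"
    then have "{s\<in>{..<len i}. s < mu i c} = {..<mu i c}" using mu_le_len[of c i] by auto
    then show "(\<Sum>s<len i. if s < mu i c then 1 else 0) = mu i c"
      by (simp add: sum.inter_filter[symmetric])
  qed
  finally show ?thesis by (simp add: weyr_size_def)
qed

lemma off_length: "off (length zs) = n"
proof -
  have "off (length zs) = (\<Sum>i<length zs. \<Sum>c<n. ep i * mu i c)"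
    by (simp add: weyr_offset_def size_eq sum_distrib_left)
  also have "\<dots> = (\<Sum>c<n. \<Sum>i<length zs. ep i * mu i c)" by (rule sum.swap)
  also have "\<dots> = (\<Sum>c<n. 1 * degree (\<alpha> (n - c)))" by (simp add: degree_alpha)
  also have "\<dots> = (\<Sum>l=1..n. degree (\<alpha> (n - l + 1)))" by (subst sum_degree_alpha) simp
  also have "\<dots> = (\<Sum>l=1..n. degree (\<alpha> l))"
    by (rule sum.reindex_bij_witness[of _ "\<lambda>l. n - l + 1" "\<lambda>l. n - l + 1"]) auto
  finally show ?thesis using deg_sum by simp
qed

lemma size_of_eq_block_offset: "size_of i = block_offset (\<lambda>j. ep i * w i j) (Suc (len i))"
  by (simp add: weyr_size_def block_offset_eq_sum sum_distrib_left)

lemma lpos_eq: "lpos i c s q = block_offset (\<lambda>j. ep i * w i j) (Suc s) + (ep i * c + q)"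
  by (simp add: lpos_def block_offset_mult)

lemma ep_mult_less: "c < m \<Longrightarrow> q < ep i \<Longrightarrow> ep i * c + q < ep i * m"
  using ep_cases[of i] by auto

lemma ep_mult_inj: "q < ep i \<Longrightarrow> q' < ep i \<Longrightarrow> ep i * c + q = ep i * c' + q' \<longleftrightarrow> c = c' \<and> q = q'"
  using ep_cases[of i] by auto presburger+

lemma ep_mult_exists: "x < ep i * m \<Longrightarrow> \<exists>c q. c < m \<and> q < ep i \<and> x = ep i * c + q"
  by (intro exI[of _ "x div ep i"] exI[of _ "x mod ep i"])
    (auto simp: ep_pos less_mult_imp_div_less mult.commute)

lemma valid_less_w: "valid i c s q \<Longrightarrow> c < w i (Suc s)"
  by (simp add: valid_def less_w_iff)

lemma lpos_less: "valid i c s q \<Longrightarrow> lpos i c s q < size_of i"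
  unfolding lpos_eq size_of_eq_block_offset
  using mu_le_len[of c i] valid_less_w[of i c s q]
  by (intro block_pos_less ep_mult_less) (auto simp: valid_def)

lemma lpos_inj:
  assumes "valid i c s q" "valid i c' s' q'" "lpos i c s q = lpos i c' s' q'"
  shows "c = c'" "s = s'" "q = q'"
proof -
  have "ep i * c + q < ep i * w i (Suc s)" "ep i * c' + q' < ep i * w i (Suc s')"
    using assms(1,2) valid_less_w by (auto intro!: ep_mult_less simp: valid_def)
  from block_pos_inj[of "Suc s" _ "\<lambda>j. ep i * w i j" "Suc s'", OF _ this(1) _ this(2) assms(3)[unfolded lpos_eq]]
  have "s = s'" "ep i * c + q = ep i * c' + q'" by auto
  then show "c = c'" "s = s'" "q = q'" using ep_mult_inj assms by (auto simp: valid_def)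
qed

lemma lpos_exists:
  assumes "i < length zs" "x < size_of i"
  shows "\<exists>c s q. valid i c s q \<and> x = lpos i c s q"
proof -
  from block_pos_exists[OF assms(2)[unfolded size_of_eq_block_offset]] obtain j a where
    ja: "1 \<le> j" "j \<le> len i" "a < ep i * w i j" "x = block_offset (\<lambda>j. ep i * w i j) j + a" by blast
  from ep_mult_exists[OF ja(3)] obtain c q where cq: "c < w i j" "q < ep i" "a = ep i * c + q" by blast
  obtain s where s: "j = Suc s" using ja(1) by (cases j) auto
  show ?thesis using ja cq assms(1) less_w_iff[of c i s] unfolding s lpos_eq valid_def by blast
qed

lemma off_eq_block_offset: "off i = block_offset (\<lambda>j. size_of (j - 1)) (Suc i)"
  unfolding weyr_offset_def block_offset_eq_sum
  by (rule sum.reindex_bij_witness[of _ "\<lambda>l. l - 1" Suc]) auto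

lemma block_offset_length: "block_offset (\<lambda>j. size_of (j - 1)) (Suc (length zs)) = n"
  using off_length off_eq_block_offset by simp

lemma off_pos_less: "i < length zs \<Longrightarrow> x < size_of i \<Longrightarrow> off i + x < n"
  using block_pos_less[of "Suc i" "length zs" x "\<lambda>j. size_of (j - 1)"]
  unfolding off_eq_block_offset block_offset_length by simp

lemma off_pos_inj:
  assumes "x < size_of i" "x' < size_of i'" "off i + x = off i' + x'"
  shows "i = i'" "x = x'"
  using block_pos_inj[of "Suc i" x "\<lambda>j. size_of (j - 1)" "Suc i'" x'] assms
  by (auto simp: off_eq_block_offset)

lemma off_pos_exists:
  assumes "b < n"
  shows "\<exists>i x. i < length zs \<and> x < size_of i \<and> b = off i + x"
proof -
  from assms have "b < block_offset (\<lambda>j. size_of (j - 1)) (Suc (length zs))"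
    unfolding block_offset_length .
  from block_pos_exists[OF this] obtain j a where "1 \<le> j" "j \<le> length zs" "a < size_of (j - 1)"
    "b = block_offset (\<lambda>j. size_of (j - 1)) j + a" by blast
  then show ?thesis unfolding off_eq_block_offset by (intro exI[of _ "j - 1"] exI[of _ a]) auto
qed

lemma pos_less: "valid i c s q \<Longrightarrow> pos i c s q < n"
  unfolding pos_def by (intro off_pos_less lpos_less) (auto simp: valid_def)

lemma pos_inj:
  assumes "valid i c s q" "valid i' c' s' q'" "pos i c s q = pos i' c' s' q'"
  shows "i = i'" "c = c'" "s = s'" "q = q'"
proof -
  from off_pos_inj[OF lpos_less[OF assms(1)] lpos_less[OF assms(2)] assms(3)[unfolded pos_def]]
  have "i = i'" "lpos i c s q = lpos i' c' s' q'" .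
  with lpos_inj[OF assms(1)] assms(2) show "i = i'" "c = c'" "s = s'" "q = q'" by auto
qed

lemma pos_exists:
  assumes "b < n"
  obtains i c s q where "valid i c s q" "b = pos i c s q"
  using off_pos_exists[OF assms] lpos_exists unfolding pos_def by metis

lemma bij_betw_pos: "bij_betw (\<lambda>(i, c, s, q). pos i c s q) Idx {..<n}"
  unfolding bij_betw_def
proof
  show "inj_on (\<lambda>(i, c, s, q). pos i c s q) Idx"
    unfolding Idx_def using pos_inj by (auto intro!: inj_onI)
  show "(\<lambda>(i, c, s, q). pos i c s q) ` Idx = {..<n}"
    unfolding Idx_def using pos_less pos_exists by (auto simp: image_iff) metis
qed

lemma finite_Idx: "finite Idx"
  using bij_betw_finite[OF bij_betw_pos] by simp

lemma sum_pos: "(\<Sum>b<n. f b) = (\<Sum>(i, c, s, q)\<in>Idx. f (pos i c s q))"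
  using sum.reindex_bij_betw[OF bij_betw_pos, of f] by (simp add: case_prod_unfold)

lemma valid_mono: "valid i c s q \<Longrightarrow> s' \<le> s \<Longrightarrow> q' < ep i \<Longrightarrow> valid i c s' q'"
  by (simp add: valid_def)

lemma dim_weyr_block: "weyr_block n \<alpha> z \<in> carrier_mat (weyr_size n \<alpha> z) (weyr_size n \<alpha> z)"
  by (auto simp: weyr_block_def Let_def block_mat_def weyr_size_def sum_distrib_left)

lemma A_carrier: "A \<in> carrier_mat n n"
proof -
  have "sum_list (map (\<lambda>z. weyr_size n \<alpha> z) zs) = n"
    using off_length by (simp add: sum_list_map_nth weyr_offset_def)
  then show ?thesis
    unfolding real_weyr_def
    by (intro carrier_matI) (simp_all add: dim_diag_block_mat o_def carrier_matD[OF dim_weyr_block])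
qed

lemma A_block_index:
  assumes "i < length zs" "i' < length zs" "a < size_of i" "b < size_of i'"
  shows "A $$ (off i + a, off i' + b) = (if i = i' then weyr_block n \<alpha> (zs ! i) $$ (a, b) else 0)"
proof -
  have "(\<Sum>j<i. dim_row (map (weyr_block n \<alpha>) zs ! j)) = off i" if "i \<le> length zs" for i
    using that dim_weyr_block unfolding weyr_offset_def by (intro sum.cong refl) auto
  moreover have "(\<Sum>j<i. dim_col (map (weyr_block n \<alpha>) zs ! j)) = off i" if "i \<le> length zs" for i
    using that dim_weyr_block unfolding weyr_offset_def by (intro sum.cong refl) auto
  ultimately show ?thesis
    using diag_block_mat_index[of i "map (weyr_block n \<alpha>) zs" i' a b] assms
    unfolding real_weyr_def by (simp add: carrier_matD[OF dim_weyr_block])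
qed

lemma weyr_block_index:
  assumes v: "valid i c s q" and v': "valid i c' s' q'"
  shows "weyr_block n \<alpha> (zs ! i) $$ (lpos i c s q, lpos i c' s' q') =
    (if c = c' \<and> s = s' then rot (zs ! i) q q' else if c = c' \<and> s' = Suc s \<and> q = q' then 1 else 0)"
proof -
  let ?z = "zs ! i"
  have b: "ep i * c + q < ep i * w i (Suc s)" "ep i * c' + q' < ep i * w i (Suc s')"
    using v v' valid_less_w by (auto intro!: ep_mult_less simp: valid_def)
  have sl: "Suc s \<le> len i" "Suc s' \<le> len i" using v v' mu_le_len[of c i] mu_le_len[of c' i] by (auto simp: valid_def)
  have q: "q < ep i" "q' < ep i" using v v' by (auto simp: valid_def)
  have cw: "c < w i (Suc s)" "c' < w i (Suc s')" using v v' valid_less_w by auto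
  have eq: "weyr_block n \<alpha> ?z $$ (lpos i c s q, lpos i c' s' q') =
    (if Suc s' = Suc s then
        (if ?z \<in> \<real> then Re ?z \<cdot>\<^sub>m 1\<^sub>m (w i (Suc s))
         else diag_block_mat (replicate (w i (Suc s)) (mat_of_rows_list 2 [[Re ?z, Im ?z], [- Im ?z, Re ?z]])))
     else if Suc s' = Suc s + 1 then eye (ep i * w i (Suc s)) (ep i * w i (Suc s'))
     else 0\<^sub>m (ep i * w i (Suc s)) (ep i * w i (Suc s'))) $$ (ep i * c + q, ep i * c' + q')"
    unfolding weyr_block_def Let_def lpos_eq
    by (subst block_mat_index) (use b sl in auto)
  show ?thesis
  proof (cases "s' = s")
    case False
    then show ?thesis unfolding eq using b ep_mult_inj[OF q] by (auto simp: eye_def)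
  next
    case True
    show ?thesis
    proof (cases "?z \<in> \<real>")
      case R: True
      then have "ep i = 1" by (simp add: root_eps_def)
      then show ?thesis unfolding eq using True R q cw by (auto simp: rot_def)
    next
      case R: False
      then have e: "ep i = 2" by (simp add: root_eps_def)
      let ?M = "mat_of_rows_list 2 [[Re ?z, Im ?z], [- Im ?z, Re ?z]]"
      have dM: "dim_row ?M = 2" "dim_col ?M = 2" by (simp_all add: mat_of_rows_list_def)
      have "diag_block_mat (replicate (w i (Suc s)) ?M) $$ (2 * c + q, 2 * c' + q') = (if c = c' then ?M $$ (q, q') else 0)"
        using diag_block_mat_index[of c "replicate (w i (Suc s)) ?M" c' q q'] cw q e True dM
        by (simp add: mult.commute)
      moreover have "?M $$ (q, q') = rot ?z q q'"
        using q e by (auto simp: mat_of_rows_list_def rot_def less_2_cases_iff)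
      ultimately show ?thesis unfolding eq using True R e by simp
    qed
  qed
qed

lemma A_index:
  assumes v: "valid i c s q" and v': "valid i' c' s' q'"
  shows "A $$ (pos i c s q, pos i' c' s' q') =
    (if i = i' \<and> c = c' \<and> s = s' then rot (zs ! i) q q'
     else if i = i' \<and> c = c' \<and> s' = Suc s \<and> q = q' then 1 else 0)"
  using A_block_index[of i i' "lpos i c s q" "lpos i' c' s' q'"] v v' weyr_block_index[of i c s q c' s' q']
    lpos_less[OF v] lpos_less[OF v'] unfolding pos_def by (auto simp: valid_def)

text \<open>A row or a column of A meets only the \<open>ep i\<close> entries with its own (i, c, s)
  and one neighbour in its chain, in degree \<open>s'\<close>; \<open>P\<close> says that this
  neighbour exists.\<close>

lemma sum_Idx_support:
  fixes f :: "nat \<times> nat \<times> nat \<times> nat \<Rightarrow> 'b::comm_monoid_add"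
  assumes v: "valid i c s q" and P: "P \<Longrightarrow> valid i c s' q" "P \<Longrightarrow> s' \<noteq> s"
    and zero: "\<And>x. x \<in> Idx \<Longrightarrow> \<forall>q'<ep i. x \<noteq> (i, c, s, q') \<Longrightarrow> \<not> (P \<and> x = (i, c, s', q)) \<Longrightarrow> f x = 0"
  shows "(\<Sum>x\<in>Idx. f x) = (\<Sum>q'<ep i. f (i, c, s, q')) + (if P then f (i, c, s', q) else 0)"
proof -
  let ?S = "(\<lambda>q'. (i, c, s, q')) ` {..<ep i}" and ?T = "if P then {(i, c, s', q)} else {}"
  have "(\<Sum>x\<in>Idx. f x) = (\<Sum>x\<in>?S \<union> ?T. f x)"
  proof (rule sum.mono_neutral_right[OF finite_Idx])
    show "?S \<union> ?T \<subseteq> Idx" using v P(1) by (auto simp: Idx_def valid_def)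
    show "\<forall>x\<in>Idx - (?S \<union> ?T). f x = 0"
    proof
      fix x assume x: "x \<in> Idx - (?S \<union> ?T)"
      then show "f x = 0" by (intro zero) (auto split: if_splits)
    qed
  qed
  also have "\<dots> = (\<Sum>x\<in>?S. f x) + (\<Sum>x\<in>?T. f x)"
    by (rule sum.union_disjoint) (use P(2) in auto)
  also have "(\<Sum>x\<in>?S. f x) = (\<Sum>q'<ep i. f (i, c, s, q'))"
    by (subst sum.reindex) (auto simp: inj_on_def)
  finally show ?thesis by simp
qed

lemma row_action:
  fixes v :: "nat \<Rightarrow> 'b::real_vector"
  assumes "valid i c s q"
  shows "(\<Sum>a<n. A $$ (a, pos i c s q) *\<^sub>R v a) =
    (\<Sum>q'<ep i. rot (zs ! i) q' q *\<^sub>R v (pos i c s q')) + (if 0 < s then v (pos i c (s - 1) q) else 0)"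
proof -
  let ?f = "\<lambda>(i', c', s', q'). A $$ (pos i' c' s' q', pos i c s q) *\<^sub>R v (pos i' c' s' q')"
  have V: "valid i c s q'" if "q' < ep i" for q' using assms that by (simp add: valid_def)
  have V1: "valid i c (s - 1) q" using assms by (rule valid_mono) (use assms in \<open>auto simp: valid_def\<close>)
  have "(\<Sum>a<n. A $$ (a, pos i c s q) *\<^sub>R v a) = (\<Sum>x\<in>Idx. ?f x)" by (rule sum_pos)
  also have "\<dots> = (\<Sum>q'<ep i. ?f (i, c, s, q')) + (if 0 < s then ?f (i, c, s - 1, q) else 0)"
  proof (rule sum_Idx_support[OF assms])
    show "?f x = 0" if "x \<in> Idx" "\<forall>q'<ep i. x \<noteq> (i, c, s, q')" "\<not> (0 < s \<and> x = (i, c, s - 1, q))" for x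
      using that assms by (cases x) (auto simp: Idx_def A_index valid_def)
  qed (use V1 in auto)
  also have "(\<Sum>q'<ep i. ?f (i, c, s, q')) = (\<Sum>q'<ep i. rot (zs ! i) q' q *\<^sub>R v (pos i c s q'))"
    using V assms by (intro sum.cong refl) (simp add: A_index)
  also have "(if 0 < s then ?f (i, c, s - 1, q) else 0) = (if 0 < s then v (pos i c (s - 1) q) else 0)"
    using V1 assms by (cases s) (simp_all add: A_index)
  finally show ?thesis .
qed

text \<open>The values lie in an arbitrary real vector space, since the lemma serves for real
  matrices as well as for complexified columns.\<close>

lemma col_action:
  fixes u :: "nat \<Rightarrow> 'b::real_vector"
  assumes "valid i c s q"
  shows "(\<Sum>b<n. A $$ (pos i c s q, b) *\<^sub>R u b) =
    (\<Sum>q'<ep i. rot (zs ! i) q q' *\<^sub>R u (pos i c s q')) + (if Suc s < mu i c then u (pos i c (Suc s) q) else 0)"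
proof -
  let ?f = "\<lambda>(i', c', s', q'). A $$ (pos i c s q, pos i' c' s' q') *\<^sub>R u (pos i' c' s' q')"
  have V: "valid i c s q'" if "q' < ep i" for q' using assms that by (simp add: valid_def)
  have "(\<Sum>b<n. A $$ (pos i c s q, b) *\<^sub>R u b) = (\<Sum>x\<in>Idx. ?f x)" by (rule sum_pos)
  also have "\<dots> = (\<Sum>q'<ep i. ?f (i, c, s, q')) + (if Suc s < mu i c then ?f (i, c, Suc s, q) else 0)"
  proof (rule sum_Idx_support[OF assms])
    show "?f x = 0" if "x \<in> Idx" "\<forall>q'<ep i. x \<noteq> (i, c, s, q')" "\<not> (Suc s < mu i c \<and> x = (i, c, Suc s, q))" for x
      using that assms by (cases x) (auto simp: Idx_def A_index valid_def)
  qed (use assms in \<open>auto simp: valid_def\<close>)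
  also have "(\<Sum>q'<ep i. ?f (i, c, s, q')) = (\<Sum>q'<ep i. rot (zs ! i) q q' *\<^sub>R u (pos i c s q'))"
    using V assms by (intro sum.cong refl) (simp add: A_index)
  also have "(if Suc s < mu i c then ?f (i, c, Suc s, q) else 0) = (if Suc s < mu i c then u (pos i c (Suc s) q) else 0)"
    using assms by (auto simp: A_index valid_def)
  finally show ?thesis .
qed

definition ccoord :: "(nat \<Rightarrow> real) \<Rightarrow> nat \<Rightarrow> nat \<Rightarrow> nat \<Rightarrow> complex" where
  "ccoord v i c s = Complex (v (pos i c s 0)) (if zs ! i \<in> \<real> then 0 else v (pos i c s 1))"

text \<open>Multiplying a row by A multiplies its truncated polynomials by z + t: by z in each
  degree, plus a shift of the coefficients by one degree. For nonreal z the two real columns combine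
  into one complex coefficient.\<close>

lemma ccoord_action:
  assumes "valid i c s 0"
  shows "ccoord (\<lambda>b. \<Sum>a<n. A $$ (a, b) * v a) i c s = zs ! i * ccoord v i c s + (if 0 < s then ccoord v i c (s - 1) else 0)"
proof (cases "zs ! i \<in> \<real>")
  case True
  then have "ep i = 1" "Im (zs ! i) = 0" by (auto simp: root_eps_def complex_is_Real_iff)
  then show ?thesis using True row_action[OF assms, of v]
    by (auto simp: ccoord_def rot_def complex_eq_iff)
next
  case False
  then have e: "ep i = 2" by (auto simp: root_eps_def)
  then have "valid i c s 1" using assms by (simp add: valid_def)
  from False row_action[OF this, of v] row_action[OF assms, of v] show ?thesis
    by (auto simp: ccoord_def rot_def complex_eq_iff e numeral_2_eq_2)
qed

lemma ccoord_eq_0D: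
  assumes "\<And>i c s. valid i c s 0 \<Longrightarrow> ccoord v i c s = 0" and "b < n"
  shows "v b = 0"
proof -
  obtain i c s q where p: "valid i c s q" "b = pos i c s q" using pos_exists[OF assms(2)] .
  then have "ccoord v i c s = 0" using assms(1) ep_pos by (auto simp: valid_def)
  then show ?thesis using p ep_cases[of i] by (auto simp: ccoord_def complex_eq_iff valid_def less_2_cases_iff split: if_splits)
qed

end

section \<open>The invariant polynomials of the real Weyr form\<close>

lemma pcompose_monom: "pcompose (monom a l) q = Polynomial.smult a (q ^ l)"
  by (induction l) (simp_all add: monom_0 monom_Suc pcompose_pCons pcompose_const)

lemma cpoly_add: "cpoly (p + q) = cpoly p + cpoly q"
  by (intro poly_eqI) (simp add: coeff_map_poly)

lemma sum_smult_power:
  "(\<Sum>l<N. Polynomial.smult (complex_of_real (y l)) (q ^ l)) = pcompose (cpoly (\<Sum>l<N. monom (y l) l)) q"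
  by (induction N) (simp_all add: cpoly_add pcompose_add pcompose_monom)

text \<open>The coefficients of p(z + t) are the Taylor coefficients of p at z; substituting s - z
  for t takes t^m to (s - z)^m.\<close>

lemma coeff_pcompose_shift_eq_0_iff:
  fixes p :: "complex poly"
  shows "(\<forall>s<m. coeff (pcompose p [:z, 1:]) s = 0) \<longleftrightarrow> [:- z, 1:] ^ m dvd p"
proof -
  have shift: "pcompose (pcompose p [:z, 1:]) [:- z, 1:] = p" for p :: "complex poly" and z
    by (subst pcompose_assoc[symmetric]) (simp add: pcompose_pCons pcompose_idR)
  have "monom 1 m dvd pcompose p [:z, 1:] \<longleftrightarrow> [:- z, 1:] ^ m dvd p"
  proof
    assume "monom 1 m dvd pcompose p [:z, 1:]"
    then obtain g where "pcompose p [:z, 1:] = monom 1 m * g" by (elim dvdE)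
    then have "p = pcompose (monom 1 m * g) [:- z, 1:]" using shift by metis
    then show "[:- z, 1:] ^ m dvd p" by (simp add: pcompose_mult pcompose_monom)
  next
    assume "[:- z, 1:] ^ m dvd p"
    then obtain g where g: "p = [:- z, 1:] ^ m * g" by (elim dvdE)
    have "[:- z, 1:] ^ m = pcompose (monom 1 m) [:- z, 1:]" by (simp add: pcompose_monom)
    then have "pcompose ([:- z, 1:] ^ m) [:z, 1:] = monom 1 m" using shift[of "monom 1 m" "- z"] by simp
    then show "monom 1 m dvd pcompose p [:z, 1:]" by (simp add: g pcompose_mult)
  qed
  then show ?thesis by (simp add: monom_1_dvd_iff')
qed

context weyr_form
begin

lemma ccoord_sum:
  "ccoord (\<lambda>b. \<Sum>x\<in>S. r x * v x b) i c s = (\<Sum>x\<in>S. of_real (r x) * ccoord (v x) i c s)"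
  by (simp add: ccoord_def complex_eq_iff)

primrec cyclic_vec :: "nat \<Rightarrow> nat \<Rightarrow> nat \<Rightarrow> real" where
  "cyclic_vec c0 0 b = (if \<exists>i. valid i c0 0 0 \<and> b = pos i c0 0 0 then 1 else 0)"
| "cyclic_vec c0 (Suc l) b = (\<Sum>a<n. cyclic_vec c0 l a * A $$ (a, b))"

text \<open>The generator is the constant polynomial 1 in chain \<open>c0\<close> of every root, so
  l multiplications by A yield (z + t)^l, truncated.\<close>

lemma ccoord_cyclic_vec:
  "valid i c s 0 \<Longrightarrow> ccoord (cyclic_vec c0 l) i c s = (if c = c0 then coeff ([:zs ! i, 1:] ^ l) s else 0)"
proof (induction l arbitrary: s)
  case 0
  have v0: "(\<exists>i'. valid i' c0 0 0 \<and> pos i c s 0 = pos i' c0 0 0) \<longleftrightarrow> c = c0 \<and> s = 0"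
  proof
    assume "\<exists>i'. valid i' c0 0 0 \<and> pos i c s 0 = pos i' c0 0 0"
    then show "c = c0 \<and> s = 0" using pos_inj[OF 0] by blast
  next
    assume "c = c0 \<and> s = 0"
    then show "\<exists>i'. valid i' c0 0 0 \<and> pos i c s 0 = pos i' c0 0 0" using 0 by blast
  qed
  have v1: "\<not> (\<exists>i'. valid i' c0 0 0 \<and> pos i c s 1 = pos i' c0 0 0)" if "zs ! i \<notin> \<real>"
  proof -
    have "valid i c s 1" using 0 that by (simp add: valid_def root_eps_def)
    then show ?thesis using pos_inj(4) by (metis zero_neq_one)
  qed
  show ?case using v1 by (auto simp: ccoord_def v0 complex_eq_iff)
next
  case (Suc l)
  have "valid i c (s - 1) 0" using Suc.prems by (auto simp: valid_def)
  have "ccoord (cyclic_vec c0 (Suc l)) i c s = ccoord (\<lambda>b. \<Sum>a<n. A $$ (a, b) * cyclic_vec c0 l a) i c s"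
    by (simp add: ccoord_def mult.commute)
  also have "\<dots> = zs ! i * ccoord (cyclic_vec c0 l) i c s + (if 0 < s then ccoord (cyclic_vec c0 l) i c (s - 1) else 0)"
    by (rule ccoord_action[OF Suc.prems])
  also have "\<dots> = (if c = c0 then coeff ([:zs ! i, 1:] ^ Suc l) s else 0)"
    using Suc.IH[OF Suc.prems] Suc.IH[OF \<open>valid i c (s - 1) 0\<close>]
    by (cases s) (simp_all add: coeff_pCons)
  finally show ?case .
qed

lemma ccoord_cyclic_vec_sum:
  assumes "valid i c s 0"
  shows "ccoord (\<lambda>b. \<Sum>l<N. y l * cyclic_vec c0 l b) i c s =
    (if c = c0 then coeff (pcompose (cpoly (\<Sum>l<N. monom (y l) l)) [:zs ! i, 1:]) s else 0)"
  unfolding ccoord_sum sum_smult_power[symmetric]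
  by (simp add: ccoord_cyclic_vec[OF assms] coeff_sum)

lemma A_inv_poly_class: "A \<in> inv_poly_class n \<alpha>"
\<comment> \<open>The length of chain c of a root is its multiplicity in
  \<open>\<alpha> (n - c)\<close>, so the summand for \<open>\<alpha> (Suc i)\<close> is generated
  by chain \<open>n - Suc i\<close>.\<close>
proof (rule cyclic_decomposition_inv_poly_class[OF A_carrier, where b = "\<lambda>i. cyclic_vec (n - Suc i)"])
  show "lead_coeff (\<alpha> (Suc i)) = 1" if "i < n" for i using monic that by auto
  show "(\<Sum>i<n. degree (\<alpha> (Suc i))) = n"
    using deg_sum sum.atLeast1_atMost_eq[of "\<lambda>i. degree (\<alpha> i)" n] by simp
  show "cyclic_vec (n - Suc i) (Suc l) c = (\<Sum>a<n. cyclic_vec (n - Suc i) l a * A $$ (a, c))" for i l c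
    by simp
next
  fix i b assume i: "i < n" and b: "b < n"
  let ?c = "n - Suc i" and ?d = "degree (\<alpha> (Suc i))"
  have c: "?c < n" "n - ?c = Suc i" using i by auto
  let ?v = "\<lambda>b. \<Sum>l<Suc ?d. coeff (\<alpha> (Suc i)) l * cyclic_vec ?c l b"
  have "ccoord ?v i' c s = 0" if v: "valid i' c s 0" for i' c s
  proof -
    have "[:- (zs ! i'), 1:] ^ mu i' ?c dvd cpoly (\<alpha> (Suc i))"
      using mu_eq[OF c(1), of i'] c(2) order_1 by metis
    then have "coeff (pcompose (cpoly (\<alpha> (Suc i))) [:zs ! i', 1:]) s = 0" if "c = ?c"
      using that v coeff_pcompose_shift_eq_0_iff[of "mu i' ?c"] by (auto simp: valid_def)
    moreover have "ccoord ?v i' c s = (if c = ?c then coeff (pcompose (cpoly (\<alpha> (Suc i))) [:zs ! i', 1:]) s else 0)"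
      using ccoord_cyclic_vec_sum[OF v, of "coeff (\<alpha> (Suc i))" ?c "Suc ?d"]
      by (simp add: lessThan_Suc_atMost poly_as_sum_of_monoms del: sum.lessThan_Suc)
    ultimately show ?thesis by simp
  qed
  from ccoord_eq_0D[of ?v, OF this b]
  show "(\<Sum>l\<le>?d. coeff (\<alpha> (Suc i)) l * cyclic_vec ?c l b) = 0" by (simp add: lessThan_Suc_atMost)
next
  fix y assume y: "\<And>b. b < n \<Longrightarrow> (\<Sum>i<n. \<Sum>l<degree (\<alpha> (Suc i)). y i l * cyclic_vec (n - Suc i) l b) = 0"
  show "\<forall>i<n. \<forall>l<degree (\<alpha> (Suc i)). y i l = 0"
  proof (intro allI impI)
    fix i l assume i: "i < n" and l: "l < degree (\<alpha> (Suc i))"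
    let ?c = "n - Suc i" and ?d = "\<lambda>i. degree (\<alpha> (Suc i))"
    have c: "?c < n" "n - ?c = Suc i" using i by auto
    define f where "f = (\<Sum>l<?d i. monom (y i l) l)"
    have f_coeff: "coeff f l = (if l < ?d i then y i l else 0)" for l
      unfolding f_def by (simp add: coeff_sum)
    \<comment> \<open>A linear relation says that \<open>f\<close> vanishes at each listed root at
      least to the order of \<open>\<alpha> (Suc i)\<close> there. A nonzero \<open>f\<close> would
      then have at least the degree of \<open>\<alpha> (Suc i)\<close>.\<close>
    have "f = 0"
    proof (rule ccontr)
      assume f0: "f \<noteq> 0"
      have "mu i' ?c \<le> Polynomial.order (zs ! i') (cpoly f)" if i': "i' < length zs" for i'
      proof -
        have "coeff (pcompose (cpoly f) [:zs ! i', 1:]) s = 0" if s: "s < mu i' ?c" for s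
        proof -
          have v: "valid i' ?c s 0" using i' s c ep_pos by (simp add: valid_def)
          have "0 = ccoord (\<lambda>b. \<Sum>j<n. 1 * (\<Sum>l<?d j. y j l * cyclic_vec (n - Suc j) l b)) i' ?c s"
            using y pos_less[OF v] pos_less[of i' ?c s 1] v
            by (auto simp: ccoord_def complex_eq_iff valid_def root_eps_def)
          also have "\<dots> = (\<Sum>j<n. ccoord (\<lambda>b. \<Sum>l<?d j. y j l * cyclic_vec (n - Suc j) l b) i' ?c s)"
            unfolding ccoord_sum by simp
          also have "\<dots> = (\<Sum>j<n. if j = i then coeff (pcompose (cpoly f) [:zs ! i', 1:]) s else 0)"
            unfolding ccoord_cyclic_vec_sum[OF v] f_def using i by (intro sum.cong refl) auto
          finally show ?thesis using i by simp
        qed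
        then have "[:- (zs ! i'), 1:] ^ mu i' ?c dvd cpoly f"
          using coeff_pcompose_shift_eq_0_iff by blast
        then show ?thesis using order_divides f0 cpoly_eq_0 by blast
      qed
      then have "(\<Sum>i'<length zs. ep i' * mu i' ?c) \<le> (\<Sum>i'<length zs. ep i' * Polynomial.order (zs ! i') (cpoly f))"
        by (intro sum_mono) auto
      also have "\<dots> \<le> degree f" using sum_root_eps_order(1)[OF roots f0] .
      finally have "?d i \<le> degree f" using degree_alpha[OF c(1)] c(2) by simp
      then show False using f0 f_coeff[of "degree f"] by (simp add: leading_coeff_0_iff[symmetric] del: leading_coeff_0_iff)
    qed
    then show "y i l = 0" using f_coeff[of l] l by simp
  qed
qed

end

section \<open>The centralizer of the real Weyr form\<close>

text \<open>An intertwiner between Jordan blocks with different eigenvalues is zero. The relation at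
  (s, l) involves row s + 1 and column l - 1, so the induction goes up in l and, for each l, down in
  s.\<close>

lemma chain_distinct_eigenvalues:
  fixes Y :: "nat \<Rightarrow> nat \<Rightarrow> complex"
  assumes ne: "\<zeta> \<noteq> z"
    and rel: "\<And>s l. s < m \<Longrightarrow> l < m' \<Longrightarrow>
      \<zeta> * Y s l + (if Suc s < m then Y (Suc s) l else 0) = z * Y s l + (if 0 < l then Y s (l - 1) else 0)"
  shows "s < m \<Longrightarrow> l < m' \<Longrightarrow> Y s l = 0"
proof (induction l arbitrary: s)
  case (0)
  have "s < m \<longrightarrow> Y s 0 = 0" for s
  proof (induction "m - s" arbitrary: s rule: less_induct)
    case less
    show ?case
    proof
      assume s: "s < m"
      have "Suc s < m \<longrightarrow> Y (Suc s) 0 = 0" using less[of "Suc s"] s by auto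
      then have "\<zeta> * Y s 0 = z * Y s 0" using rel[OF s 0(2)] by (auto split: if_splits)
      then show "Y s 0 = 0" using ne by simp
    qed
  qed
  then show ?case using 0 by simp
next
  case (Suc l)
  have "s < m \<longrightarrow> Y s (Suc l) = 0" for s
  proof (induction "m - s" arbitrary: s rule: less_induct)
    case less
    show ?case
    proof
      assume s: "s < m"
      have "Suc s < m \<longrightarrow> Y (Suc s) (Suc l) = 0" using less[of "Suc s"] s by auto
      moreover have "Y s l = 0" using Suc.IH[OF s] Suc.prems by simp
      ultimately have "\<zeta> * Y s (Suc l) = z * Y s (Suc l)" using rel[OF s Suc.prems(2)] by (auto split: if_splits)
      then show "Y s (Suc l) = 0" using ne by simp
    qed
  qed
  then show ?case using Suc.prems by simp
qed

text \<open>With equal eigenvalues the relation is a shift along diagonals, so an intertwiner is an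
  upper triangular Toeplitz block. The last row has no successor, which kills every diagonal that
  reaches the last row before the last column.\<close>

lemma chain_equal_eigenvalues:
  fixes Y :: "nat \<Rightarrow> nat \<Rightarrow> complex"
  assumes rel: "\<And>s l. s < m \<Longrightarrow> l < m' \<Longrightarrow>
      z * Y s l + (if Suc s < m then Y (Suc s) l else 0) = z * Y s l + (if 0 < l then Y s (l - 1) else 0)"
  shows "s < m \<Longrightarrow> l < m' \<Longrightarrow> Y s l = (if s \<le> l then Y 0 (l - s) else 0)"
    and "0 < m \<Longrightarrow> j + m < m' \<Longrightarrow> Y 0 j = 0"
proof -
  have toep: "s < m \<longrightarrow> l < m' \<longrightarrow> Y s l = (if s \<le> l then Y 0 (l - s) else 0)" for s l
  proof (induction s arbitrary: l)
    case (Suc s)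
    show ?case
    proof (intro impI)
      assume s: "Suc s < m" and l: "l < m'"
      show "Y (Suc s) l = (if Suc s \<le> l then Y 0 (l - Suc s) else 0)"
        using rel[of s l] s l Suc.IH[of "l - 1"] by (cases l) auto
    qed
  qed simp
  then show "s < m \<Longrightarrow> l < m' \<Longrightarrow> Y s l = (if s \<le> l then Y 0 (l - s) else 0)" by blast
  assume m: "0 < m" and j: "j + m < m'"
  have "Y (m - 1) (j + m - 1) = 0" using rel[of "m - 1" "j + m"] m j by simp
  moreover have "Y (m - 1) (j + m - 1) = Y 0 j" using toep[of "m - 1" "j + m - 1"] m j by simp
  ultimately show "Y 0 j = 0" by simp
qed

context weyr_form
begin

lemma Idx_eq: "Idx = (SIGMA i:{..<length zs}. SIGMA c:{..<n}. SIGMA s:{..<mu i c}. {..<ep i})"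
  unfolding Idx_def valid_def by auto

lemma sum_pos_iterated:
  "(\<Sum>b<n. f b) = (\<Sum>i<length zs. \<Sum>c<n. \<Sum>s<mu i c. \<Sum>q<ep i. f (pos i c s q))"
  unfolding sum_pos[of f] Idx_eq by (simp add: sum.Sigma split_def)

definition Cent :: "real mat set" where
  "Cent = {X \<in> carrier_mat n n. A * X = X * A}"

text \<open>A column (x, y) of a nonreal root splits into \<open>x - \<i> y\<close>, on which A acts
  with eigenvalue z, and \<open>x + \<i> y\<close>, with eigenvalue cnj z; \<open>\<sigma>\<close>
  is the sign.\<close>

definition eigcoord :: "complex \<Rightarrow> (nat \<Rightarrow> complex) \<Rightarrow> nat \<Rightarrow> nat \<Rightarrow> nat \<Rightarrow> complex" where
  "eigcoord \<sigma> u i c s = u (pos i c s 0) + (if zs ! i \<in> \<real> then 0 else \<sigma> * \<i> * u (pos i c s 1))"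

lemma eigcoord_action:
  assumes "valid i c s 0" and \<sigma>: "\<sigma> = - 1 \<or> \<sigma> = 1"
  shows "eigcoord \<sigma> (\<lambda>p. \<Sum>b<n. A $$ (p, b) *\<^sub>R u b) i c s =
    (if \<sigma> = - 1 then zs ! i else cnj (zs ! i)) * eigcoord \<sigma> u i c s + (if Suc s < mu i c then eigcoord \<sigma> u i c (Suc s) else 0)"
proof (cases "zs ! i \<in> \<real>")
  case True
  then have e: "ep i = 1" "Im (zs ! i) = 0" by (auto simp: root_eps_def complex_is_Real_iff)
  have "complex_of_real (Re (zs ! i)) = zs ! i" "cnj (zs ! i) = zs ! i" using e by (auto simp: complex_eq_iff)
  then show ?thesis using True e unfolding eigcoord_def col_action[OF assms(1)]
    by (simp add: rot_def scaleR_conv_of_real)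
next
  case False
  then have e: "ep i = 2" by (auto simp: root_eps_def)
  then have v: "valid i c s 1" using assms by (simp add: valid_def)
  obtain a b where z: "zs ! i = Complex a b" by (cases "zs ! i")
  have z': "Complex a b = of_real a + \<i> * of_real b" "cnj (Complex a b) = of_real a - \<i> * of_real b"
    by (simp_all add: complex_eq_iff)
  have i2: "\<i> * (\<i> * x) = - x" for x by (simp add: mult.assoc[symmetric])
  let ?t = "\<lambda>q. if Suc s < mu i c then u (pos i c (Suc s) q) else 0"
  have 0: "(\<Sum>b'<n. A $$ (pos i c s 0, b') *\<^sub>R u b') = of_real a * u (pos i c s 0) + of_real b * u (pos i c s 1) + ?t 0"
    unfolding col_action[OF assms(1)] e by (simp add: z rot_def scaleR_conv_of_real numeral_2_eq_2)
  have 1: "(\<Sum>b'<n. A $$ (pos i c s 1, b') *\<^sub>R u b') = - of_real b * u (pos i c s 0) + of_real a * u (pos i c s 1) + ?t 1"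
    unfolding col_action[OF v] e by (simp add: z rot_def scaleR_conv_of_real numeral_2_eq_2)
  have d: "eigcoord \<sigma> u i c s = u (pos i c s 0) + \<sigma> * \<i> * u (pos i c s 1)"
    "(if Suc s < mu i c then eigcoord \<sigma> u i c (Suc s) else 0) = ?t 0 + \<sigma> * \<i> * ?t 1" using False by (simp_all add: eigcoord_def)
  have l: "eigcoord \<sigma> (\<lambda>p. \<Sum>b<n. A $$ (p, b) *\<^sub>R u b) i c s =
     (of_real a * u (pos i c s 0) + of_real b * u (pos i c s 1) + ?t 0) + \<sigma> * \<i> * (- of_real b * u (pos i c s 0) + of_real a * u (pos i c s 1) + ?t 1)"
    using False by (simp only: eigcoord_def 0 1 if_False)
  show ?thesis
    unfolding l d z z' using \<sigma> by (elim disjE) (simp_all add: ring_distribs i2 mult.left_commute mult.assoc)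
qed

lemma Cent_columns:
  assumes X: "X \<in> Cent" and p: "p < n" and v: "valid i' c' l 0"
  shows "(\<Sum>b<n. A $$ (p, b) *\<^sub>R ccoord (\<lambda>b'. X $$ (b, b')) i' c' l) =
    zs ! i' * ccoord (\<lambda>b'. X $$ (p, b')) i' c' l + (if 0 < l then ccoord (\<lambda>b'. X $$ (p, b')) i' c' (l - 1) else 0)"
proof -
  have Xc: "X \<in> carrier_mat n n" "A * X = X * A" using X by (auto simp: Cent_def)
  have eq: "(\<Sum>a<n. A $$ (p, a) * X $$ (a, b')) = (\<Sum>a<n. A $$ (a, b') * X $$ (p, a))" if "b' < n" for b'
    using arg_cong[OF Xc(2), of "\<lambda>M. M $$ (p, b')"] p that
    by (simp add: mult_mat_index[OF A_carrier Xc(1)] mult_mat_index[OF Xc(1) A_carrier] mult.commute del: index_mult_mat(1))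
  have "(\<Sum>b<n. A $$ (p, b) *\<^sub>R ccoord (\<lambda>b'. X $$ (b, b')) i' c' l) =
     ccoord (\<lambda>b'. \<Sum>a<n. A $$ (p, a) * X $$ (a, b')) i' c' l"
    unfolding ccoord_sum by (simp add: scaleR_conv_of_real)
  also have "\<dots> = ccoord (\<lambda>b'. \<Sum>a<n. A $$ (a, b') * X $$ (p, a)) i' c' l"
    using eq pos_less[OF v] pos_less[of i' c' l 1] v by (auto simp: ccoord_def valid_def root_eps_def)
  also have "\<dots> = zs ! i' * ccoord (\<lambda>b'. X $$ (p, b')) i' c' l + (if 0 < l then ccoord (\<lambda>b'. X $$ (p, b')) i' c' (l - 1) else 0)"
    by (rule ccoord_action[OF v])
  finally show ?thesis .
qed

text \<open>The complexified columns of \<open>X\<close> belonging to a root are Jordan chains of \<open>A\<close>.\<close>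

lemma Cent_structure:
  assumes X: "X \<in> Cent"
  defines "x \<equiv> (\<lambda>i' c' l p. ccoord (\<lambda>b. X $$ (p, b)) i' c' l)"
  shows "valid i c s 0 \<Longrightarrow> valid i' c' l 0 \<Longrightarrow>
      x i' c' l (pos i c s 0) = (if i = i' \<and> s \<le> l then x i' c' (l - s) (pos i c 0 0) else 0)"
    and "valid i c s 1 \<Longrightarrow> valid i' c' l 0 \<Longrightarrow> x i' c' l (pos i c s 1) = \<i> * x i' c' l (pos i c s 0)"
    and "valid i c 0 0 \<Longrightarrow> c' < n \<Longrightarrow> j + mu i c < mu i c' \<Longrightarrow> x i c' j (pos i c 0 0) = 0"
proof -
  note zs = distinct_zs_cnj[OF roots]
  have rel: "(if \<sigma> = - 1 then zs ! i else cnj (zs ! i)) * eigcoord \<sigma> (x i' c' l) i c s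
       + (if Suc s < mu i c then eigcoord \<sigma> (x i' c' l) i c (Suc s) else 0) =
     zs ! i' * eigcoord \<sigma> (x i' c' l) i c s + (if 0 < l then eigcoord \<sigma> (x i' c' (l - 1)) i c s else 0)"
    if v: "valid i c s 0" and v': "valid i' c' l 0" and \<sigma>: "\<sigma> = - 1 \<or> \<sigma> = 1" for \<sigma> i c s i' c' l
  proof -
    have "eigcoord \<sigma> (\<lambda>p. \<Sum>b<n. A $$ (p, b) *\<^sub>R x i' c' l b) i c s =
      eigcoord \<sigma> (\<lambda>p. zs ! i' * x i' c' l p + (if 0 < l then x i' c' (l - 1) p else 0)) i c s"
      using Cent_columns[OF X _ v'] pos_less[OF v] pos_less[of i c s 1] v
      unfolding x_def by (auto simp: eigcoord_def valid_def root_eps_def)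
    also have "\<dots> = zs ! i' * eigcoord \<sigma> (x i' c' l) i c s + (if 0 < l then eigcoord \<sigma> (x i' c' (l - 1)) i c s else 0)"
      by (simp add: eigcoord_def algebra_simps)
    finally show ?thesis unfolding eigcoord_action[OF v \<sigma>] .
  qed
  have e0: "0 < ep i" for i by (rule ep_pos)
  have zero: "eigcoord \<sigma> (x i' c' l) i c s = 0"
    if v: "valid i c s 0" and v': "valid i' c' l 0" and \<sigma>: "\<sigma> = - 1 \<or> \<sigma> = 1"
      and ne: "(if \<sigma> = - 1 then zs ! i else cnj (zs ! i)) \<noteq> zs ! i'" for \<sigma> i c s i' c' l
  proof (rule chain_distinct_eigenvalues[OF ne, where m = "mu i c" and m' = "mu i' c'" and Y = "\<lambda>s l. eigcoord \<sigma> (x i' c' l) i c s"])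
    show "(if \<sigma> = - 1 then zs ! i else cnj (zs ! i)) * eigcoord \<sigma> (x i' c' l) i c s
       + (if Suc s < mu i c then eigcoord \<sigma> (x i' c' l) i c (Suc s) else 0) =
     zs ! i' * eigcoord \<sigma> (x i' c' l) i c s + (if 0 < l then eigcoord \<sigma> (x i' c' (l - 1)) i c s else 0)"
      if "s < mu i c" "l < mu i' c'" for s l
      by (rule rel) (use v v' \<sigma> that in \<open>auto simp: valid_def\<close>)
  qed (use v v' in \<open>auto simp: valid_def\<close>)
  \<comment> \<open>The part for the conjugate eigenvalue vanishes, because that eigenvalue is not a
    listed root. This leaves \<open>y = \<i> x\<close> in each complexified column.\<close>
  have plus: "x i' c' l (pos i c s 1) = \<i> * x i' c' l (pos i c s 0)"
    if v: "valid i c s 1" and v': "valid i' c' l 0" for i c s i' c' l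
  proof -
    have nr: "zs ! i \<notin> \<real>" using v by (auto simp: valid_def root_eps_def split: if_splits)
    have "cnj (zs ! i) \<noteq> zs ! i'"
    proof
      assume eq: "cnj (zs ! i) = zs ! i'"
      have "zs ! i' \<in> \<real>" by (rule zs(2)[OF _ _ eq[symmetric]]) (use v v' in \<open>auto simp: valid_def\<close>)
      then have "cnj (zs ! i) \<in> \<real>" using eq by simp
      then show False using nr by (simp add: complex_is_Real_iff)
    qed
    then have "eigcoord 1 (x i' c' l) i c s = 0" using zero[of i c s i' c' l 1] v v' by (auto simp: valid_def)
    then have "\<i> * x i' c' l (pos i c s 1) = - x i' c' l (pos i c s 0)"
      using nr by (simp add: eigcoord_def add_eq_0_iff)
    then have "\<i> * (\<i> * x i' c' l (pos i c s 1)) = \<i> * (- x i' c' l (pos i c s 0))" by simp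
    then show ?thesis by (simp add: mult.assoc[symmetric])
  qed
  then show "valid i c s 1 \<Longrightarrow> valid i' c' l 0 \<Longrightarrow> x i' c' l (pos i c s 1) = \<i> * x i' c' l (pos i c s 0)" .
  \<comment> \<open>With \<open>y = \<i> x\<close> the surviving part \<open>x - \<i> y\<close> is 2
    x, so the chain relations can be read off the components with q = 0 alone.\<close>
  have minus: "eigcoord (- 1) (x i' c' l) i c s = (if zs ! i \<in> \<real> then 1 else 2) * x i' c' l (pos i c s 0)"
    if v: "valid i c s 0" and v': "valid i' c' l 0" for i c s i' c' l
  proof (cases "zs ! i \<in> \<real>")
    case False
    then have "valid i c s 1" using v by (auto simp: valid_def root_eps_def)
    then show ?thesis using plus[OF _ v'] False by (simp add: eigcoord_def)
  qed (simp add: eigcoord_def)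
  have two: "(if zs ! i \<in> \<real> then 1 else 2 :: complex) \<noteq> 0" for i by simp
  show "x i' c' l (pos i c s 0) = (if i = i' \<and> s \<le> l then x i' c' (l - s) (pos i c 0 0) else 0)"
    if v: "valid i c s 0" and v': "valid i' c' l 0" for i c s i' c' l
  proof (cases "i = i'")
    case False
    then have "zs ! i \<noteq> zs ! i'" using zs(1) v v' by (simp add: nth_eq_iff_index_eq valid_def)
    then have "eigcoord (- 1) (x i' c' l) i c s = 0" using zero[OF v v', of "- 1"] by simp
    then show ?thesis using minus[OF v v'] two False by simp
  next
    case True
    have "eigcoord (- 1) (x i' c' l) i c s = (if s \<le> l then eigcoord (- 1) (x i' c' (l - s)) i c 0 else 0)"
    proof (rule chain_equal_eigenvalues(1)[where m = "mu i c" and m' = "mu i' c'" and z = "zs ! i" and Y = "\<lambda>s l. eigcoord (- 1) (x i' c' l) i c s"])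
      show "zs ! i * eigcoord (- 1) (x i' c' l) i c s + (if Suc s < mu i c then eigcoord (- 1) (x i' c' l) i c (Suc s) else 0) =
        zs ! i * eigcoord (- 1) (x i' c' l) i c s + (if 0 < l then eigcoord (- 1) (x i' c' (l - 1)) i c s else 0)"
        if "s < mu i c" "l < mu i' c'" for s l
        using rel[of i c s i' c' l "- 1"] v v' that True by (auto simp: valid_def)
    qed (use v v' in \<open>auto simp: valid_def\<close>)
    moreover have "valid i c 0 0" "valid i' c' (l - s) 0" using v v' by (auto simp: valid_def)
    ultimately show ?thesis using minus[OF v v'] minus[of i c 0 i' c' "l - s"] two[of i] True
      by (auto split: if_splits)
  qed
  show "x i c' j (pos i c 0 0) = 0" if v: "valid i c 0 0" and c': "c' < n" and j: "j + mu i c < mu i c'"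
    for i c c' j
  proof -
    have "eigcoord (- 1) (x i c' j) i c 0 = 0"
    proof (rule chain_equal_eigenvalues(2)[where m = "mu i c" and m' = "mu i c'" and z = "zs ! i" and Y = "\<lambda>s l. eigcoord (- 1) (x i c' l) i c s"])
      show "zs ! i * eigcoord (- 1) (x i c' l) i c s + (if Suc s < mu i c then eigcoord (- 1) (x i c' l) i c (Suc s) else 0) =
        zs ! i * eigcoord (- 1) (x i c' l) i c s + (if 0 < l then eigcoord (- 1) (x i c' (l - 1)) i c s else 0)"
        if "s < mu i c" "l < mu i c'" for s l
        using rel[of i c s i c' l "- 1"] v c' that by (auto simp: valid_def)
    qed (use v j in \<open>auto simp: valid_def\<close>)
    moreover have "valid i c' j 0" using v c' j by (auto simp: valid_def)
    ultimately show ?thesis using minus[OF v, of i c' j] two[of i] by simp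
  qed
qed

end

section \<open>The prescribed entries under multiplication by the centralizer\<close>

context weyr_form
begin

text \<open>Multiplication by t^s is well defined from chain g, truncated at \<open>mu i g\<close>,
  to chain c, truncated at \<open>mu i c\<close>, exactly when
  \<open>mu i c \<le> s + mu i g\<close>. The same tuples index the prescribed entries: the row
  attached to g against the column (c, s, q).\<close>

definition presc_idx :: "(nat \<times> nat \<times> nat \<times> nat \<times> nat) set" where
  "presc_idx = {(i, g, c, s, q). valid i c s q \<and> g < n \<and> mu i c \<le> s + mu i g}"

lemma finite_presc_idx: "finite presc_idx"
proof (rule finite_subset)
  show "presc_idx \<subseteq> (\<lambda>((i, c, s, q), g). (i, g, c, s, q)) ` (Idx \<times> {..<n})"
    unfolding presc_idx_def Idx_def by force
qed (simp add: finite_Idx)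

text \<open>\<open>I i g\<close> is the row of \<open>P\<close> attached to the coordinate \<open>g\<close> of the \<open>i\<close>-th root; the condition
  says that the submatrices \<open>P(\<I>\<^sub>j, 1{:}\<tau>\<^sub>j)\<close> have trivial kernel over \<open>\<complex>\<close>.\<close>

definition nondegenerate :: "(nat \<Rightarrow> nat \<Rightarrow> nat) \<Rightarrow> real mat \<Rightarrow> bool" where
  "nondegenerate I P \<longleftrightarrow> (\<forall>i<length zs. \<forall>t<len i. \<forall>y.
     (\<forall>g<n. t < mu i g \<longrightarrow> (\<Sum>c | c < n \<and> t < mu i c. ccoord (\<lambda>b. P $$ (I i g, b)) i c 0 * y c) = 0) \<longrightarrow>
     (\<forall>c<n. t < mu i c \<longrightarrow> y c = 0))"

lemma nondegenerateD:
  assumes "nondegenerate I P" "i < length zs" "t < len i"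
    and "\<And>g. g < n \<Longrightarrow> t < mu i g \<Longrightarrow> (\<Sum>c | c < n \<and> t < mu i c. ccoord (\<lambda>b. P $$ (I i g, b)) i c 0 * y c) = 0"
    and "c < n" "t < mu i c"
  shows "y c = 0"
proof -
  note nd = assms(1)[unfolded nondegenerate_def]
  have "(\<forall>g<n. t < mu i g \<longrightarrow> (\<Sum>c | c < n \<and> t < mu i c. ccoord (\<lambda>b. P $$ (I i g, b)) i c 0 * y c) = 0) \<longrightarrow>
     (\<forall>c<n. t < mu i c \<longrightarrow> y c = 0)"
    by (rule spec[OF mp[OF spec[OF mp[OF spec[OF nd, of i] assms(2)], of t] assms(3)], of y])
  moreover have "\<forall>g<n. t < mu i g \<longrightarrow> (\<Sum>c | c < n \<and> t < mu i c. ccoord (\<lambda>b. P $$ (I i g, b)) i c 0 * y c) = 0"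
    by (intro allI impI assms(4))
  ultimately show ?thesis using assms(5,6) by blast
qed

lemma ccoord_cong: "valid i c s 0 \<Longrightarrow> (\<And>b. b < n \<Longrightarrow> v b = v' b) \<Longrightarrow> ccoord v i c s = ccoord v' i c s"
  using pos_less[of i c s 0] pos_less[of i c s 1] unfolding ccoord_def
  by (auto simp: valid_def root_eps_def)

text \<open>Each block of X is determined by its row of degree 0, so P X is computed by multiplying
  truncated polynomials, and its coefficient of degree l is a convolution. Only chains of the same
  root contribute.\<close>

lemma ccoord_mult_Cent:
  assumes P: "P \<in> carrier_mat n n" and X: "X \<in> Cent" and u: "u < n" and v: "valid i c' l 0"
  shows "ccoord (\<lambda>b. (P * X) $$ (u, b)) i c' l =
    (\<Sum>c<n. \<Sum>s<mu i c. if s \<le> l then ccoord (\<lambda>b. P $$ (u, b)) i c s * ccoord (\<lambda>b. X $$ (pos i c 0 0, b)) i c' (l - s) else 0)"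
proof -
  let ?x = "\<lambda>l p. ccoord (\<lambda>b. X $$ (p, b)) i c' l"
  note st = Cent_structure[OF X]
  have Xc: "X \<in> carrier_mat n n" using X by (simp add: Cent_def)
  have "ccoord (\<lambda>b. (P * X) $$ (u, b)) i c' l = ccoord (\<lambda>b. \<Sum>p<n. P $$ (u, p) * X $$ (p, b)) i c' l"
    by (rule ccoord_cong[OF v]) (simp add: mult_mat_index[OF P Xc u] del: index_mult_mat)
  also have "\<dots> = (\<Sum>p<n. of_real (P $$ (u, p)) * ?x l p)" by (rule ccoord_sum)
  also have "\<dots> = (\<Sum>i'<length zs. \<Sum>c<n. \<Sum>s<mu i' c. \<Sum>q<ep i'. of_real (P $$ (u, pos i' c s q)) * ?x l (pos i' c s q))"
    by (rule sum_pos_iterated)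
  also have "\<dots> = (\<Sum>i'<length zs. \<Sum>c<n. \<Sum>s<mu i' c.
      if i' = i then if s \<le> l then ccoord (\<lambda>b. P $$ (u, b)) i c s * ?x (l - s) (pos i c 0 0) else 0 else 0)"
  proof (intro sum.cong refl)
    fix i' c s assume i: "i' \<in> {..<length zs}" "c \<in> {..<n}" "s \<in> {..<mu i' c}"
    then have v': "valid i' c s 0" using ep_pos by (simp add: valid_def)
    have "(\<Sum>q<ep i'. of_real (P $$ (u, pos i' c s q)) * ?x l (pos i' c s q)) =
       ccoord (\<lambda>b. P $$ (u, b)) i' c s * ?x l (pos i' c s 0)"
    proof (cases "zs ! i' \<in> \<real>")
      case True
      then have "ep i' = 1" by (simp add: root_eps_def)
      then show ?thesis using True by (simp add: ccoord_def complex_of_real_def)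
    next
      case False
      then have e: "ep i' = 2" by (simp add: root_eps_def)
      then have v1: "valid i' c s 1" using v' by (simp add: valid_def)
      have "(\<Sum>q<ep i'. of_real (P $$ (u, pos i' c s q)) * ?x l (pos i' c s q)) =
        (of_real (P $$ (u, pos i' c s 0)) + \<i> * of_real (P $$ (u, pos i' c s 1))) * ?x l (pos i' c s 0)"
        unfolding e using st(2)[OF v1 v] by (simp add: numeral_2_eq_2 algebra_simps)
      moreover have "of_real (P $$ (u, pos i' c s 0)) + \<i> * of_real (P $$ (u, pos i' c s 1)) = ccoord (\<lambda>b. P $$ (u, b)) i' c s"
        using False by (simp add: ccoord_def complex_eq_iff)
      ultimately show ?thesis by simp
    qed
    also have "\<dots> = (if i' = i then if s \<le> l then ccoord (\<lambda>b. P $$ (u, b)) i c s * ?x (l - s) (pos i c 0 0) else 0 else 0)"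
      by (subst st(1)[OF v' v]) auto
    finally show "(\<Sum>q<ep i'. of_real (P $$ (u, pos i' c s q)) * ?x l (pos i' c s q)) =
      (if i' = i then if s \<le> l then ccoord (\<lambda>b. P $$ (u, b)) i c s * ?x (l - s) (pos i c 0 0) else 0 else 0)" .
  qed
  also have "\<dots> = (\<Sum>i'<length zs. if i' = i then
     (\<Sum>c<n. \<Sum>s<mu i' c. if s \<le> l then ccoord (\<lambda>b. P $$ (u, b)) i c s * ?x (l - s) (pos i c 0 0) else 0) else 0)"
    by (intro sum.cong refl) auto
  finally show ?thesis using v by (simp add: valid_def)
qed

text \<open>Triangularity: in degree \<open>l\<close>, the prescribed entries of \<open>P X\<close> determine the coefficients of
  degree \<open>l\<close> of \<open>X\<close> up to those of smaller degree, through one of the invertible submatrices.\<close>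

lemma Cent_prescribed_inj:
  assumes P: "P \<in> carrier_mat n n" and I: "\<And>i g. i < length zs \<Longrightarrow> g < n \<Longrightarrow> 0 < mu i g \<Longrightarrow> I i g < n"
    and nondegenerate: "nondegenerate I P" and X: "X \<in> Cent"
    and zero: "\<And>i g c s q. (i, g, c, s, q) \<in> presc_idx \<Longrightarrow> (P * X) $$ (I i g, pos i c s q) = 0"
  shows "X = 0\<^sub>m n n"
proof -
  let ?x = "\<lambda>i c' l p. ccoord (\<lambda>b. X $$ (p, b)) i c' l"
  note st = Cent_structure[OF X]
  have Xc: "X \<in> carrier_mat n n" using X by (simp add: Cent_def)
  have main: "?x i c' l (pos i c 0 0) = 0"
    if i: "i < length zs" and c': "c' < n" and l: "l < mu i c'" and c: "c < n" "0 < mu i c" for i c' l c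
    using l c
  proof (induction l arbitrary: c rule: less_induct)
    case (less l)
    have v: "valid i c' l 0" using i c' less.prems ep_pos by (simp add: valid_def)
    \<comment> \<open>For this t, the entries in column (c', l) are prescribed exactly in the rows g
      with \<open>t < mu i g\<close>, and the coefficients of X in degree l can be nonzero only for
      the chains d with \<open>t < mu i d\<close>. The resulting square system has the matrix of
      \<open>nondegenerate\<close> at t.\<close>
    define t where "t = mu i c' - Suc l"
    have t: "mu i c' \<le> l + mu i d \<longleftrightarrow> t < mu i d" for d using less.prems unfolding t_def by auto
    have tl: "t < len i" using mu_le_len[OF c', of i] less.prems unfolding t_def by simp
    have low: "?x i c' l (pos i d 0 0) = 0" if "d < n" "0 < mu i d" "\<not> t < mu i d" for d
    proof (rule st(3))
      show "valid i d 0 0" using i that ep_pos by (simp add: valid_def)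
      show "l + mu i d < mu i c'" using that(3) t[of d] by simp
    qed (rule c')
    have "(\<Sum>d | d < n \<and> t < mu i d. ccoord (\<lambda>b. P $$ (I i g, b)) i d 0 * ?x i c' l (pos i d 0 0)) = 0"
      if g: "g < n" "t < mu i g" for g
    proof -
      have gl: "mu i c' \<le> l + mu i g" using t g by simp
      have Ig: "I i g < n" using I[OF i g(1)] g(2) by simp
      have "ccoord (\<lambda>b. (P * X) $$ (I i g, b)) i c' l = 0"
      proof -
        have "(i, g, c', l, 0) \<in> presc_idx" unfolding presc_idx_def using v g gl by simp
        moreover have "(i, g, c', l, 1) \<in> presc_idx" if "zs ! i \<notin> \<real>"
          unfolding presc_idx_def using v g gl that by (simp add: valid_def root_eps_def)
        ultimately show ?thesis using zero unfolding ccoord_def by (auto simp: complex_eq_iff)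
      qed
      then have "0 = (\<Sum>d<n. \<Sum>s<mu i d. if s \<le> l then ccoord (\<lambda>b. P $$ (I i g, b)) i d s * ?x i c' (l - s) (pos i d 0 0) else 0)"
        using ccoord_mult_Cent[OF P X Ig v] by simp
      also have "\<dots> = (\<Sum>d<n. if t < mu i d then ccoord (\<lambda>b. P $$ (I i g, b)) i d 0 * ?x i c' l (pos i d 0 0) else 0)"
      proof (intro sum.cong refl)
        fix d assume d: "d \<in> {..<n}"
        have "(\<Sum>s<mu i d. if s \<le> l then ccoord (\<lambda>b. P $$ (I i g, b)) i d s * ?x i c' (l - s) (pos i d 0 0) else 0) =
          (\<Sum>s<mu i d. if s = 0 then ccoord (\<lambda>b. P $$ (I i g, b)) i d 0 * ?x i c' l (pos i d 0 0) else 0)"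
        proof (intro sum.cong refl)
          fix s assume s: "s \<in> {..<mu i d}"
          \<comment> \<open>Terms with s > 0 contain a coefficient of X of degree l - s < l, which
            vanishes by induction.\<close>
          show "(if s \<le> l then ccoord (\<lambda>b. P $$ (I i g, b)) i d s * ?x i c' (l - s) (pos i d 0 0) else 0) =
            (if s = 0 then ccoord (\<lambda>b. P $$ (I i g, b)) i d 0 * ?x i c' l (pos i d 0 0) else 0)"
            using less.IH[of "l - s" d] less.prems(1) d s by (cases "s = 0") auto
        qed
        also have "\<dots> = (if t < mu i d then ccoord (\<lambda>b. P $$ (I i g, b)) i d 0 * ?x i c' l (pos i d 0 0) else 0)"
          using low[of d] d by auto
        finally show "(\<Sum>s<mu i d. if s \<le> l then ccoord (\<lambda>b. P $$ (I i g, b)) i d s * ?x i c' (l - s) (pos i d 0 0) else 0) =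
          (if t < mu i d then ccoord (\<lambda>b. P $$ (I i g, b)) i d 0 * ?x i c' l (pos i d 0 0) else 0)" .
      qed
      also have "\<dots> = (\<Sum>d\<in>{d\<in>{..<n}. t < mu i d}. ccoord (\<lambda>b. P $$ (I i g, b)) i d 0 * ?x i c' l (pos i d 0 0))"
        by (rule sum.inter_filter[symmetric]) simp
      finally show ?thesis by (simp add: lessThan_def)
    qed
    from nondegenerateD[OF nondegenerate i tl this] have "\<forall>d<n. t < mu i d \<longrightarrow> ?x i c' l (pos i d 0 0) = 0" by simp
    then show ?case using low less.prems by blast
  qed
  have x0: "?x i' c' l p = 0" if v': "valid i' c' l 0" and p: "p < n" for i' c' l p
  proof -
    obtain i c s q where v: "valid i c s q" "p = pos i c s q" using pos_exists[OF p] .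
    have v0: "valid i c s 0" using v(1) ep_pos by (simp add: valid_def)
    have 0: "?x i' c' l (pos i c s 0) = 0"
      using st(1)[OF v0 v'] main[of i c' "l - s" c] v v' by (auto simp: valid_def)
    have "q = 0 \<or> q = 1" using v(1) ep_cases[of i] by (auto simp: valid_def)
    then show ?thesis using 0 st(2)[of i c s i' c' l] v v' by auto
  qed
  show ?thesis
  proof (intro eq_matI)
    fix p b assume "p < dim_row (0\<^sub>m n n :: real mat)" "b < dim_col (0\<^sub>m n n :: real mat)"
    then have pb: "p < n" "b < n" by auto
    then show "X $$ (p, b) = 0\<^sub>m n n $$ (p, b)" using ccoord_eq_0D[of "\<lambda>b. X $$ (p, b)" b] x0 by simp
  qed (use Xc in auto)
qed

section \<open>Explicit elements of the centralizer\<close>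

definition coord :: "nat \<Rightarrow> nat \<times> nat \<times> nat \<times> nat" where
  "coord = the_inv_into Idx (\<lambda>(i, c, s, q). pos i c s q)"

lemma coord_pos: "valid i c s q \<Longrightarrow> coord (pos i c s q) = (i, c, s, q)"
  using the_inv_into_f_f[of "\<lambda>(i, c, s, q). pos i c s q" Idx "(i, c, s, q)"] bij_betw_pos
  unfolding coord_def bij_betw_def Idx_def by simp

text \<open>Multiplication by t^j, or by \<open>\<i>\<close> t^j if q0 is not 0, from chain g to
  chain c, written in real coordinates.\<close>

definition cent_elem :: "nat \<times> nat \<times> nat \<times> nat \<times> nat \<Rightarrow> real mat" where
  "cent_elem = (\<lambda>(i, g, c, j, q0). mat n n (\<lambda>(a, b).
     case coord a of (i1, c1, s, q) \<Rightarrow> case coord b of (i2, c2, l, q') \<Rightarrow>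
       if i1 = i \<and> i2 = i \<and> c1 = g \<and> c2 = c \<and> l = s + j then rot (if q0 = 0 then 1 else \<i>) q q' else 0))"

lemma cent_elem_carrier: "cent_elem x \<in> carrier_mat n n"
  unfolding cent_elem_def by (simp add: case_prod_unfold)

lemma cent_elem_index:
  assumes "valid i1 c1 s q" "valid i2 c2 l q'"
  shows "cent_elem (i, g, c, j, q0) $$ (pos i1 c1 s q, pos i2 c2 l q') =
    (if i1 = i \<and> i2 = i \<and> c1 = g \<and> c2 = c \<and> l = s + j then rot (if q0 = 0 then 1 else \<i>) q q' else 0)"
  using assms pos_less unfolding cent_elem_def by (simp add: coord_pos)

lemma rot_commute:
  assumes "q < ep i" "q' < ep i"
  shows "(\<Sum>q''<ep i. rot z q q'' * rot z' q'' q') = (\<Sum>q''<ep i. rot z q'' q' * rot z' q q'')"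
proof (cases "ep i = 1")
  case False
  then have "ep i = 2" using ep_cases[of i] by auto
  then have e: "ep i = 2" .
  have S: "(\<Sum>k<2. f k) = f 0 + f 1" for f :: "nat \<Rightarrow> real" by (simp add: numeral_2_eq_2)
  from assms e have "q = 0 \<or> q = 1" "q' = 0 \<or> q' = 1" by linarith+
  then show ?thesis unfolding e S by (elim disjE) (simp_all add: rot_def)
qed (use assms in auto)

lemma cent_elem_Cent:
  assumes x: "(i, g, c, j, q0) \<in> presc_idx"
  shows "cent_elem (i, g, c, j, q0) \<in> Cent"
proof -
  let ?E = "cent_elem (i, g, c, j, q0)" and ?z = "if q0 = 0 then 1 else \<i> :: complex"
  have "A * ?E = ?E * A"
  proof (intro eq_matI)
    fix a b assume "a < dim_row (?E * A)" "b < dim_col (?E * A)"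
    then have ab: "a < n" "b < n" using A_carrier cent_elem_carrier[of "(i, g, c, j, q0)"] by auto
    obtain i1 c1 s q where v1: "valid i1 c1 s q" and a: "a = pos i1 c1 s q" using pos_exists[OF ab(1)] .
    obtain i2 c2 l q' where v2: "valid i2 c2 l q'" and b: "b = pos i2 c2 l q'" using pos_exists[OF ab(2)] .
    have V1: "valid i1 c1 s q''" if "q'' < ep i1" for q'' using v1 that by (simp add: valid_def)
    have V2: "valid i2 c2 l q''" if "q'' < ep i2" for q'' using v2 that by (simp add: valid_def)
    have q: "q < ep i1" "q' < ep i2" using v1 v2 by (auto simp: valid_def)
    have "(A * ?E) $$ (a, b) = (\<Sum>b'<n. A $$ (pos i1 c1 s q, b') *\<^sub>R ?E $$ (b', b))"
      unfolding mult_mat_index[OF A_carrier cent_elem_carrier ab] by (simp add: a)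
    also have "\<dots> = (\<Sum>q''<ep i1. rot (zs ! i1) q q'' * ?E $$ (pos i1 c1 s q'', b))
        + (if Suc s < mu i1 c1 then ?E $$ (pos i1 c1 (Suc s) q, b) else 0)"
      by (subst col_action[OF v1]) simp
    also have "(\<Sum>q''<ep i1. rot (zs ! i1) q q'' * ?E $$ (pos i1 c1 s q'', b)) =
        (if i1 = i \<and> i2 = i \<and> c1 = g \<and> c2 = c \<and> l = s + j then \<Sum>q''<ep i. rot (zs ! i) q q'' * rot ?z q'' q' else 0)"
      unfolding b using V1 v2 by (auto simp: cent_elem_index)
    also have "(if Suc s < mu i1 c1 then ?E $$ (pos i1 c1 (Suc s) q, b) else 0) =
        (if i1 = i \<and> i2 = i \<and> c1 = g \<and> c2 = c \<and> l = Suc s + j then rot ?z q q' else 0)"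
    proof (cases "Suc s < mu i1 c1")
      case True
      then have "valid i1 c1 (Suc s) q" using v1 by (simp add: valid_def)
      then show ?thesis unfolding b using True v2 by (simp add: cent_elem_index)
    next
      case False
      \<comment> \<open>At the end of chain g the shift by A gives 0. On the other side, degree s +
        1 + j lies beyond the end of chain c by the inequality in \<open>presc_idx\<close>.\<close>
      have "\<not> (i1 = i \<and> i2 = i \<and> c1 = g \<and> c2 = c \<and> l = Suc s + j)"
        using False v2 x by (auto simp: presc_idx_def valid_def)
      then show ?thesis using False by auto
    qed
    finally have L: "(A * ?E) $$ (a, b) =
       (if i1 = i \<and> i2 = i \<and> c1 = g \<and> c2 = c \<and> l = s + j then \<Sum>q''<ep i. rot (zs ! i) q q'' * rot ?z q'' q' else 0)
       + (if i1 = i \<and> i2 = i \<and> c1 = g \<and> c2 = c \<and> l = Suc s + j then rot ?z q q' else 0)" .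
    have "(?E * A) $$ (a, b) = (\<Sum>a'<n. A $$ (a', pos i2 c2 l q') *\<^sub>R ?E $$ (a, a'))"
      unfolding mult_mat_index[OF cent_elem_carrier A_carrier ab] by (simp add: b mult.commute)
    also have "\<dots> = (\<Sum>q''<ep i2. rot (zs ! i2) q'' q' * ?E $$ (a, pos i2 c2 l q''))
        + (if 0 < l then ?E $$ (a, pos i2 c2 (l - 1) q') else 0)"
      by (subst row_action[OF v2]) simp
    also have "(\<Sum>q''<ep i2. rot (zs ! i2) q'' q' * ?E $$ (a, pos i2 c2 l q'')) =
        (if i1 = i \<and> i2 = i \<and> c1 = g \<and> c2 = c \<and> l = s + j then \<Sum>q''<ep i. rot (zs ! i) q'' q' * rot ?z q q'' else 0)"
      unfolding a using V2 v1 by (auto simp: cent_elem_index)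
    also have "(if 0 < l then ?E $$ (a, pos i2 c2 (l - 1) q') else 0) =
        (if i1 = i \<and> i2 = i \<and> c1 = g \<and> c2 = c \<and> l = Suc s + j then rot ?z q q' else 0)"
    proof (cases l)
      case (Suc l')
      then have "valid i2 c2 l' q'" using v2 by (simp add: valid_def)
      then show ?thesis unfolding a using v1 Suc by (simp add: cent_elem_index)
    qed simp
    finally show "(A * ?E) $$ (a, b) = (?E * A) $$ (a, b)"
      unfolding L using rot_commute[of q i q' "zs ! i" ?z] q by auto
  qed (use A_carrier cent_elem_carrier[of "(i, g, c, j, q0)"] in auto)
  then show ?thesis unfolding Cent_def using cent_elem_carrier by simp
qed

text \<open>As many independent elements of the centralizer as there are prescribed entries.\<close>

lemma Cent_prescribed_surj:
  assumes P: "P \<in> carrier_mat n n" and I: "\<And>i g. i < length zs \<Longrightarrow> g < n \<Longrightarrow> 0 < mu i g \<Longrightarrow> I i g < n"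
    and inj: "\<And>X. X \<in> Cent \<Longrightarrow>
      (\<And>i g c s q. (i, g, c, s, q) \<in> presc_idx \<Longrightarrow> (P * X) $$ (I i g, pos i c s q) = 0) \<Longrightarrow> X = 0\<^sub>m n n"
  obtains X where "X \<in> Cent"
    "\<And>i g c s q. (i, g, c, s, q) \<in> presc_idx \<Longrightarrow> (P * X) $$ (I i g, pos i c s q) = f i g c s q"
proof -
  define X where "X v = mat n n (\<lambda>(a, b). \<Sum>x\<in>presc_idx. v x * cent_elem x $$ (a, b))" for v
  have Xc: "X v \<in> carrier_mat n n" for v unfolding X_def by simp
  have XCent: "X v \<in> Cent" for v
  proof -
    have "A * X v = X v * A"
    proof (intro eq_matI)
      fix a b assume "a < dim_row (X v * A)" "b < dim_col (X v * A)"
      then have ab: "a < n" "b < n" using A_carrier Xc[of v] by auto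
      have "(A * X v) $$ (a, b) = (\<Sum>p<n. \<Sum>x\<in>presc_idx. v x * (A $$ (a, p) * cent_elem x $$ (p, b)))"
        unfolding mult_mat_index[OF A_carrier Xc ab] using ab
        by (simp add: X_def sum_distrib_left mult.left_commute)
      also have "\<dots> = (\<Sum>x\<in>presc_idx. v x * (A * cent_elem x) $$ (a, b))"
        by (subst sum.swap) (simp add: mult_mat_index[OF A_carrier cent_elem_carrier ab] sum_distrib_left del: index_mult_mat)
      also have "\<dots> = (\<Sum>x\<in>presc_idx. v x * (cent_elem x * A) $$ (a, b))"
      proof (intro sum.cong refl)
        fix x assume "x \<in> presc_idx"
        then have "cent_elem x \<in> Cent" using cent_elem_Cent by (cases x) auto
        then show "v x * (A * cent_elem x) $$ (a, b) = v x * (cent_elem x * A) $$ (a, b)" by (simp only: Cent_def mem_Collect_eq)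
      qed
      also have "\<dots> = (\<Sum>p<n. \<Sum>x\<in>presc_idx. v x * (cent_elem x $$ (a, p) * A $$ (p, b)))"
        by (subst sum.swap) (simp add: mult_mat_index[OF cent_elem_carrier A_carrier ab] sum_distrib_left del: index_mult_mat)
      also have "\<dots> = (X v * A) $$ (a, b)"
        unfolding mult_mat_index[OF Xc A_carrier ab] using ab
        by (simp add: X_def sum_distrib_right mult.assoc)
      finally show "(A * X v) $$ (a, b) = (X v * A) $$ (a, b)" .
    qed (use A_carrier Xc[of v] in auto)
    then show ?thesis unfolding Cent_def using Xc by simp
  qed
  define row where "row = (\<lambda>(i, g, c, s, q). (I i g, pos i c s q))"
  have row_less: "fst (row x) < n" "snd (row x) < n" if "x \<in> presc_idx" for x
    using that pos_less I unfolding row_def presc_idx_def by (auto simp: valid_def)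
  have PX: "(P * X v) $$ row x = (\<Sum>y\<in>presc_idx. (P * cent_elem y) $$ row x * v y)" if x: "x \<in> presc_idx" for v x
  proof -
    obtain a b where ab: "row x = (a, b)" by fastforce
    then have ab': "a < n" "b < n" using row_less[OF x] by auto
    then have "(P * X v) $$ (a, b) = (\<Sum>p<n. \<Sum>y\<in>presc_idx. P $$ (a, p) * cent_elem y $$ (p, b) * v y)"
      unfolding mult_mat_index[OF P Xc ab'] by (simp add: X_def sum_distrib_left mult_ac)
    also have "\<dots> = (\<Sum>y\<in>presc_idx. (P * cent_elem y) $$ (a, b) * v y)"
      using ab'
      by (subst sum.swap) (simp add: mult_mat_index[OF P cent_elem_carrier] sum_distrib_right del: index_mult_mat(1))
    finally show ?thesis unfolding ab .
  qed
  \<comment> \<open>Every coefficient \<open>v x\<close> reappears as an entry of \<open>X v\<close>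
    in a row of degree 0, so the family is independent and \<open>X v = 0\<close> forces v =
    0.\<close>
  have X_index: "X v $$ (pos i g 0 0, pos i c j q) = v (i, g, c, j, q)" if s: "(i, g, c, j, q) \<in> presc_idx" for v i g c j q
  proof -
    have v1: "valid i g 0 0" "valid i c j q" using s ep_pos by (auto simp: presc_idx_def valid_def)
    have "X v $$ (pos i g 0 0, pos i c j q) = (\<Sum>x\<in>presc_idx. v x * cent_elem x $$ (pos i g 0 0, pos i c j q))"
      unfolding X_def using pos_less[OF v1(1)] pos_less[OF v1(2)] by simp
    also have "\<dots> = (\<Sum>x\<in>presc_idx. if x = (i, g, c, j, q) then v x else 0)"
    proof (intro sum.cong refl)
      fix x assume "x \<in> presc_idx"
      obtain i' g' c' j' q' where x: "x = (i', g', c', j', q')" by (cases x)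
      have q': "q' < ep i'" "q < ep i" using \<open>x \<in> presc_idx\<close> x v1 by (auto simp: presc_idx_def valid_def)
      show "v x * cent_elem x $$ (pos i g 0 0, pos i c j q) = (if x = (i, g, c, j, q) then v x else 0)"
        unfolding x cent_elem_index[OF v1] using q' ep_cases[of i] by (auto simp: rot_def)
    qed
    finally show ?thesis using s finite_presc_idx by simp
  qed
  have "\<exists>v. \<forall>x\<in>presc_idx. (\<Sum>y\<in>presc_idx. (P * cent_elem y) $$ row x * v y) = (case x of (i, g, c, s, q) \<Rightarrow> f i g c s q)"
  proof (rule injective_system_solvable[OF finite_presc_idx])
    fix v assume v: "\<And>x. x \<in> presc_idx \<Longrightarrow> (\<Sum>y\<in>presc_idx. (P * cent_elem y) $$ row x * v y) = 0"
    have "X v = 0\<^sub>m n n"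
      by (rule inj[OF XCent]) (use v PX[of _ v] in \<open>auto simp: row_def\<close>)
    then show "\<forall>x\<in>presc_idx. v x = 0"
    proof (intro ballI)
      fix x assume x: "x \<in> presc_idx"
      obtain i g c j q where xe: "x = (i, g, c, j, q)" by (cases x)
      have v1: "valid i g 0 0" "valid i c j q" using x xe ep_pos by (auto simp: presc_idx_def valid_def)
      show "v x = 0" using X_index[of i g c j q v] x xe \<open>X v = 0\<^sub>m n n\<close> pos_less v1 by simp
    qed
  qed
  then obtain v where "\<forall>x\<in>presc_idx. (\<Sum>y\<in>presc_idx. (P * cent_elem y) $$ row x * v y) = (case x of (i, g, c, s, q) \<Rightarrow> f i g c s q)" ..
  then have v: "(P * X v) $$ row x = (case x of (i, g, c, s, q) \<Rightarrow> f i g c s q)" if "x \<in> presc_idx" for x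
    unfolding PX[OF that] using that by blast
  show thesis
  proof (rule that[OF XCent[of v]])
    show "(P * X v) $$ (I i g, pos i c s q) = f i g c s q" if "(i, g, c, s, q) \<in> presc_idx" for i g c s q
      using v[OF that] by (simp add: row_def)
  qed
qed

end

section \<open>Prescribed positions\<close>

lemma sum_double: "(\<Sum>b<2 * k. f b) = (\<Sum>c<k. f (2 * c) + f (Suc (2 * c)))"
  for f :: "nat \<Rightarrow> 'a::comm_monoid_add"
  by (induction k) (simp_all add: add.assoc)

text \<open>A real matrix has a nonzero complex kernel vector only if it has a real one, by real and
  imaginary parts. The complex formulation is the one that nonreal roots share.\<close>

lemma invertible_mat_complex_kernel:
  assumes M: "M \<in> carrier_mat k k"
  shows "invertible_mat M \<longleftrightarrow>
    (\<forall>y :: nat \<Rightarrow> complex. (\<forall>g<k. (\<Sum>c<k. of_real (M $$ (g, c)) * y c) = 0) \<longrightarrow> (\<forall>c<k. y c = 0))"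
    (is "_ \<longleftrightarrow> ?R")
proof
  assume "invertible_mat M"
  then have d: "det M \<noteq> 0" using invertible_mat_iff_det[OF M] by simp
  show ?R
  proof (intro allI impI)
    fix y :: "nat \<Rightarrow> complex" and c
    assume y: "\<forall>g<k. (\<Sum>c<k. of_real (M $$ (g, c)) * y c) = 0" and c: "c < k"
    have "(\<Sum>c<k. M $$ (g, c) * Re (y c)) = 0" "(\<Sum>c<k. M $$ (g, c) * Im (y c)) = 0" if "g < k" for g
      using y[rule_format, OF that] by (auto simp: complex_eq_iff)
    then have "Re (y c) = 0" "Im (y c) = 0"
      using det_nonzeroD[OF M d _ c, of "\<lambda>c. Re (y c)"] det_nonzeroD[OF M d _ c, of "\<lambda>c. Im (y c)"] by auto
    then show "y c = 0" by (simp add: complex_eq_iff)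
  qed
next
  assume R: ?R
  have "det M \<noteq> 0"
  proof (rule det_nonzeroI[OF M])
    fix v assume v: "\<And>a. a < k \<Longrightarrow> (\<Sum>b<k. M $$ (a, b) * v b) = 0"
    have "(\<Sum>c<k. of_real (M $$ (g, c)) * complex_of_real (v c)) = 0" if "g < k" for g
      using v[OF that] by (simp flip: of_real_mult of_real_sum)
    with R[rule_format, of "\<lambda>c. of_real (v c)"] show "\<forall>b<k. v b = 0" by simp
  qed
  then show "invertible_mat M" using invertible_mat_iff_det[OF M] by simp
qed

lemma diamond_index:
  assumes "Z \<in> carrier_mat k (2 * k)" "g < k" "c < k"
  shows "diamond Z $$ (2 * g, 2 * c) = Z $$ (g, 2 * c)"
    "diamond Z $$ (2 * g, Suc (2 * c)) = Z $$ (g, Suc (2 * c))"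
    "diamond Z $$ (Suc (2 * g), 2 * c) = - Z $$ (g, Suc (2 * c))"
    "diamond Z $$ (Suc (2 * g), Suc (2 * c)) = Z $$ (g, 2 * c)"
  using assms unfolding diamond_def by simp_all

lemma diamond_carrier: "Z \<in> carrier_mat k (2 * k) \<Longrightarrow> diamond Z \<in> carrier_mat (2 * k) (2 * k)"
  unfolding diamond_def by auto

lemma less_double_cases: "x < 2 * (k::nat) \<Longrightarrow> (\<And>g. g < k \<Longrightarrow> P (2 * g)) \<Longrightarrow> (\<And>g. g < k \<Longrightarrow> P (Suc (2 * g))) \<Longrightarrow> P x"
  by (cases "even x") (auto elim!: evenE oddE)

text \<open>\<open>Z\<^sup>\<diamond>\<close> acts on \<open>\<real>\<^sup>2\<^sup>k\<close> as the complex matrix with entries \<open>z\<^sub>1 + i z\<^sub>2\<close> does on the conjugate of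
  \<open>\<complex>\<^sup>k\<close>.\<close>

lemma invertible_diamond_kernel:
  assumes Z: "Z \<in> carrier_mat k (2 * k)"
  shows "invertible_mat (diamond Z) \<longleftrightarrow>
    (\<forall>y :: nat \<Rightarrow> complex. (\<forall>g<k. (\<Sum>c<k. Complex (Z $$ (g, 2 * c)) (Z $$ (g, Suc (2 * c))) * y c) = 0) \<longrightarrow> (\<forall>c<k. y c = 0))"
    (is "_ \<longleftrightarrow> ?R")
proof
  note D = diamond_carrier[OF Z]
  assume "invertible_mat (diamond Z)"
  then have d: "det (diamond Z) \<noteq> 0" using invertible_mat_iff_det[OF D] by simp
  show ?R
  proof (intro allI impI)
    fix y :: "nat \<Rightarrow> complex" and c
    assume y: "\<forall>g<k. (\<Sum>c<k. Complex (Z $$ (g, 2 * c)) (Z $$ (g, Suc (2 * c))) * y c) = 0" and c: "c < k"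
    define v where "v b = (if even b then Re (y (b div 2)) else - Im (y (b div 2)))" for b
    have "(\<Sum>b<2 * k. diamond Z $$ (a, b) * v b) = 0" if "a < 2 * k" for a
      using that
    proof (rule less_double_cases)
      fix g assume g: "g < k"
      show "(\<Sum>b<2 * k. diamond Z $$ (2 * g, b) * v b) = 0"
        using arg_cong[OF y[rule_format, OF g], of Re] by (simp add: sum_double diamond_index[OF Z g] v_def)
      show "(\<Sum>b<2 * k. diamond Z $$ (Suc (2 * g), b) * v b) = 0"
        using arg_cong[OF y[rule_format, OF g], of Im]
        by (simp add: sum_double diamond_index[OF Z g] v_def sum.distrib sum_negf sum_subtractf)
    qed
    from det_nonzeroD[OF D d this, of "2 * c"] det_nonzeroD[OF D d this, of "Suc (2 * c)"] c
    show "y c = 0" by (simp add: v_def complex_eq_iff)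
  qed
next
  note D = diamond_carrier[OF Z]
  assume R: ?R
  have "det (diamond Z) \<noteq> 0"
  proof (rule det_nonzeroI[OF D])
    fix v assume v: "\<And>a. a < 2 * k \<Longrightarrow> (\<Sum>b<2 * k. diamond Z $$ (a, b) * v b) = 0"
    define y where "y c = Complex (v (2 * c)) (- v (Suc (2 * c)))" for c
    have "(\<Sum>c<k. Complex (Z $$ (g, 2 * c)) (Z $$ (g, Suc (2 * c))) * y c) = 0" if g: "g < k" for g
    proof -
      have "2 * g < 2 * k" "Suc (2 * g) < 2 * k" using g by auto
      from v[OF this(1)] v[OF this(2)] show ?thesis
        by (simp add: sum_double diamond_index[OF Z g] y_def complex_eq_iff sum.distrib sum_negf sum_subtractf)
    qed
    with R have y0: "y c = 0" if "c < k" for c using that by blast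
    have "v b = 0" if "b < 2 * k" for b
      using that by (rule less_double_cases) (use y0 in \<open>auto simp: y_def complex_eq_iff\<close>)
    then show "\<forall>b<2 * k. v b = 0" by blast
  qed
  then show "invertible_mat (diamond Z)" using invertible_mat_iff_det[OF D] by simp
qed

text \<open>The even rows of \<open>diamond Z\<close> are the rows of \<open>Z\<close>, and the odd
  rows are determined by them. The condition is thus the one for real roots, with all imaginary
  components equal to 0.\<close>

lemma diamond_eq_one_iff:
  assumes Z: "Z \<in> carrier_mat k (2 * k)"
  shows "diamond Z = 1\<^sub>m (2 * k) \<longleftrightarrow> Z = mat k (2 * k) (\<lambda>(u, v). if v = 2 * u then 1 else 0)"
proof
  assume eq: "diamond Z = 1\<^sub>m (2 * k)"
  show "Z = mat k (2 * k) (\<lambda>(u, v). if v = 2 * u then 1 else 0)"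
  proof (intro eq_matI)
    fix u v assume uv: "u < dim_row (mat k (2 * k) (\<lambda>(u, v). if v = 2 * u then 1 else 0 :: real))"
      "v < dim_col (mat k (2 * k) (\<lambda>(u, v). if v = 2 * u then 1 else 0 :: real))"
    then have "Z $$ (u, v) = diamond Z $$ (2 * u, v)" using Z unfolding diamond_def by simp
    then show "Z $$ (u, v) = mat k (2 * k) (\<lambda>(u, v). if v = 2 * u then 1 else 0) $$ (u, v)"
      using uv unfolding eq by auto
  qed (use Z in auto)
next
  assume Z': "Z = mat k (2 * k) (\<lambda>(u, v). if v = 2 * u then 1 else 0)"
  show "diamond Z = 1\<^sub>m (2 * k)"
  proof (intro eq_matI)
    fix a b assume "a < dim_row (1\<^sub>m (2 * k) :: real mat)" "b < dim_col (1\<^sub>m (2 * k) :: real mat)"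
    then have "a < 2 * k" "b < 2 * k" by auto
    from \<open>a < 2 * k\<close> show "diamond Z $$ (a, b) = 1\<^sub>m (2 * k) $$ (a, b)"
    proof (rule less_double_cases)
      fix g assume g: "g < k"
      from \<open>b < 2 * k\<close> show "diamond Z $$ (2 * g, b) = 1\<^sub>m (2 * k) $$ (2 * g, b)"
      proof (rule less_double_cases)
        fix c assume "c < k"
        then show "diamond Z $$ (2 * g, 2 * c) = 1\<^sub>m (2 * k) $$ (2 * g, 2 * c)"
          "diamond Z $$ (2 * g, Suc (2 * c)) = 1\<^sub>m (2 * k) $$ (2 * g, Suc (2 * c))"
          using g unfolding diamond_index[OF Z g \<open>c < k\<close>] unfolding Z' by (auto simp: Suc_double_not_eq_double double_not_eq_Suc_double)
      qed
      from \<open>b < 2 * k\<close> show "diamond Z $$ (Suc (2 * g), b) = 1\<^sub>m (2 * k) $$ (Suc (2 * g), b)"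
      proof (rule less_double_cases)
        fix c assume "c < k"
        then show "diamond Z $$ (Suc (2 * g), 2 * c) = 1\<^sub>m (2 * k) $$ (Suc (2 * g), 2 * c)"
          "diamond Z $$ (Suc (2 * g), Suc (2 * c)) = 1\<^sub>m (2 * k) $$ (Suc (2 * g), Suc (2 * c))"
          using g unfolding diamond_index[OF Z g \<open>c < k\<close>] unfolding Z' by (auto simp: Suc_double_not_eq_double double_not_eq_Suc_double)
      qed
    qed
  qed (use Z in \<open>auto simp: diamond_def\<close>)
qed

text \<open>The minimum over a pair is the value at the larger index, and l is the larger index of 2
  l + 1 pairs. This is the classical formula for the dimension of a centralizer.\<close>

lemma sum_min_antimono:
  fixes f :: "nat \<Rightarrow> nat"
  assumes "\<And>c c'. c \<le> c' \<Longrightarrow> c' < n \<Longrightarrow> f c' \<le> f c"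
  shows "(\<Sum>g<n. \<Sum>c<n. min (f c) (f g)) = (\<Sum>l<n. (2 * l + 1) * f l)"
  using assms
proof (induction n)
  case (Suc n)
  have "(\<Sum>g<n. min (f n) (f g)) = n * f n" "(\<Sum>c<n. min (f c) (f n)) = n * f n"
    using Suc.prems by (simp_all add: min_absorb1 min_absorb2)
  then show ?case using Suc by (simp add: sum.distrib)
qed simp

section \<open>Index sequences and the positions they prescribe\<close>

locale weyr_index = weyr_form +
  fixes \<rho> :: nat and J :: "nat \<Rightarrow> nat \<Rightarrow> nat list"
  assumes J: "J \<in> index_families \<rho> n \<alpha> zs" and rho_le: "\<rho> \<le> n"
begin

abbreviation "tau i \<equiv> weyr_tau n \<alpha> (zs ! i)"

text \<open>All sequences of the i-th root are initial segments of the last one, so the row attached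
  to chain g does not depend on j.\<close>

definition I :: "nat \<Rightarrow> nat \<Rightarrow> nat" where
  "I i g = J i (len i) ! g"

lemma less_tau_iff:
  assumes "1 \<le> j" "j \<le> len i"
  shows "c < tau i j \<longleftrightarrow> c < n \<and> len i - j < mu i c"
  using assms less_w_iff[of c i "len i - j"] by (simp add: weyr_tau_def)

lemma tau_0: "tau i 0 = 0"
  by (simp add: weyr_tau_def)

lemma J_props:
  assumes "i < length zs" "1 \<le> j" "j \<le> len i"
  shows "length (J i j) = tau i j" "distinct (J i j)" "set (J i j) \<subseteq> {0..<\<rho>}"
    "\<exists>ys. J i j = J i (j - 1) @ ys"
proof -
  have "j \<in> {1..len i}" using assms by simp
  then have "length (J i j) = tau i j \<and> distinct (J i j) \<and> set (J i j) \<subseteq> {0..<\<rho>} \<and>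
      (\<exists>ys. J i j = J i (j - 1) @ ys \<and> sorted_wrt (<) ys)"
    using J assms(1) unfolding index_families_def index_seqs_def by blast
  then show "length (J i j) = tau i j" "distinct (J i j)" "set (J i j) \<subseteq> {0..<\<rho>}"
    "\<exists>ys. J i j = J i (j - 1) @ ys" by blast+
qed

lemma J_prefix:
  assumes i: "i < length zs" and "j \<le> j'" "j' \<le> len i"
  shows "\<exists>ys. J i j' = J i j @ ys"
  using assms(2,3)
proof (induction rule: dec_induct)
  case (step m)
  then obtain ys where "J i m = J i j @ ys" by auto
  moreover obtain zs' where "J i (Suc m) = J i m @ zs'"
    using J_props(4)[OF i, of "Suc m"] step by auto
  ultimately show ?case by simp
qed simp

lemma J_nth:
  assumes i: "i < length zs" and j: "1 \<le> j" "j \<le> len i" and g: "g < tau i j"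
  shows "J i j ! g = I i g"
proof -
  obtain ys where "J i (len i) = J i j @ ys" using J_prefix[OF i j(2)] by blast
  then show ?thesis using J_props(1)[OF i j] g by (simp add: I_def nth_append)
qed

lemma less_tau_len: "g < n \<Longrightarrow> 0 < mu i g \<Longrightarrow> 1 \<le> len i \<and> g < tau i (len i)"
  using mu_le_len[of g i] less_tau_iff[of "len i" i g] by auto

lemma I_less:
  assumes "i < length zs" "g < n" "0 < mu i g"
  shows "I i g < \<rho>"
proof -
  have l: "1 \<le> len i" "g < tau i (len i)" using less_tau_len[OF assms(2,3)] by auto
  then have "I i g \<in> set (J i (len i))" unfolding I_def using J_props(1)[OF assms(1) l(1)] by (intro nth_mem) simp
  then show ?thesis using J_props(3)[OF assms(1) l(1)] by auto
qed

lemma I_inj: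
  "i < length zs \<Longrightarrow> g < n \<Longrightarrow> 0 < mu i g \<Longrightarrow> g' < n \<Longrightarrow> 0 < mu i g' \<Longrightarrow> I i g = I i g' \<longleftrightarrow> g = g'"
  using less_tau_len[of g i] less_tau_len[of g' i] J_props(1,2)[of i "len i"]
  by (auto simp: I_def nth_eq_iff_index_eq)

text \<open>\<open>tau i a\<close> counts the chains longer than \<open>len i - a\<close>, so the
  a-th group of indices consists of the chains of length exactly \<open>len i - a + 1\<close>. The
  case a = 1 is separate because \<open>less_tau_iff\<close> speaks of j \<ge> 1 only.\<close>

lemma group_iff:
  assumes "1 \<le> a" "a \<le> len i"
  shows "tau i (a - 1) \<le> g \<and> g < tau i a \<longleftrightarrow> g < n \<and> 0 < mu i g \<and> mu i g = len i - a + 1"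
proof (cases "a = 1")
  case True
  then show ?thesis using less_tau_iff[OF assms, of g] mu_le_len[of g i] assms by (auto simp: tau_0)
next
  case False
  then have "1 \<le> a - 1" "a - 1 \<le> len i" using assms by auto
  from less_tau_iff[OF this, of g] less_tau_iff[OF assms, of g] mu_le_len[of g i] assms show ?thesis by auto
qed

definition grp :: "nat \<Rightarrow> nat \<Rightarrow> nat" where
  "grp i g = len i - mu i g + 1"

lemma grp_props:
  assumes "g < n" "0 < mu i g"
  shows "1 \<le> grp i g" "grp i g \<le> len i" "tau i (grp i g - 1) \<le> g" "g < tau i (grp i g)" "mu i g = len i - grp i g + 1"
proof -
  show 1: "1 \<le> grp i g" "grp i g \<le> len i" "mu i g = len i - grp i g + 1"
    using assms mu_le_len[of g i] by (auto simp: grp_def)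
  show "tau i (grp i g - 1) \<le> g" "g < tau i (grp i g)"
    using group_iff[OF 1(1,2), of g] 1(3) assms by auto
qed

lemma grp_eqI:
  assumes "1 \<le> a" "a \<le> len i" "u < tau i a - tau i (a - 1)"
  shows "tau i (a - 1) + u < n" "0 < mu i (tau i (a - 1) + u)" "mu i (tau i (a - 1) + u) = len i - a + 1"
    "grp i (tau i (a - 1) + u) = a"
  using group_iff[OF assms(1,2), of "tau i (a - 1) + u"] assms by (auto simp: grp_def)

text \<open>With \<open>mu i c = len i - b + 1\<close>, \<open>mu i g = len i - a + 1\<close> and s
  = j - 1, the bounds \<open>a - j + 1 \<le> b\<close> and \<open>b \<le> len i - j + 1\<close> on
  the blocks become \<open>mu i c \<le> s + mu i g\<close> and \<open>s < mu i c\<close>. For j = 1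
  the diagonal blocks are included.\<close>

lemma prescribed_positions_eq:
  assumes i: "i < length zs"
  shows "prescribed_positions n \<alpha> (zs ! i) (J i) = {(I i g, lpos i c s q) | g c s q. (i, g, c, s, q) \<in> presc_idx}"
proof (intro subset_antisym subsetI)
  fix x assume "x \<in> prescribed_positions n \<alpha> (zs ! i) (J i)"
  then obtain j a b u v where x: "x = (J i (len i) ! (tau i (a - 1) + u), ep i * block_offset (w i) j + ep i * tau i (b - 1) + v)"
    and j: "1 \<le> j" "j \<le> len i" and a: "1 \<le> a" "a \<le> len i"
    and b: "if j = 1 then a \<le> b else max (a - j + 1) 1 \<le> b" "b \<le> len i - j + 1"
    and uv: "u < tau i a - tau i (a - 1)" "v < ep i * (tau i b - tau i (b - 1))"
    unfolding prescribed_positions_def Let_def by blast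
  have b1: "1 \<le> b" "b \<le> len i" using b a j by (auto split: if_splits)
  obtain s where s: "j = Suc s" using j(1) by (cases j) auto
  from ep_mult_exists[OF uv(2)] obtain c0 q where c0: "c0 < tau i b - tau i (b - 1)" "q < ep i" "v = ep i * c0 + q" by blast
  let ?g = "tau i (a - 1) + u" and ?c = "tau i (b - 1) + c0"
  note g = grp_eqI[OF a uv(1)] and c = grp_eqI[OF b1 c0(1)]
  have "s < mu i ?c" unfolding c(3) using b1 b j s by simp
  moreover have "a \<le> s + b"
  proof (cases "s = 0")
    case False
    then have "a - j + 1 \<le> b" using b(1) s by simp
    then show ?thesis using s by arith
  qed (use b(1) s in simp)
  then have "mu i ?c \<le> s + mu i ?g" unfolding c(3) g(3) using a b1 by arith
  ultimately have "(i, ?g, ?c, s, q) \<in> presc_idx"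
    unfolding presc_idx_def valid_def using i g(1) c(1) c0(2) by simp
  moreover have "x = (I i ?g, lpos i ?c s q)"
    unfolding x I_def lpos_def s c0(3) by (simp add: algebra_simps)
  ultimately show "x \<in> {(I i g, lpos i c s q) | g c s q. (i, g, c, s, q) \<in> presc_idx}" by blast
next
  fix x assume "x \<in> {(I i g, lpos i c s q) | g c s q. (i, g, c, s, q) \<in> presc_idx}"
  then obtain g c s q where x: "x = (I i g, lpos i c s q)" and S: "(i, g, c, s, q) \<in> presc_idx" by blast
  then have g: "g < n" "0 < mu i g" and c: "c < n" "0 < mu i c" "s < mu i c" "q < ep i" and m: "mu i c \<le> s + mu i g"
    by (auto simp: presc_idx_def valid_def)
  let ?a = "grp i g" and ?b = "grp i c"
  note pa = grp_props[OF g] and pb = grp_props[OF c(1,2)]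
  have L: "ep i * (c - tau i (?b - 1)) + q < ep i * (tau i ?b - tau i (?b - 1))"
    using pb c(4) by (intro ep_mult_less) auto
  have U: "g - tau i (?a - 1) < tau i ?a - tau i (?a - 1)" using pa(3,4) by linarith
  have X: "x = (J i (len i) ! (tau i (?a - 1) + (g - tau i (?a - 1))),
      ep i * block_offset (w i) (Suc s) + ep i * tau i (?b - 1) + (ep i * (c - tau i (?b - 1)) + q))"
  proof -
    have "ep i * c = ep i * tau i (?b - 1) + ep i * (c - tau i (?b - 1))"
      using pb(3) by (simp only: distrib_left[symmetric] le_add_diff_inverse)
    then show ?thesis unfolding x I_def lpos_def using pa(3) by simp
  qed
  have C: "if Suc s = 1 then ?a \<le> ?b else max (?a - Suc s + 1) 1 \<le> ?b" "?b \<le> len i - Suc s + 1"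
    using pa pb m c(3) by auto
  have S: "1 \<le> Suc s" "Suc s \<le> len i" using c mu_le_len[of c i] by simp_all
  show "x \<in> prescribed_positions n \<alpha> (zs ! i) (J i)"
    unfolding prescribed_positions_def Let_def
    by (intro CollectI exI[of _ "Suc s"] exI[of _ ?a] exI[of _ ?b] exI[of _ "g - tau i (?a - 1)"]
        exI[of _ "ep i * (c - tau i (?b - 1)) + q"] conjI X S pa(1,2) C U L)
qed

definition presc_pos :: "(nat \<times> nat) set" where
  "presc_pos = {(I i g, pos i c s q) | i g c s q. (i, g, c, s, q) \<in> presc_idx}"

lemma presc_idx_inj:
  assumes "(i, g, c, s, q) \<in> presc_idx" "(i', g', c', s', q') \<in> presc_idx" "I i g = I i' g'" "pos i c s q = pos i' c' s' q'"
  shows "(i, g, c, s, q) = (i', g', c', s', q')"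
proof -
  have "i = i'" "c = c'" "s = s'" "q = q'" using pos_inj[OF _ _ assms(4)] assms(1,2) by (auto simp: presc_idx_def)
  moreover have "g = g'"
    using I_inj[of i g g'] assms calculation by (auto simp: presc_idx_def valid_def)
  ultimately show ?thesis by simp
qed

lemma presc_pos_eq_image: "presc_pos = (\<lambda>(i, g, c, s, q). (I i g, pos i c s q)) ` presc_idx"
  unfolding presc_pos_def by force

text \<open>A pair of chains (g, c) admits \<open>min (mu i c) (mu i g)\<close> shifts s, each with
  \<open>ep i\<close> components.\<close>

lemma card_presc_idx: "card presc_idx = orbit_dim n \<alpha>"
proof -
  have "presc_idx = (SIGMA i:{..<length zs}. SIGMA g:{..<n}. SIGMA c:{..<n}. SIGMA s:{mu i c - mu i g..<mu i c}. {..<ep i})"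
    unfolding presc_idx_def valid_def by auto
  then have "card presc_idx = (\<Sum>i<length zs. \<Sum>g<n. \<Sum>c<n. min (mu i c) (mu i g) * ep i)"
    by (simp add: min_def) (intro sum.cong refl, auto)
  also have "\<dots> = (\<Sum>i<length zs. ep i * (\<Sum>g<n. \<Sum>c<n. min (mu i c) (mu i g)))"
    by (simp add: sum_distrib_left mult.commute)
  also have "\<dots> = (\<Sum>i<length zs. ep i * (\<Sum>l<n. (2 * l + 1) * mu i l))"
    by (subst sum_min_antimono) (auto intro: mu_antimono)
  also have "\<dots> = (\<Sum>i<length zs. \<Sum>l<n. (2 * l + 1) * (ep i * mu i l))"
    unfolding sum_distrib_left by (simp only: mult.left_commute)
  also have "\<dots> = (\<Sum>l<n. \<Sum>i<length zs. (2 * l + 1) * (ep i * mu i l))" by (rule sum.swap)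
  also have "\<dots> = (\<Sum>l<n. (2 * l + 1) * degree (\<alpha> (n - l)))"
    by (intro sum.cong refl) (simp only: sum_distrib_left[symmetric] degree_alpha lessThan_iff)
  also have "\<dots> = (\<Sum>l=1..n. (2 * (l - 1) + 1) * degree (\<alpha> (n - l + 1)))" by (rule sum_degree_alpha)
  also have "\<dots> = orbit_dim n \<alpha>"
    unfolding orbit_dim_def by (intro sum.cong refl arg_cong2[of _ _ _ _ "(*)"]) auto
  finally show ?thesis .
qed

lemma presc_pos_subset: "presc_pos \<subseteq> {..<\<rho>} \<times> {..<n}"
  unfolding presc_pos_def presc_idx_def using I_less pos_less by (auto simp: valid_def)

lemma card_presc_pos: "card presc_pos = orbit_dim n \<alpha>"
  unfolding presc_pos_eq_image card_presc_idx[symmetric]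
  by (rule card_image) (auto intro!: inj_onI dest: presc_idx_inj)

lemma mem_presc_pos_iff:
  assumes "i < length zs" "v < size_of i"
  shows "(u, off i + v) \<in> presc_pos \<longleftrightarrow> (u, v) \<in> prescribed_positions n \<alpha> (zs ! i) (J i)"
proof -
  have "(u, off i + v) \<in> presc_pos \<longleftrightarrow> (\<exists>i' g c s q. u = I i' g \<and> off i + v = off i' + lpos i' c s q \<and> (i', g, c, s, q) \<in> presc_idx)"
    unfolding presc_pos_def pos_def by blast
  also have "\<dots> \<longleftrightarrow> (\<exists>g c s q. u = I i g \<and> v = lpos i c s q \<and> (i, g, c, s, q) \<in> presc_idx)"
  proof
    assume "\<exists>i' g c s q. u = I i' g \<and> off i + v = off i' + lpos i' c s q \<and> (i', g, c, s, q) \<in> presc_idx"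
    then obtain i' g c s q where h: "u = I i' g" "off i + v = off i' + lpos i' c s q" "(i', g, c, s, q) \<in> presc_idx" by blast
    then have "lpos i' c s q < size_of i'" by (intro lpos_less) (simp add: presc_idx_def)
    from off_pos_inj[OF assms(2) this h(2)] h show "\<exists>g c s q. u = I i g \<and> v = lpos i c s q \<and> (i, g, c, s, q) \<in> presc_idx" by blast
  qed blast
  finally show ?thesis unfolding prescribed_positions_eq[OF assms(1)] by blast
qed

lemma free_positions_eq: "free_positions \<rho> n \<alpha> zs J = {..<\<rho>} \<times> {..<n} - presc_pos"
proof (intro subset_antisym subsetI)
  fix x assume "x \<in> free_positions \<rho> n \<alpha> zs J"
  then show "x \<in> {..<\<rho>} \<times> {..<n} - presc_pos"
    unfolding free_positions_def using mem_presc_pos_iff off_pos_less by auto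
next
  fix x assume x: "x \<in> {..<\<rho>} \<times> {..<n} - presc_pos"
  then obtain i v where "i < length zs" "v < size_of i" "snd x = off i + v" using off_pos_exists[of "snd x"] by auto
  then show "x \<in> free_positions \<rho> n \<alpha> zs J"
    unfolding free_positions_def using x mem_presc_pos_iff by (cases x) auto
qed

lemma card_free_positions: "card (free_positions \<rho> n \<alpha> zs J) = n * \<rho> - orbit_dim n \<alpha>"
  unfolding free_positions_eq using presc_pos_subset card_presc_pos
  by (subst card_Diff_subset) (auto intro: finite_subset simp: mult.commute)

text \<open>A function of the position in the matrix rather than of the tuple, as it serves as the
  right-hand side of a linear system in the entries. The value 1 is taken where the row of g meets
  its own chain in degree 0, in the real component.\<close>

definition pres_val :: "nat \<times> nat \<Rightarrow> real" where
  "pres_val x = (if \<exists>i g. valid i g 0 0 \<and> x = (I i g, pos i g 0 0) then 1 else 0)"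

lemma pres_val_eq:
  assumes "(i, g, c, s, q) \<in> presc_idx"
  shows "pres_val (I i g, pos i c s q) = (if c = g \<and> s = 0 \<and> q = 0 then 1 else 0)"
proof -
  have "(i', g', g', 0, 0) \<in> presc_idx" if "valid i' g' 0 0" for i' g' using that by (auto simp: presc_idx_def valid_def)
  note diag = this
  have "(\<exists>i' g'. valid i' g' 0 0 \<and> (I i g, pos i c s q) = (I i' g', pos i' g' 0 0)) \<longleftrightarrow> c = g \<and> s = 0 \<and> q = 0"
  proof
    assume "\<exists>i' g'. valid i' g' 0 0 \<and> (I i g, pos i c s q) = (I i' g', pos i' g' 0 0)"
    then obtain i' g' where "valid i' g' 0 0" "I i g = I i' g'" "pos i c s q = pos i' g' 0 0" by blast
    from presc_idx_inj[OF assms diag[OF this(1)] this(2,3)] show "c = g \<and> s = 0 \<and> q = 0" by simp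
  next
    assume "c = g \<and> s = 0 \<and> q = 0"
    moreover from this assms have "valid i g 0 0" by (simp add: presc_idx_def)
    ultimately show "\<exists>i' g'. valid i' g' 0 0 \<and> (I i g, pos i c s q) = (I i' g', pos i' g' 0 0)" by blast
  qed
  then show ?thesis unfolding pres_val_def by simp
qed

section \<open>Matrices with the prescribed entries\<close>

definition prescribed_entries :: "real mat \<Rightarrow> bool" where
  "prescribed_entries P \<longleftrightarrow> (\<forall>x\<in>presc_pos. P $$ x = pres_val x)"

lemma prescribed_entries_iff:
  "prescribed_entries P \<longleftrightarrow> (\<forall>i g c s q. (i, g, c, s, q) \<in> presc_idx \<longrightarrow>
     P $$ (I i g, pos i c s q) = (if c = g \<and> s = 0 \<and> q = 0 then 1 else 0))"
proof
  assume P: "prescribed_entries P"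
  show "\<forall>i g c s q. (i, g, c, s, q) \<in> presc_idx \<longrightarrow> P $$ (I i g, pos i c s q) = (if c = g \<and> s = 0 \<and> q = 0 then 1 else 0)"
  proof (intro allI impI)
    fix i g c s q assume S: "(i, g, c, s, q) \<in> presc_idx"
    then have "(I i g, pos i c s q) \<in> presc_pos" unfolding presc_pos_def by blast
    with P have "P $$ (I i g, pos i c s q) = pres_val (I i g, pos i c s q)" unfolding prescribed_entries_def by blast
    then show "P $$ (I i g, pos i c s q) = (if c = g \<and> s = 0 \<and> q = 0 then 1 else 0)"
      unfolding pres_val_eq[OF S] .
  qed
next
  assume R: "\<forall>i g c s q. (i, g, c, s, q) \<in> presc_idx \<longrightarrow> P $$ (I i g, pos i c s q) = (if c = g \<and> s = 0 \<and> q = 0 then 1 else 0)"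
  show "prescribed_entries P"
    unfolding prescribed_entries_def
  proof
    fix x assume "x \<in> presc_pos"
    then obtain i g c s q where x: "x = (I i g, pos i c s q)" and S: "(i, g, c, s, q) \<in> presc_idx" unfolding presc_pos_def by blast
    show "P $$ x = pres_val x" unfolding x pres_val_eq[OF S] using R S by blast
  qed
qed

text \<open>The submatrices are unitriangular over the complex numbers: in the row of c, the chains
  d > c are not longer than c, so their entries are prescribed to be 0; the entry of d = c is 1; and
  the chains d < c drop out by induction.\<close>

lemma prescribed_entries_nondegenerate:
  assumes P: "prescribed_entries P"
  shows "nondegenerate I P"
  unfolding nondegenerate_def
proof (intro allI impI)
  fix i t y c
  assume i: "i < length zs" and t: "t < len i"
    and y: "\<forall>g<n. t < mu i g \<longrightarrow> (\<Sum>c | c < n \<and> t < mu i c. ccoord (\<lambda>b. P $$ (I i g, b)) i c 0 * y c) = 0"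
    and c: "c < n" "t < mu i c"
  show "y c = 0"
    using c
  proof (induction c rule: less_induct)
    case (less c)
    have "0 = (\<Sum>d | d < n \<and> t < mu i d. ccoord (\<lambda>b. P $$ (I i c, b)) i d 0 * y d)" using y less.prems by simp
    also have "\<dots> = (\<Sum>d | d < n \<and> t < mu i d. if d = c then y d else 0)"
    proof (intro sum.cong refl)
      fix d assume "d \<in> {d. d < n \<and> t < mu i d}"
      then have d: "d < n" "t < mu i d" by auto
      show "ccoord (\<lambda>b. P $$ (I i c, b)) i d 0 * y d = (if d = c then y d else 0)"
      proof (cases "d < c")
        case True
        then show ?thesis using less.IH[OF True d] by simp
      next
        case False
        then have "mu i d \<le> mu i c" using mu_antimono[of c d] d by simp
        then have S: "(i, c, d, 0, q) \<in> presc_idx" if "q < ep i" for q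
          using that i less.prems d by (simp add: presc_idx_def valid_def)
        have "P $$ (I i c, pos i d 0 0) = (if d = c then 1 else 0)"
          using P[unfolded prescribed_entries_iff] S[OF ep_pos] by simp
        moreover have "P $$ (I i c, pos i d 0 1) = 0" if "zs ! i \<notin> \<real>"
          using P[unfolded prescribed_entries_iff] S[of 1] that by (simp add: root_eps_def)
        ultimately show ?thesis by (auto simp: ccoord_def complex_eq_iff)
      qed
    qed
    also have "\<dots> = y c" using less.prems by simp
    finally show ?case by simp
  qed
qed

section \<open>Invertibility conditions and reduced shape in adapted coordinates\<close>

lemma pick_mat_index_pos:
  assumes i: "i < length zs" and P: "P \<in> carrier_mat n n" and j: "1 \<le> j" "j \<le> len i"
    and g: "g < tau i j" and c: "c < tau i j" and q: "q < ep i"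
  shows "pick_mat (weyr_cols n \<alpha> zs i P) (J i j) (ep i * tau i j) $$ (g, ep i * c + q) = P $$ (I i g, pos i c 0 q)"
proof -
  have g': "g < n" "0 < mu i g" and c': "c < n" "0 < mu i c" using g c less_tau_iff[OF j] by auto
  have "ep i * c + q < ep i * tau i j" using c q by (rule ep_mult_less)
  moreover have "valid i c 0 q" using i c' q by (simp add: valid_def)
  then have "ep i * c + q < size_of i" using lpos_less[of i c 0 q] by (simp add: lpos_def block_offset_1)
  moreover have "I i g < n" using I_less[OF i g'] rho_le by simp
  ultimately show ?thesis
    using g P J_props(1)[OF i j] J_nth[OF i j g]
    by (simp add: pick_mat_def weyr_cols_def pos_def lpos_def block_offset_1)
qed

text \<open>The numbering is reversed: j = len i - t. The first \<open>tau i j\<close> chains are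
  those longer than t, and triviality of the complex kernel is invertibility of
  \<open>pick_mat\<close> or of its diamond.\<close>

lemma nondegenerate_iff:
  assumes P: "P \<in> carrier_mat n n"
  shows "nondegenerate I P \<longleftrightarrow> (\<forall>i<length zs. \<forall>j\<in>{1..len i}.
     if zs ! i \<in> \<real> then invertible_mat (pick_mat (weyr_cols n \<alpha> zs i P) (J i j) (tau i j))
     else invertible_mat (diamond (pick_mat (weyr_cols n \<alpha> zs i P) (J i j) (2 * tau i j))))"
proof -
  have key: "(if zs ! i \<in> \<real> then invertible_mat (pick_mat (weyr_cols n \<alpha> zs i P) (J i j) (tau i j))
     else invertible_mat (diamond (pick_mat (weyr_cols n \<alpha> zs i P) (J i j) (2 * tau i j)))) \<longleftrightarrow>
    (\<forall>y. (\<forall>g<n. len i - j < mu i g \<longrightarrow> (\<Sum>c | c < n \<and> len i - j < mu i c. ccoord (\<lambda>b. P $$ (I i g, b)) i c 0 * y c) = 0) \<longrightarrow>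
     (\<forall>c<n. len i - j < mu i c \<longrightarrow> y c = 0))"
    if i: "i < length zs" and j: "1 \<le> j" "j \<le> len i" for i j
  proof -
    have S: "{c. c < n \<and> len i - j < mu i c} = {..<tau i j}" using less_tau_iff[OF j] by auto
    have R: "(\<forall>y. (\<forall>g<n. len i - j < mu i g \<longrightarrow> (\<Sum>c | c < n \<and> len i - j < mu i c. ccoord (\<lambda>b. P $$ (I i g, b)) i c 0 * y c) = 0) \<longrightarrow>
       (\<forall>c<n. len i - j < mu i c \<longrightarrow> y c = 0)) \<longleftrightarrow>
      (\<forall>y. (\<forall>g<tau i j. (\<Sum>c<tau i j. ccoord (\<lambda>b. P $$ (I i g, b)) i c 0 * y c) = 0) \<longrightarrow> (\<forall>c<tau i j. y c = 0))"
      unfolding S using less_tau_iff[OF j] by auto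
    show ?thesis
    proof (cases "zs ! i \<in> \<real>")
      case True
      then have e: "ep i = 1" by (simp add: root_eps_def)
      let ?M = "pick_mat (weyr_cols n \<alpha> zs i P) (J i j) (tau i j)"
      have M: "?M \<in> carrier_mat (tau i j) (tau i j)" using J_props(1)[OF i j] by (simp add: pick_mat_def)
      have "of_real (?M $$ (g, c)) = ccoord (\<lambda>b. P $$ (I i g, b)) i c 0" if "g < tau i j" "c < tau i j" for g c
        using pick_mat_index_pos[OF i P j that, of 0] True by (simp add: e ccoord_def complex_of_real_def)
      then show ?thesis unfolding R if_P[OF True] invertible_mat_complex_kernel[OF M] by simp
    next
      case False
      then have e: "ep i = 2" by (simp add: root_eps_def)
      let ?M = "pick_mat (weyr_cols n \<alpha> zs i P) (J i j) (2 * tau i j)"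
      have M: "?M \<in> carrier_mat (tau i j) (2 * tau i j)" using J_props(1)[OF i j] by (simp add: pick_mat_def)
      have "Complex (?M $$ (g, 2 * c)) (?M $$ (g, Suc (2 * c))) = ccoord (\<lambda>b. P $$ (I i g, b)) i c 0"
        if "g < tau i j" "c < tau i j" for g c
        using pick_mat_index_pos[OF i P j that, of 0] pick_mat_index_pos[OF i P j that, of 1] False
        by (simp add: e ccoord_def)
      then show ?thesis unfolding R if_not_P[OF False] invertible_diamond_kernel[OF M] by simp
    qed
  qed
  show ?thesis
  proof
    assume L: "nondegenerate I P"
    show "\<forall>i<length zs. \<forall>j\<in>{1..len i}.
     if zs ! i \<in> \<real> then invertible_mat (pick_mat (weyr_cols n \<alpha> zs i P) (J i j) (tau i j))
     else invertible_mat (diamond (pick_mat (weyr_cols n \<alpha> zs i P) (J i j) (2 * tau i j)))"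
    proof (intro allI impI ballI)
      fix i j assume i: "i < length zs" and "j \<in> {1..len i}"
      then have j: "1 \<le> j" "j \<le> len i" "len i - j < len i" by auto
      show "if zs ! i \<in> \<real> then invertible_mat (pick_mat (weyr_cols n \<alpha> zs i P) (J i j) (tau i j))
         else invertible_mat (diamond (pick_mat (weyr_cols n \<alpha> zs i P) (J i j) (2 * tau i j)))"
        unfolding key[OF i j(1,2)] using nondegenerateD[OF L i j(3)] by blast
    qed
  next
    assume R: "\<forall>i<length zs. \<forall>j\<in>{1..len i}.
     if zs ! i \<in> \<real> then invertible_mat (pick_mat (weyr_cols n \<alpha> zs i P) (J i j) (tau i j))
     else invertible_mat (diamond (pick_mat (weyr_cols n \<alpha> zs i P) (J i j) (2 * tau i j)))"
    show "nondegenerate I P"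
      unfolding nondegenerate_def
    proof (rule allI, rule impI, rule allI, rule impI)
      fix i t assume i: "i < length zs" and t: "t < len i"
      then have j: "1 \<le> len i - t" "len i - t \<le> len i" "len i - (len i - t) = t" by auto
      have "if zs ! i \<in> \<real> then invertible_mat (pick_mat (weyr_cols n \<alpha> zs i P) (J i (len i - t)) (tau i (len i - t)))
         else invertible_mat (diamond (pick_mat (weyr_cols n \<alpha> zs i P) (J i (len i - t)) (2 * tau i (len i - t))))"
        using R i j by simp
      then show "\<forall>y. (\<forall>g<n. t < mu i g \<longrightarrow> (\<Sum>c | c < n \<and> t < mu i c. ccoord (\<lambda>b. P $$ (I i g, b)) i c 0 * y c) = 0) \<longrightarrow>
          (\<forall>c<n. t < mu i c \<longrightarrow> y c = 0)"
        unfolding key[OF i j(1,2)] j(3) .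
    qed
  qed
qed

lemma reduced_block_eq_iff:
  assumes i: "i < length zs" and a: "1 \<le> a" "a \<le> len i" and b: "1 \<le> b" "b \<le> len i"
    and M: "M \<in> carrier_mat (tau i a - tau i (a - 1)) (ep i * (tau i b - tau i (b - 1)))"
  shows "reduced_block n \<alpha> (zs ! i) (J i) R (Suc s) a b = M \<longleftrightarrow>
    (\<forall>g c q. g < n \<and> 0 < mu i g \<and> grp i g = a \<and> c < n \<and> 0 < mu i c \<and> grp i c = b \<and> q < ep i \<longrightarrow>
       R $$ (I i g, lpos i c s q) = M $$ (g - tau i (a - 1), ep i * (c - tau i (b - 1)) + q))"
    (is "?B = M \<longleftrightarrow> ?R")
proof -
  have Bi: "?B $$ (u, ep i * c0 + q) = R $$ (I i (tau i (a - 1) + u), lpos i (tau i (b - 1) + c0) s q)"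
    if "u < tau i a - tau i (a - 1)" "c0 < tau i b - tau i (b - 1)" "q < ep i" for u c0 q
    using that ep_mult_less[OF that(2,3)]
    by (simp add: reduced_block_def Let_def I_def lpos_def algebra_simps)
  show ?thesis
  proof
    assume eq: "?B = M"
    show ?R
    proof (intro allI impI)
      fix g c q assume h: "g < n \<and> 0 < mu i g \<and> grp i g = a \<and> c < n \<and> 0 < mu i c \<and> grp i c = b \<and> q < ep i"
      then show "R $$ (I i g, lpos i c s q) = M $$ (g - tau i (a - 1), ep i * (c - tau i (b - 1)) + q)"
        using grp_props[of g i] grp_props[of c i] Bi[of "g - tau i (a - 1)" "c - tau i (b - 1)" q] eq by auto
    qed
  next
    assume R: ?R
    show "?B = M"
    proof (intro eq_matI)
      fix u v assume "u < dim_row M" "v < dim_col M"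
      then have uv: "u < tau i a - tau i (a - 1)" "v < ep i * (tau i b - tau i (b - 1))" using M by auto
      from ep_mult_exists[OF uv(2)] obtain c0 q where c0: "c0 < tau i b - tau i (b - 1)" "q < ep i" "v = ep i * c0 + q" by blast
      show "?B $$ (u, v) = M $$ (u, v)"
        using R[rule_format, of "tau i (a - 1) + u" "tau i (b - 1) + c0" q] Bi[OF uv(1) c0(1,2)] c0
          grp_eqI[OF a uv(1)] grp_eqI[OF b c0(1)] by simp
    qed (use M in \<open>auto simp: reduced_block_def Let_def\<close>)
  qed
qed

text \<open>Together the three kinds of block conditions concern exactly the tuples of
  \<open>presc_idx\<close>: identity blocks for s = 0 and chains of equal length, zero blocks for
  all others.\<close>

lemma reduced_shape_iff:
  assumes i: "i < length zs"
  shows "reduced_shape r k n \<alpha> (zs ! i) (J i) R \<longleftrightarrow> has_shape r k (weyr_block n \<alpha> (zs ! i)) R \<and>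
    (\<forall>g c s q. (i, g, c, s, q) \<in> presc_idx \<longrightarrow> R $$ (I i g, lpos i c s q) = (if c = g \<and> s = 0 \<and> q = 0 then 1 else 0))"
proof -
  let ?B = "reduced_block n \<alpha> (zs ! i) (J i) R"
  let ?k = "\<lambda>a. tau i a - tau i (a - 1)"
  let ?E = "\<lambda>a. mat (?k a) (ep i * ?k a) (\<lambda>(u, v). if v = ep i * u then 1 else 0 :: real)"
  let ?C1 = "\<forall>a\<in>{1..len i}. (if zs ! i \<in> \<real> then ?B 1 a a else diamond (?B 1 a a)) = 1\<^sub>m (ep i * ?k a)"
  let ?C2 = "\<forall>a\<in>{1..len i}. \<forall>b\<in>{1..len i}. a < b \<longrightarrow> ?B 1 a b = 0\<^sub>m (?k a) (ep i * ?k b)"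
  let ?C3 = "\<forall>j\<in>{2..len i}. \<forall>a\<in>{1..len i}. \<forall>b. max (a - j + 1) 1 \<le> b \<and> b \<le> len i - j + 1 \<longrightarrow> ?B j a b = 0\<^sub>m (?k a) (ep i * ?k b)"
  let ?S = "\<forall>g c s q. (i, g, c, s, q) \<in> presc_idx \<longrightarrow> R $$ (I i g, lpos i c s q) = (if c = g \<and> s = 0 \<and> q = 0 then 1 else 0)"
  have C1: "(if zs ! i \<in> \<real> then ?B 1 a a else diamond (?B 1 a a)) = 1\<^sub>m (ep i * ?k a) \<longleftrightarrow> ?B (Suc 0) a a = ?E a" for a
  proof (cases "zs ! i \<in> \<real>")
    case True
    then have e: "ep i = 1" by (simp add: root_eps_def)
    have "1\<^sub>m (?k a) = ?E a" unfolding e by (intro eq_matI) auto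
    then show ?thesis using True e by simp
  next
    case False
    then have e: "ep i = 2" by (simp add: root_eps_def)
    have "?B 1 a a \<in> carrier_mat (?k a) (2 * ?k a)" by (simp add: reduced_block_def Let_def e)
    from diamond_eq_one_iff[OF this] show ?thesis using False e by simp
  qed
  have E: "?E a \<in> carrier_mat (?k a) (ep i * ?k a)" for a by simp
  have Z: "0\<^sub>m (?k a) (ep i * ?k b) \<in> carrier_mat (?k a) (ep i * ?k b)" for a b by simp
  have "?C1 \<and> ?C2 \<and> ?C3 \<longleftrightarrow> ?S"
  proof
    assume C: "?C1 \<and> ?C2 \<and> ?C3"
    show ?S
    proof (intro allI impI)
      fix g c s q assume "(i, g, c, s, q) \<in> presc_idx"
      then have g: "g < n" "0 < mu i g" and c: "c < n" "0 < mu i c" "s < mu i c" "q < ep i" and m: "mu i c \<le> s + mu i g"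
        by (auto simp: presc_idx_def valid_def)
      let ?a = "grp i g" and ?b = "grp i c"
      note pa = grp_props[OF g] and pb = grp_props[OF c(1,2)]
      have gl: "g - tau i (?a - 1) < ?k ?a" using pa(3,4) by linarith
      have lt: "ep i * (c - tau i (?b - 1)) + q < ep i * ?k ?b"
        using pb c(4) by (intro ep_mult_less) auto
      have zero: "R $$ (I i g, lpos i c s q) = 0" if "?B (Suc s) ?a ?b = 0\<^sub>m (?k ?a) (ep i * ?k ?b)"
        using that[unfolded reduced_block_eq_iff[OF i pa(1,2) pb(1,2) Z], rule_format, of g c q] g c
        unfolding index_zero_mat(1)[OF gl lt] by simp
      show "R $$ (I i g, lpos i c s q) = (if c = g \<and> s = 0 \<and> q = 0 then 1 else 0)"
      proof (cases "s = 0")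
        case s: True
        have ab: "?a \<le> ?b" using m s pa(5) pb(5) pa(2) pb(2) by linarith
        show ?thesis
        proof (cases "?a = ?b")
          case False
          then have "?B (Suc s) ?a ?b = 0\<^sub>m (?k ?a) (ep i * ?k ?b)" using C ab pa pb s by simp
          moreover have "c \<noteq> g" using False by auto
          ultimately show ?thesis using zero by simp
        next
          case True
          have "?B (Suc 0) ?a ?a = ?E ?a" using C C1[of ?a] pa by simp
          then have "R $$ (I i g, lpos i c s q) = ?E ?a $$ (g - tau i (?a - 1), ep i * (c - tau i (?a - 1)) + q)"
            unfolding reduced_block_eq_iff[OF i pa(1,2) pa(1,2) E] using g c True s by auto
          also have "\<dots> = (if ep i * (c - tau i (?a - 1)) + q = ep i * (g - tau i (?a - 1)) + 0 then 1 else 0)"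
            using lt gl True by simp
          also have "\<dots> = (if c = g \<and> s = 0 \<and> q = 0 then 1 else 0)"
            unfolding ep_mult_inj[OF c(4) ep_pos] using eq_diff_iff[of "tau i (?a - 1)" c g] pa(3) pb(3) True s by simp
          finally show ?thesis .
        qed
      next
        case False
        have "max (?a - Suc s + 1) 1 \<le> ?b" "?b \<le> len i - Suc s + 1" "Suc s \<in> {2..len i}"
          using pa pb m c(3) False mu_le_len[of c i] c(1) by auto
        then have "?B (Suc s) ?a ?b = 0\<^sub>m (?k ?a) (ep i * ?k ?b)" using C pa pb by auto
        then show ?thesis using zero False by simp
      qed
    qed
  next
    assume S: ?S
    have presc_idxI: "(i, g, c, s, q) \<in> presc_idx"
      if "g < n" "0 < mu i g" "c < n" "s < mu i c" "q < ep i" "mu i c \<le> s + mu i g" for g c s q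
      using that i by (simp add: presc_idx_def valid_def)
    have ?C1
    proof
      fix a assume "a \<in> {1..len i}"
      then have a: "1 \<le> a" "a \<le> len i" by auto
      show "(if zs ! i \<in> \<real> then ?B 1 a a else diamond (?B 1 a a)) = 1\<^sub>m (ep i * ?k a)"
        unfolding C1 reduced_block_eq_iff[OF i a a E]
      proof (intro allI impI, elim conjE)
        fix g c q assume h: "g < n" "0 < mu i g" "grp i g = a" "c < n" "0 < mu i c" "grp i c = a" "q < ep i"
        note pa = grp_props[OF h(1,2)] and pb = grp_props[OF h(4,5)]
        have lt: "ep i * (c - tau i (a - 1)) + q < ep i * ?k a"
          using pb h by (intro ep_mult_less) auto
        have gl: "g - tau i (a - 1) < ?k a" using pa(3,4)[unfolded h(3)] by linarith
        have "R $$ (I i g, lpos i c 0 q) = (if c = g \<and> q = 0 then 1 else 0)"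
          using S presc_idxI[of g c 0 q] h pa(5) pb(5) by simp
        also have "\<dots> = (if ep i * (c - tau i (a - 1)) + q = ep i * (g - tau i (a - 1)) + 0 then 1 else 0)"
          unfolding ep_mult_inj[OF h(7) ep_pos] using eq_diff_iff[of "tau i (a - 1)" c g] pa(3) pb(3) h(3,6) by simp
        also have "\<dots> = ?E a $$ (g - tau i (a - 1), ep i * (c - tau i (a - 1)) + q)"
          using lt gl by simp
        finally show "R $$ (I i g, lpos i c 0 q) = ?E a $$ (g - tau i (a - 1), ep i * (c - tau i (a - 1)) + q)" .
      qed
    qed
    moreover have zero: "?B (Suc s) a b = 0\<^sub>m (?k a) (ep i * ?k b)"
      if a: "1 \<le> a" "a \<le> len i" and b: "1 \<le> b" "b \<le> len i"
        and s: "b \<le> len i - s" "a \<le> b + s" "s = 0 \<longrightarrow> a \<noteq> b" and sl: "s < len i" for a b s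
      unfolding reduced_block_eq_iff[OF i a b Z]
    proof (intro allI impI, elim conjE)
      fix g c q assume h: "g < n" "0 < mu i g" "grp i g = a" "c < n" "0 < mu i c" "grp i c = b" "q < ep i"
      note pa = grp_props[OF h(1,2)] and pb = grp_props[OF h(4,5)]
      have lt: "ep i * (c - tau i (b - 1)) + q < ep i * ?k b"
        using pb h by (intro ep_mult_less) auto
      have gl: "g - tau i (a - 1) < ?k a" using pa(3,4)[unfolded h(3)] by linarith
      have "(i, g, c, s, q) \<in> presc_idx" using presc_idxI[of g c s q] h pa(5) pb(5) s a b sl by auto
      then have "R $$ (I i g, lpos i c s q) = 0" using S s(3) h by auto
      then show "R $$ (I i g, lpos i c s q) = 0\<^sub>m (?k a) (ep i * ?k b) $$ (g - tau i (a - 1), ep i * (c - tau i (b - 1)) + q)"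
        unfolding index_zero_mat(1)[OF gl lt] .
    qed
    moreover have ?C2
    proof (intro ballI impI)
      fix a b assume "a \<in> {1..len i}" "b \<in> {1..len i}" "a < b"
      then show "?B 1 a b = 0\<^sub>m (?k a) (ep i * ?k b)" using zero[of a b 0] by auto
    qed
    moreover have ?C3
    proof (intro ballI allI impI)
      fix j a b assume j: "j \<in> {2..len i}" and a: "a \<in> {1..len i}" and b: "max (a - j + 1) 1 \<le> b \<and> b \<le> len i - j + 1"
      obtain s where "j = Suc s" using j by (cases j) auto
      then show "?B j a b = 0\<^sub>m (?k a) (ep i * ?k b)" using zero[of a b s] j a b by auto
    qed
    ultimately show "?C1 \<and> ?C2 \<and> ?C3" by blast
  qed
  then show ?thesis unfolding reduced_shape_def Let_def by blast
qed

end

section \<open>Ranks\<close>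

lemma mat_rank_obtain:
  fixes M :: "real mat"
  obtains U where "U \<subseteq> set (cols M)" "module.lin_indpt class_ring (module_vec TYPE(real) (dim_row M)) U" "mat_rank M = card U"
proof -
  interpret vec_space "TYPE(real)" "dim_row M" .
  have M: "M \<in> carrier_mat (dim_row M) (dim_col M)" by simp
  have "lin_indpt {}" unfolding lin_dep_def by simp
  then obtain U where U: "maximal U (\<lambda>T. T \<subseteq> set (cols M) \<and> lin_indpt T)"
    using maximal_exists_superset[of "set (cols M)" "\<lambda>T. T \<subseteq> set (cols M) \<and> lin_indpt T" "{}"] by auto
  from rank_card_indpt[OF M U] U show thesis
    by (intro that[of U]) (auto simp: mat_rank_def maximal_def)
qed

lemma mat_rank_le_dim_row: "mat_rank M \<le> dim_row M"
proof -
  interpret vec_space "TYPE(real)" "dim_row M" .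
  obtain U where U: "U \<subseteq> set (cols M)" "lin_indpt U" "mat_rank M = card U" by (rule mat_rank_obtain)
  have "U \<subseteq> carrier_vec (dim_row M)" using U(1) cols_dim by blast
  then have "card U \<le> dim" using li_le_dim(2)[OF fin_dim _ U(2)] by simp
  then show ?thesis using U(3) dim_is_n by simp
qed

lemma mat_rank_mono:
  assumes "set (cols M) \<subseteq> set (cols M')" "dim_row M = dim_row M'"
  shows "mat_rank M \<le> mat_rank M'"
proof -
  interpret vec_space "TYPE(real)" "dim_row M" .
  obtain U where U: "U \<subseteq> set (cols M)" "lin_indpt U" "mat_rank M = card U" by (rule mat_rank_obtain)
  have "M' \<in> carrier_mat (dim_row M) (dim_col M')" using assms(2) by auto
  from rank_ge_card_indpt[OF this _ U(2)] U assms show ?thesis by (auto simp: mat_rank_def)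
qed

text \<open>Independence refers to the set of columns, so equal columns must be excluded first: two
  of them would give a kernel vector with entries 1 and -1.\<close>

lemma mat_rank_trivial_kernel:
  assumes M: "M \<in> carrier_mat n d"
    and ker: "\<And>v. (\<And>a. a < n \<Longrightarrow> (\<Sum>b<d. M $$ (a, b) * v b) = 0) \<Longrightarrow> \<forall>b<d. v b = 0"
  shows "mat_rank M = d"
proof -
  interpret vec_space "TYPE(real)" n .
  have dist: "distinct (cols M)"
  proof (rule ccontr)
    assume "\<not> distinct (cols M)"
    then obtain i j where ij: "i < d" "j < d" "i \<noteq> j" "col M i = col M j"
      using M by (auto simp: distinct_conv_nth)
    have eq: "M $$ (a, i) = M $$ (a, j)" if "a < n" for a
    proof -
      have "M $$ (a, i) = col M i $ a" "M $$ (a, j) = col M j $ a" using that ij(1,2) M by auto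
      then show ?thesis using ij(4) by simp
    qed
    have "(\<Sum>b<d. M $$ (a, b) * ((if b = i then 1 else 0) - (if b = j then 1 else 0))) = 0" if "a < n" for a
    proof -
      have "(\<Sum>b<d. M $$ (a, b) * ((if b = i then 1 else 0) - (if b = j then 1 else 0))) =
        (\<Sum>b<d. if b = i then M $$ (a, b) else 0) - (\<Sum>b<d. if b = j then M $$ (a, b) else 0)"
        unfolding sum_subtractf[symmetric] by (intro sum.cong refl) auto
      then show ?thesis using ij eq[OF that] by simp
    qed
    from ker[OF this] ij show False by auto
  qed
  have "lin_indpt (set (cols M))"
  proof (rule ccontr)
    assume "\<not> lin_indpt (set (cols M))"
    then obtain v where v: "v \<in> carrier_vec d" "v \<noteq> 0\<^sub>v d" "M *\<^sub>v v = 0\<^sub>v n" using lin_depE[OF M _ dist] by blast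
    have "(\<Sum>b<d. M $$ (a, b) * v $ b) = 0" if "a < n" for a
      using arg_cong[OF v(3), of "\<lambda>u. u $ a"] that M v(1) by (auto simp: scalar_prod_def atLeast0LessThan)
    from ker[OF this] v(1) have "v = 0\<^sub>v d" by (intro eq_vecI) auto
    with v(2) show False by simp
  qed
  from lin_indpt_full_rank[OF M dist this] M show ?thesis by (simp add: mat_rank_def)
qed

lemma mat_rank_eq_iff_det:
  assumes "M \<in> carrier_mat n n"
  shows "mat_rank M = n \<longleftrightarrow> det M \<noteq> 0"
proof -
  interpret vec_space "TYPE(real)" n .
  show ?thesis using det_rank_iff[OF assms] assms by (simp add: mat_rank_def)
qed

section \<open>Pairs in Brunovsky form\<close>

text \<open>Truncated differences are at least the true ones, and equality of the totals leaves no
  room for a truncation, so f cannot increase. Applied to the number of columns of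
  \<open>G1\<close>, this yields the monotonicity of the Brunovsky indices.\<close>

lemma telescope_truncated:
  fixes f :: "nat \<Rightarrow> nat"
  shows "f 1 \<le> (\<Sum>i=1..k. f i - f (i + 1)) + f (k + 1)"
    and "(\<Sum>i=1..k. f i - f (i + 1)) + f (k + 1) = f 1 \<Longrightarrow> \<forall>i\<in>{1..k}. f (i + 1) \<le> f i"
proof (induction k)
  case (Suc k)
  {
    case 1
    then show ?case using Suc(1) by simp
  next
    case 2
    then have "(\<Sum>i=1..k. f i - f (i + 1)) + f (k + 1) = f 1" "f (k + 1 + 1) \<le> f (k + 1)"
      using Suc(1) by (auto simp: algebra_simps)
    then show ?case using Suc(2) by (auto simp: atLeastAtMostSuc_conv)
  }
qed simp_all

locale brunovsky_indices =
  fixes n k :: nat and r \<kappa> :: "nat \<Rightarrow> nat"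
  assumes k_pos: "1 \<le> k"
    and r_antimono: "\<And>l. 1 \<le> l \<Longrightarrow> l < k \<Longrightarrow> r (l + 1) \<le> r l"
    and sum_r: "(\<Sum>l=1..k. r l) = n"
    and kappa: "\<And>a. \<kappa> (Suc a) = card {l. 1 \<le> l \<and> l \<le> k \<and> a < r l}"
begin

abbreviation "F \<equiv> brunovsky_F r k"
abbreviation "G1 \<equiv> brunovsky_G1 r k"

definition ri :: "nat \<Rightarrow> nat \<Rightarrow> nat" where
  "ri l a = block_offset r l + a"

definition r' :: "nat \<Rightarrow> nat" where
  "r' i = (if i \<le> k then r i else 0)"

lemma r_le:
  assumes "1 \<le> l" "l \<le> l'" "l' \<le> k"
  shows "r l' \<le> r l"
  using assms(2,3)
proof (induction rule: dec_induct)
  case (step m)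
  then show ?case using r_antimono[of m] assms(1) by simp
qed simp

lemma r'_antimono: "1 \<le> l \<Longrightarrow> l \<le> l' \<Longrightarrow> r' l' \<le> r' l"
  using r_le by (simp add: r'_def)

lemma block_offset_n: "block_offset r (Suc k) = n"
  using sum_r by (simp add: block_offset_eq_sum)

lemma ri_less: "1 \<le> l \<Longrightarrow> l \<le> k \<Longrightarrow> a < r l \<Longrightarrow> ri l a < n"
  using block_pos_less[of l k a r] by (simp add: block_offset_n ri_def)

lemma ri_exists: "u < n \<Longrightarrow> \<exists>l a. 1 \<le> l \<and> l \<le> k \<and> a < r l \<and> u = ri l a"
  using block_pos_exists[of u r k] by (simp add: block_offset_n ri_def)

lemma ri_inj: "1 \<le> l \<Longrightarrow> a < r l \<Longrightarrow> 1 \<le> l' \<Longrightarrow> a' < r l' \<Longrightarrow> ri l a = ri l' a' \<longleftrightarrow> l = l' \<and> a = a'"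
  using block_pos_inj[of l a r l' a'] by (auto simp: ri_def)

lemma ri_1: "ri (Suc 0) a = a"
  by (simp add: ri_def block_offset_1)

lemma r1_le_n: "r 1 \<le> n"
  using ri_less[of 1 "r 1 - 1"] k_pos by (cases "r 1") (auto simp: ri_1)

lemma F_carrier: "F \<in> carrier_mat n n"
  unfolding brunovsky_F_def block_mat_def using sum_r by auto

lemma F_index:
  assumes "1 \<le> l" "l \<le> k" "a < r l" "1 \<le> l'" "l' \<le> k" "a' < r l'"
  shows "F $$ (ri l a, ri l' a') = (if l' = l + 1 \<and> a = a' then 1 else 0)"
  unfolding brunovsky_F_def ri_def using assms by (subst block_mat_index) (auto simp: eye_def)

definition cw :: "nat \<Rightarrow> nat" where
  "cw j = r' (k - j + 1) - r' (k - j + 2)"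

text \<open>The column blocks of \<open>G1\<close> run through the indices backwards, so the first p
  widths telescope; the sum starts from \<open>r' (k + 1) = 0\<close>.\<close>

lemma block_offset_cw: "p \<le> k \<Longrightarrow> block_offset cw (Suc p) = r' (k - p + 1)"
proof (induction p)
  case (Suc p)
  have "r' (k - p + 1) \<le> r' (k - p)" using Suc.prems by (intro r'_antimono) auto
  moreover have k: "k - Suc p + 1 = k - p" "k - Suc p + 2 = k - p + 1" using Suc.prems by auto
  moreover have "cw (Suc p) = r' (k - p) - r' (k - p + 1)" unfolding cw_def k ..
  ultimately show ?case using Suc block_offset_Suc[of "Suc p" cw] by simp
qed (simp add: block_offset_1 r'_def)

lemma G1_eq: "G1 = block_mat r k cw k (\<lambda>i j. if j = k - i + 1
    then 0\<^sub>m (r' (i + 1)) (cw j) @\<^sub>r 1\<^sub>m (cw j) else 0\<^sub>m (r i) (cw j))"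
  unfolding brunovsky_G1_def Let_def r'_def[abs_def] cw_def[abs_def] ..

lemma G1_carrier: "G1 \<in> carrier_mat n (r 1)"
proof -
  have "(\<Sum>j=1..k. cw j) = r 1"
    using block_offset_cw[of k] k_pos by (simp add: block_offset_eq_sum r'_def)
  then show ?thesis unfolding G1_eq block_mat_def using sum_r by auto
qed

text \<open>Column b of \<open>G1\<close> is a unit vector: it feeds row b of the last block that is
  large enough to have a row b. The inequality \<open>r' (l + 1) \<le> a\<close> says that l is this
  block.\<close>

lemma G1_index:
  assumes l: "1 \<le> l" "l \<le> k" and a: "a < r l" and b: "b < r 1"
  shows "G1 $$ (ri l a, b) = (if r' (l + 1) \<le> a \<and> b = a then 1 else 0)"
proof -
  have "b < block_offset cw (Suc k)" using b block_offset_cw[of k] k_pos by (simp add: r'_def)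
  from block_pos_exists[OF this] obtain j b' where j: "1 \<le> j" "j \<le> k" "b' < cw j" "b = block_offset cw j + b'" by blast
  define l' where "l' = k - j + 1"
  have l': "1 \<le> l'" "l' \<le> k" "j = k - l' + 1" "k - (j - 1) + 1 = l' + 1" "k - j + 2 = l' + 1" using j by (auto simp: l'_def)
  have off: "block_offset cw j = r' (l' + 1)" using block_offset_cw[of "j - 1"] j(1,2) l'(4) by simp
  have cwj: "cw j = r' l' - r' (l' + 1)" unfolding cw_def using l'(5) by (simp add: l'_def)
  have ra: "a < r' l" using a l by (simp add: r'_def)
  have "G1 $$ (ri l a, b) = (if j = k - l + 1 then 0\<^sub>m (r' (l + 1)) (cw j) @\<^sub>r 1\<^sub>m (cw j) else 0\<^sub>m (r l) (cw j)) $$ (a, b')"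
    unfolding G1_eq ri_def j(4) by (subst block_mat_index) (use l a j in simp_all)
  also have "\<dots> = (if r' (l + 1) \<le> a \<and> b = a then 1 else 0)"
  proof (cases "l' = l")
    case True
    have cl: "cw j = r' l - r' (l + 1)" using cwj True by simp
    show ?thesis
    proof (cases "a < r' (l + 1)")
      case False
      then have "a - r' (l + 1) < cw j" using ra cl by simp
      then show ?thesis using False True l'(3) j(3,4) off
        by (auto simp: append_rows_def)
    qed (use True l'(3) j(3) off in \<open>auto simp: append_rows_def\<close>)
  next
    case False
    \<comment> \<open>Column b lies between \<open>r' (l' + 1)\<close> and \<open>r' l'\<close>, and
      for different indices these half-open intervals are disjoint.\<close>
    have "\<not> (r' (l + 1) \<le> a \<and> b = a)"
    proof
      assume h: "r' (l + 1) \<le> a \<and> b = a"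
      have bl: "r' (l' + 1) \<le> a" "a < r' l'" using h j(3,4) off cwj by auto
      show False
      proof (cases "l < l'")
        case True
        then have "r' l' \<le> r' (l + 1)" by (intro r'_antimono) auto
        then show False using bl h by simp
      next
        case lf: False
        then have "r' l \<le> r' (l' + 1)" using False l'(1) by (intro r'_antimono) auto
        then show False using bl ra by simp
      qed
    qed
    moreover have "j \<noteq> k - l + 1" using False l' l by auto
    ultimately show ?thesis using a j by simp
  qed
  finally show ?thesis .
qed

lemma sum_ri: "(\<Sum>u<n. f u) = (\<Sum>l=1..k. \<Sum>a<r l. f (ri l a))"
proof -
  have "bij_betw (\<lambda>(l, a). ri l a) (SIGMA l:{1..k}. {..<r l}) {..<n}"
    unfolding bij_betw_def
  proof
    show "inj_on (\<lambda>(l, a). ri l a) (SIGMA l:{1..k}. {..<r l})"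
      by (rule inj_onI) (auto simp: ri_inj)
    show "(\<lambda>(l, a). ri l a) ` (SIGMA l:{1..k}. {..<r l}) = {..<n}"
    proof (intro subset_antisym subsetI)
      fix u assume "u \<in> {..<n}"
      then obtain l a where "1 \<le> l" "l \<le> k" "a < r l" "u = ri l a" using ri_exists by blast
      then show "u \<in> (\<lambda>(l, a). ri l a) ` (SIGMA l:{1..k}. {..<r l})"
        by (intro image_eqI[of _ _ "(l, a)"]) auto
    qed (auto simp: ri_less)
  qed
  from sum.reindex_bij_betw[OF this, of f] show ?thesis
    by (simp add: sum.Sigma split_def)
qed

text \<open>F puts row a of block l + 1 in the place of row a of block l, as long as the next block
  has a row a. Where this chain of rows ends, \<open>G1\<close> feeds in row a of K P.\<close>

lemma closed_loop_index:
  assumes K: "K \<in> carrier_mat (r 1) n" and P: "P \<in> carrier_mat n d"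
    and l: "1 \<le> l" "l \<le> k" and a: "a < r l" and b: "b < d"
  shows "((F + G1 * K) * P) $$ (ri l a, b) =
    (if l < k \<and> a < r (l + 1) then P $$ (ri (l + 1) a, b) else (K * P) $$ (a, b))"
proof -
  have u: "ri l a < n" using ri_less l a by simp
  have a1: "a < r 1" using r_le[of 1 l] l a by simp
  have FP: "(F * P) $$ (ri l a, b) = (if l < k \<and> a < r (l + 1) then P $$ (ri (l + 1) a, b) else 0)"
  proof -
    have "(F * P) $$ (ri l a, b) = (\<Sum>l'=1..k. \<Sum>a'<r l'. F $$ (ri l a, ri l' a') * P $$ (ri l' a', b))"
      unfolding mult_mat_index[OF F_carrier P u b] by (rule sum_ri)
    also have "\<dots> = (\<Sum>l'=1..k. if l' = l + 1 then if a < r l' then P $$ (ri l' a, b) else 0 else 0)"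
    proof (intro sum.cong refl)
      fix l' assume l': "l' \<in> {1..k}"
      have "(\<Sum>a'<r l'. F $$ (ri l a, ri l' a') * P $$ (ri l' a', b)) =
         (\<Sum>a'<r l'. if a' = a then if l' = l + 1 then P $$ (ri l' a, b) else 0 else 0)"
        using l' l a by (intro sum.cong refl) (auto simp: F_index)
      then show "(\<Sum>a'<r l'. F $$ (ri l a, ri l' a') * P $$ (ri l' a', b)) =
         (if l' = l + 1 then if a < r l' then P $$ (ri l' a, b) else 0 else 0)" by auto
    qed
    also have "\<dots> = (if l < k \<and> a < r (l + 1) then P $$ (ri (l + 1) a, b) else 0)"
      using l by auto
    finally show ?thesis .
  qed
  have KP: "K * P \<in> carrier_mat (r 1) d" using K P by simp
  have GKP: "(G1 * (K * P)) $$ (ri l a, b) = (if r' (l + 1) \<le> a then (K * P) $$ (a, b) else 0)"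
  proof -
    have "(G1 * (K * P)) $$ (ri l a, b) = (\<Sum>b'<r 1. if b' = a then if r' (l + 1) \<le> a then (K * P) $$ (a, b) else 0 else 0)"
      unfolding mult_mat_index[OF G1_carrier KP u b]
      by (intro sum.cong refl) (auto simp: G1_index[OF l a])
    then show ?thesis using a1 by simp
  qed
  have "(F + G1 * K) * P = F * P + G1 * (K * P)"
    using add_mult_distrib_mat[OF F_carrier _ P, of "G1 * K"] assoc_mult_mat[OF G1_carrier K P] G1_carrier K by simp
  then have "((F + G1 * K) * P) $$ (ri l a, b) = (F * P) $$ (ri l a, b) + (G1 * (K * P)) $$ (ri l a, b)"
    using u b F_carrier G1_carrier K P by simp
  then show ?thesis unfolding FP GKP using l by (auto simp: r'_def)
qed

text \<open>Powers of M are traded for a recursion from block to block, which is the form met in the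
  rows of the closed-loop equation. Block sizes do not increase, so the preceding block always
  contains row a.\<close>

lemma has_shape_iff:
  assumes M: "M \<in> carrier_mat d d" and P: "P \<in> carrier_mat n d"
  shows "has_shape r k M P \<longleftrightarrow> (\<forall>l. 1 \<le> l \<and> l < k \<longrightarrow> (\<forall>a<r (l + 1). \<forall>b<d.
    P $$ (ri (l + 1) a, b) = (P * M) $$ (ri l a, b)))"
proof -
  define Q where "Q l = row_block r 1 P * M ^\<^sub>m l" for l
  have B: "row_block r 1 P \<in> carrier_mat (r 1) d" using P unfolding row_block_def by simp
  have Mp: "M ^\<^sub>m l \<in> carrier_mat d d" for l using M by simp
  have Q: "Q l \<in> carrier_mat (r 1) d" for l unfolding Q_def using B Mp by simp
  have Q0: "Q 0 = row_block r 1 P" unfolding Q_def using B M by simp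
  have QS: "Q (Suc l) = Q l * M" for l unfolding Q_def using assoc_mult_mat[OF B Mp M] by simp
  have shape: "has_shape r k M P \<longleftrightarrow> (\<forall>l\<in>{1..k}. \<forall>a<r l. \<forall>b<d. P $$ (ri l a, b) = Q (l - 1) $$ (a, b))"
  proof -
    have "row_block r l P = first_rows (r l) (row_block r 1 P * M ^\<^sub>m (l - 1)) \<longleftrightarrow>
      (\<forall>a<r l. \<forall>b<d. P $$ (ri l a, b) = Q (l - 1) $$ (a, b))" for l
      unfolding Q_def[symmetric] using P Q[of "l - 1"]
      by (auto simp: mat_eq_iff row_block_def first_rows_def ri_def)
    then show ?thesis unfolding has_shape_def using P M sum_r by auto
  qed
  have step: "(P * M) $$ (ri l a, b) = Q l $$ (a, b)"
    if l: "1 \<le> l" "l \<le> k" and a: "a < r l" and b: "b < d"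
      and eq: "\<forall>b<d. P $$ (ri l a, b) = Q (l - 1) $$ (a, b)" for l a b
  proof -
    have a1: "a < r 1" using r_le[of 1 l] l a by simp
    have "Q l = Q (l - 1) * M" using QS[of "l - 1"] l by simp
    then show ?thesis
      using eq by (simp add: mult_mat_index[OF P M ri_less[OF l a] b] mult_mat_index[OF Q M a1 b] del: index_mult_mat)
  qed
  show ?thesis
    unfolding shape
  proof
    assume L: "\<forall>l\<in>{1..k}. \<forall>a<r l. \<forall>b<d. P $$ (ri l a, b) = Q (l - 1) $$ (a, b)"
    show "\<forall>l. 1 \<le> l \<and> l < k \<longrightarrow> (\<forall>a<r (l + 1). \<forall>b<d. P $$ (ri (l + 1) a, b) = (P * M) $$ (ri l a, b))"
    proof (intro allI impI)
      fix l a b assume l: "1 \<le> l \<and> l < k" and a: "a < r (l + 1)" and b: "b < d"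
      have al: "a < r l" using a r_antimono[of l] l by simp
      have "\<forall>b<d. P $$ (ri l a, b) = Q (l - 1) $$ (a, b)" using L l al by simp
      from step[OF _ _ al b this] have "(P * M) $$ (ri l a, b) = Q l $$ (a, b)" using l by simp
      moreover have "P $$ (ri (l + 1) a, b) = Q l $$ (a, b)" using L[rule_format, of "l + 1" a b] l a b by simp
      ultimately show "P $$ (ri (l + 1) a, b) = (P * M) $$ (ri l a, b)" by simp
    qed
  next
    assume R: "\<forall>l. 1 \<le> l \<and> l < k \<longrightarrow> (\<forall>a<r (l + 1). \<forall>b<d. P $$ (ri (l + 1) a, b) = (P * M) $$ (ri l a, b))"
    have "Suc l \<le> k \<longrightarrow> (\<forall>a<r (Suc l). \<forall>b<d. P $$ (ri (Suc l) a, b) = Q l $$ (a, b))" for l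
    proof (induction l)
      case 0
      then show ?case unfolding Q0 using P by (auto simp: row_block_def block_offset_1 ri_1)
    next
      case (Suc l)
      show ?case
      proof (intro impI allI)
        fix a b assume l: "Suc (Suc l) \<le> k" and a: "a < r (Suc (Suc l))" and b: "b < d"
        have al: "a < r (Suc l)" using a r_antimono[of "Suc l"] l by simp
        have "\<forall>b<d. P $$ (ri (Suc l) a, b) = Q (Suc l - 1) $$ (a, b)" using Suc l al by simp
        from step[OF _ _ al b this] have "(P * M) $$ (ri (Suc l) a, b) = Q (Suc l) $$ (a, b)" using l by simp
        then show "P $$ (ri (Suc (Suc l)) a, b) = Q (Suc l) $$ (a, b)" using R[rule_format, of "Suc l" a b] l a b by simp
      qed
    qed
    then have "\<forall>a<r l. \<forall>b<d. P $$ (ri l a, b) = Q (l - 1) $$ (a, b)" if "1 \<le> l" "l \<le> k" for l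
      using that by (cases l) auto
    then show "\<forall>l\<in>{1..k}. \<forall>a<r l. \<forall>b<d. P $$ (ri l a, b) = Q (l - 1) $$ (a, b)" by simp
  qed
qed

text \<open>By conjugacy of the two partitions, \<open>\<kappa> (Suc j)\<close> is the last block
  that contains row j.\<close>

lemma kappa_props:
  assumes "j < r 1"
  shows "1 \<le> \<kappa> (Suc j)" "\<kappa> (Suc j) \<le> k" "1 \<le> l \<Longrightarrow> l \<le> k \<Longrightarrow> j < r l \<longleftrightarrow> l \<le> \<kappa> (Suc j)"
proof -
  let ?S = "{l. l < k \<and> j < r (Suc l)}"
  have S: "?S = {..<card ?S}"
  proof (rule down_closed_eq_lessThan_card)
    show "x \<in> ?S" if "y \<in> ?S" "x \<le> y" for x y
      using that r_le[of "Suc x" "Suc y"] by auto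
  qed simp
  have "{l. 1 \<le> l \<and> l \<le> k \<and> j < r l} = Suc ` ?S"
  proof (intro subset_antisym subsetI)
    fix l assume "l \<in> {l. 1 \<le> l \<and> l \<le> k \<and> j < r l}"
    then show "l \<in> Suc ` ?S" by (cases l) auto
  qed auto
  then have c: "\<kappa> (Suc j) = card ?S" unfolding kappa by (simp add: card_image)
  have 0: "0 \<in> ?S" using assms k_pos by simp
  have iff: "l \<in> ?S \<longleftrightarrow> l < \<kappa> (Suc j)" for l unfolding c using S by blast
  show "1 \<le> \<kappa> (Suc j)" using iff 0 by (simp add: Suc_leI)
  show "\<kappa> (Suc j) \<le> k" using iff[of "\<kappa> (Suc j) - 1"] \<open>1 \<le> \<kappa> (Suc j)\<close> by auto
  show "j < r l \<longleftrightarrow> l \<le> \<kappa> (Suc j)" if "1 \<le> l" "l \<le> k" using iff[of "l - 1"] that by auto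
qed

lemma row_power_kappa:
  assumes M: "M \<in> carrier_mat n n" and P: "P \<in> carrier_mat n n" and sh: "has_shape r k M P"
    and j: "j < r 1" and b: "b < n"
  shows "(P * M) $$ (ri (\<kappa> (Suc j)) j, b) = (P * M ^\<^sub>m \<kappa> (Suc j)) $$ (j, b)"
proof -
  note kp = kappa_props[OF j]
  have Mp: "M ^\<^sub>m l \<in> carrier_mat n n" for l using M by simp
  have PMp: "P * M ^\<^sub>m l \<in> carrier_mat n n" for l using P Mp by simp
  have S: "P * M ^\<^sub>m Suc l = (P * M ^\<^sub>m l) * M" for l using assoc_mult_mat[OF P Mp M] by simp
  have jn: "j < n" using j r1_le_n by simp
  have "1 \<le> l \<longrightarrow> l \<le> \<kappa> (Suc j) \<longrightarrow> (\<forall>b<n. P $$ (ri l j, b) = (P * M ^\<^sub>m (l - 1)) $$ (j, b))" for l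
  proof (induction l)
    case (Suc l)
    show ?case
    proof (cases "l = 0")
      case True
      then show ?thesis using P M by (simp add: ri_1)
    next
      case False
      show ?thesis
      proof (intro impI allI)
        fix b assume l: "Suc l \<le> \<kappa> (Suc j)" and b: "b < n"
        have lk: "1 \<le> l" "l < k" "l \<le> k" using False l kp(2) by auto
        have jr: "j < r (l + 1)" "j < r l" using kp(3)[of "l + 1"] kp(3)[of l] l lk by auto
        have IH: "\<forall>b<n. P $$ (ri l j, b) = (P * M ^\<^sub>m (l - 1)) $$ (j, b)" using Suc l lk by simp
        have "P $$ (ri (Suc l) j, b) = (P * M) $$ (ri l j, b)"
          using sh[unfolded has_shape_iff[OF M P]] lk jr b by simp
        also have "\<dots> = ((P * M ^\<^sub>m (l - 1)) * M) $$ (j, b)"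
          using IH by (simp add: mult_mat_index[OF P M ri_less[OF lk(1,3) jr(2)] b] mult_mat_index[OF PMp M jn b] del: index_mult_mat)
        also have "\<dots> = (P * M ^\<^sub>m (Suc l - 1)) $$ (j, b)" using S[of "l - 1"] lk by simp
        finally show "P $$ (ri (Suc l) j, b) = (P * M ^\<^sub>m (Suc l - 1)) $$ (j, b)" .
      qed
    qed
  qed simp
  from this[of "\<kappa> (Suc j)"] have eq: "\<forall>b<n. P $$ (ri (\<kappa> (Suc j)) j, b) = (P * M ^\<^sub>m (\<kappa> (Suc j) - 1)) $$ (j, b)"
    using kp(1) by simp
  have jr: "j < r (\<kappa> (Suc j))" using kp(3)[OF kp(1,2)] by simp
  have "(P * M) $$ (ri (\<kappa> (Suc j)) j, b) = ((P * M ^\<^sub>m (\<kappa> (Suc j) - 1)) * M) $$ (j, b)"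
    using eq by (simp add: mult_mat_index[OF P M ri_less[OF kp(1,2) jr] b] mult_mat_index[OF PMp M jn b] del: index_mult_mat)
  then show ?thesis using S[of "\<kappa> (Suc j) - 1"] kp(1) by simp
qed

text \<open>The equation splits by rows. The rows that continue into the next block state the shape
  of P; the last row of index j, in block \<open>\<kappa> (Suc j)\<close>, states that row j of K P
  is row j of \<open>P * M ^\<^sub>m \<kappa> (Suc j)\<close>.\<close>

lemma closed_loop_eq_iff:
  assumes M: "M \<in> carrier_mat n n" and P: "P \<in> carrier_mat n n" and K: "K \<in> carrier_mat (r 1) n"
  shows "(F + G1 * K) * P = P * M \<longleftrightarrow> has_shape r k M P \<and>
    (\<forall>j<r 1. \<forall>b<n. (K * P) $$ (j, b) = (P * M ^\<^sub>m \<kappa> (Suc j)) $$ (j, b))"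
proof
  have C: "(F + G1 * K) * P \<in> carrier_mat n n" "P * M \<in> carrier_mat n n"
    using F_carrier G1_carrier K P M by auto
  note ci = closed_loop_index[OF K P]
  {
    assume eq: "(F + G1 * K) * P = P * M"
    have sh: "has_shape r k M P"
      unfolding has_shape_iff[OF M P]
    proof (intro allI impI)
      fix l a b assume l: "1 \<le> l \<and> l < k" and a: "a < r (l + 1)" and b: "b < n"
      have "a < r l" using a r_antimono[of l] l by simp
      then show "P $$ (ri (l + 1) a, b) = (P * M) $$ (ri l a, b)" using ci[of l a b] l a b eq by simp
    qed
    moreover have "(K * P) $$ (j, b) = (P * M ^\<^sub>m \<kappa> (Suc j)) $$ (j, b)" if j: "j < r 1" and b: "b < n" for j b
    proof -
      note kp = kappa_props[OF j]
      have jr: "j < r (\<kappa> (Suc j))" and nf: "\<not> (\<kappa> (Suc j) < k \<and> j < r (\<kappa> (Suc j) + 1))"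
        using kp(3)[OF kp(1,2)] kp(3)[of "\<kappa> (Suc j) + 1"] by auto
      show ?thesis
        using ci[OF kp(1,2) jr b] unfolding if_not_P[OF nf] eq row_power_kappa[OF M P sh j b] by simp
    qed
    ultimately show "has_shape r k M P \<and> (\<forall>j<r 1. \<forall>b<n. (K * P) $$ (j, b) = (P * M ^\<^sub>m \<kappa> (Suc j)) $$ (j, b))"
      by blast
  }
  assume R: "has_shape r k M P \<and> (\<forall>j<r 1. \<forall>b<n. (K * P) $$ (j, b) = (P * M ^\<^sub>m \<kappa> (Suc j)) $$ (j, b))"
  show "(F + G1 * K) * P = P * M"
  proof (intro eq_matI)
    fix u b assume "u < dim_row (P * M)" "b < dim_col (P * M)"
    then have u: "u < n" and b: "b < n" using C by auto
    obtain l a where l: "1 \<le> l" "l \<le> k" and a: "a < r l" and ua: "u = ri l a" using ri_exists[OF u] by blast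
    have a1: "a < r 1" using r_le[of 1 l] l a by simp
    note kp = kappa_props[OF a1]
    show "((F + G1 * K) * P) $$ (u, b) = (P * M) $$ (u, b)"
    proof (cases "l < k \<and> a < r (l + 1)")
      case True
      then show ?thesis unfolding ua using ci[OF l a b] R[unfolded has_shape_iff[OF M P]] l b by simp
    next
      case False
      have "l \<le> \<kappa> (Suc a)" using kp(3)[OF l] a by simp
      moreover have "\<not> l + 1 \<le> \<kappa> (Suc a)"
        using False kp(2) kp(3)[of "l + 1"] by (cases "l < k") auto
      ultimately have "\<kappa> (Suc a) = l" by simp
      moreover have "(K * P) $$ (a, b) = (P * M ^\<^sub>m \<kappa> (Suc a)) $$ (a, b)" using R a1 b by blast
      moreover have "(P * M) $$ (ri (\<kappa> (Suc a)) a, b) = (P * M ^\<^sub>m \<kappa> (Suc a)) $$ (a, b)"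
        using row_power_kappa[OF M P _ a1 b] R by blast
      ultimately show ?thesis unfolding ua ci[OF l a b] if_not_P[OF False] by simp
    qed
  qed (use C F_carrier G1_carrier K P M in auto)
qed

lemma feedback_of_eq_iff:
  assumes M: "M \<in> carrier_mat n n" and P: "P \<in> carrier_mat n n" and d: "det P \<noteq> 0" and K: "K \<in> carrier_mat (r 1) n"
  shows "K = feedback_of \<kappa> (r 1) M P \<longleftrightarrow> (\<forall>j<r 1. \<forall>b<n. (K * P) $$ (j, b) = (P * M ^\<^sub>m \<kappa> (Suc j)) $$ (j, b))"
proof -
  define Q where "Q = mat (r 1) n (\<lambda>(j, b). (P * M ^\<^sub>m \<kappa> (Suc j)) $$ (j, b))"
  have Q: "Q \<in> carrier_mat (r 1) n" unfolding Q_def by simp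
  note inv = adj_inverse[OF P d]
  define B where "B = the (mat_inverse P)"
  have B: "B \<in> carrier_mat n n" "P * B = 1\<^sub>m n" "B * P = 1\<^sub>m n" unfolding B_def inv(4) using inv(1-3) by auto
  have fb: "feedback_of \<kappa> (r 1) M P = Q * B" unfolding feedback_of_def Q_def B_def using P by simp
  have KP: "K * P \<in> carrier_mat (r 1) n" using K P by simp
  have "K = Q * B \<longleftrightarrow> K * P = Q"
  proof
    assume "K = Q * B"
    then have "K * P = Q * (B * P)" using assoc_mult_mat[OF Q B(1) P] by simp
    then show "K * P = Q" using B Q by simp
  next
    assume "K * P = Q"
    then have "Q * B = K * (P * B)" using assoc_mult_mat[OF K P B(1)] by simp
    then show "K = Q * B" using B K by simp
  qed
  also have "\<dots> \<longleftrightarrow> (\<forall>j<r 1. \<forall>b<n. (K * P) $$ (j, b) = (P * M ^\<^sub>m \<kappa> (Suc j)) $$ (j, b))"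
    using KP by (auto simp: mat_eq_iff Q_def simp del: index_mult_mat(1))
  finally show ?thesis unfolding fb .
qed

lemma feedback_of_carrier:
  assumes "P \<in> carrier_mat n n" "det P \<noteq> 0"
  shows "feedback_of \<kappa> (r 1) M P \<in> carrier_mat (r 1) n"
  unfolding feedback_of_def adj_inverse(4)[OF assms] by (rule mult_carrier_mat[of _ _ n]) (use assms in auto)

end

text \<open>The combinatorics is read off the sizes in the canonical form. F is n by n, so the first
  k indices add up to n; this exhausts the rank and makes all later indices vanish; and the width of
  \<open>G1\<close>, equal to the first index, makes the sequence nonincreasing.\<close>

lemma brunovsky_indicesI:
  assumes "1 \<le> n" and F: "F \<in> carrier_mat n n" and G: "G \<in> carrier_mat n m"
    and r: "r = brunovsky_index F G" and \<kappa>: "\<kappa> = controllability_index F G" and k: "k = \<kappa> 1"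
    and Feq: "F = brunovsky_F r k" and G1eq: "G1 = brunovsky_G1 r k" and G1: "G1 \<in> carrier_mat n (r 1)"
  shows "brunovsky_indices n k r \<kappa>"
proof -
  define R where "R i = mat_rank (ctrb F G i)" for i
  have ri: "r i = R i - R (i - 1)" for i unfolding r brunovsky_index_def R_def ..
  have R_le: "R i \<le> n" for i unfolding R_def using mat_rank_le_dim_row[of "ctrb F G i"] G by (simp add: ctrb_def)
  have R_mono: "R i \<le> R j" if "i \<le> j" for i j
    unfolding R_def
  proof (rule mat_rank_mono)
    show "dim_row (ctrb F G i) = dim_row (ctrb F G j)" by (simp add: ctrb_def)
    show "set (cols (ctrb F G i)) \<subseteq> set (cols (ctrb F G j))"
    proof
      fix v assume "v \<in> set (cols (ctrb F G i))"
      then obtain b where b: "b < i * dim_col G" "v = col (ctrb F G i) b"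
        by (auto simp: cols_def ctrb_def)
      then have bj: "b < j * dim_col G" using that by (meson less_le_trans mult_le_mono1)
      have "v = col (ctrb F G j) b" unfolding b(2) using b(1) bj by (intro eq_vecI) (auto simp: ctrb_def)
      then show "v \<in> set (cols (ctrb F G j))" using bj by (auto simp: cols_def ctrb_def)
    qed
  qed
  have sum: "(\<Sum>l=1..k. r l) = n" using F unfolding Feq brunovsky_F_def block_mat_def by auto
  have k1: "1 \<le> k" using sum assms(1) by (cases k) auto
  have "(\<Sum>l=1..p. r l) + R 0 = R p" for p
  proof (induction p)
    case (Suc p)
    then show ?case using R_mono[of p "Suc p"] ri[of "Suc p"] by simp
  qed simp
  then have Rk: "R k = n" using sum R_le[of k] by (metis le_add1 le_antisym)
  have r0: "r l = 0" if "k < l" for l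
  proof -
    have "k \<le> l - 1" using that by simp
    from R_mono[OF this] R_le[of l] Rk show ?thesis unfolding ri by simp
  qed
  have anti: "\<forall>l\<in>{1..k}. r (l + 1) \<le> r l"
  proof -
    let ?r' = "\<lambda>i. if i \<le> k then r i else 0"
    have "dim_col G1 = (\<Sum>j=1..k. ?r' (k - j + 1) - ?r' (k - j + 2))"
      unfolding G1eq brunovsky_G1_def Let_def block_mat_def by simp
    also have "\<dots> = (\<Sum>i=1..k. ?r' i - ?r' (i + 1))"
      by (rule sum.reindex_bij_witness[of _ "\<lambda>i. k - i + 1" "\<lambda>i. k - i + 1"]) (auto simp: Suc_diff_le)
    finally have "(\<Sum>i=1..k. ?r' i - ?r' (i + 1)) + ?r' (k + 1) = ?r' 1" using G1 k1 by simp
    from telescope_truncated(2)[of ?r' k, OF this] show ?thesis using r0 by (auto split: if_splits)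
  qed
  have "\<kappa> (Suc a) = card {l. 1 \<le> l \<and> l \<le> k \<and> a < r l}" for a
  proof -
    have "{j. 1 \<le> j \<and> Suc a \<le> r j} = {l. 1 \<le> l \<and> l \<le> k \<and> a < r l}"
    proof (intro subset_antisym subsetI)
      fix j assume "j \<in> {j. 1 \<le> j \<and> Suc a \<le> r j}"
      then show "j \<in> {l. 1 \<le> l \<and> l \<le> k \<and> a < r l}" using r0[of j] by (cases "k < j") auto
    qed auto
    then show ?thesis unfolding \<kappa> controllability_index_def r by simp
  qed
  then show ?thesis using k1 sum anti by unfold_locales auto
qed

section \<open>The charts\<close>

lemma openin_coords_topology:
  "openin (coords_topology c X) S \<longleftrightarrow> (\<exists>T. open T \<and> S = snd c -` T \<inter> X)"
  unfolding coords_topology_def openin_pullback_topology by simp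

lemma smooth_mapI:
  assumes "\<And>x. x \<in> X \<Longrightarrow> \<exists>U g. openin (top_of_set (euc (fst c))) U \<and> snd c x \<in> U \<and>
        (\<forall>j\<in>fst d. C_inf (fst c) U (g j)) \<and>
        (\<forall>y\<in>X. snd c y \<in> U \<longrightarrow> (\<forall>j\<in>fst d. snd d (f y) j = g j (snd c y)))"
  shows "smooth_map c d X f"
  using assms unfolding smooth_map_def C_inf_def by blast

lemma smooth_mapD:
  assumes "smooth_map c d X f" "x \<in> X"
  obtains U g where "openin (top_of_set (euc (fst c))) U" "snd c x \<in> U"
        "\<And>j. j \<in> fst d \<Longrightarrow> C_inf (fst c) U (g j)"
        "\<And>y j. y \<in> X \<Longrightarrow> snd c y \<in> U \<Longrightarrow> j \<in> fst d \<Longrightarrow> snd d (f y) j = g j (snd c y)"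
proof -
  obtain U g where U: "openin (top_of_set (euc (fst c))) U" "snd c x \<in> U"
        "\<forall>j\<in>fst d. \<forall>k. C_on k (fst c) U (g j)"
        "\<forall>y\<in>X. snd c y \<in> U \<longrightarrow> (\<forall>j\<in>fst d. snd d (f y) j = g j (snd c y))"
    using bspec[OF assms(1)[unfolded smooth_map_def] assms(2)] by (elim exE conjE) (rule that; assumption)
  show thesis
  proof (rule that[OF U(1,2)])
    show "C_inf (fst c) U (g j)" if "j \<in> fst d" for j using U(3) that unfolding C_inf_def by blast
    show "snd d (f y) j = g j (snd c y)" if "y \<in> X" "snd c y \<in> U" "j \<in> fst d" for y j using U(4) that by blast
  qed
qed

lemma mat_coords_simps:
  "fst (mat_coords p q) = {..<p} \<times> {..<q}"
  "snd (mat_coords p q) K (i, j) = (if i < p \<and> j < q then K $$ (i, j) else 0)"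
  by (simp_all add: mat_coords_def)

lemma mat_coords_euc: "snd (mat_coords p q) K \<in> euc ({..<p} \<times> {..<q})"
  unfolding euc_def by (auto simp: mat_coords_simps)

locale chart_setting = weyr_index n \<alpha> zs "r 1" J + brunovsky_indices n k r \<kappa>
  for n k \<alpha> zs r \<kappa> J +
  fixes es :: "(nat \<times> nat) list"
  assumes es_distinct: "distinct es" and es_set: "set es = free_positions (r 1) n \<alpha> zs J"
begin

section \<open>Blocks of columns and the closed-loop equation\<close>

abbreviation "chart_dim \<equiv> n * r 1 - orbit_dim n \<alpha>"
abbreviation "cols_of \<equiv> weyr_cols n \<alpha> zs"
abbreviation "blk i \<equiv> weyr_block n \<alpha> (zs ! i)"

lemma length_es: "length es = chart_dim"
  using distinct_card[OF es_distinct] es_set card_free_positions by simp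

lemma A_dim: "dim_row A = n" "dim_col A = n"
  using A_carrier by auto

lemma cols_carrier: "P \<in> carrier_mat n n \<Longrightarrow> cols_of i P \<in> carrier_mat n (size_of i)"
  unfolding weyr_cols_def by auto

lemma cols_index: "P \<in> carrier_mat n n \<Longrightarrow> u < n \<Longrightarrow> b < size_of i \<Longrightarrow> cols_of i P $$ (u, b) = P $$ (u, off i + b)"
  unfolding weyr_cols_def by simp

lemma cols_mult:
  assumes P: "P \<in> carrier_mat n n" and i: "i < length zs" and u: "u < n" and b: "b < size_of i"
  shows "(cols_of i P * blk i) $$ (u, b) = (P * A) $$ (u, off i + b)"
proof -
  have "(P * A) $$ (u, off i + b) = (\<Sum>d<n. P $$ (u, d) * A $$ (d, off i + b))"
    using mult_mat_index[OF P A_carrier u off_pos_less[OF i b]] .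
  also have "\<dots> = (\<Sum>d\<in>(\<lambda>x. off i + x) ` {..<size_of i}. P $$ (u, d) * A $$ (d, off i + b))"
  proof (rule sum.mono_neutral_right)
    show "(\<lambda>x. off i + x) ` {..<size_of i} \<subseteq> {..<n}" using off_pos_less[OF i] by auto
    show "\<forall>d\<in>{..<n} - (\<lambda>x. off i + x) ` {..<size_of i}. P $$ (u, d) * A $$ (d, off i + b) = 0"
    proof
      fix d assume d: "d \<in> {..<n} - (\<lambda>x. off i + x) ` {..<size_of i}"
      then obtain i' x where h: "i' < length zs" "x < size_of i'" "d = off i' + x" using off_pos_exists[of d] by auto
      then have "i' \<noteq> i" using d by auto
      then show "P $$ (u, d) * A $$ (d, off i + b) = 0" using A_block_index[OF h(1) i h(2) b] h(3) by simp
    qed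
  qed simp
  also have "\<dots> = (\<Sum>x<size_of i. P $$ (u, off i + x) * A $$ (off i + x, off i + b))"
    by (subst sum.reindex) (auto simp: inj_on_def)
  also have "\<dots> = (\<Sum>x<size_of i. cols_of i P $$ (u, x) * blk i $$ (x, b))"
    using A_block_index[OF i i _ b] cols_index[OF P u] by (intro sum.cong refl) auto
  also have "\<dots> = (cols_of i P * blk i) $$ (u, b)"
    by (rule mult_mat_index[OF cols_carrier[OF P] dim_weyr_block u b, symmetric])
  finally show ?thesis by simp
qed

lemma has_shape_cols_iff:
  assumes P: "P \<in> carrier_mat n n"
  shows "has_shape r k A P \<longleftrightarrow> (\<forall>i<length zs. has_shape r k (blk i) (cols_of i P))"
proof -
  have 1: "cols_of i P $$ (ri (l + 1) a, x) = (cols_of i P * blk i) $$ (ri l a, x) \<longleftrightarrow>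
     P $$ (ri (l + 1) a, off i + x) = (P * A) $$ (ri l a, off i + x)"
    if i: "i < length zs" and l: "1 \<le> l" "l < k" and a: "a < r (l + 1)" and x: "x < size_of i" for i l a x
  proof -
    have "ri (l + 1) a < n" "ri l a < n" using ri_less[of "l + 1" a] ri_less[of l a] r_antimono[of l] l a by auto
    then show ?thesis unfolding cols_mult[OF P i _ x] using cols_index[OF P _ x] cols_mult[OF P i _ x] by (simp del: index_mult_mat)
  qed
  show ?thesis
  proof
    assume L: "has_shape r k A P"
    show "\<forall>i<length zs. has_shape r k (blk i) (cols_of i P)"
    proof (intro allI impI)
      fix i assume i: "i < length zs"
      show "has_shape r k (blk i) (cols_of i P)"
        unfolding has_shape_iff[OF dim_weyr_block[of "zs ! i"] cols_carrier[OF P, of i]]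
      proof (intro allI impI)
        fix l a x assume l: "1 \<le> l \<and> l < k" and a: "a < r (l + 1)" and x: "x < size_of i"
        have "P $$ (ri (l + 1) a, off i + x) = (P * A) $$ (ri l a, off i + x)"
          using L[unfolded has_shape_iff[OF A_carrier P]] l a off_pos_less[OF i x] by blast
        then show "cols_of i P $$ (ri (l + 1) a, x) = (cols_of i P * blk i) $$ (ri l a, x)"
          using 1[OF i _ _ a x] l by blast
      qed
    qed
  next
    assume R: "\<forall>i<length zs. has_shape r k (blk i) (cols_of i P)"
    show "has_shape r k A P"
      unfolding has_shape_iff[OF A_carrier P]
    proof (intro allI impI)
      fix l a b assume l: "1 \<le> l \<and> l < k" and a: "a < r (l + 1)" and b: "b < n"
      obtain i x where h: "i < length zs" "x < size_of i" "b = off i + x" using off_pos_exists[OF b] by blast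
      have "has_shape r k (blk i) (cols_of i P)" using R h by simp
      then have "cols_of i P $$ (ri (l + 1) a, x) = (cols_of i P * blk i) $$ (ri l a, x)"
        unfolding has_shape_iff[OF dim_weyr_block[of "zs ! i"] cols_carrier[OF P, of i]] using l a h(2) by blast
      then show "P $$ (ri (l + 1) a, b) = (P * A) $$ (ri l a, b)" unfolding h(3) using 1[OF h(1) _ _ a h(2)] l by blast
    qed
  qed
qed

lemma has_shape_carrier: "has_shape r k M P \<Longrightarrow> P \<in> carrier_mat n (dim_row M)"
  unfolding has_shape_def using sum_r by simp

lemma P_set_iff: "P \<in> P_set r k A \<longleftrightarrow> P \<in> carrier_mat n n \<and> has_shape r k A P \<and> det P \<noteq> 0"
  unfolding P_set_def using has_shape_carrier[of A P] mat_rank_eq_iff_det[of P n] A_dim by auto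

lemma mat_rank_cols:
  assumes P: "P \<in> carrier_mat n n" and d: "det P \<noteq> 0" and i: "i < length zs"
  shows "mat_rank (cols_of i P) = size_of i"
proof (rule mat_rank_trivial_kernel[OF cols_carrier[OF P]])
  fix v assume v: "\<And>a. a < n \<Longrightarrow> (\<Sum>b<size_of i. cols_of i P $$ (a, b) * v b) = 0"
  define v' where "v' b = (if off i \<le> b \<and> b < off i + size_of i then v (b - off i) else 0)" for b
  have "(\<Sum>b<n. P $$ (a, b) * v' b) = 0" if a: "a < n" for a
  proof -
    have "(\<Sum>b<n. P $$ (a, b) * v' b) = (\<Sum>b\<in>(\<lambda>x. off i + x) ` {..<size_of i}. P $$ (a, b) * v' b)"
    proof (rule sum.mono_neutral_right)
      show "(\<lambda>x. off i + x) ` {..<size_of i} \<subseteq> {..<n}" using off_pos_less[OF i] by auto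
      show "\<forall>b\<in>{..<n} - (\<lambda>x. off i + x) ` {..<size_of i}. P $$ (a, b) * v' b = 0"
      proof
        fix b assume b: "b \<in> {..<n} - (\<lambda>x. off i + x) ` {..<size_of i}"
        have "\<not> (off i \<le> b \<and> b < off i + size_of i)"
        proof
          assume h: "off i \<le> b \<and> b < off i + size_of i"
          then have "b = off i + (b - off i)" "b - off i < size_of i" by auto
          then show False using b by blast
        qed
        then have "v' b = 0" unfolding v'_def by (rule if_not_P)
        then show "P $$ (a, b) * v' b = 0" by simp
      qed
    qed simp
    also have "\<dots> = (\<Sum>x<size_of i. P $$ (a, off i + x) * v x)"
      by (subst sum.reindex) (auto simp: inj_on_def v'_def)
    also have "\<dots> = 0" using v[OF a] cols_index[OF P a] by simp
    finally show ?thesis .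
  qed
  from det_nonzeroD[OF P d this] have z: "v' b = 0" if "b < n" for b using that by blast
  show "\<forall>b<size_of i. v b = 0"
    using z off_pos_less[OF i] by (fastforce simp: v'_def)
qed

text \<open>An invertible P has column blocks of full rank, so for these blocks membership in
  \<open>P_set\<close> reduces to their shape.\<close>

lemma V_set_iff:
  "P \<in> V_set r k n \<alpha> zs J \<longleftrightarrow> P \<in> carrier_mat n n \<and> has_shape r k A P \<and> det P \<noteq> 0 \<and> nondegenerate I P"
proof -
  have U: "cols_of i P \<in> U_set r k n \<alpha> (zs ! i) (J i) \<longleftrightarrow>
    (\<forall>j\<in>{1..len i}. if zs ! i \<in> \<real> then invertible_mat (pick_mat (cols_of i P) (J i j) (tau i j))
        else invertible_mat (diamond (pick_mat (cols_of i P) (J i j) (2 * tau i j))))"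
    if P: "P \<in> carrier_mat n n" "has_shape r k A P" "det P \<noteq> 0" and i: "i < length zs" for i
  proof -
    have "cols_of i P \<in> P_set r k (blk i)"
      unfolding P_set_def mem_Collect_eq carrier_matD(1)[OF dim_weyr_block]
      using has_shape_cols_iff[OF P(1)] P(2) i mat_rank_cols[OF P(1,3) i] by blast
    then show ?thesis unfolding U_set_def by simp
  qed
  show ?thesis
    unfolding V_set_def mem_Collect_eq P_set_iff using U nondegenerate_iff[of P] by meson
qed

abbreviation closed_loop :: "real mat \<Rightarrow> real mat \<Rightarrow> bool" where
  "closed_loop K P \<equiv> (F + G1 * K) * P = P * A"

lemma closed_loop_iff_feedback_of:
  assumes "P \<in> carrier_mat n n" "det P \<noteq> 0" "K \<in> carrier_mat (r 1) n"
  shows "closed_loop K P \<longleftrightarrow> has_shape r k A P \<and> K = feedback_of \<kappa> (r 1) A P"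
  unfolding closed_loop_eq_iff[OF A_carrier assms(1,3)] feedback_of_eq_iff[OF A_carrier assms] ..

lemma feedback_set_iff:
  "K \<in> feedback_set n \<alpha> F G1 \<longleftrightarrow> K \<in> carrier_mat (r 1) n \<and>
     (\<exists>P\<in>carrier_mat n n. det P \<noteq> 0 \<and> closed_loop K P)"
proof -
  have dG: "dim_col G1 = r 1" using G1_carrier by simp
  have "F + G1 * K \<in> inv_poly_class n \<alpha> \<longleftrightarrow> (\<exists>P\<in>carrier_mat n n. det P \<noteq> 0 \<and> closed_loop K P)"
    if K: "K \<in> carrier_mat (r 1) n"
  proof
    assume "F + G1 * K \<in> inv_poly_class n \<alpha>"
    from inv_poly_class_similar[OF A_inv_poly_class this] obtain T T' where
      T: "T \<in> carrier_mat n n" "T' \<in> carrier_mat n n" "T' * T = 1\<^sub>m n" "T * A = (F + G1 * K) * T" by blast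
    have "det T' * det T = 1" using det_mult[OF T(2,1)] T(3) by simp
    then have "det T \<noteq> 0" by auto
    then show "\<exists>P\<in>carrier_mat n n. det P \<noteq> 0 \<and> closed_loop K P" using T by metis
  next
    assume "\<exists>P\<in>carrier_mat n n. det P \<noteq> 0 \<and> closed_loop K P"
    then obtain P where P: "P \<in> carrier_mat n n" "det P \<noteq> 0" "closed_loop K P" by blast
    show "F + G1 * K \<in> inv_poly_class n \<alpha>"
      by (rule inv_poly_class_similarI[OF A_inv_poly_class _ P(1) adj_inverse(1)[OF P(1,2)] adj_inverse(3)[OF P(1,2)]
            adj_inverse(2)[OF P(1,2)] P(3)[symmetric]])
        (use F_carrier G1_carrier K in auto)
  qed
  then show ?thesis unfolding feedback_set_def dG by blast
qed

subsection \<open>The map \<open>\<nu>\<close>\<close>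

definition first_block :: "(nat \<Rightarrow> real) \<Rightarrow> real mat" where
  "first_block x = mat (r 1) n (\<lambda>ub. if ub \<in> presc_pos then pres_val ub else x (the_inv_into {..<length es} ((!) es) ub))"

definition nu_mat :: "(nat \<Rightarrow> real) \<Rightarrow> real mat" where
  "nu_mat x = mat n n (\<lambda>(u, b). (first_block x * A ^\<^sub>m (block_index r u - 1)) $$ (u - block_offset r (block_index r u), b))"

lemma first_block_carrier: "first_block x \<in> carrier_mat (r 1) n"
  unfolding first_block_def by simp

lemma nu_mat_carrier: "nu_mat x \<in> carrier_mat n n"
  unfolding nu_mat_def by simp

lemma nu_mat_index:
  assumes "1 \<le> l" "l \<le> k" "a < r l" "b < n"
  shows "nu_mat x $$ (ri l a, b) = (first_block x * A ^\<^sub>m (l - 1)) $$ (a, b)"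
  using ri_less[OF assms(1-3)] assms block_index_eq[of l a r] unfolding nu_mat_def by (simp add: ri_def)

lemma nu_mat_first_rows: "a < r 1 \<Longrightarrow> b < n \<Longrightarrow> nu_mat x $$ (a, b) = first_block x $$ (a, b)"
  using nu_mat_index[of 1 a b x] k_pos A_carrier right_mult_one_mat[OF first_block_carrier[of x]] by (simp add: ri_1)

lemma nu_mat_shape: "has_shape r k A (nu_mat x)"
  unfolding has_shape_iff[OF A_carrier nu_mat_carrier]
proof (intro allI impI)
  fix l a b assume l: "1 \<le> l \<and> l < k" and a: "a < r (l + 1)" and b: "b < n"
  have al: "a < r l" "a < r 1" using a r_antimono[of l] r_le[of 1 "l + 1"] l by auto
  have Ap: "A ^\<^sub>m (l - 1) \<in> carrier_mat n n" using A_carrier by simp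
  have Q: "first_block x * A ^\<^sub>m (l - 1) \<in> carrier_mat (r 1) n" using first_block_carrier Ap by (rule mult_carrier_mat)
  have "A ^\<^sub>m l = A ^\<^sub>m (l - 1) * A" using l by (cases l) auto
  then have "first_block x * A ^\<^sub>m l = (first_block x * A ^\<^sub>m (l - 1)) * A"
    using assoc_mult_mat[OF first_block_carrier Ap A_carrier] by simp
  then have "nu_mat x $$ (ri (l + 1) a, b) = ((first_block x * A ^\<^sub>m (l - 1)) * A) $$ (a, b)"
    using nu_mat_index[of "l + 1" a b x] l a b by simp
  also have "\<dots> = (\<Sum>d<n. (first_block x * A ^\<^sub>m (l - 1)) $$ (a, d) * A $$ (d, b))"
    by (rule mult_mat_index[OF Q A_carrier al(2) b])
  also have "\<dots> = (\<Sum>d<n. nu_mat x $$ (ri l a, d) * A $$ (d, b))"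
    using nu_mat_index[of l a _ x] l al by simp
  also have "\<dots> = (nu_mat x * A) $$ (ri l a, b)"
    using mult_mat_index[OF nu_mat_carrier A_carrier ri_less[of l a] b] l al by simp
  finally show "nu_mat x $$ (ri (l + 1) a, b) = (nu_mat x * A) $$ (ri l a, b)" .
qed

lemma has_shape_eqI:
  assumes P: "P \<in> carrier_mat n n" "has_shape r k A P" and P': "P' \<in> carrier_mat n n" "has_shape r k A P'"
    and eq: "\<And>a b. a < r 1 \<Longrightarrow> b < n \<Longrightarrow> P $$ (a, b) = P' $$ (a, b)"
  shows "P = P'"
proof (intro eq_matI)
  have "Suc l \<le> k \<longrightarrow> (\<forall>a<r (Suc l). \<forall>b<n. P $$ (ri (Suc l) a, b) = P' $$ (ri (Suc l) a, b))" for l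
  proof (induction l)
    case 0
    then show ?case using eq by (simp add: ri_1)
  next
    case (Suc l)
    show ?case
    proof (intro impI allI)
      fix a b assume l: "Suc (Suc l) \<le> k" and a: "a < r (Suc (Suc l))" and b: "b < n"
      have al: "a < r (Suc l)" using a r_antimono[of "Suc l"] l by simp
      have u: "ri (Suc l) a < n" using ri_less al l by simp
      have "P $$ (ri (Suc (Suc l)) a, b) = (P * A) $$ (ri (Suc l) a, b)"
        "P' $$ (ri (Suc (Suc l)) a, b) = (P' * A) $$ (ri (Suc l) a, b)"
        using P(2)[unfolded has_shape_iff[OF A_carrier P(1)], rule_format, of "Suc l" a b]
          P'(2)[unfolded has_shape_iff[OF A_carrier P'(1)], rule_format, of "Suc l" a b] l a b by simp_all
      then show "P $$ (ri (Suc (Suc l)) a, b) = P' $$ (ri (Suc (Suc l)) a, b)"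
        using Suc al l by (simp add: mult_mat_index[OF P(1) A_carrier u b] mult_mat_index[OF P'(1) A_carrier u b] del: index_mult_mat)
    qed
  qed
  note all = this
  fix u b assume "u < dim_row P'" "b < dim_col P'"
  then have "u < n" "b < n" using P' by auto
  then obtain l a where "1 \<le> l" "l \<le> k" "a < r l" "u = ri l a" using ri_exists by blast
  then show "P $$ (u, b) = P' $$ (u, b)" using all[of "l - 1"] \<open>b < n\<close> by simp
qed (use P P' in auto)

lemma es_index: "t < length es \<Longrightarrow> es ! t \<in> {..<r 1} \<times> {..<n} - presc_pos"
  using es_set free_positions_eq nth_mem by blast

lemma nu_mat_es:
  assumes t: "t < length es"
  shows "nu_mat x $$ (es ! t) = x t"
proof -
  obtain u b where ub: "es ! t = (u, b)" by fastforce
  then have h: "u < r 1" "b < n" "(u, b) \<notin> presc_pos" using es_index[OF t] by auto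
  have "the_inv_into {..<length es} ((!) es) (u, b) = t"
    unfolding ub[symmetric] using es_distinct t by (intro the_inv_into_f_f) (auto simp: inj_on_nth)
  then show ?thesis unfolding ub nu_mat_first_rows[OF h(1,2)] first_block_def using h by simp
qed

lemma nu_mat_prescribed: "prescribed_entries (nu_mat x)"
  unfolding prescribed_entries_def
proof
  fix ub assume ub: "ub \<in> presc_pos"
  then obtain u b where e: "ub = (u, b)" "u < r 1" "b < n" using presc_pos_subset by auto
  show "nu_mat x $$ ub = pres_val ub"
    unfolding e(1) nu_mat_first_rows[OF e(2,3)] first_block_def using e ub by simp
qed

lemma reduced_iff:
  assumes P: "P \<in> carrier_mat n n"
  shows "(\<forall>i<length zs. reduced_shape r k n \<alpha> (zs ! i) (J i) (cols_of i P)) \<longleftrightarrow>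
     has_shape r k A P \<and> prescribed_entries P"
proof -
  have idx: "cols_of i P $$ (I i g, lpos i c s q) = P $$ (I i g, pos i c s q)" if "(i, g, c, s, q) \<in> presc_idx" for i g c s q
  proof -
    have "I i g < n" using I_less[of i g] that r1_le_n by (auto simp: presc_idx_def valid_def)
    moreover have "lpos i c s q < size_of i" using that by (intro lpos_less) (simp add: presc_idx_def)
    ultimately show ?thesis using cols_index[OF P] by (simp add: pos_def)
  qed
  have bound: "i < length zs" if "(i, g, c, s, q) \<in> presc_idx" for i g c s q using that by (simp add: presc_idx_def valid_def)
  define S where "S i \<longleftrightarrow> (\<forall>g c s q. (i, g, c, s, q) \<in> presc_idx \<longrightarrow>
      cols_of i P $$ (I i g, lpos i c s q) = (if c = g \<and> s = 0 \<and> q = 0 then 1 else 0))" for i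
  have "prescribed_entries P \<longleftrightarrow> (\<forall>i<length zs. S i)"
  proof
    assume L: "prescribed_entries P"
    show "\<forall>i<length zs. S i"
      unfolding S_def
    proof (intro allI impI)
      fix i g c s q assume "(i, g, c, s, q) \<in> presc_idx"
      then show "cols_of i P $$ (I i g, lpos i c s q) = (if c = g \<and> s = 0 \<and> q = 0 then 1 else 0)"
        unfolding idx[OF \<open>(i, g, c, s, q) \<in> presc_idx\<close>] using L[unfolded prescribed_entries_iff] by blast
    qed
  next
    assume R: "\<forall>i<length zs. S i"
    show "prescribed_entries P"
      unfolding prescribed_entries_iff
    proof (intro allI impI)
      fix i g c s q assume presc_idx: "(i, g, c, s, q) \<in> presc_idx"
      then have "S i" using R bound by blast
      then show "P $$ (I i g, pos i c s q) = (if c = g \<and> s = 0 \<and> q = 0 then 1 else 0)"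
        unfolding S_def idx[OF presc_idx, symmetric] using presc_idx by blast
    qed
  qed
  moreover have "reduced_shape r k n \<alpha> (zs ! i) (J i) (cols_of i P) \<longleftrightarrow> has_shape r k (blk i) (cols_of i P) \<and> S i"
    if "i < length zs" for i
    unfolding S_def by (rule reduced_shape_iff[OF that])
  ultimately show ?thesis
    unfolding has_shape_cols_iff[OF P] by blast
qed

lemma eq_nu_mat:
  assumes P: "P \<in> carrier_mat n n" "has_shape r k A P" "prescribed_entries P"
    and x: "\<And>t. t < length es \<Longrightarrow> P $$ (es ! t) = x t"
  shows "P = nu_mat x"
proof (rule has_shape_eqI[OF P(1,2) nu_mat_carrier nu_mat_shape])
  fix a b assume ab: "a < r 1" "b < n"
  show "P $$ (a, b) = nu_mat x $$ (a, b)"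
  proof (cases "(a, b) \<in> presc_pos")
    case True
    then show ?thesis using P(3) nu_mat_prescribed unfolding prescribed_entries_def by metis
  next
    case False
    then have "(a, b) \<in> set es" unfolding es_set free_positions_eq using ab by simp
    then obtain t where "t < length es" "es ! t = (a, b)" by (auto simp: in_set_conv_nth)
    then show ?thesis using x[of t] nu_mat_es[of t x] by simp
  qed
qed

text \<open>Prescribed and free entries together fill the first block of rows, and the shape
  propagates it to the others, so the description that defines \<open>nu\<close> has exactly one
  solution.\<close>

lemma nu_eq: "nu r k n \<alpha> zs J es x = nu_mat x"
  unfolding nu_def
proof (rule the_equality)
  show "nu_mat x \<in> carrier_mat n n \<and>
     (\<forall>i<length zs. reduced_shape r k n \<alpha> (zs ! i) (J i) (cols_of i (nu_mat x))) \<and>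
     (\<forall>t<length es. nu_mat x $$ (es ! t) = x t)"
    using nu_mat_carrier nu_mat_es reduced_iff[OF nu_mat_carrier] nu_mat_shape nu_mat_prescribed by simp
  show "R = nu_mat x" if "R \<in> carrier_mat n n \<and>
     (\<forall>i<length zs. reduced_shape r k n \<alpha> (zs ! i) (J i) (cols_of i R)) \<and>
     (\<forall>t<length es. R $$ (es ! t) = x t)" for R
    using that reduced_iff[of R] by (intro eq_nu_mat) auto
qed

lemma nu_mat_smooth:
  assumes "u < n" "b < n"
  shows "C_inf S UNIV (\<lambda>x. nu_mat x $$ (u, b))"
proof -
  obtain l a where l: "1 \<le> l" "l \<le> k" "a < r l" "u = ri l a" using ri_exists[OF assms(1)] by blast
  have a1: "a < r 1" using r_le[of 1 l] l by simp
  have Ap: "A ^\<^sub>m (l - 1) \<in> carrier_mat n n" using A_carrier by simp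
  have "(\<lambda>x. nu_mat x $$ (u, b)) = (\<lambda>x. \<Sum>p<n. first_block x $$ (a, p) * (A ^\<^sub>m (l - 1)) $$ (p, b))"
    unfolding l(4) nu_mat_index[OF l(1-3) assms(2)] mult_mat_index[OF first_block_carrier Ap a1 assms(2)] ..
  moreover have "C_inf S UNIV (\<lambda>x. first_block x $$ (a, p))" if "p < n" for p
  proof -
    have "(\<lambda>x. first_block x $$ (a, p)) = (\<lambda>x. if (a, p) \<in> presc_pos then pres_val (a, p) else x (the_inv_into {..<length es} ((!) es) (a, p)))"
      unfolding first_block_def using a1 that by simp
    then show ?thesis by (cases "(a, p) \<in> presc_pos") (simp_all add: C_inf_const C_inf_coordinate)
  qed
  ultimately show ?thesis by (auto intro!: C_inf_sum C_inf_mult C_inf_const)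
qed

lemma det_smooth:
  assumes "\<And>u b. u < n \<Longrightarrow> b < n \<Longrightarrow> C_inf S U (\<lambda>x. M x $$ (u, b))" "\<And>x. M x \<in> carrier_mat n n"
  shows "C_inf S U (\<lambda>x. det (M x :: real mat))"
proof -
  have "M x = mat n n (\<lambda>(a, b). M x $$ (a, b))" for x using assms(2)[of x] by (intro eq_matI) auto
  then have "(\<lambda>x. det (M x)) = (\<lambda>x. det (mat n n (\<lambda>(a, b). M x $$ (a, b))))" by simp
  then show ?thesis using C_inf_det[of n S U "\<lambda>x a b. M x $$ (a, b)"] assms(1) by simp
qed

section \<open>The chart as a rational map\<close>

definition W :: "(nat \<Rightarrow> real) set" where
  "W = {x \<in> euc {..<chart_dim}. det (nu_mat x) \<noteq> 0}"

definition chart :: "(nat \<Rightarrow> real) \<Rightarrow> real mat" where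
  "chart x = feedback_of \<kappa> (r 1) A (nu_mat x)"

lemma W_set_eq: "W_set r k n \<alpha> zs J es = W"
  unfolding W_set_def W_def nu_eq P_set_iff using nu_mat_carrier nu_mat_shape by auto

lemma W_open: "\<exists>T. open T \<and> W = euc {..<chart_dim} \<inter> T"
proof -
  have "C_inf {..<chart_dim} UNIV (\<lambda>x. det (nu_mat x))" by (intro det_smooth nu_mat_smooth nu_mat_carrier)
  from open_Collect_neq[OF C_inf_imp_continuous_on[OF this] continuous_on_const[of _ 0]]
  show ?thesis unfolding W_def by (intro exI[of _ "{x. det (nu_mat x) \<noteq> 0}"]) auto
qed

lemma chart_carrier: "x \<in> W \<Longrightarrow> chart x \<in> carrier_mat (r 1) n"
  unfolding chart_def by (rule feedback_of_carrier[OF nu_mat_carrier]) (simp add: W_def)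

lemma chart_closed_loop: "x \<in> W \<Longrightarrow> closed_loop (chart x) (nu_mat x)"
  using closed_loop_iff_feedback_of[OF nu_mat_carrier _ chart_carrier] nu_mat_shape
  unfolding chart_def W_def by auto

text \<open>Cramer's rule for the entries of \<open>chart\<close>, as one rational expression in x;
  it is the function on coordinates that \<open>smooth_map\<close> asks for.\<close>

definition chart_entry :: "nat \<times> nat \<Rightarrow> (nat \<Rightarrow> real) \<Rightarrow> real" where
  "chart_entry = (\<lambda>(j, b) x. \<Sum>p<n. (\<Sum>e<n. nu_mat x $$ (j, e) * (A ^\<^sub>m \<kappa> (Suc j)) $$ (e, p)) *
      (cofactor (nu_mat x) b p / det (nu_mat x)))"

lemma chart_smooth:
  assumes j: "j < r 1" and b: "b < n"
  shows "C_inf {..<chart_dim} W (chart_entry (j, b))"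
    and "x \<in> W \<Longrightarrow> chart x $$ (j, b) = chart_entry (j, b) x"
proof -
  have nu: "nu_mat x = mat n n (\<lambda>(a, b). nu_mat x $$ (a, b))" for x
    using nu_mat_carrier[of x] by (intro eq_matI) auto
  have "C_inf {..<chart_dim} W (\<lambda>x. cofactor (nu_mat x) b p)" if "p < n" for p
    by (subst nu, rule C_inf_cofactor) (use b that nu_mat_smooth C_inf_subset in blast)+
  moreover have "C_inf {..<chart_dim} W (\<lambda>x. nu_mat x $$ (j, e))" if "e < n" for e
    using nu_mat_smooth[of j e] C_inf_subset j r1_le_n that by (meson less_le_trans subset_UNIV)
  moreover have "C_inf {..<chart_dim} W (\<lambda>x. det (nu_mat x))"
    by (rule C_inf_subset[OF det_smooth[OF nu_mat_smooth nu_mat_carrier]]) auto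
  ultimately show "C_inf {..<chart_dim} W (chart_entry (j, b))"
    unfolding chart_entry_def prod.case by (intro C_inf_sum C_inf_mult C_inf_divide C_inf_const) (auto simp: W_def)
  assume "x \<in> W"
  then have d: "det (nu_mat x) \<noteq> 0" by (simp add: W_def)
  have jn: "j < n" using j r1_le_n by simp
  define B where "B = mat n n (\<lambda>(i, j). cofactor (nu_mat x) j i / det (nu_mat x))"
  define Q where "Q = mat (r 1) n (\<lambda>(j, b). (nu_mat x * A ^\<^sub>m \<kappa> (Suc j)) $$ (j, b))"
  have Ap: "A ^\<^sub>m l \<in> carrier_mat n n" for l using A_carrier by simp
  have "chart x = Q * B"
    unfolding chart_def feedback_of_def adj_inverse(4)[OF nu_mat_carrier d] Q_def B_def using nu_mat_carrier[of x] by simp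
  then have "chart x $$ (j, b) = (\<Sum>p<n. Q $$ (j, p) * B $$ (p, b))"
    using mult_mat_index[of Q "r 1" n B n j b] j b by (simp add: Q_def B_def)
  also have "\<dots> = chart_entry (j, b) x"
    unfolding chart_entry_def prod.case using j b by (intro sum.cong refl arg_cong2[of _ _ _ _ "(*)"])
      (simp_all add: Q_def B_def mult_mat_index[OF nu_mat_carrier Ap jn] del: index_mult_mat)
  finally show "chart x $$ (j, b) = chart_entry (j, b) x" .
qed

text \<open>The inverse of P turns the closed-loop matrix into A, so multiplying P' by it gives a
  matrix that commutes with A. P' may be singular, which covers the kernel elements of the linear
  system.\<close>

lemma Cent_of_intertwiners:
  assumes P: "P \<in> carrier_mat n n" "det P \<noteq> 0" and P': "P' \<in> carrier_mat n n"
    and K: "K \<in> carrier_mat (r 1) n" and cl: "closed_loop K P" "closed_loop K P'"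
  obtains X where "X \<in> Cent" "P' = P * X"
proof -
  obtain B where B: "B \<in> carrier_mat n n" "P * B = 1\<^sub>m n" "B * P = 1\<^sub>m n" using adj_inverse[OF P] by blast
  define M where "M = F + G1 * K"
  have M: "M \<in> carrier_mat n n" unfolding M_def using F_carrier G1_carrier K by auto
  have cl': "M * P = P * A" "M * P' = P' * A" using cl unfolding M_def by auto
  note as = assoc_mult_mat[of _ n n _ n _ n]
  have BM: "B * M = A * B"
  proof -
    have "B * M = B * (M * (P * B))" using B M by simp
    also have "\<dots> = B * ((M * P) * B)" using B M P by (simp add: as)
    also have "\<dots> = B * (P * (A * B))" unfolding cl'(1) using assoc_mult_mat[OF P(1) A_carrier B(1)] by simp
    also have "\<dots> = (B * P) * (A * B)" using assoc_mult_mat[OF B(1) P(1) mult_carrier_mat[OF A_carrier B(1)]] by simp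
    finally show ?thesis unfolding B(3) using left_mult_one_mat[OF mult_carrier_mat[OF A_carrier B(1)]] by simp
  qed
  have "A * (B * P') = (A * B) * P'" using assoc_mult_mat[OF A_carrier B(1) P'] by simp
  also have "\<dots> = B * (M * P')" unfolding BM[symmetric] using assoc_mult_mat[OF B(1) M P'] by simp
  also have "\<dots> = (B * P') * A" unfolding cl'(2) using assoc_mult_mat[OF B(1) P' A_carrier] by simp
  finally have "B * P' \<in> Cent" unfolding Cent_def using B P' by auto
  moreover have "P' = P * (B * P')" using assoc_mult_mat[OF P(1) B(1) P'] B P' by simp
  ultimately show thesis using that by blast
qed

lemma closed_loop_Cent:
  assumes P: "P \<in> carrier_mat n n" and K: "K \<in> carrier_mat (r 1) n" and cl: "closed_loop K P" and X: "X \<in> Cent"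
  shows "closed_loop K (P * X)"
proof -
  define M where "M = F + G1 * K"
  have M: "M \<in> carrier_mat n n" unfolding M_def using F_carrier G1_carrier K by auto
  have X': "X \<in> carrier_mat n n" "A * X = X * A" using X by (auto simp: Cent_def)
  have cl': "M * P = P * A" using cl unfolding M_def .
  have "M * (P * X) = (M * P) * X" using assoc_mult_mat[OF M P X'(1)] by simp
  also have "\<dots> = P * (A * X)" unfolding cl' using assoc_mult_mat[OF P A_carrier X'(1)] by simp
  also have "\<dots> = P * X * A" unfolding X'(2) using assoc_mult_mat[OF P X'(1) A_carrier] by simp
  finally show ?thesis unfolding M_def .
qed

section \<open>Injectivity, orbits and the image of the chart\<close>

lemma I_less_n: "i < length zs \<Longrightarrow> g < n \<Longrightarrow> 0 < mu i g \<Longrightarrow> I i g < n"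
  using I_less r1_le_n by (meson less_le_trans)

lemma Cent_diff: "X \<in> Cent \<Longrightarrow> Y \<in> Cent \<Longrightarrow> X - Y \<in> Cent"
  unfolding Cent_def using A_carrier
  by (auto simp: mult_minus_distrib_mat[of _ n n] minus_mult_distrib_mat[of _ n n])

lemma Cent_one: "1\<^sub>m n \<in> Cent"
  unfolding Cent_def using A_carrier by auto

lemma Cent_mult: "X \<in> Cent \<Longrightarrow> Y \<in> Cent \<Longrightarrow> X * Y \<in> Cent"
proof -
  assume X: "X \<in> Cent" and Y: "Y \<in> Cent"
  then have c: "X \<in> carrier_mat n n" "Y \<in> carrier_mat n n" "A * X = X * A" "A * Y = Y * A" by (auto simp: Cent_def)
  have "A * (X * Y) = (X * A) * Y" using assoc_mult_mat[OF A_carrier c(1,2)] c(3) by simp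
  also have "\<dots> = X * (Y * A)" using assoc_mult_mat[OF c(1) A_carrier c(2)] c(4) by simp
  also have "\<dots> = X * Y * A" using assoc_mult_mat[OF c(1,2) A_carrier] by simp
  finally show "X * Y \<in> Cent" unfolding Cent_def using c by auto
qed

lemma presc_idx_bounds: "(i, g, c, s, q) \<in> presc_idx \<Longrightarrow> I i g < n \<and> pos i c s q < n"
  using I_less_n pos_less by (auto simp: presc_idx_def valid_def)

text \<open>Uniqueness for the affine conditions is linear injectivity applied to X - 1.\<close>

lemma Cent_eq_oneI:
  assumes P: "P \<in> carrier_mat n n" "nondegenerate I P" and X: "X \<in> Cent"
    and eq: "\<And>i g c s q. (i, g, c, s, q) \<in> presc_idx \<Longrightarrow> (P * X) $$ (I i g, pos i c s q) = P $$ (I i g, pos i c s q)"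
  shows "X = 1\<^sub>m n"
proof -
  have Xc: "X \<in> carrier_mat n n" using X by (simp add: Cent_def)
  have PX: "P * (X - 1\<^sub>m n) = P * X - P" using mult_minus_distrib_mat[OF P(1) Xc one_carrier_mat] P by simp
  have "X - 1\<^sub>m n = 0\<^sub>m n n"
  proof (rule Cent_prescribed_inj[OF P(1) I_less_n P(2) Cent_diff[OF X Cent_one]])
    fix i g c s q assume S: "(i, g, c, s, q) \<in> presc_idx"
    then show "(P * (X - 1\<^sub>m n)) $$ (I i g, pos i c s q) = 0"
      unfolding PX using eq[OF S] presc_idx_bounds[OF S] P Xc by simp
  qed
  then have z: "(X - 1\<^sub>m n) $$ (a, b) = 0" if "a < n" "b < n" for a b using that by simp
  show ?thesis
  proof (intro eq_matI)
    fix a b assume "a < dim_row (1\<^sub>m n :: real mat)" "b < dim_col (1\<^sub>m n :: real mat)"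
    then have "a < n" "b < n" by auto
    with z[OF this] Xc show "X $$ (a, b) = 1\<^sub>m n $$ (a, b)" by simp
  qed (use Xc in auto)
qed

text \<open>Two reduced solutions for the same K differ by a factor X in the centralizer that
  preserves the prescribed entries, so X = 1; the free entries then give back x.\<close>

lemma inj_chart: "inj_on chart W"
proof (rule inj_onI)
  fix x y assume x: "x \<in> W" and y: "y \<in> W" and eq: "chart x = chart y"
  have d: "det (nu_mat x) \<noteq> 0" using x by (simp add: W_def)
  obtain X where X: "X \<in> Cent" "nu_mat y = nu_mat x * X"
    using Cent_of_intertwiners[OF nu_mat_carrier d nu_mat_carrier chart_carrier[OF x] chart_closed_loop[OF x]]
      chart_closed_loop[OF y] eq by metis
  have "X = 1\<^sub>m n"
  proof (rule Cent_eq_oneI[OF nu_mat_carrier prescribed_entries_nondegenerate[OF nu_mat_prescribed] X(1)])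
    fix i g c s q assume "(i, g, c, s, q) \<in> presc_idx"
    then show "(nu_mat x * X) $$ (I i g, pos i c s q) = nu_mat x $$ (I i g, pos i c s q)"
      unfolding X(2)[symmetric] using nu_mat_prescribed[unfolded prescribed_entries_iff] by simp
  qed
  then have "nu_mat y = nu_mat x" using X(2) nu_mat_carrier[of x] by simp
  then have "x t = y t" if "t < chart_dim" for t using nu_mat_es[of t x] nu_mat_es[of t y] that length_es by simp
  then show "x = y" using x y by (intro ext) (auto simp: W_def euc_def, metis lessThan_iff)
qed

text \<open>P and P X solve the same equation with the same K, and an invertible solution determines
  K.\<close>

lemma feedback_of_orbit:
  assumes P: "P \<in> carrier_mat n n" "det P \<noteq> 0" "has_shape r k A P" and X: "X \<in> Cent" "det X \<noteq> 0"
  shows "feedback_of \<kappa> (r 1) A (P * X) = feedback_of \<kappa> (r 1) A P" "has_shape r k A (P * X)"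
proof -
  let ?K = "feedback_of \<kappa> (r 1) A P"
  have Xc: "X \<in> carrier_mat n n" using X by (simp add: Cent_def)
  have K: "?K \<in> carrier_mat (r 1) n" by (rule feedback_of_carrier[OF P(1,2)])
  have "closed_loop ?K P" using closed_loop_iff_feedback_of[OF P(1,2) K] P(3) by simp
  then have cl: "closed_loop ?K (P * X)" by (rule closed_loop_Cent[OF P(1) K _ X(1)])
  have PX: "P * X \<in> carrier_mat n n" "det (P * X) \<noteq> 0" using P X Xc det_mult[OF P(1) Xc] by auto
  from cl show "feedback_of \<kappa> (r 1) A (P * X) = ?K" "has_shape r k A (P * X)"
    unfolding closed_loop_iff_feedback_of[OF PX K] by auto
qed

lemma commuting_group_eq: "commuting_group A = {X \<in> Cent. det X \<noteq> 0}"
  unfolding commuting_group_def Cent_def A_dim using invertible_mat_iff_det by auto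

lemma orbit_map_orbit_proj:
  assumes P: "P \<in> carrier_mat n n" "det P \<noteq> 0" "has_shape r k A P"
  shows "orbit_map \<kappa> (r 1) A (orbit_proj A P) = feedback_of \<kappa> (r 1) A P"
proof -
  have "feedback_of \<kappa> (r 1) A ` orbit_proj A P = {feedback_of \<kappa> (r 1) A P}"
  proof (intro subset_antisym subsetI)
    fix K assume "K \<in> feedback_of \<kappa> (r 1) A ` orbit_proj A P"
    then show "K \<in> {feedback_of \<kappa> (r 1) A P}"
      unfolding orbit_proj_def commuting_group_eq using feedback_of_orbit(1)[OF P] by auto
  next
    fix K assume "K \<in> {feedback_of \<kappa> (r 1) A P}"
    moreover have "P \<in> orbit_proj A P"
      unfolding orbit_proj_def commuting_group_eq using Cent_one P(1) by (auto intro!: exI[of _ "1\<^sub>m n"])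
    ultimately show "K \<in> feedback_of \<kappa> (r 1) A ` orbit_proj A P" by blast
  qed
  then show ?thesis unfolding orbit_map_def by simp
qed

abbreviation V_hat :: "real mat set" where
  "V_hat \<equiv> orbit_map \<kappa> (r 1) A ` (orbit_proj A ` V_set r k n \<alpha> zs J)"

text \<open>If \<open>P\<close> is in the domain and \<open>P X\<close> is reduced, then \<open>X\<close> is invertible: as \<open>P X\<close> is in the
  domain as well, some \<open>P X Z\<close> has the same prescribed entries as \<open>P\<close>, whence \<open>X Z = 1\<close>.\<close>

lemma reducible:
  assumes P: "P \<in> carrier_mat n n" "nondegenerate I P"
  obtains X where "X \<in> Cent" "det X \<noteq> 0" "prescribed_entries (P * X)"
proof -
  have surj: "\<exists>X\<in>Cent. \<forall>i g c s q. (i, g, c, s, q) \<in> presc_idx \<longrightarrow> (P * X) $$ (I i g, pos i c s q) = f i g c s q"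
    if P: "P \<in> carrier_mat n n" "nondegenerate I P" for P f
  proof -
    have inj: "X = 0\<^sub>m n n" if "X \<in> Cent"
      and "\<And>i g c s q. (i, g, c, s, q) \<in> presc_idx \<Longrightarrow> (P * X) $$ (I i g, pos i c s q) = 0" for X
      by (rule Cent_prescribed_inj[OF P(1) I_less_n P(2) that])
    show ?thesis
    proof (rule Cent_prescribed_surj[OF P(1), where I = I and f = f])
      fix X assume X: "X \<in> Cent" "\<And>i g c s q. (i, g, c, s, q) \<in> presc_idx \<Longrightarrow> (P * X) $$ (I i g, pos i c s q) = f i g c s q"
      show ?thesis by (intro bexI[OF _ X(1)] allI impI X(2))
    qed (fact I_less_n, fact inj)
  qed
  obtain X where X: "X \<in> Cent" "\<forall>i g c s q. (i, g, c, s, q) \<in> presc_idx \<longrightarrow>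
      (P * X) $$ (I i g, pos i c s q) = (if c = g \<and> s = 0 \<and> q = 0 then 1 else 0)"
    using surj[OF P, of "\<lambda>i g c s q. if c = g \<and> s = 0 \<and> q = 0 then 1 else 0"] by blast
  have Xc: "X \<in> carrier_mat n n" using X by (simp add: Cent_def)
  have PX: "prescribed_entries (P * X)" unfolding prescribed_entries_iff by (rule X(2))
  have PXc: "P * X \<in> carrier_mat n n" using P Xc by simp
  obtain Z where Z: "Z \<in> Cent" "\<forall>i g c s q. (i, g, c, s, q) \<in> presc_idx \<longrightarrow>
      (P * X * Z) $$ (I i g, pos i c s q) = P $$ (I i g, pos i c s q)"
    using surj[OF PXc prescribed_entries_nondegenerate[OF PX], of "\<lambda>i g c s q. P $$ (I i g, pos i c s q)"] by blast
  have Zc: "Z \<in> carrier_mat n n" using Z by (simp add: Cent_def)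
  have "X * Z = 1\<^sub>m n"
    by (rule Cent_eq_oneI[OF P Cent_mult[OF X(1) Z(1)]])
      (use Z(2) assoc_mult_mat[OF P(1) Xc Zc] in simp)
  then have "det X * det Z = 1" using det_mult[OF Xc Zc] by simp
  then have "det X \<noteq> 0" by auto
  from that[OF X(1) this PX] show thesis .
qed

lemma V_hat_eq: "V_hat = chart ` W"
proof (intro subset_antisym subsetI)
  fix K assume "K \<in> V_hat"
  then obtain P where P: "P \<in> V_set r k n \<alpha> zs J" "K = orbit_map \<kappa> (r 1) A (orbit_proj A P)" by blast
  then have P': "P \<in> carrier_mat n n" "has_shape r k A P" "det P \<noteq> 0" "nondegenerate I P" unfolding V_set_iff by auto
  have K: "K = feedback_of \<kappa> (r 1) A P" unfolding P(2) by (rule orbit_map_orbit_proj[OF P'(1,3,2)])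
  obtain X where X: "X \<in> Cent" "det X \<noteq> 0" "prescribed_entries (P * X)" using reducible[OF P'(1,4)] .
  have Xc: "X \<in> carrier_mat n n" using X by (simp add: Cent_def)
  note fo = feedback_of_orbit[OF P'(1,3,2) X(1,2)]
  \<comment> \<open>Set to 0 from \<open>chart_dim\<close> on, as membership in \<open>euc\<close>
    demands.\<close>
  define x where "x t = (if t < chart_dim then (P * X) $$ (es ! t) else 0)" for t
  have PX: "P * X = nu_mat x"
    by (rule eq_nu_mat[OF _ fo(2) X(3)]) (use P' Xc length_es in \<open>auto simp: x_def simp del: index_mult_mat\<close>)
  have "x \<in> W"
    unfolding W_def mem_Collect_eq PX[symmetric] det_mult[OF P'(1) Xc] using P'(3) X(2) by (simp add: x_def euc_def)
  moreover have "K = chart x" unfolding chart_def PX[symmetric] K fo(1) ..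
  ultimately show "K \<in> chart ` W" by blast
next
  fix K assume "K \<in> chart ` W"
  then obtain x where x: "x \<in> W" "K = chart x" by blast
  have d: "det (nu_mat x) \<noteq> 0" using x by (simp add: W_def)
  have "nu_mat x \<in> V_set r k n \<alpha> zs J"
    unfolding V_set_iff using nu_mat_carrier nu_mat_shape d prescribed_entries_nondegenerate[OF nu_mat_prescribed] by blast
  moreover have "K = orbit_map \<kappa> (r 1) A (orbit_proj A (nu_mat x))"
    unfolding x(2) chart_def by (rule orbit_map_orbit_proj[OF nu_mat_carrier d nu_mat_shape, symmetric])
  ultimately show "K \<in> V_hat" by blast
qed

lemma chart_feedback_set: "x \<in> W \<Longrightarrow> chart x \<in> feedback_set n \<alpha> F G1"
  unfolding feedback_set_iff using chart_carrier chart_closed_loop nu_mat_carrier by (auto simp: W_def)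

end

context chart_setting
begin

subsection \<open>The inverse of the chart\<close>

abbreviation "IK \<equiv> {..<r 1} \<times> {..<n}"
abbreviation "co \<equiv> snd (mat_coords (r 1) n)"

text \<open>The linear system for \<open>P\<close>: \<open>(F + G\<^sub>1 K) P = P A\<close>, with given entries in the prescribed
  positions; \<open>y\<close> are the entries of \<open>K\<close>.\<close>

definition sysM :: "(nat \<times> nat \<Rightarrow> real) \<Rightarrow> (nat \<times> nat) + (nat \<times> nat) \<Rightarrow> nat \<times> nat \<Rightarrow> real" where
  "sysM y e q = (case e of
      Inl (a, b) \<Rightarrow> (if snd q = b then F $$ (a, fst q) + (\<Sum>t<r 1. G1 $$ (a, t) * y (t, fst q)) else 0)
        - (if fst q = a then A $$ (snd q, b) else 0)
    | Inr x \<Rightarrow> if q = x then 1 else 0)"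

lemma sysM_smooth: "C_inf S UNIV (\<lambda>y. sysM y e q)"
proof (cases e)
  case (Inl ab)
  obtain a b where ab: "ab = (a, b)" by fastforce
  have "C_inf S UNIV (\<lambda>y. F $$ (a, fst q) + (\<Sum>t<r 1. G1 $$ (a, t) * y (t, fst q)))"
    by (intro C_inf_add C_inf_sum C_inf_mult C_inf_const C_inf_coordinate)
  then have "C_inf S UNIV (\<lambda>y. if snd q = b then F $$ (a, fst q) + (\<Sum>t<r 1. G1 $$ (a, t) * y (t, fst q)) else 0)"
    by (cases "snd q = b") (simp_all add: C_inf_const)
  then show ?thesis unfolding sysM_def Inl ab by (simp add: C_inf_diff C_inf_const)
qed (simp add: sysM_def C_inf_const)

lemma sysM_Inl:
  assumes K: "K \<in> carrier_mat (r 1) n" and P: "P \<in> carrier_mat n n" and ab: "a < n" "b < n"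
  shows "(\<Sum>q\<in>{..<n} \<times> {..<n}. sysM (co K) (Inl (a, b)) q * P $$ q) = ((F + G1 * K) * P) $$ (a, b) - (P * A) $$ (a, b)"
proof -
  have M: "F + G1 * K \<in> carrier_mat n n" using F_carrier G1_carrier K by auto
  have Mi: "F $$ (a, c) + (\<Sum>t<r 1. G1 $$ (a, t) * co K (t, c)) = (F + G1 * K) $$ (a, c)" if "c < n" for c
  proof -
    have "(G1 * K) $$ (a, c) = (\<Sum>t<r 1. G1 $$ (a, t) * co K (t, c))"
      unfolding mult_mat_index[OF G1_carrier K ab(1) that] using that by (simp add: mat_coords_simps)
    then show ?thesis using ab that F_carrier G1_carrier K by simp
  qed
  have "(\<Sum>q\<in>{..<n} \<times> {..<n}. sysM (co K) (Inl (a, b)) q * P $$ q) =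
    (\<Sum>c<n. \<Sum>d<n. (if d = b then (F + G1 * K) $$ (a, c) * P $$ (c, d) else 0) - (if c = a then P $$ (c, d) * A $$ (d, b) else 0))"
  proof -
    have split: "(\<Sum>q\<in>{..<n} \<times> {..<n}. f q) = (\<Sum>c<n. \<Sum>d<n. f (c, d))" for f :: "nat \<times> nat \<Rightarrow> real"
      by (simp add: sum.cartesian_product split_def)
    have entry: "sysM (co K) (Inl (a, b)) (c, d) = (if d = b then (F + G1 * K) $$ (a, c) else 0) - (if c = a then A $$ (d, b) else 0)"
      if "c < n" for c d
      unfolding sysM_def sum.case prod.case fst_conv snd_conv Mi[OF that] ..
    show ?thesis unfolding split
    proof (intro sum.cong refl)
      fix c d assume "c \<in> {..<n}"
      then show "sysM (co K) (Inl (a, b)) (c, d) * P $$ (c, d) =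
        (if d = b then (F + G1 * K) $$ (a, c) * P $$ (c, d) else 0) - (if c = a then P $$ (c, d) * A $$ (d, b) else 0)"
        using entry[of c d] by (cases "d = b"; cases "c = a") (simp_all add: left_diff_distrib)
    qed
  qed
  also have "\<dots> = (\<Sum>c<n. (F + G1 * K) $$ (a, c) * P $$ (c, b) - (if c = a then \<Sum>d<n. P $$ (c, d) * A $$ (d, b) else 0))"
    using ab by (intro sum.cong refl) (simp add: sum_subtractf)
  also have "\<dots> = ((F + G1 * K) * P) $$ (a, b) - (P * A) $$ (a, b)"
    unfolding mult_mat_index[OF M P ab] mult_mat_index[OF P A_carrier ab] using ab by (simp add: sum_subtractf)
  finally show ?thesis .
qed

lemma sysM_Inr:
  assumes "x \<in> presc_pos"
  shows "(\<Sum>q\<in>{..<n} \<times> {..<n}. sysM y (Inr x) q * v q) = v x"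
proof -
  have "x \<in> {..<n} \<times> {..<n}" using assms presc_pos_subset r1_le_n by auto
  moreover have "(\<Sum>q\<in>{..<n} \<times> {..<n}. sysM y (Inr x) q * v q) = (\<Sum>q\<in>{..<n} \<times> {..<n}. if q = x then v q else 0)"
    by (intro sum.cong refl) (simp add: sysM_def)
  ultimately show ?thesis by simp
qed

text \<open>The system is injective at K0: a kernel element is P0 X with X in the centralizer and
  vanishing prescribed entries, so X = 0. The last two conclusions are uniqueness at every nearby K,
  for the inhomogeneous system with \<open>sol\<close> as the only candidate, and for the
  homogeneous one.\<close>

lemma local_solution:
  assumes K0: "K0 \<in> carrier_mat (r 1) n" and P0: "P0 \<in> carrier_mat n n" "det P0 \<noteq> 0"
    and cl: "closed_loop K0 P0" and nondegenerate: "nondegenerate I P0"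
  obtains U sol where "openin (top_of_set (euc IK)) U" "co K0 \<in> U"
    "\<And>q. q \<in> {..<n} \<times> {..<n} \<Longrightarrow> C_inf IK U (sol q)"
    "\<And>K P q. K \<in> carrier_mat (r 1) n \<Longrightarrow> co K \<in> U \<Longrightarrow> P \<in> carrier_mat n n \<Longrightarrow> closed_loop K P \<Longrightarrow>
       prescribed_entries P \<Longrightarrow> q \<in> {..<n} \<times> {..<n} \<Longrightarrow> P $$ q = sol q (co K)"
    "\<And>K P. K \<in> carrier_mat (r 1) n \<Longrightarrow> co K \<in> U \<Longrightarrow> P \<in> carrier_mat n n \<Longrightarrow> closed_loop K P \<Longrightarrow>
       (\<And>x. x \<in> presc_pos \<Longrightarrow> P $$ x = 0) \<Longrightarrow> P = 0\<^sub>m n n"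
proof -
  let ?Q = "{..<n} \<times> {..<n}"
  let ?E = "?Q <+> presc_pos"
  have finE: "finite ?E" using finite_subset[OF presc_pos_subset] by simp
  have closed: "(\<Sum>q\<in>?Q. sysM (co K) (Inl ab) q * P $$ q) = 0"
    if "K \<in> carrier_mat (r 1) n" "P \<in> carrier_mat n n" "closed_loop K P" "ab \<in> ?Q" for K P ab
    using that sysM_Inl[OF that(1,2), of "fst ab" "snd ab"] by auto
  have inj0: "\<forall>q\<in>?Q. v q = 0" if v: "\<And>e. e \<in> ?E \<Longrightarrow> (\<Sum>q\<in>?Q. sysM (co K0) e q * v q) = 0" for v
  proof -
    define P where "P = mat n n v"
    have P: "P \<in> carrier_mat n n" unfolding P_def by simp
    have Pv: "P $$ q = v q" if "q \<in> ?Q" for q using that unfolding P_def by auto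
    have "closed_loop K0 P"
    proof (intro eq_matI)
      fix a b assume "a < dim_row (P * A)" "b < dim_col (P * A)"
      then have ab: "a < n" "b < n" using P A_dim by auto
      have "(\<Sum>q\<in>?Q. sysM (co K0) (Inl (a, b)) q * P $$ q) = 0" using v[of "Inl (a, b)"] ab Pv by (simp add: InlI)
      then show "((F + G1 * K0) * P) $$ (a, b) = (P * A) $$ (a, b)" using sysM_Inl[OF K0 P ab] by simp
    qed (use P A_dim F_carrier G1_carrier K0 in auto)
    then obtain X where X: "X \<in> Cent" "P = P0 * X" using Cent_of_intertwiners[OF P0 P K0 cl] by blast
    have "X = 0\<^sub>m n n"
    proof (rule Cent_prescribed_inj[OF P0(1) I_less_n nondegenerate X(1)])
      fix i g c s q assume "(i, g, c, s, q) \<in> presc_idx"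
      then have x: "(I i g, pos i c s q) \<in> presc_pos" unfolding presc_pos_def by blast
      then have "(I i g, pos i c s q) \<in> ?Q" using presc_pos_subset r1_le_n by auto
      then show "(P0 * X) $$ (I i g, pos i c s q) = 0"
        using v[of "Inr (I i g, pos i c s q)"] x Pv unfolding X(2)[symmetric] by (simp add: sysM_Inr InrI)
    qed
    then have "P = 0\<^sub>m n n" using X(2) P0 by simp
    then show ?thesis using Pv by fastforce
  qed
  have finQ: "finite ?Q" by simp
  show thesis
  proof (rule smooth_solution_of_injective_system[OF finQ finE sysM_smooth inj0 mat_coords_euc, where c = "case_sum (\<lambda>_. 0) pres_val"])
    fix U sol assume U: "openin (top_of_set (euc IK)) U" "co K0 \<in> U"
    "\<And>q. q \<in> ?Q \<Longrightarrow> C_inf IK U (sol q)"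
    "\<And>y v q. y \<in> U \<Longrightarrow> (\<And>e. e \<in> ?E \<Longrightarrow> (\<Sum>q\<in>?Q. sysM y e q * v q) = case_sum (\<lambda>_. 0) pres_val e) \<Longrightarrow> q \<in> ?Q \<Longrightarrow> v q = sol q y"
    "\<And>y v q. y \<in> U \<Longrightarrow> (\<And>e. e \<in> ?E \<Longrightarrow> (\<Sum>q\<in>?Q. sysM y e q * v q) = 0) \<Longrightarrow> q \<in> ?Q \<Longrightarrow> v q = 0"
    show thesis
    proof (rule that[OF U(1-3)])
    fix K P q assume K: "K \<in> carrier_mat (r 1) n" "co K \<in> U" and P: "P \<in> carrier_mat n n" "closed_loop K P"
      "prescribed_entries P" and q: "q \<in> ?Q"
    show "P $$ q = sol q (co K)"
    proof (rule U(4)[OF K(2) _ q, of "\<lambda>q. P $$ q"])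
      fix e assume "e \<in> ?E"
      then show "(\<Sum>q\<in>?Q. sysM (co K) e q * P $$ q) = case_sum (\<lambda>_. 0) pres_val e"
        using closed[OF K(1) P(1,2)] P(3) by (auto simp: sysM_Inr prescribed_entries_def)
    qed
  next
    fix K P assume K: "K \<in> carrier_mat (r 1) n" "co K \<in> U" and P: "P \<in> carrier_mat n n" "closed_loop K P"
      "\<And>x. x \<in> presc_pos \<Longrightarrow> P $$ x = 0"
    have "P $$ q = 0" if "q \<in> ?Q" for q
    proof (rule U(5)[OF K(2) _ that, of "\<lambda>q. P $$ q"])
      fix e assume "e \<in> ?E"
      then show "(\<Sum>q\<in>?Q. sysM (co K) e q * P $$ q) = 0"
        using closed[OF K(1) P(1,2)] P(3) by (auto simp: sysM_Inr)
    qed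
    then show "P = 0\<^sub>m n n" using P(1) by (intro eq_matI) auto
    qed
  qed
qed

text \<open>Near \<open>x0\<close>, the prescribed entries are coordinates on the space of intertwiners from \<open>A\<close> to
  \<open>F + G\<^sub>1 K\<close>, which has the dimension of the centralizer.\<close>

lemma local_chart_inverse:
  assumes x0: "x0 \<in> W"
  obtains U g where "openin (top_of_set (euc IK)) U" "co (chart x0) \<in> U"
    "\<And>t. t < chart_dim \<Longrightarrow> C_inf IK U (g t)"
    "\<And>x t. x \<in> W \<Longrightarrow> co (chart x) \<in> U \<Longrightarrow> t < chart_dim \<Longrightarrow> x t = g t (co (chart x))"
    "\<And>K. K \<in> feedback_set n \<alpha> F G1 \<Longrightarrow> co K \<in> U \<Longrightarrow> K \<in> chart ` W"
proof -
  let ?Q = "{..<n} \<times> {..<n}"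
  have d0: "det (nu_mat x0) \<noteq> 0" using x0 by (simp add: W_def)
  obtain U sol where U: "openin (top_of_set (euc IK)) U" "co (chart x0) \<in> U"
    "\<And>q. q \<in> ?Q \<Longrightarrow> C_inf IK U (sol q)"
    "\<And>K P q. K \<in> carrier_mat (r 1) n \<Longrightarrow> co K \<in> U \<Longrightarrow> P \<in> carrier_mat n n \<Longrightarrow> closed_loop K P \<Longrightarrow>
       prescribed_entries P \<Longrightarrow> q \<in> ?Q \<Longrightarrow> P $$ q = sol q (co K)"
    "\<And>K P. K \<in> carrier_mat (r 1) n \<Longrightarrow> co K \<in> U \<Longrightarrow> P \<in> carrier_mat n n \<Longrightarrow> closed_loop K P \<Longrightarrow>
       (\<And>x. x \<in> presc_pos \<Longrightarrow> P $$ x = 0) \<Longrightarrow> P = 0\<^sub>m n n"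
    using local_solution[OF chart_carrier[OF x0] nu_mat_carrier d0 chart_closed_loop[OF x0]
        prescribed_entries_nondegenerate[OF nu_mat_prescribed]] by blast
  define S where "S y = mat n n (\<lambda>q. sol q y)" for y
  have S: "S y \<in> carrier_mat n n" for y unfolding S_def by simp
  have PS: "P = S (co K)" if "K \<in> carrier_mat (r 1) n" "co K \<in> U" "P \<in> carrier_mat n n" "closed_loop K P"
       "prescribed_entries P" for K P
    using U(4)[OF that] that(3) unfolding S_def by (intro eq_matI) auto
  have det_S: "C_inf IK U (\<lambda>y. det (S y))"
    by (rule det_smooth) (use U(3) S in \<open>auto simp: S_def\<close>)
  \<comment> \<open>\<open>S y\<close> is the only candidate for a reduced solution. Shrinking to
    the set where it is invertible yields the invertibility of P X below, without prior knowledge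
    about X.\<close>
  define V where "V = {y \<in> U. det (S y) \<noteq> 0}"
  have opV: "openin (top_of_set (euc IK)) V"
  proof -
    have "openin (top_of_set U) (U \<inter> (\<lambda>y. det (S y)) -` (- {0}))"
      by (rule continuous_openin_preimage_gen[OF C_inf_imp_continuous_on[OF det_S]]) auto
    moreover have "V = U \<inter> (\<lambda>y. det (S y)) -` (- {0})" unfolding V_def by auto
    ultimately show ?thesis using openin_trans[OF _ U(1)] by simp
  qed
  have esQ: "es ! t \<in> ?Q" if "t < chart_dim" for t
    using es_index[of t] that length_es r1_le_n by (cases "es ! t") auto
  show thesis
  proof (rule that[OF opV, of "\<lambda>t. sol (es ! t)"])
    have "nu_mat x0 = S (co (chart x0))"
      by (rule PS[OF chart_carrier[OF x0] U(2) nu_mat_carrier chart_closed_loop[OF x0] nu_mat_prescribed])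
    then show "co (chart x0) \<in> V" unfolding V_def using U(2) d0 by simp
    show "C_inf IK V (sol (es ! t))" if "t < chart_dim" for t
      by (rule C_inf_subset[OF U(3)[OF esQ[OF that]]]) (auto simp: V_def)
    show "x t = sol (es ! t) (co (chart x))" if x: "x \<in> W" "co (chart x) \<in> V" "t < chart_dim" for x t
      using U(4)[OF chart_carrier[OF x(1)] _ nu_mat_carrier chart_closed_loop[OF x(1)] nu_mat_prescribed esQ[OF x(3)]]
        nu_mat_es[of t x] x length_es by (simp add: V_def)
    fix K assume K: "K \<in> feedback_set n \<alpha> F G1" and KV: "co K \<in> V"
    have KU: "co K \<in> U" "det (S (co K)) \<noteq> 0" using KV by (auto simp: V_def)
    obtain P where Kc: "K \<in> carrier_mat (r 1) n" and P: "P \<in> carrier_mat n n" "det P \<noteq> 0" "closed_loop K P"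
      using K unfolding feedback_set_iff by blast
    \<comment> \<open>P comes from an arbitrary nearby K and its submatrices are not known to be
      invertible, so injectivity on the centralizer is taken from the homogeneous system at
      K.\<close>
    have inj: "X = 0\<^sub>m n n" if X: "X \<in> Cent"
      and z: "\<And>i g c s q. (i, g, c, s, q) \<in> presc_idx \<Longrightarrow> (P * X) $$ (I i g, pos i c s q) = 0" for X
    proof -
      have Xc: "X \<in> carrier_mat n n" using X by (simp add: Cent_def)
      have "P * X = 0\<^sub>m n n"
      proof (rule U(5)[OF Kc KU(1) _ closed_loop_Cent[OF P(1) Kc P(3) X]])
        show "(P * X) $$ x = 0" if "x \<in> presc_pos" for x using that z unfolding presc_pos_def by blast
      qed (use P Xc in simp)
      moreover obtain B where B: "B \<in> carrier_mat n n" "B * P = 1\<^sub>m n" using adj_inverse[OF P(1,2)] by blast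
      ultimately have "(B * P) * X = 0\<^sub>m n n" using assoc_mult_mat[OF B(1) P(1) Xc] by simp
      then show ?thesis using B Xc by simp
    qed
    have "\<exists>X\<in>Cent. \<forall>i g c s q. (i, g, c, s, q) \<in> presc_idx \<longrightarrow>
        (P * X) $$ (I i g, pos i c s q) = (if c = g \<and> s = 0 \<and> q = 0 then 1 else 0)"
    proof (rule Cent_prescribed_surj[OF P(1), where I = I and f = "\<lambda>i g c s q. if c = g \<and> s = 0 \<and> q = 0 then 1 else 0"])
      fix X assume X: "X \<in> Cent" "\<And>i g c s q. (i, g, c, s, q) \<in> presc_idx \<Longrightarrow>
        (P * X) $$ (I i g, pos i c s q) = (if c = g \<and> s = 0 \<and> q = 0 then 1 else 0)"
      show "\<exists>X\<in>Cent. \<forall>i g c s q. (i, g, c, s, q) \<in> presc_idx \<longrightarrow>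
        (P * X) $$ (I i g, pos i c s q) = (if c = g \<and> s = 0 \<and> q = 0 then 1 else 0)"
        by (intro bexI[OF _ X(1)] allI impI X(2))
    qed (fact I_less_n, fact inj)
    then obtain X where X: "X \<in> Cent" "\<And>i g c s q. (i, g, c, s, q) \<in> presc_idx \<Longrightarrow>
        (P * X) $$ (I i g, pos i c s q) = (if c = g \<and> s = 0 \<and> q = 0 then 1 else 0)" by blast
    have Xc: "X \<in> carrier_mat n n" using X by (simp add: Cent_def)
    define R where "R = P * X"
    have R: "R \<in> carrier_mat n n" unfolding R_def using P Xc by simp
    have clR: "closed_loop K R" unfolding R_def by (rule closed_loop_Cent[OF P(1) Kc P(3) X(1)])
    have pR: "prescribed_entries R" unfolding prescribed_entries_iff R_def using X(2) by blast
    have dR: "det R \<noteq> 0" using PS[OF Kc KU(1) R clR pR] KU(2) by simp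
    have shR: "has_shape r k A R" "K = feedback_of \<kappa> (r 1) A R"
      using closed_loop_iff_feedback_of[OF R dR Kc] clR by auto
    define x where "x t = (if t < chart_dim then R $$ (es ! t) else 0)" for t
    have Rx: "R = nu_mat x"
      by (rule eq_nu_mat[OF R shR(1) pR]) (use length_es in \<open>simp add: x_def\<close>)
    have "x \<in> W" unfolding W_def mem_Collect_eq Rx[symmetric] using dR by (simp add: x_def euc_def)
    moreover have "K = chart x" unfolding chart_def Rx[symmetric] by (rule shR(2))
    ultimately show "K \<in> chart ` W" by blast
  qed
qed

lemma openin_V_hat: "openin (coords_topology (mat_coords (r 1) n) (feedback_set n \<alpha> F G1)) V_hat"
proof -
  have "\<exists>T. open T \<and> co K \<in> T \<and> co -` T \<inter> feedback_set n \<alpha> F G1 \<subseteq> V_hat" if K: "K \<in> V_hat" for K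
  proof -
    obtain x0 where x0: "x0 \<in> W" "K = chart x0" using K unfolding V_hat_eq by blast
    show ?thesis
    proof (rule local_chart_inverse[OF x0(1)])
    fix U assume U: "openin (top_of_set (euc IK)) U" "co (chart x0) \<in> U"
      "\<And>K. K \<in> feedback_set n \<alpha> F G1 \<Longrightarrow> co K \<in> U \<Longrightarrow> K \<in> chart ` W"
    from U(1) obtain T where T: "open T" "U = euc IK \<inter> T" unfolding openin_open by blast
    have "co L \<in> U" if "co L \<in> T" for L unfolding T(2) using that mat_coords_euc by blast
    then have "co -` T \<inter> feedback_set n \<alpha> F G1 \<subseteq> V_hat" unfolding V_hat_eq using U(3) by blast
    then show ?thesis using T U(2) x0(2) by blast
    qed
  qed
  then obtain T where T: "\<And>K. K \<in> V_hat \<Longrightarrow> open (T K) \<and> co K \<in> T K \<and> co -` T K \<inter> feedback_set n \<alpha> F G1 \<subseteq> V_hat"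
    by metis
  have "V_hat \<subseteq> feedback_set n \<alpha> F G1" unfolding V_hat_eq using chart_feedback_set by blast
  then have "V_hat = co -` (\<Union>K\<in>V_hat. T K) \<inter> feedback_set n \<alpha> F G1" using T by blast
  moreover have "open (\<Union>K\<in>V_hat. T K)" using T by blast
  ultimately show ?thesis unfolding openin_coords_topology by blast
qed

lemma diffeomorphism_chart: "diffeomorphism (vec_coords chart_dim) (mat_coords (r 1) n) W V_hat chart"
  unfolding diffeomorphism_def
proof (intro conjI)
  show "bij_betw chart W V_hat" unfolding V_hat_eq using inj_chart by (rule inj_on_imp_bij_betw)
  obtain T where T: "open T" "W = euc {..<chart_dim} \<inter> T" using W_open by blast
  show "smooth_map (vec_coords chart_dim) (mat_coords (r 1) n) W chart"
  proof (rule smooth_mapI, intro exI conjI ballI impI)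
    show "openin (top_of_set (euc (fst (vec_coords chart_dim)))) W" using T by (auto simp: openin_open vec_coords_def)
    show "snd (vec_coords chart_dim) x \<in> W" if "x \<in> W" for x using that by (simp add: vec_coords_def)
    show "C_inf (fst (vec_coords chart_dim)) W (chart_entry q)" if "q \<in> fst (mat_coords (r 1) n)" for q
      using that chart_smooth(1) by (auto simp: vec_coords_def mat_coords_simps)
    show "snd (mat_coords (r 1) n) (chart y) q = chart_entry q (snd (vec_coords chart_dim) y)"
      if "q \<in> fst (mat_coords (r 1) n)" "y \<in> W" for q y
      using that chart_smooth(2)[OF _ _ that(2)] by (auto simp: vec_coords_def mat_coords_simps)
  qed
  show "smooth_map (mat_coords (r 1) n) (vec_coords chart_dim) V_hat (the_inv_into W chart)"
  proof (rule smooth_mapI)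
    fix K assume "K \<in> V_hat"
    then obtain x0 where x0: "x0 \<in> W" "K = chart x0" unfolding V_hat_eq by blast
    show "\<exists>U g. openin (top_of_set (euc (fst (mat_coords (r 1) n)))) U \<and> co K \<in> U \<and>
        (\<forall>j\<in>fst (vec_coords chart_dim). C_inf (fst (mat_coords (r 1) n)) U (g j)) \<and>
        (\<forall>y\<in>V_hat. co y \<in> U \<longrightarrow> (\<forall>j\<in>fst (vec_coords chart_dim). snd (vec_coords chart_dim) (the_inv_into W chart y) j = g j (co y)))"
    proof (rule local_chart_inverse[OF x0(1)], intro exI conjI ballI impI)
      fix U g assume U: "openin (top_of_set (euc IK)) U" "co (chart x0) \<in> U"
        "\<And>t. t < chart_dim \<Longrightarrow> C_inf IK U (g t)"
        "\<And>x t. x \<in> W \<Longrightarrow> co (chart x) \<in> U \<Longrightarrow> t < chart_dim \<Longrightarrow> x t = g t (co (chart x))"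
      show "openin (top_of_set (euc (fst (mat_coords (r 1) n)))) U" using U(1) by (simp add: mat_coords_simps)
      show "co K \<in> U" using U(2) x0 by simp
      show "C_inf (fst (mat_coords (r 1) n)) U (g j)" if "j \<in> fst (vec_coords chart_dim)" for j
        using U(3)[of j] that by (simp add: vec_coords_def mat_coords_simps)
      show "snd (vec_coords chart_dim) (the_inv_into W chart y) j = g j (co y)"
        if y: "y \<in> V_hat" "co y \<in> U" "j \<in> fst (vec_coords chart_dim)" for y j
      proof -
        obtain x where x: "x \<in> W" "y = chart x" using y(1) unfolding V_hat_eq by blast
        then have "the_inv_into W chart y = x" using the_inv_into_f_f[OF inj_chart x(1)] by simp
        then show ?thesis using U(4)[OF x(1), of j] y x by (simp add: vec_coords_def)
      qed
    qed
  qed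
qed

end

subsection \<open>Stacking\<close>

lemma append_rows_index:
  assumes "K1 \<in> carrier_mat p n" "K2 \<in> carrier_mat q n" "i < p + q" "j < n"
  shows "(K1 @\<^sub>r K2) $$ (i, j) = (if i < p then K1 $$ (i, j) else K2 $$ (i - p, j))"
  using assms unfolding append_rows_def by auto

lemma append_rows_carrier:
  "K1 \<in> carrier_mat p n \<Longrightarrow> K2 \<in> carrier_mat q n \<Longrightarrow> K1 @\<^sub>r K2 \<in> carrier_mat (p + q) n"
  by (rule carrier_append_rows)

lemma append_rows_inj:
  assumes "K1 \<in> carrier_mat p n" "K2 \<in> carrier_mat q n" "L1 \<in> carrier_mat p n" "L2 \<in> carrier_mat q n"
    and eq: "K1 @\<^sub>r K2 = L1 @\<^sub>r L2"
  shows "K1 = L1 \<and> K2 = L2"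
proof
  note i1 = append_rows_index[OF assms(1,2)] and i2 = append_rows_index[OF assms(3,4)]
  show "K1 = L1"
  proof (intro eq_matI)
    fix i j assume "i < dim_row L1" "j < dim_col L1"
    then have "i < p" "j < n" using assms by auto
    then show "K1 $$ (i, j) = L1 $$ (i, j)" using i1[of i j] i2[of i j] eq by simp
  qed (use assms in auto)
  show "K2 = L2"
  proof (intro eq_matI)
    fix i j assume "i < dim_row L2" "j < dim_col L2"
    then have "i < q" "j < n" using assms by auto
    then show "K2 $$ (i, j) = L2 $$ (i, j)" using i1[of "p + i" j] i2[of "p + i" j] eq by simp
  qed (use assms in auto)
qed

lemma append_rows_split:
  assumes "K \<in> carrier_mat (p + q) n"
  shows "K = mat p n (($$) K) @\<^sub>r mat q n (\<lambda>(i, j). K $$ (p + i, j))"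
  by (intro eq_matI) (use assms in \<open>auto simp: append_rows_def\<close>)

lemma mat_coords_append_rows_top:
  assumes "K1 \<in> carrier_mat p n" "K2 \<in> carrier_mat q n"
  shows "(\<lambda>ij. if ij \<in> {..<p} \<times> {..<n} then snd (mat_coords (p + q) n) (K1 @\<^sub>r K2) ij else 0) = snd (mat_coords p n) K1"
  using append_rows_index[OF assms] by (auto simp: fun_eq_iff mat_coords_simps)

text \<open>The open condition on K1 is pulled back along the restriction of coordinates to the
  upper rows and leaves K2 unconstrained.\<close>

lemma openin_append_rows:
  assumes V: "openin (coords_topology (mat_coords p n) H1) V" and H1: "H1 \<subseteq> carrier_mat p n"
  shows "openin (coords_topology (mat_coords (p + q) n) ((\<lambda>(K1, K2). K1 @\<^sub>r K2) ` (H1 \<times> carrier_mat q n)))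
    ((\<lambda>(K1, K2). K1 @\<^sub>r K2) ` (V \<times> carrier_mat q n))"
proof -
  obtain T where T: "open T" "V = snd (mat_coords p n) -` T \<inter> H1" using V unfolding openin_coords_topology by blast
  let ?\<rho> = "\<lambda>y ij. if ij \<in> {..<p} \<times> {..<n} then y ij else (0::real)"
  have "continuous_on UNIV ?\<rho>"
  proof (rule continuous_on_coordinatewise_then_product)
    show "continuous_on UNIV (\<lambda>y. ?\<rho> y ij)" for ij
      by (cases "ij \<in> {..<p} \<times> {..<n}") (auto intro: continuous_on_coordinate)
  qed
  then have op: "open (?\<rho> -` T)" using T(1) by (simp add: continuous_on_open_vimage)
  have key: "snd (mat_coords (p + q) n) (K1 @\<^sub>r K2) \<in> ?\<rho> -` T \<longleftrightarrow> snd (mat_coords p n) K1 \<in> T"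
    if "K1 \<in> H1" "K2 \<in> carrier_mat q n" for K1 K2
    using mat_coords_append_rows_top[of K1 p n K2 q] that H1 by auto
  have "(\<lambda>(K1, K2). K1 @\<^sub>r K2) ` (V \<times> carrier_mat q n) =
    snd (mat_coords (p + q) n) -` (?\<rho> -` T) \<inter> (\<lambda>(K1, K2). K1 @\<^sub>r K2) ` (H1 \<times> carrier_mat q n)"
  proof (intro subset_antisym subsetI)
    fix K assume "K \<in> (\<lambda>(K1, K2). K1 @\<^sub>r K2) ` (V \<times> carrier_mat q n)"
    then obtain K1 K2 where K: "K = K1 @\<^sub>r K2" "K1 \<in> H1" "snd (mat_coords p n) K1 \<in> T" "K2 \<in> carrier_mat q n"
      unfolding T(2) by auto
    from key[OF K(2,4)] K show "K \<in> snd (mat_coords (p + q) n) -` (?\<rho> -` T) \<inter> (\<lambda>(K1, K2). K1 @\<^sub>r K2) ` (H1 \<times> carrier_mat q n)"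
      by (intro IntI vimageI2) (blast, force)
  next
    fix K assume "K \<in> snd (mat_coords (p + q) n) -` (?\<rho> -` T) \<inter> (\<lambda>(K1, K2). K1 @\<^sub>r K2) ` (H1 \<times> carrier_mat q n)"
    then obtain K1 K2 where K: "K = K1 @\<^sub>r K2" "K1 \<in> H1" "K2 \<in> carrier_mat q n"
      "snd (mat_coords (p + q) n) K \<in> ?\<rho> -` T" by auto
    then have "K1 \<in> V" using key[OF K(2,3)] unfolding T(2) by auto
    then show "K \<in> (\<lambda>(K1, K2). K1 @\<^sub>r K2) ` (V \<times> carrier_mat q n)" using K by force
  qed
  with op show ?thesis unfolding openin_coords_topology by blast
qed

text \<open>Local extensions for f and for its inverse are pulled back along the inclusions of their
  coordinates into those of the product and of the stacked matrix; the entries of K2 are passed on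
  as coordinates.\<close>

lemma diffeomorphism_append_rows:
  assumes f: "diffeomorphism (vec_coords d) (mat_coords p n) W V f" and W: "W \<subseteq> euc {..<d}" and V: "V \<subseteq> carrier_mat p n"
  shows "diffeomorphism (prod_coords (vec_coords d) (mat_coords q n)) (mat_coords (p + q) n)
    (W \<times> carrier_mat q n) ((\<lambda>(K1, K2). K1 @\<^sub>r K2) ` (V \<times> carrier_mat q n)) (\<lambda>(x, K2). f x @\<^sub>r K2)"
    (is "diffeomorphism ?c ?d ?X ?Y ?f")
proof -
  have bij: "bij_betw f W V" and sf: "smooth_map (vec_coords d) (mat_coords p n) W f"
    and sg: "smooth_map (mat_coords p n) (vec_coords d) V (the_inv_into W f)"
    using f unfolding diffeomorphism_def by auto
  have fW: "f x \<in> carrier_mat p n" if "x \<in> W" for x using bij that V unfolding bij_betw_def by blast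
  have inj: "inj_on ?f ?X"
  proof (rule inj_onI)
    fix z z' assume z: "z \<in> ?X" "z' \<in> ?X" "?f z = ?f z'"
    obtain x K x' K' where e: "z = (x, K)" "z' = (x', K')" by fastforce
    have "f x = f x' \<and> K = K'" using append_rows_inj[of "f x" p n K q "f x'" K'] fW z e by auto
    then show "z = z'" using bij z e unfolding bij_betw_def by (auto simp: inj_on_eq_iff)
  qed
  have im: "?f ` ?X = ?Y"
  proof -
    have "V = f ` W" using bij by (simp add: bij_betw_def)
    then show ?thesis by (force simp: image_iff)
  qed
  have cd: "fst ?c = {..<d} <+> {..<q} \<times> {..<n}" "fst ?d = {..<p + q} \<times> {..<n}"
    "snd ?c (x, K) = case_sum x (snd (mat_coords q n) K)" for x K
    by (simp_all add: prod_coords_def vec_coords_def mat_coords_def)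
  have pull1: "(\<lambda>t. if t \<in> {..<d} then snd ?c (x, K) (Inl t) else 0) = x" if "x \<in> W" for x K
    using that W unfolding cd by (auto simp: fun_eq_iff euc_def)
  have eucc: "snd ?c (x, K) \<in> euc (fst ?c)" if "x \<in> W" for x K
    using that W mat_coords_euc[of q n K] unfolding cd euc_def by (auto split: sum.splits)
  have "smooth_map ?c ?d ?X ?f"
  proof (rule smooth_mapI)
    fix z assume z: "z \<in> ?X"
    obtain x0 K0 where z0: "z = (x0, K0)" "x0 \<in> W" using z by auto
    obtain U g where
      U: "openin (top_of_set (euc {..<d})) U" "x0 \<in> U"
        "\<And>j. j \<in> {..<p} \<times> {..<n} \<Longrightarrow> C_inf {..<d} U (g j)"
        "\<And>y j. y \<in> W \<Longrightarrow> y \<in> U \<Longrightarrow> j \<in> {..<p} \<times> {..<n} \<Longrightarrow> snd (mat_coords p n) (f y) j = g j y"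
    proof (rule smooth_mapD[OF sf z0(2), unfolded vec_coords_def mat_coords_simps fst_conv snd_conv])
    qed (rule that)
    let ?\<rho> = "\<lambda>y t. if t \<in> {..<d} then y (Inl t) else (0::real)"
    let ?g = "\<lambda>(i, j) y. if i < p then g (i, j) (?\<rho> y) else y (Inr (i - p, j))"
    let ?U = "{y \<in> euc (fst ?c). ?\<rho> y \<in> U}"
    show "\<exists>U g. openin (top_of_set (euc (fst ?c))) U \<and> snd ?c z \<in> U \<and> (\<forall>j\<in>fst ?d. C_inf (fst ?c) U (g j)) \<and>
        (\<forall>y\<in>?X. snd ?c y \<in> U \<longrightarrow> (\<forall>j\<in>fst ?d. snd ?d (?f y) j = g j (snd ?c y)))"
    proof (intro exI[of _ ?U] exI[of _ ?g] conjI ballI impI)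
      show "openin (top_of_set (euc (fst ?c))) ?U" by (rule openin_euc_pullback[OF U(1)])
      show "snd ?c z \<in> ?U" unfolding z0(1) using eucc[OF z0(2)] pull1[OF z0(2)] U(2) by simp
      show "C_inf (fst ?c) ?U (?g j)" if j: "j \<in> fst ?d" for j
      proof -
        obtain a b where ab: "j = (a, b)" "a < p + q" "b < n" using j unfolding cd by auto
        show ?thesis
        proof (cases "a < p")
          case True
          have "C_inf (fst ?c) {y. ?\<rho> y \<in> U} (\<lambda>y. g (a, b) (?\<rho> y))"
            by (rule C_inf_pullback) (use U(3)[of "(a, b)"] openin_imp_subset[OF U(1)] True ab in \<open>auto simp: inj_on_def\<close>)
          then have "C_inf (fst ?c) ?U (\<lambda>y. g (a, b) (?\<rho> y))" by (rule C_inf_subset) auto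
          then show ?thesis using ab True by simp
        qed (use ab C_inf_coordinate in simp)
      qed
      show "snd ?d (?f y) j = ?g j (snd ?c y)" if y: "y \<in> ?X" "snd ?c y \<in> ?U" and j: "j \<in> fst ?d" for y j
      proof -
        obtain a b where ab: "j = (a, b)" "a < p + q" "b < n" using j unfolding cd by auto
        obtain x K where xK: "y = (x, K)" "x \<in> W" "K \<in> carrier_mat q n" using y by auto
        have xU: "x \<in> U" using y(2) pull1[OF xK(2)] unfolding xK(1) by simp
        have 1: "snd ?d (?f y) j = (if a < p then f x $$ (a, b) else K $$ (a - p, b))"
          unfolding xK(1) ab(1) using append_rows_index[OF fW[OF xK(2)] xK(3) ab(2,3)] ab by (simp add: mat_coords_simps)
        show ?thesis
        proof (cases "a < p")
          case True
          then show ?thesis using U(4)[OF xK(2) xU, of "(a, b)"] pull1[OF xK(2), of K] ab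
            unfolding 1 unfolding xK(1) by (simp add: mat_coords_simps)
        next
          case False
          then show ?thesis unfolding 1 unfolding xK(1) ab(1) cd using ab by (auto simp: mat_coords_simps)
        qed
      qed
    qed
  qed
  moreover have "smooth_map ?d ?c ?Y (the_inv_into ?X ?f)"
  proof (rule smooth_mapI)
    fix L assume L: "L \<in> ?Y"
    then obtain L1 L2 where L12: "L = L1 @\<^sub>r L2" "L1 \<in> V" "L2 \<in> carrier_mat q n" by auto
    obtain U g where
      U: "openin (top_of_set (euc ({..<p} \<times> {..<n}))) U" "snd (mat_coords p n) L1 \<in> U"
        "\<And>t. t \<in> {..<d} \<Longrightarrow> C_inf ({..<p} \<times> {..<n}) U (g t)"
        "\<And>y t. y \<in> V \<Longrightarrow> snd (mat_coords p n) y \<in> U \<Longrightarrow> t \<in> {..<d} \<Longrightarrow> the_inv_into W f y t = g t (snd (mat_coords p n) y)"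
    proof (rule smooth_mapD[OF sg L12(2), unfolded vec_coords_def mat_coords_simps fst_conv snd_conv])
    qed (rule that)
    let ?\<rho> = "\<lambda>y ij. if ij \<in> {..<p} \<times> {..<n} then y ij else (0::real)"
    let ?g = "\<lambda>s y. case s of Inl t \<Rightarrow> g t (?\<rho> y) | Inr ij \<Rightarrow> y (p + fst ij, snd ij)"
    let ?U = "{y \<in> euc (fst ?d). ?\<rho> y \<in> U}"
    show "\<exists>U g. openin (top_of_set (euc (fst ?d))) U \<and> snd ?d L \<in> U \<and> (\<forall>j\<in>fst ?c. C_inf (fst ?d) U (g j)) \<and>
        (\<forall>y\<in>?Y. snd ?d y \<in> U \<longrightarrow> (\<forall>j\<in>fst ?c. snd ?c (the_inv_into ?X ?f y) j = g j (snd ?d y)))"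
    proof (intro exI[of _ ?U] exI[of _ ?g] conjI ballI impI)
      show "openin (top_of_set (euc (fst ?d))) ?U" by (rule openin_euc_pullback[OF U(1), of _ "\<lambda>x. x"])
      have "L1 \<in> carrier_mat p n" using L12(2) V by blast
      from mat_coords_append_rows_top[OF this L12(3)] have "?\<rho> (snd ?d L) = snd (mat_coords p n) L1" unfolding L12(1) .
      then show "snd ?d L \<in> ?U" using U(2) mat_coords_euc[of "p + q" n L] by (simp add: mat_coords_simps)
      show "C_inf (fst ?d) ?U (?g s)" if s: "s \<in> fst ?c" for s
      proof (cases s)
        case (Inl t)
        then have t: "t \<in> {..<d}" using s unfolding cd by auto
        have "C_inf (fst ?d) {y. ?\<rho> y \<in> U} (\<lambda>y. g t (?\<rho> y))"
          by (rule C_inf_pullback[of "\<lambda>x. x"]) (use U(3)[OF t] openin_imp_subset[OF U(1)] in auto)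
        then have "C_inf (fst ?d) ?U (\<lambda>y. g t (?\<rho> y))" by (rule C_inf_subset) auto
        then show ?thesis using Inl by simp
      qed (simp add: C_inf_coordinate)
      show "snd ?c (the_inv_into ?X ?f y) s = ?g s (snd ?d y)" if y: "y \<in> ?Y" "snd ?d y \<in> ?U" and s: "s \<in> fst ?c" for y s
      proof -
        obtain K1 K2 where K: "y = K1 @\<^sub>r K2" "K1 \<in> V" "K2 \<in> carrier_mat q n" using y by auto
        have K1: "K1 \<in> carrier_mat p n" using K(2) V by blast
        have \<rho>: "?\<rho> (snd ?d y) = snd (mat_coords p n) K1" unfolding K(1) by (rule mat_coords_append_rows_top[OF K1 K(3)])
        define x where "x = the_inv_into W f K1"
        have x: "x \<in> W" "f x = K1"
          using f_the_inv_into_f[of f W K1] the_inv_into_into[of f W K1 W] bij K(2)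
          unfolding x_def bij_betw_def by auto
        have inv: "the_inv_into ?X ?f y = (x, K2)"
          by (rule the_inv_into_f_eq[OF inj]) (use K x in auto)
        show ?thesis
        proof (cases s)
          case (Inl t)
          then have t: "t \<in> {..<d}" using s unfolding cd by auto
          have "x t = g t (snd (mat_coords p n) K1)" unfolding x_def by (rule U(4)[OF K(2) _ t]) (use y(2) \<rho> in simp)
          then show ?thesis unfolding inv cd Inl using \<rho> by simp
        next
          case (Inr ij)
          obtain a b where ab: "ij = (a, b)" "a < q" "b < n" using s Inr unfolding cd by auto
          then show ?thesis unfolding inv cd Inr ab(1) using append_rows_index[OF K1 K(3), of "p + a" b] K(1)
            by (simp add: mat_coords_simps)
        qed
      qed
    qed
  qed
  ultimately show ?thesis unfolding diffeomorphism_def bij_betw_def using inj im by blast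
qed

lemma append_cols_zero_mult:
  assumes G1: "G1 \<in> carrier_mat n p" and K1: "K1 \<in> carrier_mat p d" and K2: "K2 \<in> carrier_mat q d"
  shows "append_cols G1 (0\<^sub>m n q) * (K1 @\<^sub>r K2) = G1 * K1"
proof (intro eq_matI)
  have G: "append_cols G1 (0\<^sub>m n q) \<in> carrier_mat n (p + q)" using G1 unfolding append_cols_def by auto
  have K: "K1 @\<^sub>r K2 \<in> carrier_mat (p + q) d" using K1 K2 by (rule append_rows_carrier)
  fix a b assume "a < dim_row (G1 * K1)" "b < dim_col (G1 * K1)"
  then have ab: "a < n" "b < d" using G1 K1 by auto
  have "(append_cols G1 (0\<^sub>m n q) * (K1 @\<^sub>r K2)) $$ (a, b) = (\<Sum>c<p + q. if c < p then G1 $$ (a, c) * K1 $$ (c, b) else 0)"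
    unfolding mult_mat_index[OF G K ab] using G1 ab
    by (intro sum.cong refl) (simp add: append_rows_index[OF K1 K2] append_cols_def)
  also have "\<dots> = (\<Sum>c<p. G1 $$ (a, c) * K1 $$ (c, b))"
    by (rule sum.mono_neutral_cong_right) auto
  finally show "(append_cols G1 (0\<^sub>m n q) * (K1 @\<^sub>r K2)) $$ (a, b) = (G1 * K1) $$ (a, b)"
    unfolding mult_mat_index[OF G1 K1 ab] .
qed (use assms in \<open>auto simp: append_cols_def append_rows_def\<close>)

text \<open>The zero columns of G meet only the lower rows K2, which are therefore
  arbitrary.\<close>

lemma feedback_set_append_cols:
  assumes G1: "G1 \<in> carrier_mat n p"
  shows "feedback_set n \<alpha> F (append_cols G1 (0\<^sub>m n q)) =
    (\<lambda>(K1, K2). K1 @\<^sub>r K2) ` (feedback_set n \<alpha> F G1 \<times> carrier_mat q n)"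
proof -
  have d: "dim_col (append_cols G1 (0\<^sub>m n q)) = p + q" "dim_col G1 = p" using G1 by (auto simp: append_cols_def)
  show ?thesis
  proof (intro subset_antisym subsetI)
    fix K assume K: "K \<in> feedback_set n \<alpha> F (append_cols G1 (0\<^sub>m n q))"
    define K1 where "K1 = mat p n (($$) K)"
    define K2 where "K2 = mat q n (\<lambda>(i, j). K $$ (p + i, j))"
    have KK: "K = K1 @\<^sub>r K2" unfolding K1_def K2_def
      by (rule append_rows_split) (use K d in \<open>simp add: feedback_set_def\<close>)
    have c: "K1 \<in> carrier_mat p n" "K2 \<in> carrier_mat q n" unfolding K1_def K2_def by auto
    have "K1 \<in> feedback_set n \<alpha> F G1"
      using K c d append_cols_zero_mult[OF G1 c] unfolding feedback_set_def KK by simp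
    then show "K \<in> (\<lambda>(K1, K2). K1 @\<^sub>r K2) ` (feedback_set n \<alpha> F G1 \<times> carrier_mat q n)"
      using KK c(2) by (intro image_eqI[of _ _ "(K1, K2)"]) auto
  next
    fix K assume "K \<in> (\<lambda>(K1, K2). K1 @\<^sub>r K2) ` (feedback_set n \<alpha> F G1 \<times> carrier_mat q n)"
    then obtain K1 K2 where K: "K = K1 @\<^sub>r K2" "K1 \<in> feedback_set n \<alpha> F G1" "K2 \<in> carrier_mat q n" by auto
    then have c: "K1 \<in> carrier_mat p n" using d by (simp add: feedback_set_def)
    show "K \<in> feedback_set n \<alpha> F (append_cols G1 (0\<^sub>m n q))"
      using K append_cols_zero_mult[OF G1 c K(3)] append_rows_carrier[OF c K(3)] d
      unfolding feedback_set_def by simp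
  qed
qed

theorem mainTheorem6:
  fixes n m k :: nat
    and \<alpha> :: "nat \<Rightarrow> real poly"
    and F G G1 A :: "real mat"
    and r \<kappa> :: "nat \<Rightarrow> nat"
    and zs :: "complex list"
    and J :: "nat \<Rightarrow> nat \<Rightarrow> nat list"
    and es :: "(nat \<times> nat) list"
  assumes "1 \<le> n"
    and "\<forall>i\<in>{1..n}. lead_coeff (\<alpha> i) = 1"
    and "\<forall>i\<in>{1..<n}. \<alpha> i dvd \<alpha> (i + 1)"
    and "(\<Sum>i=1..n. degree (\<alpha> i)) = n"
    and "F \<in> carrier_mat n n" and "G \<in> carrier_mat n m"
    and "controllable F G"
    and "r = brunovsky_index F G" and "\<kappa> = controllability_index F G" and "k = \<kappa> 1"
    and "F = brunovsky_F r k"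
    and "G1 = brunovsky_G1 r k"
    and "G1 \<in> carrier_mat n (r 1)" and "mat_rank G1 = r 1"
    and "G = append_cols G1 (0\<^sub>m n (m - r 1))"
    and "majorized_by (map \<kappa> [1..<m + 1]) (map (\<lambda>i. degree (\<alpha> (n - i + 1))) [1..<n + 1])"
    and "root_listing (\<alpha> n) zs"
    and "A = real_weyr n \<alpha> zs"
    and "J \<in> index_families (r 1) n \<alpha> zs"
    and "distinct es" and "set es = free_positions (r 1) n \<alpha> zs J"
  shows
    "let d = n * r 1 - orbit_dim n \<alpha>;
         W = W_set r k n \<alpha> zs J es;
         chart = (\<lambda>x. feedback_of \<kappa> (r 1) A (nu r k n \<alpha> zs J es x));
         V_hat = orbit_map \<kappa> (r 1) A ` (orbit_proj A ` V_set r k n \<alpha> zs J);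
         H1 = feedback_set n \<alpha> F G1;
         H = feedback_set n \<alpha> F G;
         stack = (\<lambda>(K1, K2). K1 @\<^sub>r K2);
         V_hat' = stack ` (V_hat \<times> carrier_mat (m - r 1) n)
     in openin (coords_topology (vec_coords d) (euc {..<d})) W \<and>
        openin (coords_topology (mat_coords (r 1) n) H1) V_hat \<and>
        diffeomorphism (vec_coords d) (mat_coords (r 1) n) W V_hat chart \<and>
        H = stack ` (H1 \<times> carrier_mat (m - r 1) n) \<and>
        openin (coords_topology (mat_coords m n) H) V_hat' \<and>
        diffeomorphism (prod_coords (vec_coords d) (mat_coords (m - r 1) n)) (mat_coords m n)
          (W \<times> carrier_mat (m - r 1) n) V_hat' (\<lambda>(x, K2). stack (chart x, K2))"
proof -
  interpret b: brunovsky_indices n k r \<kappa>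
    by (rule brunovsky_indicesI[OF assms(1,5,6,8,9,10,11,12,13)])
  interpret w: weyr_form n \<alpha> zs
    by (rule weyr_form.intro[OF assms(1,2,3,4,17)])
  interpret w: weyr_index n \<alpha> zs "r 1" J
    by (rule weyr_index.intro[OF w.weyr_form_axioms weyr_index_axioms.intro[OF assms(19) b.r1_le_n]])
  interpret c: chart_setting n k \<alpha> zs r \<kappa> J es
    by (rule chart_setting.intro[OF w.weyr_index_axioms b.brunovsky_indices_axioms chart_setting_axioms.intro[where r = r, OF assms(20,21)]])
  let ?d = "n * r 1 - orbit_dim n \<alpha>" and ?q = "m - r 1"
  let ?H1 = "feedback_set n \<alpha> F G1"
  let ?V = "orbit_map \<kappa> (r 1) A ` (orbit_proj A ` V_set r k n \<alpha> zs J)"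
  \<comment> \<open>\<open>m - r 1\<close> is a truncated difference; the width of G shows that
    \<open>r 1\<close> does not exceed m.\<close>
  have m: "m = r 1 + ?q"
  proof -
    have "dim_col (append_cols G1 (0\<^sub>m n ?q)) = r 1 + ?q" using carrier_matD(2)[OF assms(13)] by (simp add: append_cols_def)
    then show ?thesis using carrier_matD(2)[OF assms(6)] assms(15) by metis
  qed
  have chart: "(\<lambda>x. feedback_of \<kappa> (r 1) A (nu r k n \<alpha> zs J es x)) = c.chart"
    unfolding c.chart_def c.nu_eq assms(18) ..
  have W: "openin (coords_topology (vec_coords ?d) (euc {..<?d})) c.W"
    unfolding openin_coords_topology using c.W_open by (auto simp: vec_coords_def Int_commute)
  have V: "openin (coords_topology (mat_coords (r 1) n) ?H1) ?V"
    using c.openin_V_hat unfolding assms(11)[symmetric] assms(12)[symmetric] assms(18)[symmetric] .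
  have D: "diffeomorphism (vec_coords ?d) (mat_coords (r 1) n) c.W ?V c.chart"
    using c.diffeomorphism_chart unfolding assms(18)[symmetric] .
  have H1: "?H1 \<subseteq> carrier_mat (r 1) n"
    using assms(13) by (auto simp: feedback_set_def)
  \<comment> \<open>Openness in the topology on the feedback set includes containment in that
    set.\<close>
  have VH: "?V \<subseteq> ?H1" using openin_subset[OF V] by (simp add: coords_topology_def topspace_pullback_topology)
  have H: "feedback_set n \<alpha> F G = (\<lambda>(K1, K2). K1 @\<^sub>r K2) ` (?H1 \<times> carrier_mat ?q n)"
    unfolding assms(15) by (rule feedback_set_append_cols[OF assms(13)])
  have V': "openin (coords_topology (mat_coords m n) (feedback_set n \<alpha> F G)) ((\<lambda>(K1, K2). K1 @\<^sub>r K2) ` (?V \<times> carrier_mat ?q n))"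
    using openin_append_rows[OF V H1, of ?q] unfolding H m[symmetric] .
  have D': "diffeomorphism (prod_coords (vec_coords ?d) (mat_coords ?q n)) (mat_coords m n)
      (c.W \<times> carrier_mat ?q n) ((\<lambda>(K1, K2). K1 @\<^sub>r K2) ` (?V \<times> carrier_mat ?q n)) (\<lambda>(x, K2). c.chart x @\<^sub>r K2)"
    using diffeomorphism_append_rows[OF D, of ?q] VH H1 unfolding m[symmetric] by (auto simp: c.W_def)
  have st: "(\<lambda>(x, K2). (\<lambda>(K1, K2). K1 @\<^sub>r K2) (c.chart x, K2)) = (\<lambda>(x, K2). c.chart x @\<^sub>r K2)" by auto
  show ?thesis
    unfolding Let_def chart c.W_set_eq st using W V D H V' D' by blast
qed

end
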